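(* Let $k$ be an algebraically closed field of characteristic $p\ge 0$ and let $C\subset\mathbb{P}^2$ be an irreducible plane curve over $k$ of degree $d\ge 3$. Assume that $p=0$ or $d-1$ is prime to $p$. Then the following conditions are equivalent. (a) There exist an inner Galois point $P$ and an outer Galois point $Q$ for $C$ such that $G_PG_Q=G_P\rtimes G_Q$. (b) There exist an inner Galois point $P$ and an outer Galois point $Q$ for $C$ such that $G_PG_Q=G_P\times G_Q$. (c) $C$ is in one of the following cases: - $p=0$ or $d$ is prime to $p$, and $C$ is projectively equivalent to the plane curve defined by $x^{d-1}+y^d+c=0$, where $c=0$ or $1$; - $p>0$, $d$ is divisible by $p$, and $C$ is projectively equivalent to the plane curve defined by $$x^{d-1}+\Bigl(\sum_{0\le i\le e,\ m\mid p^i-1}\alpha_i y^{p^i}\Bigr)^m+c=0,$$ where $d=p^em$, $m$ is not divisible by $p$, $m\mid p^e-1$, the $\alpha_i$ are in $k$ with $\alpha_e\alpha_0\ne 0$, and $c=0$ or $1$.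
   Context: For an irreducible plane curve $C\subset\mathbb{P}^2$ and a point $R\in\mathbb{P}^2$, let $\pi_R:C\dashrightarrow\mathbb{P}^1$ be the projection from $R$. The point $R$ is called a Galois point for $C$ if the extension of function fields $k(C)/\pi_R^*k(\mathbb{P}^1)$ is Galois; its Galois group is denoted $G_R$. A Galois point $R$ is inner if $R\in C\setminus\mathrm{Sing}(C)$ and outer if $R\in\mathbb{P}^2\setminus C$. Let $\varphi:X\to C$ be the normalization; $G_R$ is regarded as a subgroup of $\mathrm{Aut}(X)$, namely $G_R=\{\sigma\in\mathrm{Aut}(X):(\pi_R\circ\varphi)\circ\sigma=\pi_R\circ\varphi\}$. $G_PG_Q=\{\sigma\tau:\sigma\in G_P,\tau\in G_Q\}\subset\mathrm{Aut}(X)$. The notation $G_PG_Q=G_P\rtimes G_Q$ means that $G_PG_Q$ is a subgroup of $\mathrm{Aut}(X)$ which is the internal semidirect product of $G_P$ and $G_Q$ with $G_P$ normal; $G_PG_Q=G_P\times G_Q$ means that $G_PG_Q$ is a subgroup which is the internal direct product of $G_P$ and $G_Q$. The affine equations in $x,y$ define plane projective curves by homogenization (taking closure in $\mathbb{P}^2$). *)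

theory Defs
  imports
    "HOL-Analysis.Cartesian_Space"
    "HOL-Computational_Algebra.Polynomial"
    "HOL-Computational_Algebra.Fraction_Field"
    "HOL-Algebra.Coset"
    "HOL-Algebra.Bij"
    "HOL-Algebra.QuotRing"
    "HOL-Algebra.Embedded_Algebras"
    "HOL-Algebra.Generated_Fields"
begin

section \<open>Forms and plane curves\<close>

text \<open>
  The ring \<open>k[X,Y,Z]\<close> is represented by iterated univariate polynomials; the outermost
  variable is \<open>X\<close>, the innermost one is \<open>Z\<close>. Likewise \<open>k[x,y]\<close> is represented with \<open>x\<close>
  outermost.
\<close>

type_synonym 'a poly3 = "'a poly poly poly"

definition term3 :: "'a::zero \<Rightarrow> nat \<Rightarrow> nat \<Rightarrow> nat \<Rightarrow> 'a poly3" where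
  "term3 a i j l = Polynomial.monom (Polynomial.monom (Polynomial.monom a l) j) i"

definition homogeneous :: "nat \<Rightarrow> 'a::zero poly3 \<Rightarrow> bool" where
  "homogeneous n G \<longleftrightarrow>
     (\<forall>i j l. Polynomial.coeff (Polynomial.coeff (Polynomial.coeff G i) j) l \<noteq> 0 \<longrightarrow> i + j + l = n)"

definition eval3 :: "'a::comm_ring_1 poly3 \<Rightarrow> 'a^3 \<Rightarrow> 'a" where
  "eval3 G v = poly (poly (poly G [:[:v$1:]:]) [:v$2:]) (v$3)"

definition linear_form :: "('a::comm_ring_1)^3 \<Rightarrow> 'a poly3" where
  "linear_form w = term3 (w$1) 1 0 0 + term3 (w$2) 0 1 0 + term3 (w$3) 0 0 1"

text \<open>Points of the projective plane are the one-dimensional subspaces of \<open>k\<^sup>3\<close>.\<close>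

definition proj_plane :: "(('a::field)^3) set set" where
  "proj_plane = {vec.span {v} | v. v \<noteq> 0}"

definition curve :: "'a::field poly3 \<Rightarrow> ('a^3) set set" where
  "curve F = {R \<in> proj_plane. \<forall>v\<in>R. eval3 F v = 0}"

text \<open>An irreducible plane curve of degree \<open>d\<close> is given by its defining form, which is
  determined by the curve up to a nonzero constant.\<close>

definition irreducible_plane_curve :: "nat \<Rightarrow> 'a::field poly3 \<Rightarrow> bool" where
  "irreducible_plane_curve d F \<longleftrightarrow> homogeneous d F \<and> Factorial_Ring.irreducible F"

definition singular_points :: "'a::field poly3 \<Rightarrow> ('a^3) set set" where
  "singular_points F = {R \<in> curve F. \<forall>v\<in>R.
     eval3 (pderiv F) v = 0 \<and>
     eval3 (map_poly pderiv F) v = 0 \<and>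
     eval3 (map_poly (map_poly pderiv) F) v = 0}"

definition projectively_equivalent :: "(('a::field)^3) set set \<Rightarrow> ('a^3) set set \<Rightarrow> bool" where
  "projectively_equivalent C C' \<longleftrightarrow>
     (\<exists>A :: 'a^3^3. invertible A \<and> (\<lambda>R. (\<lambda>v. A *v v) ` R) ` C = C')"

definition affine_x :: "'a::comm_ring_1 poly poly" where
  "affine_x = [:0, 1:]"

definition affine_y :: "'a::comm_ring_1 poly poly" where
  "affine_y = [:[:0, 1:]:]"

definition affine_const :: "'a::comm_ring_1 \<Rightarrow> 'a poly poly" where
  "affine_const c = [:[:c:]:]"

definition total_degree :: "'a::zero poly poly \<Rightarrow> nat" where
  "total_degree f = Max (insert 0 {i + j | i j. Polynomial.coeff (Polynomial.coeff f i) j \<noteq> 0})"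

definition homogenization :: "'a::comm_ring_1 poly poly \<Rightarrow> 'a poly3" where
  "homogenization f =
     (\<Sum>i\<le>Polynomial.degree f. \<Sum>j\<le>Polynomial.degree (Polynomial.coeff f i).
        term3 (Polynomial.coeff (Polynomial.coeff f i) j) i j (total_degree f - i - j))"

definition curve_of_affine_equation :: "'a::field poly poly \<Rightarrow> ('a^3) set set" where
  "curve_of_affine_equation f = curve (homogenization f)"


section \<open>The function field\<close>

text \<open>
  The local ring of the projective plane at the generic point of the curve \<open>F = 0\<close>, and its
  maximal ideal. The residue field is the function field \<open>k(C)\<close>.
\<close>

definition generic_local_ring :: "'a::field poly3 \<Rightarrow> 'a poly3 fract ring" where
  "generic_local_ring F =
     \<lparr>carrier = {Fract G H | G H n. homogeneous n G \<and> homogeneous n H \<and> \<not> F dvd H},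
      mult = (*), one = 1, zero = 0, add = (+)\<rparr>"

definition vanishing_ideal :: "'a::field poly3 \<Rightarrow> 'a poly3 fract set" where
  "vanishing_ideal F =
     {Fract G H | G H n. homogeneous n G \<and> homogeneous n H \<and> \<not> F dvd H \<and> F dvd G}"

definition function_field :: "'a::field poly3 \<Rightarrow> 'a poly3 fract set ring" where
  "function_field F = generic_local_ring F Quot vanishing_ideal F"

text \<open>The restriction to \<open>C\<close> of the rational function \<open>G/H\<close>.\<close>

definition rational_function ::
    "'a::field poly3 \<Rightarrow> 'a poly3 \<Rightarrow> 'a poly3 \<Rightarrow> 'a poly3 fract set" where
  "rational_function F G H = vanishing_ideal F +>\<^bsub>generic_local_ring F\<^esub> Fract G H"

definition constant_fun :: "'a::field poly3 \<Rightarrow> 'a \<Rightarrow> 'a poly3 fract set" where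
  "constant_fun F c = rational_function F [:[:[:c:]:]:] 1"


section \<open>The normalization and its automorphisms\<close>

text \<open>
  The normalization \<open>X\<close> of \<open>C\<close> is the abstract nonsingular curve of \<open>k(C)\<close> (Hartshorne,
  Section I.6): its points are the valuation rings \<open>k \<subset> \<O> \<subset> k(C)\<close> (all of which are discrete),
  its proper closed subsets are the finite ones, and the regular functions on an open set
  \<open>U\<close> are the elements of the intersection of the rings \<open>\<O> \<in> U\<close>, seen as functions with values in
  the residue fields \<open>\<O>/m = k\<close>.
\<close>

type_synonym 'a place = "'a poly3 fract set set"

definition normalization :: "'a::field poly3 \<Rightarrow> 'a place set" where
  "normalization F = (let K = function_field F in
     {V. subring V K \<and> range (constant_fun F) \<subseteq> V \<and> V \<noteq> carrier K \<and>
         (\<forall>f\<in>carrier K - {\<zero>\<^bsub>K\<^esub>}. f \<in> V \<or> inv\<^bsub>K\<^esub> f \<in> V)})"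

definition place_ideal :: "'a::field poly3 \<Rightarrow> 'a place \<Rightarrow> 'a place" where
  "place_ideal F V = (let K = function_field F in {f \<in> V. f = \<zero>\<^bsub>K\<^esub> \<or> inv\<^bsub>K\<^esub> f \<notin> V})"

text \<open>The value in \<open>k\<close> of a function \<open>f \<in> \<O>\<close> at the point \<open>\<O>\<close>.\<close>

definition residue_at :: "'a::field poly3 \<Rightarrow> 'a poly3 fract set \<Rightarrow> 'a place \<Rightarrow> 'a" where
  "residue_at F f V = (THE c. f \<ominus>\<^bsub>function_field F\<^esub> constant_fun F c \<in> place_ideal F V)"

text \<open>The morphism from \<open>X\<close> to the projective line \<open>k \<union> {\<infinity>}\<close> given by \<open>f\<close>; here \<open>None\<close> is \<open>\<infinity>\<close>.\<close>

definition value_at :: "'a::field poly3 \<Rightarrow> 'a poly3 fract set \<Rightarrow> 'a place \<Rightarrow> 'a option" where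
  "value_at F f V = (if f \<in> V then Some (residue_at F f V) else None)"

definition open_in_normalization :: "'a::field poly3 \<Rightarrow> 'a place set \<Rightarrow> bool" where
  "open_in_normalization F U \<longleftrightarrow>
     U \<subseteq> normalization F \<and> (U = {} \<or> finite (normalization F - U))"

definition regular_function_on ::
    "'a::field poly3 \<Rightarrow> 'a place set \<Rightarrow> ('a place \<Rightarrow> 'a) \<Rightarrow> bool" where
  "regular_function_on F U g \<longleftrightarrow>
     (\<exists>f\<in>carrier (function_field F). \<forall>V\<in>U. f \<in> V \<and> g V = residue_at F f V)"

definition self_morphism :: "'a::field poly3 \<Rightarrow> ('a place \<Rightarrow> 'a place) \<Rightarrow> bool" where
  "self_morphism F \<sigma> \<longleftrightarrow>
     \<sigma> \<in> normalization F \<rightarrow> normalization F \<and>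
     (\<forall>U. open_in_normalization F U \<longrightarrow>
        open_in_normalization F (\<sigma> -` U \<inter> normalization F) \<and>
        (\<forall>g. regular_function_on F U g \<longrightarrow>
           regular_function_on F (\<sigma> -` U \<inter> normalization F) (g \<circ> \<sigma>)))"

definition Aut_X :: "'a::field poly3 \<Rightarrow> ('a place \<Rightarrow> 'a place) monoid" where
  "Aut_X F = (BijGroup (normalization F))\<lparr>carrier :=
     {\<sigma> \<in> Bij (normalization F).
        self_morphism F \<sigma> \<and> self_morphism F (inv_into (normalization F) \<sigma>)}\<rparr>"


section \<open>Galois points\<close>

definition galois_extension :: "('b, 'c) ring_scheme \<Rightarrow> 'b set \<Rightarrow> bool" where
  "galois_extension K L \<longleftrightarrow>
     subfield L K \<and> ring.finite_dimension K L (carrier K) \<and>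
     {x \<in> carrier K. \<forall>\<tau>\<in>ring_iso K K. (\<forall>y\<in>L. \<tau> y = y) \<longrightarrow> \<tau> x = x} = L"

text \<open>
  The bases of the space of linear forms vanishing at \<open>R\<close>. For each of them the projection from
  \<open>R\<close> is \<open>S \<mapsto> (w\<^sub>0(S) : w\<^sub>1(S))\<close>; another choice changes it by an automorphism of the projective
  line, which affects neither the pulled back function field nor \<open>G\<^sub>R\<close>.
\<close>

definition projection_forms :: "(('a::field)^3) set \<Rightarrow> (('a^3) \<times> ('a^3)) set" where
  "projection_forms R = {(w\<^sub>0, w\<^sub>1). w\<^sub>0 \<noteq> w\<^sub>1 \<and> vec.independent {w\<^sub>0, w\<^sub>1} \<and>
     vec.span {w\<^sub>0, w\<^sub>1} = {w. \<forall>v\<in>R. (\<Sum>i\<in>UNIV. w$i * v$i) = 0}}"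

definition projection_function ::
    "'a::field poly3 \<Rightarrow> ('a^3) \<times> ('a^3) \<Rightarrow> 'a poly3 fract set" where
  "projection_function F = (\<lambda>(w\<^sub>0, w\<^sub>1).
     rational_function F (linear_form w\<^sub>0) (linear_form w\<^sub>1))"

text \<open>The morphism \<open>\<pi>\<^sub>R \<circ> \<phi>\<close> from \<open>X\<close> to the projective line, in the coordinates \<open>w\<close>.\<close>

definition projection_map ::
    "'a::field poly3 \<Rightarrow> ('a^3) \<times> ('a^3) \<Rightarrow> 'a place \<Rightarrow> 'a option" where
  "projection_map F w V = value_at F (projection_function F w) V"

text \<open>The subfield \<open>\<pi>\<^sub>R\<^sup>*k(\<P>\<^sup>1)\<close> of \<open>k(C)\<close>.\<close>

definition projection_field :: "'a::field poly3 \<Rightarrow> ('a^3) set \<Rightarrow> 'a poly3 fract set set" where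
  "projection_field F R = generate_field (function_field F)
     (range (constant_fun F) \<union> projection_function F ` projection_forms R)"

definition galois_point :: "'a::field poly3 \<Rightarrow> ('a^3) set \<Rightarrow> bool" where
  "galois_point F R \<longleftrightarrow>
     R \<in> proj_plane \<and> galois_extension (function_field F) (projection_field F R)"

definition inner_galois_point :: "'a::field poly3 \<Rightarrow> ('a^3) set \<Rightarrow> bool" where
  "inner_galois_point F R \<longleftrightarrow> galois_point F R \<and> R \<in> curve F - singular_points F"

definition outer_galois_point :: "'a::field poly3 \<Rightarrow> ('a^3) set \<Rightarrow> bool" where
  "outer_galois_point F R \<longleftrightarrow> galois_point F R \<and> R \<in> proj_plane - curve F"

definition galois_group_at :: "'a::field poly3 \<Rightarrow> ('a^3) set \<Rightarrow> ('a place \<Rightarrow> 'a place) set" where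
  "galois_group_at F R = {\<sigma> \<in> carrier (Aut_X F). \<forall>w\<in>projection_forms R. \<forall>V\<in>normalization F.
     projection_map F w (\<sigma> V) = projection_map F w V}"


section \<open>Internal products of groups\<close>

definition internal_semidirect_product :: "('g, 'h) monoid_scheme \<Rightarrow> 'g set \<Rightarrow> 'g set \<Rightarrow> bool" where
  "internal_semidirect_product G N H \<longleftrightarrow>
     subgroup (N <#>\<^bsub>G\<^esub> H) G \<and>
     N \<lhd> G\<lparr>carrier := N <#>\<^bsub>G\<^esub> H\<rparr> \<and>
     subgroup H (G\<lparr>carrier := N <#>\<^bsub>G\<^esub> H\<rparr>) \<and>
     N \<inter> H = {\<one>\<^bsub>G\<^esub>}"

definition internal_direct_product :: "('g, 'h) monoid_scheme \<Rightarrow> 'g set \<Rightarrow> 'g set \<Rightarrow> bool" where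
  "internal_direct_product G N H \<longleftrightarrow>
     subgroup (N <#>\<^bsub>G\<^esub> H) G \<and>
     N \<lhd> G\<lparr>carrier := N <#>\<^bsub>G\<^esub> H\<rparr> \<and>
     H \<lhd> G\<lparr>carrier := N <#>\<^bsub>G\<^esub> H\<rparr> \<and>
     N \<inter> H = {\<one>\<^bsub>G\<^esub>}"


section \<open>The curves in the classification\<close>

definition prime_to_char_equation :: "nat \<Rightarrow> 'a::comm_ring_1 \<Rightarrow> 'a poly poly" where
  "prime_to_char_equation d c = affine_x ^ (d - 1) + affine_y ^ d + affine_const c"

definition char_dvd_equation ::
    "nat \<Rightarrow> nat \<Rightarrow> nat \<Rightarrow> (nat \<Rightarrow> 'a::comm_ring_1) \<Rightarrow> 'a \<Rightarrow> 'a poly poly" where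
  "char_dvd_equation d e m \<alpha> c =
     affine_x ^ (d - 1)
     + (\<Sum>i\<in>{i. i \<le> e \<and> m dvd CHAR('a) ^ i - 1}. affine_const (\<alpha> i) * affine_y ^ (CHAR('a) ^ i)) ^ m
     + affine_const c"

end

theory Submission
  imports Defs "HOL-Algebra.Algebraic_Closure_Type" "HOL-Analysis.Determinants"
    "HOL-Computational_Algebra.Polynomial_Factorial" "HOL-Computational_Algebra.Field_as_Ring"
begin

text \<open>
  The function field of \<open>C\<close> is realised inside an algebraically closed field as the field \<open>S\<close> of the
  values \<open>G(v)/H(v)\<close> at a generic point \<open>v\<close> of the cone over \<open>C\<close>; since the places of \<open>S\<close> separate
  its elements, \<open>Aut(X)\<close> becomes the group of \<open>k\<close>-automorphisms of \<open>S\<close>. With \<open>P = (1:0:0)\<close> and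
  \<open>Q = (0:1:0)\<close> the curve is \<open>f(x,y) = 0\<close> of degree \<open>d - 1\<close> in \<open>x\<close> and \<open>d\<close> in \<open>y\<close>, \<open>G\<^sub>P\<close> fixes \<open>y\<close> and
  \<open>G\<^sub>Q\<close> fixes \<open>x\<close>. Normality of \<open>G\<^sub>P\<close> puts the conjugates \<open>\<sigma> y\<close> (\<open>\<sigma> \<in> G\<^sub>Q\<close>) into \<open>k(y)\<close>; comparing coefficients
  in \<open>x\<close>, they are \<open>\<alpha> y + \<beta>\<close>, and counting them forces \<open>f = f\<^sub>0(y) + h(x)\<close> with \<open>f\<^sub>0\<close> invariant under
  \<open>d\<close> affine maps, which makes \<open>f\<^sub>0\<close> the \<open>m\<close>-th power of an additive polynomial up to constants. At a pole
  of \<open>x\<close> the orders of \<open>x\<close> and \<open>y\<close> are proportional to the coprime numbers \<open>d\<close> and \<open>d - 1\<close>, so \<open>G\<^sub>Q\<close> fixes the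
  conjugates of \<open>x\<close> over \<open>k(y)\<close>, which by tameness are distinguished by their leading terms; hence they are
  affine in \<open>x\<close> and \<open>h\<close> is a power of a linear polynomial. Conversely, the automorphisms
  \<open>(x, y) \<mapsto> (\<zeta> x, \<omega> y + \<beta>)\<close> of the curves in the list exhaust both groups, and they commute.
\<close>

hide_const (open) UnivPoly.up_ring.coeff UnivPoly.up_ring.monom Polynomials.degree Polynomials.lead_coeff
  module.smult

section \<open>Evaluation of forms\<close>

text \<open>Normality is used once, to get \<sigma> y in k(y): from \<tau> \<sigma> = \<sigma>
  \<tau>' with \<tau>' y = y follows \<tau> (\<sigma> y) = \<sigma> y. After that everything
  concerns explicit polynomials, and the commuting of the two groups is read off the final equation.
  The obstacle is the other variable: nothing puts the conjugates of x into k(x). Here the pole of x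
  enters. A conjugate x' is expanded over k(x) in powers of y; coprimality of d and d - 1 makes the
  orders of the terms distinct, and the leading term is the one free of y. So x' and \<sigma> x'
  have the same leading coefficient, and two roots T of h(T) = h(x) with one leading coefficient
  coincide because deg h = d - 1 is nonzero in k. No numerical valuation is defined: an equality of
  orders is stated as \<open>un V\<close> of a quotient of powers, and orders are compared through
  d-th powers. The first family of the classification is the second one with e = 0 and m = d;
  characteristic 0 is included through 0 ^ 0 = 1. Projective equivalence sees only point sets, so
  the converse recovers the form, up to a constant, from its zeros.\<close>

definition rhom :: "('a::comm_ring_1 \<Rightarrow> 'b::comm_ring_1) \<Rightarrow> bool" where
  "rhom h \<longleftrightarrow> h 1 = 1 \<and> (\<forall>a b. h (a + b) = h a + h b) \<and> (\<forall>a b. h (a * b) = h a * h b)"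

lemma rhomI:
  assumes "h 1 = 1" "\<And>a b. h (a + b) = h a + h b" "\<And>a b. h (a * b) = h a * h b"
  shows "rhom h"
  using assms by (auto simp: rhom_def)

lemma
  assumes "rhom h"
  shows rhom_1: "h 1 = 1" and rhom_add: "h (a + b) = h a + h b" and rhom_mult: "h (a * b) = h a * h b"
    and rhom_0: "h 0 = 0" and rhom_minus: "h (- a) = - h a" and rhom_diff: "h (a - b) = h a - h b"
proof -
  show "h 1 = 1" "h (a * b) = h a * h b" using assms by (auto simp: rhom_def)
  have 2: "h (a + b) = h a + h b" for a b using assms by (auto simp: rhom_def)
  show "h (a + b) = h a + h b" by (rule 2)
  show 0: "h 0 = 0" using 2[of 0 0] by simp
  have m: "h (- a) = - h a" for a using 2[of a "- a"] 0 by (simp add: add_eq_0_iff)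
  show "h (- a) = - h a" by (rule m)
  show "h (a - b) = h a - h b" using 2[of a "- b"] m[of b] by simp
qed

lemma rhom_power: "rhom h \<Longrightarrow> h (a ^ n) = h a ^ n"
  by (induct n) (auto simp: rhom_1 rhom_mult)

lemma rhom_sum: "rhom h \<Longrightarrow> h (sum f A) = (\<Sum>x\<in>A. h (f x))"
  by (induct A rule: infinite_finite_induct) (auto simp: rhom_0 rhom_add)

lemma rhom_prod: "rhom h \<Longrightarrow> h (prod f A) = (\<Prod>x\<in>A. h (f x))"
  by (induct A rule: infinite_finite_induct) (auto simp: rhom_1 rhom_mult)

lemma rhom_of_nat: "rhom h \<Longrightarrow> h (of_nat n) = of_nat n"
  by (induct n) (auto simp: rhom_0 rhom_1 rhom_add)

lemma rhom_comp: "rhom g \<Longrightarrow> rhom h \<Longrightarrow> rhom (\<lambda>x. g (h x))"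
  by (auto simp: rhom_def)

lemma rhom_id: "rhom (\<lambda>x. x)" by (auto simp: rhom_def)

lemma rhom_inj:
  fixes h :: "'a::field \<Rightarrow> 'b::idom"
  assumes "rhom h" shows "h a = h b \<longleftrightarrow> a = b" and "h a = 0 \<longleftrightarrow> a = 0"
proof -
  have *: "h a \<noteq> 0" if "a \<noteq> 0" for a
  proof
    assume "h a = 0"
    then have "h (a * inverse a) = 0" using assms by (simp add: rhom_mult)
    then show False using that assms by (simp add: rhom_1)
  qed
  show "h a = h b \<longleftrightarrow> a = b" using *[of "a - b"] assms by (auto simp: rhom_diff)
  show "h a = 0 \<longleftrightarrow> a = 0" using * assms by (auto simp: rhom_0)
qed

lemma rhom_inverse:
  fixes h :: "'a::field \<Rightarrow> 'b::field"
  assumes "rhom h" shows "h (inverse a) = inverse (h a)" and "h (a / b) = h a / h b"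
proof -
  have *: "h (inverse a) = inverse (h a)" for a
  proof (cases "a = 0")
    case False
    then have "h a * h (inverse a) = 1" using assms by (simp flip: rhom_mult add: rhom_1)
    then show ?thesis by (metis inverse_unique)
  qed (use assms in \<open>simp add: rhom_0\<close>)
  show "h (inverse a) = inverse (h a)" by (rule *)
  show "h (a / b) = h a / h b" using assms * by (simp add: divide_inverse rhom_mult)
qed

lemma rhom_pconst: "rhom (\<lambda>a. [:a:])"
  by (auto simp: rhom_def)

lemma rhom_map_poly:
  assumes "rhom h" shows "rhom (map_poly h)"
proof (rule rhomI)
  note [simp] = rhom_0[OF assms] rhom_1[OF assms]
  show "map_poly h 1 = 1" by (simp add: map_poly_1')
  show "map_poly h (a + b) = map_poly h a + map_poly h b" for a b
    by (intro poly_eqI) (simp add: coeff_map_poly rhom_add[OF assms])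
  show "map_poly h (a * b) = map_poly h a * map_poly h b" for a b
    by (intro poly_eqI)
      (simp add: coeff_map_poly coeff_mult rhom_sum[OF assms] rhom_mult[OF assms])
qed

definition evp :: "('c::comm_ring_1 \<Rightarrow> 'b::comm_ring_1) \<Rightarrow> 'b \<Rightarrow> 'c poly \<Rightarrow> 'b" where
  "evp h x p = poly (map_poly h p) x"

lemma rhom_evp: "rhom h \<Longrightarrow> rhom (evp h x)"
  unfolding evp_def using rhom_map_poly[of h] by (auto simp: rhom_def)

lemma evp_0: "evp h x 0 = 0" by (simp add: evp_def)

lemma evp_pCons: "rhom h \<Longrightarrow> evp h x (pCons c p) = h c + x * evp h x p"
proof (cases "c = 0 \<and> p = 0")
  case True then show "rhom h \<Longrightarrow> ?thesis" by (simp add: evp_0 rhom_0)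
qed (simp add: evp_def map_poly_pCons rhom_0)

lemma evp_const: "rhom h \<Longrightarrow> evp h x [:c:] = h c"
  by (simp add: evp_pCons evp_0)

lemma evp_var: "rhom h \<Longrightarrow> evp h x [:0, 1:] = x"
  by (simp add: evp_pCons evp_0 rhom_0 rhom_1)

lemma evp_sum: "rhom h \<Longrightarrow> evp h x p = (\<Sum>i\<le>degree p. h (coeff p i) * x ^ i)"
proof (induct p)
  case (pCons c p)
  show ?case
  proof (cases "p = 0")
    case False
    then show ?thesis using pCons
      by (simp add: evp_pCons sum.atMost_Suc_shift sum_distrib_left algebra_simps del: sum.atMost_Suc)
  qed (use pCons in \<open>simp add: evp_const\<close>)
qed (simp add: evp_0 rhom_0)

lemma evp_sum_le:
  assumes "rhom h" "degree p \<le> n"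
  shows "evp h x p = (\<Sum>i\<le>n. h (coeff p i) * x ^ i)"
  unfolding evp_sum[OF assms(1)]
  by (rule sum.mono_neutral_cong_left) (use assms in \<open>auto simp: rhom_0 coeff_eq_0\<close>)

lemma evp_monom: "rhom h \<Longrightarrow> evp h x (monom c n) = h c * x ^ n"
  by (induct n) (auto simp: monom_0 monom_Suc evp_const evp_pCons evp_0 rhom_0)

lemma evp_pcompose: "rhom h \<Longrightarrow> evp h x (pcompose q p) = evp h (evp h x p) q"
  by (induct q)
    (simp_all add: evp_0 pcompose_pCons evp_pCons evp_const rhom_add[OF rhom_evp] rhom_mult[OF rhom_evp])

lemma rhom_poly_eqI:
  assumes "rhom f" "rhom g" "\<And>c. f [:c:] = g [:c:]" "f [:0, 1:] = g [:0, 1:]"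
  shows "f p = g p"
proof (induct p)
  case 0 then show ?case using assms by (simp add: rhom_0)
next
  case (pCons a p)
  have "pCons a p = [:a:] + [:0, 1:] * p" by simp
  then show ?case using pCons assms(3,4)
    by (simp only: rhom_add[OF assms(1)] rhom_add[OF assms(2)] rhom_mult[OF assms(1)] rhom_mult[OF assms(2)])
qed

definition C3 :: "'a::comm_ring_1 \<Rightarrow> 'a poly3" where "C3 a = [:[:[:a:]:]:]"
definition X3 :: "('a::comm_ring_1 poly3)^3" where
  "X3 = vector [[:0, 1:], [:[:0, 1:]:], [:[:[:0, 1:]:]:]]"

text \<open>The coefficient map \<open>h\<close> is a parameter because forms are evaluated in k, in
  the generic field, in k[t], in k[x,y] and in k[X,Y,Z] itself.\<close>

definition ev3 :: "('a::comm_ring_1 \<Rightarrow> 'b::comm_ring_1) \<Rightarrow> 'b^3 \<Rightarrow> 'a poly3 \<Rightarrow> 'b" where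
  "ev3 h v = evp (evp (evp h (v$3)) (v$2)) (v$1)"

lemma rhom_C3: "rhom C3" by (auto simp: rhom_def C3_def one_pCons)

lemma rhom_ev3: "rhom h \<Longrightarrow> rhom (ev3 h v)"
  by (simp add: ev3_def rhom_evp)

lemma ev3_C3: "rhom h \<Longrightarrow> ev3 h v (C3 c) = h c"
  by (simp add: ev3_def C3_def evp_const rhom_evp)

lemma ev3_X3: assumes "rhom h" shows "ev3 h v (X3 $ i) = v $ i"
proof -
  consider "i = 1" | "i = 2" | "i = 3" using exhaust_3 by blast
  then show ?thesis using assms
    by cases (simp_all add: ev3_def X3_def evp_const evp_var rhom_evp vector_3)
qed

text \<open>The universal property of k[X,Y,Z]. Identities between evaluations, substitutions and
  dehomogenisations are reduced to constants and the three variables by it.\<close>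

lemma rhom3_eqI:
  assumes f: "rhom f" and g: "rhom g" and C: "\<And>c. f (C3 c) = g (C3 c)" and X: "\<And>i. f (X3 $ i) = g (X3 $ i)"
  shows "f G = g G"
proof (rule rhom_poly_eqI[OF f g])
  show "f [:0, 1:] = g [:0, 1:]" using X[of 1] by (simp add: X3_def vector_3)
  fix q
  show "f [:q:] = g [:q:]"
  proof (rule rhom_poly_eqI[of "\<lambda>q. f [:q:]" "\<lambda>q. g [:q:]"])
    show "rhom (\<lambda>q. f [:q:])" "rhom (\<lambda>q. g [:q:])" using f g rhom_comp rhom_pconst by blast+
    show "f [:[:0, 1:]:] = g [:[:0, 1:]:]" using X[of 2] by (simp add: X3_def vector_3)
    fix r
    show "f [:[:r:]:] = g [:[:r:]:]"
    proof (rule rhom_poly_eqI[of "\<lambda>r. f [:[:r:]:]" "\<lambda>r. g [:[:r:]:]"])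
      show "rhom (\<lambda>q. f [:[:q:]:])" "rhom (\<lambda>q. g [:[:q:]:])"
        using f g rhom_comp[OF _ rhom_pconst] rhom_comp[OF _ rhom_comp[OF rhom_pconst rhom_pconst]] by blast+
      show "f [:[:[:0, 1:]:]:] = g [:[:[:0, 1:]:]:]" using X[of 3] by (simp add: X3_def vector_3)
      show "f [:[:[:c:]:]:] = g [:[:[:c:]:]:]" for c using C[of c] by (simp add: C3_def)
    qed
  qed
qed

lemma ev3_X3_self: "ev3 C3 X3 G = G"
  by (rule rhom3_eqI[OF rhom_ev3[OF rhom_C3] rhom_id]) (simp_all add: ev3_C3 ev3_X3 rhom_C3)

lemma rhom_ev3_commute:
  assumes "rhom h" "rhom g"
  shows "g (ev3 h v G) = ev3 (\<lambda>a. g (h a)) (\<chi> i. g (v $ i)) G"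
  by (rule rhom3_eqI[of "\<lambda>G. g (ev3 h v G)"])
     (use assms in \<open>simp_all add: rhom_comp rhom_ev3 ev3_C3 ev3_X3\<close>)

lemma eval3_eq_ev3: "eval3 G v = ev3 (\<lambda>x. x) v G"
proof (rule rhom3_eqI)
  show "rhom (\<lambda>G. eval3 G v)" by (auto simp: rhom_def eval3_def)
  show "eval3 (X3 $ i) v = ev3 (\<lambda>x. x) v (X3 $ i)" for i
    unfolding ev3_X3[OF rhom_id] using exhaust_3[of i] by (auto simp: eval3_def X3_def vector_3)
qed (auto simp: rhom_ev3 rhom_id ev3_C3, auto simp: eval3_def C3_def)

lemma term3_eq: "term3 a i j l = C3 a * X3$1 ^ i * X3$2 ^ j * X3$3 ^ l"
proof -
  have p: "[:0, 1::'x::comm_ring_1:] ^ n = monom 1 n" for n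
    by (induct n) (auto simp: monom_0 monom_Suc)
  have q: "[:p:] ^ n = [:p ^ n:]" for p :: "'x::comm_ring_1" and n
    by (induct n) auto
  show ?thesis
    by (simp add: term3_def C3_def X3_def vector_3 p q smult_monom mult.commute)
qed

lemma linear_form_eq: "linear_form w = (\<Sum>i\<in>UNIV. C3 (w$i) * X3$i)"
  by (simp add: linear_form_def term3_eq sum_3)

lemma ev3_linear_form: "rhom h \<Longrightarrow> ev3 h v (linear_form w) = (\<Sum>i\<in>UNIV. h (w$i) * v$i)"
  by (simp add: linear_form_eq rhom_sum rhom_mult rhom_ev3 ev3_C3 ev3_X3)

text \<open>The matrix stays over k while the vector lives in any ring that receives k through
  \<open>h\<close>; for the identity map this is \<open>*v\<close> (\<open>mv_id\<close>).\<close>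

definition mv :: "('a::comm_ring_1 \<Rightarrow> 'b::comm_ring_1) \<Rightarrow> 'a^3^3 \<Rightarrow> 'b^3 \<Rightarrow> 'b^3" where
  "mv h A v = (\<chi> i. \<Sum>j\<in>UNIV. h (A$i$j) * v$j)"

lemma mv_mult:
  assumes "rhom h" shows "mv h A (mv h B v) = mv h (A ** B) v"
  unfolding mv_def matrix_matrix_mult_def vec_eq_iff
  by (simp add: sum_3 rhom_add[OF assms] rhom_mult[OF assms] algebra_simps)

lemma mv_one: "rhom h \<Longrightarrow> mv h (mat 1) v = v"
  unfolding mv_def vec_eq_iff mat_def
  by (simp add: if_distrib[of h] if_distrib[of "\<lambda>x. x * _"] rhom_0 rhom_1 cong: if_cong)

lemma mv_id: "mv (\<lambda>x. x) A v = A *v v"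
  by (simp add: mv_def matrix_vector_mult_def)

definition subst3 :: "'a::comm_ring_1^3^3 \<Rightarrow> 'a poly3 \<Rightarrow> 'a poly3" where
  "subst3 A = ev3 C3 (mv C3 A X3)"

lemma rhom_subst3: "rhom (subst3 A)" by (simp add: subst3_def rhom_ev3 rhom_C3)

lemma ev3_subst3: "rhom h \<Longrightarrow> ev3 h v (subst3 A G) = ev3 h (mv h A v) G"
  unfolding subst3_def by (subst rhom_ev3_commute)
    (auto simp: rhom_C3 rhom_ev3 mv_def rhom_sum rhom_mult ev3_C3 ev3_X3)

lemma eval3_subst3: "eval3 (subst3 A G) v = eval3 G (A *v v)"
  by (simp add: eval3_eq_ev3 ev3_subst3 rhom_id mv_id)

text \<open>Substitution is a pullback of functions, hence the reversed order of the
  matrices.\<close>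

lemma subst3_subst3: "subst3 A (subst3 B G) = subst3 (B ** A) G"
  unfolding subst3_def[of A] subst3_def[of "B ** A"] by (simp add: ev3_subst3 mv_mult rhom_C3)

lemma subst3_one: "subst3 (mat 1) G = G"
  by (simp add: subst3_def mv_one rhom_C3 ev3_X3_self)

lemma subst3_inverse:
  fixes A :: "'a::field^3^3"
  assumes "invertible A"
  shows "subst3 A (subst3 (matrix_inv A) G) = G" "subst3 (matrix_inv A) (subst3 A G) = G"
proof -
  have "matrix_inv A ** A = mat 1" "A ** matrix_inv A = mat 1"
    using assms unfolding invertible_def matrix_inv_def by (metis (mono_tags, lifting) someI_ex)+
  then show "subst3 A (subst3 (matrix_inv A) G) = G" "subst3 (matrix_inv A) (subst3 A G) = G"
    by (simp_all add: subst3_subst3 subst3_one)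
qed

section \<open>Homogeneity\<close>

text \<open>\<open>grade G\<close> is \<open>G(tX, tY, tZ)\<close>, a polynomial in \<open>t\<close>: its coefficient at \<open>t\<^sup>n\<close> is the
  homogeneous component of degree \<open>n\<close>.\<close>

definition grade :: "'a::comm_ring_1 poly3 \<Rightarrow> 'a poly3 poly" where
  "grade = ev3 (\<lambda>a. [:C3 a:]) (\<chi> i. monom (X3$i) 1)"

lemma rhom_gc: "rhom (\<lambda>a. [:C3 a:])" using rhom_comp[OF rhom_pconst rhom_C3] .

lemma rhom_grade: "rhom grade" by (simp add: grade_def rhom_ev3 rhom_gc)

text \<open>Each variable carries one factor t, so a multiplication by a variable shifts one
  exponent and the t-degree together. The inductions peel Z, then Y, then X, as the nesting of
  \<open>poly3\<close> dictates.\<close>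

lemma coeff_grade:
  "coeff (coeff (coeff (coeff (grade G) n) i) j) l =
   (if i + j + l = n then coeff (coeff (coeff G i) j) l else 0)"
proof -
  define c4 where "c4 P n i j l = coeff (coeff (coeff (coeff P n) i) j) l"
    for P :: "'a poly3 poly" and n i j l
  have gX: "grade (X3$i) = monom (X3$i) 1" for i :: 3
    by (simp add: grade_def ev3_X3 rhom_gc)
  have gC: "grade (C3 c) = [:C3 c:]" for c :: 'a by (simp add: grade_def ev3_C3 rhom_gc)
  have 1: "c4 (grade [:[:r:]:]) n i j l = (if i = 0 \<and> j = 0 \<and> l = n then coeff r l else 0)"
    for r :: "'a poly" and n i j l
  proof (induct r arbitrary: n l)
    case 0 then show ?case by (simp add: rhom_0[OF rhom_grade] c4_def)
  next
    case (pCons c r)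
    have "[:[:pCons c r:]:] = C3 c + X3$3 * [:[:r:]:]" by (simp add: C3_def X3_def vector_3)
    then have "grade [:[:pCons c r:]:] = [:C3 c:] + [:0, [:[:[:0, 1:]:]:]:] * grade [:[:r:]:]"
      by (simp only: rhom_add[OF rhom_grade] rhom_mult[OF rhom_grade] gX gC)
         (simp add: X3_def vector_3 monom_Suc monom_0)
    then show ?case using pCons(2)[of "n - 1" "l - 1"]
      by (cases n; cases l; cases i; cases j) (auto simp: c4_def C3_def)
  qed
  have 2: "c4 (grade [:q:]) n i j l = (if i = 0 \<and> j + l = n then coeff (coeff q j) l else 0)"
    for q :: "'a poly poly" and n i j l
  proof (induct q arbitrary: n j)
    case 0 then show ?case by (simp add: rhom_0[OF rhom_grade] c4_def)
  next
    case (pCons r q)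
    have "[:pCons r q:] = [:[:r:]:] + X3$2 * [:q:]" by (simp add: X3_def vector_3)
    then have "grade [:pCons r q:] = grade [:[:r:]:] + [:0, [:[:0, 1:]:]:] * grade [:q:]"
      by (simp only: rhom_add[OF rhom_grade] rhom_mult[OF rhom_grade] gX gC)
         (simp add: X3_def vector_3 monom_Suc monom_0)
    then show ?case using pCons(2)[of "n - 1" "j - 1"] 1[of r n i j l]
      by (cases n; cases l; cases i; cases j) (auto simp: c4_def)
  qed
  have "c4 (grade G) n i j l = (if i + j + l = n then coeff (coeff (coeff G i) j) l else 0)"
  proof (induct G arbitrary: n i)
    case 0 then show ?case by (simp add: rhom_0[OF rhom_grade] c4_def)
  next
    case (pCons q G)
    have "pCons q G = [:q:] + X3$1 * G" by (simp add: X3_def vector_3)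
    then have "grade (pCons q G) = grade [:q:] + [:0, [:0, 1:]:] * grade G"
      by (simp only: rhom_add[OF rhom_grade] rhom_mult[OF rhom_grade] gX gC)
         (simp add: X3_def vector_3 monom_Suc monom_0)
    then show ?case using pCons(2)[of "n - 1" "i - 1"] 2[of q n i j l]
      by (cases n; cases l; cases i; cases j) (auto simp: c4_def)
  qed
  then show ?thesis by (simp add: c4_def)
qed

text \<open>Turns a condition on exponents into an equation for the ring homomorphism
  \<open>grade\<close>; products, sums and factors of forms are then handled by calculation in
  k[X,Y,Z][t].\<close>

lemma homogeneous_iff_grade: "homogeneous n G \<longleftrightarrow> grade G = monom G n"
proof
  assume "homogeneous n G"
  then show "grade G = monom G n"
    unfolding homogeneous_def
    by (intro poly_eqI) (auto simp: coeff_grade coeff_monom)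
next
  assume "grade G = monom G n"
  then have "(if i + j + l = m then coeff (coeff (coeff G i) j) l else 0) =
    coeff (coeff (coeff (coeff (monom G n) m) i) j) l" for i j l m
    by (metis coeff_grade)
  then have "i + j + l = n" if "coeff (coeff (coeff G i) j) l \<noteq> 0" for i j l
    using that by (metis coeff_0 coeff_monom)
  then show "homogeneous n G" unfolding homogeneous_def by blast
qed

text \<open>G(t v) is the value at t of \<open>grade G\<close> once its coefficients have been
  evaluated at v.\<close>

lemma ev3_homogeneous:
  assumes "homogeneous n G" "rhom h"
  shows "ev3 h (\<chi> i. t * v$i) G = t ^ n * ev3 h v G"
proof -
  have "ev3 h (\<chi> i. t * v$i) G = evp (ev3 h v) t (grade G)"
    unfolding grade_def
    by (subst rhom_ev3_commute[OF rhom_gc rhom_evp])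
       (use assms(2) in \<open>simp_all add: rhom_ev3 evp_const evp_monom ev3_C3 ev3_X3 mult.commute\<close>)
  also have "\<dots> = evp (ev3 h v) t (monom G n)" using assms(1) by (simp only: homogeneous_iff_grade)
  finally show ?thesis using assms(2) by (simp add: evp_monom rhom_ev3 mult.commute)
qed

lemma eval3_homogeneous:
  assumes "homogeneous n G" shows "eval3 G (t *s v) = t ^ n * eval3 G v"
  using ev3_homogeneous[OF assms rhom_id] by (simp add: eval3_eq_ev3 vector_scalar_mult_def)

lemma homogeneous_mult:
  fixes G :: "'a::comm_ring_1 poly3"
  shows "homogeneous m G \<Longrightarrow> homogeneous n H \<Longrightarrow> homogeneous (m + n) (G * H)"
  unfolding homogeneous_iff_grade by (simp add: rhom_mult[OF rhom_grade] mult_monom)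

lemma homogeneous_add:
  fixes G :: "'a::comm_ring_1 poly3"
  shows "homogeneous n G \<Longrightarrow> homogeneous n H \<Longrightarrow> homogeneous n (G + H)"
  unfolding homogeneous_iff_grade by (simp add: rhom_add[OF rhom_grade] add_monom)

lemma homogeneous_minus:
  fixes G :: "'a::comm_ring_1 poly3"
  shows "homogeneous n G \<Longrightarrow> homogeneous n (- G)"
  unfolding homogeneous_iff_grade by (simp add: rhom_minus[OF rhom_grade] minus_monom)

lemma homogeneous_zero: "homogeneous n 0"
  by (simp add: homogeneous_def)

lemma homogeneous_sum:
  fixes f :: "'b \<Rightarrow> 'a::comm_ring_1 poly3"
  shows "(\<And>x. x \<in> A \<Longrightarrow> homogeneous n (f x)) \<Longrightarrow> homogeneous n (sum f A)"
  by (induct A rule: infinite_finite_induct) (auto simp: homogeneous_zero homogeneous_add)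

lemma homogeneous_C3: "homogeneous 0 (C3 c)"
  by (simp add: homogeneous_iff_grade grade_def ev3_C3 rhom_gc monom_0)

lemma homogeneous_X3: "homogeneous 1 (X3 $ i)"
  by (simp add: homogeneous_iff_grade grade_def ev3_X3 rhom_gc)

lemma homogeneous_linear_form: "homogeneous 1 (linear_form w)"
  unfolding linear_form_eq using homogeneous_mult[OF homogeneous_C3 homogeneous_X3]
  by (intro homogeneous_sum) auto

lemma homogeneous_term3: "homogeneous (i + j + l) (term3 a i j l)"
  by (auto simp: homogeneous_def term3_def coeff_monom split: if_splits)

lemma homogeneous_subst3:
  assumes "homogeneous n G" shows "homogeneous n (subst3 A G)"
proof -
  let ?t = "monom 1 1 :: 'a poly3 poly"
  have "grade (subst3 A G) = ev3 (\<lambda>a. [:C3 a:]) (mv (\<lambda>a. [:C3 a:]) A (\<chi> i. monom (X3$i) 1)) G"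
    by (simp add: grade_def ev3_subst3 rhom_gc)
  \<comment> \<open>The linear forms M X become t times themselves, so
    \<open>ev3_homogeneous\<close> over the ring k[X,Y,Z][t] extracts the factor t ^ n.\<close>
  also have "mv (\<lambda>a. [:C3 a:]) A (\<chi> i. monom (X3$i) 1) = (\<chi> i. ?t * [:mv C3 A X3 $ i:])"
    by (simp add: mv_def vec_eq_iff sum_3 smult_monom monom_Suc monom_0)
  also have "ev3 (\<lambda>a. [:C3 a:]) (\<chi> i. ?t * [:mv C3 A X3 $ i:]) G
    = ?t ^ n * ev3 (\<lambda>a. [:C3 a:]) (\<chi> i. [:mv C3 A X3 $ i:]) G"
    using ev3_homogeneous[OF assms rhom_gc, of ?t "\<chi> i. [:mv C3 A X3 $ i:]"] by simp
  also have "ev3 (\<lambda>a. [:C3 a:]) (\<chi> i. [:mv C3 A X3 $ i:]) G = [:subst3 A G:]"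
    unfolding subst3_def using rhom_ev3_commute[OF rhom_C3 rhom_pconst, of "mv C3 A X3" G] by simp
  also have "?t ^ n * [:subst3 A G:] = monom (subst3 A G) n"
    by (simp add: monom_power smult_monom)
  finally show ?thesis by (simp add: homogeneous_iff_grade)
qed

text \<open>In k[X,Y,Z][t], a domain, the grade of the product is
  \<open>monom F d * grade G\<close>; comparing t-degrees bounds d, and cancelling
  \<open>monom F d\<close> shows that the cofactor is a form.\<close>

lemma homogeneous_factor:
  fixes F G :: "'a::idom poly3"
  assumes "homogeneous d F" "homogeneous n (F * G)" "F * G \<noteq> 0"
  shows "d \<le> n" "homogeneous (n - d) G"
proof -
  have eq: "monom F d * grade G = monom (F * G) n"
    using assms by (simp add: homogeneous_iff_grade rhom_mult[OF rhom_grade])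
  have "monom F d * grade G \<noteq> 0" using assms eq by simp
  then have "degree (monom F d * grade G) = d + degree (grade G)"
    using assms(3) by (subst degree_mult_eq) (auto simp: degree_monom_eq)
  then show dn: "d \<le> n" using eq assms(3) by (simp add: degree_monom_eq)
  have "monom F d * grade G = monom F d * monom G (n - d)"
    unfolding eq using dn by (simp add: mult_monom)
  then show "homogeneous (n - d) G" using assms(3) by (simp add: homogeneous_iff_grade)
qed

lemma homogeneous_0_const:
  assumes "homogeneous 0 G" shows "\<exists>c. G = C3 c"
proof -
  have z: "coeff (coeff (coeff G i) j) l \<noteq> 0 \<Longrightarrow> i + j + l = 0" for i j l
    using assms by (auto simp: homogeneous_def)
  have "G = C3 (coeff (coeff (coeff G 0) 0) 0)"
  proof (intro poly_eqI)
    fix i j l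
    show "coeff (coeff (coeff G i) j) l =
      coeff (coeff (coeff (C3 (coeff (coeff (coeff G 0) 0) 0)) i) j) l"
      using z[of i j l] by (cases i; cases j; cases l) (auto simp: C3_def)
  qed
  then show ?thesis by blast
qed

section \<open>The generic point and the Nullstellensatz\<close>

text \<open>A gcd on every fraction field makes Gauss's lemma and Bezout coefficients available over
  it. It also serves the field k itself: k is isomorphic to its own fraction field
  (\<open>bij_to_fract\<close>), and over this copy the polynomial rings in one and two variables
  are factorial with a chosen gcd.\<close>

instantiation fract :: (idom)
  "{unique_euclidean_ring, normalization_euclidean_semiring, normalization_semidom_multiplicative}"
begin

definition [simp]: "normalize_fract = (normalize_field :: 'a fract \<Rightarrow> _)"
definition [simp]: "unit_factor_fract = (unit_factor_field :: 'a fract \<Rightarrow> _)"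
definition [simp]: "modulo_fract = (mod_field :: 'a fract \<Rightarrow> _)"
definition [simp]: "euclidean_size_fract = (euclidean_size_field :: 'a fract \<Rightarrow> _)"
definition [simp]: "division_segment (x :: 'a fract) = 1"

instance
  by standard (simp_all add: dvd_field_iff field_split_simps split: if_splits)

end

instantiation fract :: (idom) euclidean_ring_gcd
begin

definition gcd_fract :: "'a fract \<Rightarrow> 'a fract \<Rightarrow> 'a fract" where
  "gcd_fract = Euclidean_Algorithm.gcd"
definition lcm_fract :: "'a fract \<Rightarrow> 'a fract \<Rightarrow> 'a fract" where
  "lcm_fract = Euclidean_Algorithm.lcm"
definition Gcd_fract :: "'a fract set \<Rightarrow> 'a fract" where
  "Gcd_fract = Euclidean_Algorithm.Gcd"
definition Lcm_fract :: "'a fract set \<Rightarrow> 'a fract" where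
  "Lcm_fract = Euclidean_Algorithm.Lcm"

instance by standard (simp_all add: gcd_fract_def lcm_fract_def Gcd_fract_def Lcm_fract_def)

end

instance fract :: (idom) field_gcd ..

lemma rhom_to_fract: "rhom to_fract"
  by (auto simp: rhom_def)

lemma bij_to_fract: "bij (to_fract :: 'a::field \<Rightarrow> 'a fract)"
proof (rule bijI)
  show "inj (to_fract :: 'a \<Rightarrow> 'a fract)" by (auto simp: inj_def)
  have "\<exists>a. q = to_fract a" for q :: "'a fract"
  proof (cases q)
    case (Fract a b)
    then have "q = to_fract (a / b)" by (simp add: to_fract_def eq_fract)
    then show ?thesis by blast
  qed
  then show "surj (to_fract :: 'a \<Rightarrow> 'a fract)" by (auto simp: surj_def)
qed

lemma rhom_inv:
  assumes "rhom f" "bij f" shows "rhom (inv_into UNIV f)"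
proof (rule rhomI)
  have f: "f (inv_into UNIV f x) = x" for x using assms(2) by (simp add: bij_is_surj surj_f_inv_f)
  have i: "inv_into UNIV f (f x) = x" for x using assms(2) by (simp add: bij_is_inj)
  show "inv_into UNIV f 1 = 1" using i[of 1] by (simp add: rhom_1[OF assms(1)])
  show "inv_into UNIV f (a + b) = inv_into UNIV f a + inv_into UNIV f b" for a b
    using i[of "inv_into UNIV f a + inv_into UNIV f b"] by (simp add: rhom_add[OF assms(1)] f)
  show "inv_into UNIV f (a * b) = inv_into UNIV f a * inv_into UNIV f b" for a b
    using i[of "inv_into UNIV f a * inv_into UNIV f b"] by (simp add: rhom_mult[OF assms(1)] f)
qed

lemma bij_map_poly:
  assumes "rhom f" "bij f" shows "bij (map_poly f)"
proof (rule o_bij)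
  have 0: "f 0 = 0" "inv_into UNIV f 0 = 0" using rhom_0 assms rhom_inv by blast+
  show "map_poly (inv_into UNIV f) \<circ> map_poly f = id"
    using assms(2) by (auto simp: fun_eq_iff poly_eq_iff coeff_map_poly 0 bij_is_inj)
  show "map_poly f \<circ> map_poly (inv_into UNIV f) = id"
    using assms(2) by (auto simp: fun_eq_iff poly_eq_iff coeff_map_poly 0 bij_is_surj surj_f_inv_f)
qed

lemma rhom_dvd: "rhom f \<Longrightarrow> a dvd b \<Longrightarrow> f a dvd f b"
  by (auto simp: dvd_def rhom_mult)

lemma bij_rhom_dvd_iff:
  assumes "rhom f" "bij f" shows "f a dvd f b \<longleftrightarrow> a dvd b"
  using rhom_dvd[OF assms(1), of a b] rhom_dvd[OF rhom_inv[OF assms], of "f a" "f b"] assms(2)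
  by (auto simp: bij_is_inj)

lemma bij_rhom_irreducible:
  assumes "rhom f" "bij f" "Factorial_Ring.irreducible F" shows "Factorial_Ring.irreducible (f F)"
proof (rule Factorial_Ring.irreducibleI)
  have inj: "f x = f y \<longleftrightarrow> x = y" for x y using assms(2) by (auto dest: bij_is_inj injD)
  show "f F \<noteq> 0" using assms(3) inj[of F 0] by (auto simp: rhom_0[OF assms(1)] Factorial_Ring.irreducible_def)
  show "\<not> f F dvd 1"
    using assms(3) bij_rhom_dvd_iff[OF assms(1,2), of F 1] by (auto simp: rhom_1[OF assms(1)] Factorial_Ring.irreducible_def)
  fix a b assume ab: "f F = a * b"
  obtain a' b' where a': "a = f a'" "b = f b'" using assms(2) by (metis bij_pointE)
  have "F = a' * b'" using ab inj[of F "a' * b'"] by (simp add: a' rhom_mult[OF assms(1)])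
  then have "a' dvd 1 \<or> b' dvd 1" using assms(3) by (auto simp: Factorial_Ring.irreducible_def)
  then show "a dvd 1 \<or> b dvd 1" using rhom_dvd[OF assms(1), of _ 1] by (auto simp: a' rhom_1[OF assms(1)])
qed

lemma clear_denominators:
  fixes p :: "'a::{factorial_ring_gcd, semiring_gcd_mult_normalize} fract poly"
  obtains b p' where "b \<noteq> 0" "smult (to_fract b) p = map_poly to_fract p'"
proof -
  obtain c q where p: "p = smult c (map_poly to_fract q)"
    by (rule content_decompose_fract)
  obtain a b where c: "c = Fract a b" "b \<noteq> 0" by (cases c)
  have "smult (to_fract b) p = map_poly to_fract (smult a q)"
    using c by (simp add: p Fract_conv_to_fract)
  then show ?thesis using c(2) that by blast
qed

text \<open>By Gauss's lemma F stays irreducible over the fraction field, hence is coprime to G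
  there; D arises from clearing denominators in the Bezout identity. It plays the part of a
  resultant: a nonzero element free of the main variable.\<close>

lemma irreducible_bezout_ufd:
  fixes F G :: "'a::{factorial_ring_gcd, semiring_gcd_mult_normalize} poly"
  assumes "Factorial_Ring.irreducible F" "degree F \<noteq> 0" "\<not> F dvd G"
  obtains A B D where "D \<noteq> 0" "A * F + B * G = [:D:]"
proof -
  have irr: "Factorial_Ring.irreducible (map_poly to_fract F)" "content F = 1"
    using assms by (simp_all add: nonconst_poly_irreducible_iff)
  then have "\<not> map_poly to_fract F dvd map_poly to_fract G" using fract_poly_dvdD assms(3) by blast
  then have "coprime (map_poly to_fract F) (map_poly to_fract G)"
    using prime_elem_imp_coprime field_poly_irreducible_imp_prime[OF irr(1)] by blast
  then obtain u w where uw: "u * map_poly to_fract F + w * map_poly to_fract G = 1"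
    using bezout_coefficients_fst_snd[of "map_poly to_fract F" "map_poly to_fract G"]
    by (metis coprime_imp_gcd_eq_1)
  obtain b u' where u: "b \<noteq> 0" "smult (to_fract b) u = map_poly to_fract u'"
    by (rule clear_denominators)
  obtain c w' where w: "c \<noteq> 0" "smult (to_fract c) w = map_poly to_fract w'"
    by (rule clear_denominators)
  have "map_poly to_fract (smult c u' * F + smult b w' * G) =
     smult (to_fract c) (smult (to_fract b) u) * map_poly to_fract F
     + smult (to_fract b) (smult (to_fract c) w) * map_poly to_fract G"
    by (simp add: u(2) w(2))
  also have "\<dots> = smult (to_fract (b * c)) (u * map_poly to_fract F + w * map_poly to_fract G)"
    by (simp add: smult_add_right mult.commute)
  also have "\<dots> = map_poly to_fract [:b * c:]"
    by (simp only: uw) (simp add: map_poly_pCons one_pCons)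
  finally have "smult c u' * F + smult b w' * G = [:b * c:]"
    by (simp only: fract_poly_eq_iff)
  then show ?thesis by (rule that[rotated]) (use u(1) w(1) in simp)
qed

text \<open>The previous result is transported along the isomorphism from k to its fraction field,
  applied to the innermost coefficients.\<close>

lemma irreducible_bezout:
  fixes F G :: "'a::field poly3"
  assumes "Factorial_Ring.irreducible F" "degree F \<noteq> 0" "\<not> F dvd G"
  obtains A B D where "D \<noteq> 0" "A * F + B * G = [:D:]"
proof -
  let ?f2 = "map_poly (map_poly (to_fract :: 'a \<Rightarrow> _))"
  let ?f = "map_poly ?f2"
  have r2: "rhom ?f2" and b2: "bij ?f2"
    by (intro rhom_map_poly rhom_to_fract bij_map_poly bij_to_fract)+
  have r: "rhom ?f" and b: "bij ?f"
    by (intro rhom_map_poly rhom_to_fract bij_map_poly bij_to_fract)+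
  note rg = rhom_inv[OF r b]
  have deg: "degree (?f F) = degree F"
    using b2 by (intro degree_map_poly) (metis bij_pointE rhom_0[OF r2])
  obtain A B D where D: "D \<noteq> 0" "A * ?f F + B * ?f G = [:D:]"
    using irreducible_bezout_ufd[of "?f F" "?f G"] bij_rhom_irreducible[OF r b assms(1)]
      assms(2,3) deg bij_rhom_dvd_iff[OF r b] by metis
  obtain D' where D': "D = ?f2 D'" using b2 by (metis bij_pointE)
  have "inv_into UNIV ?f [:D:] = [:D':]"
    using b by (intro inv_f_eq) (auto simp: bij_is_inj map_poly_pCons D' rhom_0[OF r2])
  moreover have "inv_into UNIV ?f [:D:] = inv_into UNIV ?f A * F + inv_into UNIV ?f B * G"
    unfolding D(2)[symmetric] using b by (simp add: rhom_add[OF rg] rhom_mult[OF rg] bij_is_inj)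
  moreover have "D' \<noteq> 0" using D(1) D' rhom_0[OF r2] by auto
  ultimately show ?thesis using that by metis
qed

text \<open>The algebraic closure of k(Y,Z): here F = 0 can be solved for the first coordinate while
  the other two stay independent.\<close>

type_synonym 'a generic_field = "'a poly poly fract alg_closure"

definition gconst :: "'a::field \<Rightarrow> 'a generic_field" where
  "gconst a = to_ac (to_fract [:[:a:]:])"

lemma rhom_to_ac: "rhom to_ac" by (auto simp: rhom_def)

lemma rhom_gconst: "rhom gconst"
  unfolding gconst_def
  by (intro rhom_comp[OF rhom_to_ac] rhom_comp[OF rhom_to_fract] rhom_comp[OF rhom_pconst rhom_pconst])

lemma infinite_alg_closed: "infinite (UNIV :: 'a::alg_closed_field set)"
proof
  assume fin: "finite (UNIV :: 'a set)"
  let ?p = "(\<Prod>a\<in>UNIV. [:- a, 1 :: 'a:]) + 1"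
  have "degree (\<Prod>a\<in>UNIV. [:- a, 1 :: 'a:]) = card (UNIV :: 'a set)"
    by (subst degree_prod_eq_sum_degree) auto
  then have "degree ?p > 0"
    using fin by (subst degree_add_eq_left) (auto simp: card_gt_0_iff)
  then obtain x where "poly ?p x = 0" using alg_closed_imp_poly_has_root by blast
  moreover have "poly (\<Prod>a\<in>UNIV. [:- a, 1 :: 'a:]) x = 0"
    unfolding poly_prod using fin by (intro prod_zero) auto
  ultimately show False by simp
qed

lemma poly_nonroot_ex:
  fixes p :: "'a::alg_closed_field poly"
  assumes "p \<noteq> 0" obtains x where "poly p x \<noteq> 0"
proof -
  have "finite {x. poly p x = 0}" using assms by (rule poly_roots_finite)
  then have "{x. poly p x = 0} \<noteq> UNIV" using infinite_alg_closed by metis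
  then show ?thesis using that by blast
qed

lemma irreducible_homogeneous_dvd:
  fixes F L :: "'a::idom poly3"
  assumes "Factorial_Ring.irreducible F" "homogeneous d F" "homogeneous n L" "L \<noteq> 0" "F dvd L"
  shows "d \<le> n"
  using assms homogeneous_factor(1) by (metis dvdE)

text \<open>A form in Y and Z alone splits into linear forms over an algebraically closed field, so
  an irreducible form of degree at least 2 must involve X.\<close>

lemma homogeneous_irreducible_degree:
  fixes F :: "'a::alg_closed_field poly3"
  assumes irr: "Factorial_Ring.irreducible F" and hom: "homogeneous d F" and d: "d \<ge> 2"
  shows "degree F \<noteq> 0"
proof
  assume "degree F = 0"
  then obtain F0 where F0: "F = [:F0:]" by (metis degree_eq_zeroE)
  have c: "coeff (coeff F0 j) l = 0" if "j + l \<noteq> d" for j l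
  proof (rule ccontr)
    assume "coeff (coeff F0 j) l \<noteq> 0"
    then have "coeff (coeff (coeff F 0) j) l \<noteq> 0" by (simp add: F0)
    then show False using hom that unfolding homogeneous_def by fastforce
  qed
  have nolin: False if "L dvd F" "homogeneous 1 L" "L \<noteq> 0" for L
  proof -
    obtain G where G: "F = L * G" using \<open>L dvd F\<close> by (rule dvdE)
    then have "L dvd 1 \<or> G dvd 1" using irr by (auto simp: Factorial_Ring.irreducible_def)
    then show False
    proof
      assume "L dvd 1"
      then obtain M where "L * M = 1" by (metis dvdE)
      moreover have "homogeneous 0 (1 :: 'a poly3)" using homogeneous_C3[of 1] by (simp add: rhom_1[OF rhom_C3])
      ultimately have "1 \<le> (0::nat)" using homogeneous_factor(1)[OF that(2), of 0 M] by simp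
      then show False by simp
    next
      assume "G dvd 1"
      then obtain M where M: "1 = G * M" by (rule dvdE)
      have "F * M = L * (G * M)" using G by (simp add: mult.assoc)
      then have "F dvd L" using M by (metis dvd_triv_left mult.right_neutral)
      then show False using irreducible_homogeneous_dvd[OF irr hom that(2,3)] d by simp
    qed
  qed
  \<comment> \<open>f0 is F0(Y, 1); homogeneity lets its coefficients determine F0.\<close>
  define f0 where "f0 = map_poly (\<lambda>r. poly r 1) F0"
  have cf0: "coeff f0 j = coeff (coeff F0 j) (d - j)" for j
  proof -
    have "coeff F0 j = monom (coeff (coeff F0 j) (d - j)) (d - j)"
    proof (rule poly_eqI)
      fix n
      show "coeff (coeff F0 j) n =
          coeff (monom (coeff (coeff F0 j) (d - j)) (d - j)) n"
        using c[of j n] by (cases "j + n = d") (auto simp: coeff_monom)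
    qed
    then have "poly (coeff F0 j) 1 = coeff (coeff F0 j) (d - j)"
      by (metis mult.right_neutral poly_monom power_one)
    then show ?thesis by (simp add: f0_def coeff_map_poly)
  qed
  show False
  proof (cases "degree f0 = 0")
    case True
    \<comment> \<open>With f0 constant, F0 is a constant multiple of Z ^ d, so Z divides it.\<close>
    have "[:[:[:0, 1:]:]:] dvd F"
    proof -
      have z: "coeff F0 j = 0" if "j > 0" for j
      proof (rule poly_eqI)
        fix l
        show "coeff (coeff F0 j) l = coeff 0 l"
        proof (cases "j + l = d")
          case l: True
          have "coeff f0 j = 0" using True that by (simp add: coeff_eq_0)
          then show ?thesis using l cf0[of j] by auto
        qed (simp add: c)
      qed
      have "F0 = [:coeff F0 0:]"
      proof (rule poly_eqI)
        fix j show "coeff F0 j = coeff [:coeff F0 0:] j"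
          using z[of j] by (cases j) auto
      qed
      moreover have "[:0, 1:] dvd coeff F0 0"
        using c[of 0 0] d poly_eq_0_iff_dvd[of "coeff F0 0" 0] by (simp add: poly_0_coeff_0)
      ultimately show ?thesis unfolding F0 by (metis const_poly_dvd_const_poly_iff)
    qed
    moreover have x3: "(X3 $ 3 :: 'a poly3) = [:[:[:0, 1:]:]:]" unfolding X3_def by (rule vector_3)
    ultimately have "X3 $ 3 dvd F" by (simp only:)
    then show False by (rule nolin[OF _ homogeneous_X3]) (simp only: x3 pCons_eq_0_iff one_neq_zero simp_thms)
  next
    case False
    then obtain b where b: "poly f0 b = 0" using alg_closed_imp_poly_has_root by blast
    \<comment> \<open>A root b of f0 makes Y = b Z a zero of F0, and Y - b Z becomes the linear
      factor.\<close>
    have "poly F0 [:0, b:] = 0"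
    proof -
      have "poly F0 [:0, b:] = (\<Sum>j\<le>degree F0. coeff F0 j * [:0, b:] ^ j)" by (simp add: poly_altdef)
      also have "\<dots> = (\<Sum>j\<le>degree F0. monom (coeff f0 j * b ^ j) d)"
      proof (rule sum.cong)
        fix j
        show "coeff F0 j * [:0, b:] ^ j = monom (coeff f0 j * b ^ j) d"
        proof (cases "j \<le> d")
          case True
          have "coeff F0 j = monom (coeff f0 j) (d - j)"
          proof (rule poly_eqI)
            fix n
            show "coeff (coeff F0 j) n = coeff (monom (coeff f0 j) (d - j)) n"
              using c[of j n] by (cases "j + n = d") (auto simp: coeff_monom cf0)
          qed
          moreover have "[:0, b:] ^ j = monom (b ^ j) j"
            by (metis monom_0 monom_Suc monom_power mult_1 One_nat_def)
          ultimately show ?thesis using True by (simp add: mult_monom)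
        next
          case False
          then have "coeff F0 j = 0" using c[of j] by (intro poly_eqI) auto
          moreover have "coeff f0 j = 0" using c[of j] False by (simp add: cf0)
          ultimately show ?thesis by simp
        qed
      qed simp
      also have "\<dots> = monom (\<Sum>j\<le>degree F0. coeff f0 j * b ^ j) d"
        by (simp add: poly_eq_iff coeff_sum coeff_monom)
      also have "(\<Sum>j\<le>degree F0. coeff f0 j * b ^ j) = poly f0 b"
        unfolding poly_altdef
        by (rule sum.mono_neutral_right) (auto simp: f0_def map_poly_degree_leq coeff_eq_0)
      finally show ?thesis by (simp add: b)
    qed
    then have "[:- [:0, b:], 1:] dvd F0" by (simp add: poly_eq_0_iff_dvd)
    then have "[:[:- [:0, b:], 1:]:] dvd F" unfolding F0 by (simp add: const_poly_dvd_const_poly_iff)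
    moreover have "[:[:- [:0, b:], 1:]:] = linear_form (vector [0, 1, - b] :: 'a^3)"
      by (simp add: linear_form_eq sum_3 vector_3 X3_def C3_def)
    ultimately show False using nolin homogeneous_linear_form[of "vector [0, 1, - b] :: 'a^3"] by (metis pCons_eq_0_iff one_neq_zero)
  qed
qed

text \<open>Take independent y, z and a root x of F(X, y, z). If G vanished at (x, y, z) without
  being divisible by F, the Bezout identity would give D(y, z) = 0 for some D \<noteq> 0 in
  k[Y,Z].\<close>

lemma generic_point_ex:
  fixes F :: "'a::field poly3"
  assumes irr: "Factorial_Ring.irreducible F" and deg: "degree F \<noteq> 0"
  obtains v :: "'a generic_field^3" where "\<And>G. ev3 gconst v G = 0 \<longleftrightarrow> F dvd G"
proof -
  let ?y = "to_ac (to_fract [:0, 1:]) :: 'a generic_field" and ?z = "to_ac (to_fract [:[:0, 1:]:]) :: 'a generic_field"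
  let ?h = "\<lambda>q. to_ac (to_fract q) :: 'a generic_field"
  have rh: "rhom ?h" by (intro rhom_comp[OF rhom_to_ac rhom_to_fract])
  have e: "evp (evp gconst ?z) ?y q = ?h q" for q :: "'a poly poly"
  proof (rule rhom_poly_eqI[OF rhom_evp[OF rhom_evp[OF rhom_gconst]] rh])
    fix r :: "'a poly"
    have "evp gconst ?z r = ?h [:r:]"
    proof (rule rhom_poly_eqI[OF rhom_evp[OF rhom_gconst]])
      show "rhom (\<lambda>r. ?h [:r:])" by (intro rhom_comp[OF rh rhom_pconst])
      show "evp gconst ?z [:c:] = ?h [:[:c:]:]" for c by (simp add: evp_const rhom_gconst gconst_def)
      show "evp gconst ?z [:0, 1:] = ?h [:[:0, 1:]:]" by (simp add: evp_var rhom_gconst)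
    qed
    then show "evp (evp gconst ?z) ?y [:r:] = ?h [:r:]" by (simp add: evp_const rhom_evp rhom_gconst)
    show "evp (evp gconst ?z) ?y [:0, 1:] = ?h [:0, 1:]" by (simp add: evp_var rhom_evp rhom_gconst)
  qed
  have h0: "?h q = 0 \<longleftrightarrow> q = 0" for q by (metis rhom_inj(2) rhom_to_ac to_fract_eq_0_iff)
  have "degree (map_poly ?h F) = degree F"
    by (intro degree_map_poly) (simp add: h0 del: to_ac_eq_0_iff)
  then obtain x where x: "poly (map_poly ?h F) x = 0"
    using alg_closed_imp_poly_has_root[of "map_poly ?h F"] deg by auto
  define v where "v = (vector [x, ?y, ?z] :: 'a generic_field^3)"
  have ev: "ev3 gconst v G = evp ?h x G" for G
    unfolding ev3_def v_def by (simp add: vector_3 e[abs_def] fun_eq_iff)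
  have F0: "ev3 gconst v F = 0" using x by (simp add: ev evp_def)
  show ?thesis
  proof (rule that[of v])
    fix G
    show "ev3 gconst v G = 0 \<longleftrightarrow> F dvd G"
    proof
      assume "F dvd G"
      then show "ev3 gconst v G = 0" using F0 by (auto simp: rhom_mult[OF rhom_ev3[OF rhom_gconst]])
    next
      assume G: "ev3 gconst v G = 0"
      show "F dvd G"
      proof (rule ccontr)
        assume "\<not> F dvd G"
        then obtain A B D where D: "D \<noteq> 0" "A * F + B * G = [:D:]" using irreducible_bezout[OF irr deg] by metis
        have "ev3 gconst v [:D:] = 0" unfolding D(2)[symmetric]
          by (simp add: rhom_mult[OF rhom_ev3[OF rhom_gconst]] rhom_add[OF rhom_ev3[OF rhom_gconst]] F0 G)
        then show False using D(1) h0[of D] by (simp add: ev evp_const[OF rh])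
      qed
    qed
  qed
qed

lemma proj_plane_eval3:
  assumes "homogeneous n G" "n > 0"
  shows "vec.span {v} \<in> curve G \<longleftrightarrow> v \<noteq> 0 \<and> eval3 G v = 0"
proof -
  have nz: "v \<noteq> 0" if "vec.span {v} \<in> proj_plane"
  proof
    assume "v = 0"
    have "\<exists>w. vec.span {v} = vec.span {w} \<and> w \<noteq> 0"
      using that by (simp only: proj_plane_def mem_Collect_eq)
    then obtain w where w: "w \<noteq> 0" "vec.span {v} = vec.span {w}" by metis
    have "w \<in> vec.span {v}" using w(2) vec.span_base[of w "{w}"] by simp
    then show False using w(1) \<open>v = 0\<close> by (simp add: vec.span_singleton)
  qed
  show ?thesis
    unfolding curve_def using nz eval3_homogeneous[OF assms(1)]
    by (auto simp: vec.span_singleton proj_plane_def)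
qed

text \<open>Needed because projective equivalence compares point sets only. From A F + B G = D(Y,Z)
  one finds a point of the curve over some (b, c) with D(b, c) \<noteq> 0, where G cannot
  vanish.\<close>

lemma nullstellensatz:
  fixes F G :: "'a::alg_closed_field poly3"
  assumes irr: "Factorial_Ring.irreducible F" and hom: "homogeneous d F" and d: "d \<ge> 2"
    and van: "\<And>u. u \<noteq> 0 \<Longrightarrow> eval3 F u = 0 \<Longrightarrow> eval3 G u = 0"
  shows "F dvd G"
proof (rule ccontr)
  assume "\<not> F dvd G"
  have deg: "degree F \<noteq> 0" using homogeneous_irreducible_degree[OF irr hom d] .
  from \<open>\<not> F dvd G\<close> obtain A B D where D: "D \<noteq> 0" "A * F + B * G = [:D:]"
    using irreducible_bezout[OF irr deg] by metis
  \<comment> \<open>The factor \<open>lead_coeff F\<close> keeps the degree in X at (b, c), so that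
    a root a exists; the factor Z makes c \<noteq> 0, so that (a, b, c) is a point.\<close>
  define E where "E = D * lead_coeff F * [:[:0, 1:]:]"
  have "E \<noteq> 0" using D(1) deg by (auto simp: E_def)
  then have "lead_coeff E \<noteq> 0" by simp
  then obtain c where c: "poly (lead_coeff E) c \<noteq> 0" by (rule poly_nonroot_ex)
  define p where "p = map_poly (\<lambda>r. poly r c) E"
  have "p \<noteq> 0"
  proof
    assume "p = 0"
    then have "coeff p (degree E) = 0" by simp
    then show False using c by (simp add: p_def coeff_map_poly)
  qed
  then obtain b where b: "poly p b \<noteq> 0" by (rule poly_nonroot_ex)
  have rc: "rhom (\<lambda>r. poly r c)" by (auto simp: rhom_def)
  let ?e = "evp (\<lambda>r. poly r c) b"
  have re: "rhom ?e" by (rule rhom_evp[OF rc])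
  have "?e E \<noteq> 0" using b by (simp add: p_def evp_def)
  moreover have "?e E = ?e D * ?e (lead_coeff F) * c"
    unfolding E_def by (simp only: rhom_mult[OF re] evp_const[OF rc]) simp
  ultimately have nz: "?e D \<noteq> 0" "?e (lead_coeff F) \<noteq> 0" "c \<noteq> 0" by auto
  define q where "q = map_poly ?e F"
  have "degree q = degree F"
    unfolding q_def by (intro map_poly_degree_eq) (use nz(2) in simp)
  then obtain a where a: "poly q a = 0" using alg_closed_imp_poly_has_root[of q] deg by auto
  define u where "u = (vector [a, b, c] :: 'a^3)"
  have "u \<noteq> 0"
  proof
    assume "u = 0"
    then have "u $ 3 = 0" by simp
    then show False using nz(3) by (simp add: u_def vector_3)
  qed
  have ec: "evp (\<lambda>x. x) c = (\<lambda>r. poly r c)" by (auto simp: evp_def fun_eq_iff map_poly_id)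
  have ev: "eval3 H u = evp ?e a H" for H
    by (simp add: eval3_eq_ev3 ev3_def u_def vector_3 ec)
  have F0: "eval3 F u = 0" using a by (simp add: ev q_def evp_def)
  then have "eval3 G u = 0" using van \<open>u \<noteq> 0\<close> by blast
  then have "evp ?e a [:D:] = 0" using F0
    unfolding D(2)[symmetric] ev by (simp add: rhom_add[OF rhom_evp[OF re]] rhom_mult[OF rhom_evp[OF re]])
  then show False using nz(1) by (simp add: evp_const[OF re])
qed

section \<open>Places of a function field\<close>

text \<open>S is a function field of one variable inside a larger field. \<open>y_dep\<close>
  expresses [S : k(y)] \<le> n by relations with coefficients in k[y], which avoids rational
  functions.\<close>

locale func_field =
  fixes \<iota> :: "'a::alg_closed_field \<Rightarrow> 'b::field" and S :: "'b set" and y :: 'b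
  assumes rhom_iota: "rhom \<iota>"
    and S_const: "\<iota> c \<in> S"
    and S_add: "a \<in> S \<Longrightarrow> b \<in> S \<Longrightarrow> a + b \<in> S"
    and S_mult: "a \<in> S \<Longrightarrow> b \<in> S \<Longrightarrow> a * b \<in> S"
    and S_inverse: "a \<in> S \<Longrightarrow> inverse a \<in> S"
    and y_S: "y \<in> S"
    and y_trans: "evp \<iota> y p = 0 \<Longrightarrow> p = 0"
    and y_dep: "\<exists>n::nat. \<forall>e. (\<forall>i\<le>n. e i \<in> S) \<longrightarrow>
      (\<exists>c. (\<exists>i\<le>n. c i \<noteq> 0) \<and> (\<Sum>i\<le>n. evp \<iota> y (c i) * e i) = 0)"
begin

lemmas iota_simps [simp] = rhom_0[OF rhom_iota] rhom_1[OF rhom_iota] rhom_add[OF rhom_iota]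
  rhom_mult[OF rhom_iota] rhom_minus[OF rhom_iota] rhom_diff[OF rhom_iota] rhom_inj[OF rhom_iota]

lemma S_01 [simp]: "0 \<in> S" "1 \<in> S" "\<iota> c \<in> S"
  using S_const[of 0] S_const[of 1] S_const by auto

lemma S_minus: "a \<in> S \<Longrightarrow> - a \<in> S"
  using S_mult[OF S_const[of "- 1"], of a] by simp

lemma S_diff: "a \<in> S \<Longrightarrow> b \<in> S \<Longrightarrow> a - b \<in> S"
  using S_add[of a "- b"] S_minus[of b] by simp

lemma S_power: "a \<in> S \<Longrightarrow> a ^ n \<in> S"
  by (induct n) (auto intro: S_mult)

lemma S_sum: "(\<And>i. i \<in> A \<Longrightarrow> f i \<in> S) \<Longrightarrow> sum f A \<in> S"
  by (induct A rule: infinite_finite_induct) (auto intro: S_add)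

lemma S_evp: "z \<in> S \<Longrightarrow> evp \<iota> z p \<in> S"
  by (induct p) (auto simp: evp_0 evp_pCons rhom_iota intro: S_add S_mult)

text \<open>\<open>kdep t\<close>: \<open>t\<close> is transcendental over \<open>k\<close> and \<open>S\<close> is finite over \<open>k(t)\<close>.\<close>

definition kdep :: "'b \<Rightarrow> bool" where
  "kdep t \<longleftrightarrow> t \<in> S \<and> (\<forall>p. evp \<iota> t p = 0 \<longrightarrow> p = 0) \<and>
     (\<exists>n::nat. \<forall>e. (\<forall>i\<le>n. e i \<in> S) \<longrightarrow>
      (\<exists>c. (\<exists>i\<le>n. c i \<noteq> 0) \<and> (\<Sum>i\<le>n. evp \<iota> t (c i) * e i) = 0))"

lemma kdep_y: "kdep y"
  using y_S y_trans y_dep by (auto simp: kdep_def)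

lemma evp_smult: "evp \<iota> t (smult c p) = \<iota> c * evp \<iota> t p"
  using rhom_mult[OF rhom_evp[OF rhom_iota], of t "[:c:]" p] by (simp add: evp_const rhom_iota)

lemma evp_shift: "evp \<iota> t (pcompose p [:c, 1:]) = evp \<iota> (t + \<iota> c) p"
  by (induct p)
     (simp_all add: evp_0 pcompose_pCons evp_pCons rhom_iota evp_const rhom_add[OF rhom_evp[OF rhom_iota]]
       rhom_mult[OF rhom_evp[OF rhom_iota]] evp_smult algebra_simps)

lemma kdep_shift:
  assumes "kdep t" shows "kdep (t - \<iota> c)"
proof -
  have t: "t \<in> S" and tr: "\<And>p. evp \<iota> t p = 0 \<Longrightarrow> p = 0" using assms by (auto simp: kdep_def)
  from assms obtain n :: nat where n: "\<And>e. (\<forall>i\<le>n. e i \<in> S) \<Longrightarrow>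
      (\<exists>c. (\<exists>i\<le>n. c i \<noteq> 0) \<and> (\<Sum>i\<le>n. evp \<iota> t (c i) * e i) = 0)"
    unfolding kdep_def by blast
  have sh: "evp \<iota> t p = evp \<iota> (t - \<iota> c) (pcompose p [:c, 1:])" for p
    by (simp add: evp_shift)
  have "p = 0" if "evp \<iota> (t - \<iota> c) p = 0" for p
  proof -
    have "evp \<iota> t (pcompose p [:- c, 1:]) = 0" using that by (simp add: evp_shift)
    then have "pcompose p [:- c, 1:] = 0" by (rule tr)
    then show "p = 0" by (rule pcompose_eq_0) simp
  qed
  moreover have "\<exists>d. (\<exists>i\<le>n. d i \<noteq> 0) \<and> (\<Sum>i\<le>n. evp \<iota> (t - \<iota> c) (d i) * e i) = 0"
    if eS: "\<forall>i\<le>n. e i \<in> S" for e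
  proof -
    obtain d where d: "\<exists>i\<le>n. d i \<noteq> 0" "(\<Sum>i\<le>n. evp \<iota> t (d i) * e i) = 0" using n[OF eS] by blast
    have "\<exists>i\<le>n. pcompose (d i) [:c, 1:] \<noteq> 0"
      using d(1) pcompose_eq_0[of _ "[:c, 1:]"] by fastforce
    then show ?thesis using d(2) by (intro exI[of _ "\<lambda>i. pcompose (d i) [:c, 1:]"]) (simp add: sh)
  qed
  ultimately show ?thesis using t by (auto simp: kdep_def intro: S_diff)
qed

lemma kdep_inverse:
  assumes "kdep t" shows "kdep (inverse t)"
proof -
  have t: "t \<in> S" and tr: "\<And>p. evp \<iota> t p = 0 \<Longrightarrow> p = 0" using assms by (auto simp: kdep_def)
  from assms obtain n :: nat where n: "\<And>e. (\<forall>i\<le>n. e i \<in> S) \<Longrightarrow>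
      (\<exists>c. (\<exists>i\<le>n. c i \<noteq> 0) \<and> (\<Sum>i\<le>n. evp \<iota> t (c i) * e i) = 0)"
    unfolding kdep_def by blast
  have t0: "t \<noteq> 0" using tr[of "[:0, 1:]"] by (auto simp: evp_var rhom_iota)
  \<comment> \<open>The reciprocal polynomial: t ^ N times \<open>rv N p\<close> at 1/t is
    p(t).\<close>
  define rv where "rv N p = (\<Sum>i\<le>N. monom (coeff p i) (N - i))" for N and p :: "'a poly"
  have crv: "coeff (rv N p) (N - i) = coeff p i" if "i \<le> N" for N p i
  proof -
    have "coeff (rv N p) (N - i) = (\<Sum>j\<le>N. if j = i then coeff p j else 0)"
      unfolding rv_def coeff_sum by (intro sum.cong) (use that in \<open>auto simp: coeff_monom\<close>)
    then show ?thesis using that by simp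
  qed
  have rv0: "p = 0" if "rv N p = 0" "degree p \<le> N" for N p
    using crv[of "degree p" N p] that by simp
  have ev: "u ^ N * evp \<iota> (inverse u) (rv N p) = evp \<iota> u p" if "degree p \<le> N" "u \<noteq> 0" for u N p
  proof -
    have "u ^ N * evp \<iota> (inverse u) (rv N p) = (\<Sum>i\<le>N. u ^ N * (\<iota> (coeff p i) * inverse u ^ (N - i)))"
      by (simp add: rv_def rhom_sum[OF rhom_evp[OF rhom_iota]] evp_monom rhom_iota sum_distrib_left)
    also have "\<dots> = (\<Sum>i\<le>N. \<iota> (coeff p i) * u ^ i)"
    proof (rule sum.cong)
      fix i assume "i \<in> {..N}"
      then have "u ^ N = u ^ i * u ^ (N - i)" by (simp flip: power_add)
      then show "u ^ N * (\<iota> (coeff p i) * inverse u ^ (N - i)) = \<iota> (coeff p i) * u ^ i"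
        using that(2) by (simp add: field_simps)
    qed simp
    finally show ?thesis using that(1) by (simp add: evp_sum_le rhom_iota)
  qed
  have "p = 0" if "evp \<iota> (inverse t) p = 0" for p
  proof -
    have "evp \<iota> t (rv (degree p) p) = 0"
      using ev[of p "degree p" "inverse t"] that t0 by simp
    then have "rv (degree p) p = 0" by (rule tr)
    then show ?thesis using rv0 by blast
  qed
  moreover have "\<exists>d. (\<exists>i\<le>n. d i \<noteq> 0) \<and> (\<Sum>i\<le>n. evp \<iota> (inverse t) (d i) * e i) = 0"
    if eS: "\<forall>i\<le>n. e i \<in> S" for e
  proof -
    obtain d where d: "\<exists>i\<le>n. d i \<noteq> 0" "(\<Sum>i\<le>n. evp \<iota> t (d i) * e i) = 0" using n[OF eS] by blast
    define N where "N = Max ((\<lambda>i. degree (d i)) ` {..n})"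
    have N: "degree (d i) \<le> N" if "i \<le> n" for i using that by (auto simp: N_def)
    have "t ^ N * (\<Sum>i\<le>n. evp \<iota> (inverse t) (rv N (d i)) * e i) = (\<Sum>i\<le>n. evp \<iota> t (d i) * e i)"
      unfolding sum_distrib_left
    proof (rule sum.cong)
      fix i assume "i \<in> {..n}"
      then show "t ^ N * (evp \<iota> (inverse t) (rv N (d i)) * e i) = evp \<iota> t (d i) * e i"
        using ev[OF N t0, of i] by (simp only: mult.assoc[symmetric] atMost_iff)
    qed simp
    then have "(\<Sum>i\<le>n. evp \<iota> (inverse t) (rv N (d i)) * e i) = 0" using d(2) t0 by simp
    moreover have "\<exists>i\<le>n. rv N (d i) \<noteq> 0"
    proof -
      obtain i where i: "i \<le> n" "d i \<noteq> 0" using d(1) by blast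
      then show ?thesis using rv0[OF _ N[OF i(1)]] by blast
    qed
    ultimately show ?thesis by (intro exI[of _ "\<lambda>i. rv N (d i)"] conjI)
  qed
  ultimately show ?thesis using t by (auto simp: kdep_def intro: S_inverse)
qed

lemma divide_out_X:
  fixes c :: "nat \<Rightarrow> 'a poly"
  assumes "i \<le> n" "c i \<noteq> 0"
  shows "\<exists>k d. (\<forall>j\<le>n. c j = [:0, 1:] ^ k * d j) \<and> (\<exists>j\<le>n. poly (d j) 0 \<noteq> 0)"
  using assms
proof (induct "degree (c i)" arbitrary: c rule: less_induct)
  case less
  show ?case
  proof (cases "\<exists>j\<le>n. poly (c j) 0 \<noteq> 0")
    case True
    then show ?thesis by (intro exI[of _ 0] exI[of _ c]) simp
  next
    case False
    then have "\<forall>j. \<exists>d. j \<le> n \<longrightarrow> c j = [:0, 1:] * d"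
      by (metis dvdE minus_zero poly_eq_0_iff_dvd)
    then obtain d where d: "\<And>j. j \<le> n \<Longrightarrow> c j = [:0, 1:] * d j" by metis
    have di: "d i \<noteq> 0" using less(2,3) d by fastforce
    then have "degree (d i) < degree (c i)"
      using d[OF less(2)] by (simp add: degree_mult_eq)
    then obtain k d' where d': "\<forall>j\<le>n. d j = [:0, 1:] ^ k * d' j" "\<exists>j\<le>n. poly (d' j) 0 \<noteq> 0"
      using less(1)[of d] less(2) di by blast
    then show ?thesis using d
      by (intro exI[of _ "Suc k"] exI[of _ d']) (auto simp: mult.assoc)
  qed
qed

text \<open>A relation over k[t] may be divided by the common power of t, so that its reduction at t
  = 0 is a nontrivial relation over k. This controls residue fields and the number of zeros of
  t.\<close>

lemma kdep0:
  assumes "kdep t"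
  obtains n :: nat where "\<forall>e. (\<forall>i\<le>n. e i \<in> S) \<longrightarrow>
    (\<exists>c. (\<exists>i\<le>n. poly (c i) 0 \<noteq> 0) \<and> (\<Sum>i\<le>n. evp \<iota> t (c i) * e i) = 0)"
proof -
  have t: "t \<in> S" and tr: "\<And>p. evp \<iota> t p = 0 \<Longrightarrow> p = 0" using assms by (auto simp: kdep_def)
  from assms obtain n :: nat where n: "\<And>e. (\<forall>i\<le>n. e i \<in> S) \<Longrightarrow>
      (\<exists>c. (\<exists>i\<le>n. c i \<noteq> 0) \<and> (\<Sum>i\<le>n. evp \<iota> t (c i) * e i) = 0)"
    unfolding kdep_def by blast
  have t0: "t \<noteq> 0" using tr[of "[:0, 1:]"] by (auto simp: evp_var rhom_iota)
  show ?thesis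
  proof (rule that[of n], intro allI impI)
    fix e assume e: "\<forall>i\<le>n. e i \<in> S"
    then obtain c where c: "\<exists>i\<le>n. c i \<noteq> 0" "(\<Sum>i\<le>n. evp \<iota> t (c i) * e i) = 0" using n by blast
    obtain k d where d: "\<forall>j\<le>n. c j = [:0, 1:] ^ k * d j" "\<exists>j\<le>n. poly (d j) 0 \<noteq> 0"
      using c(1) divide_out_X by blast
    have "t ^ k * (\<Sum>i\<le>n. evp \<iota> t (d i) * e i) = (\<Sum>i\<le>n. evp \<iota> t (c i) * e i)"
      unfolding sum_distrib_left
      by (intro sum.cong) (auto simp: d rhom_mult[OF rhom_evp[OF rhom_iota]] rhom_power[OF rhom_evp[OF rhom_iota]] evp_var rhom_iota)
    then show "\<exists>c. (\<exists>i\<le>n. poly (c i) 0 \<noteq> 0) \<and> (\<Sum>i\<le>n. evp \<iota> t (c i) * e i) = 0"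
      using c(2) t0 d(2) by auto
  qed
qed

section \<open>Places, their maximal ideals and residues in k\<close>

definition place :: "'b set \<Rightarrow> bool" where
  "place V \<longleftrightarrow> V \<subseteq> S \<and> range \<iota> \<subseteq> V \<and> V \<noteq> S \<and> (\<forall>a\<in>V. \<forall>b\<in>V. a + b \<in> V \<and> a * b \<in> V \<and> - a \<in> V) \<and>
     (\<forall>z\<in>S - {0}. z \<in> V \<or> inverse z \<in> V)"

definition mx :: "'b set \<Rightarrow> 'b set" where
  "mx V = {z \<in> V. z = 0 \<or> inverse z \<notin> V}"

definition Pl :: "'b set set" where "Pl = {V. place V}"

lemma place_D:
  assumes "place V"
  shows "V \<subseteq> S" "\<iota> c \<in> V" "0 \<in> V" "1 \<in> V" "a \<in> V \<Longrightarrow> b \<in> V \<Longrightarrow> a + b \<in> V" "a \<in> V \<Longrightarrow> b \<in> V \<Longrightarrow> a * b \<in> V"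
    "a \<in> V \<Longrightarrow> - a \<in> V" "a \<in> V \<Longrightarrow> b \<in> V \<Longrightarrow> a - b \<in> V" "z \<in> S \<Longrightarrow> z \<notin> V \<Longrightarrow> inverse z \<in> V"
    "z \<in> V \<Longrightarrow> z \<in> S"
proof -
  have c: "\<iota> c \<in> V" for c using assms by (auto simp: place_def)
  show "\<iota> c \<in> V" "0 \<in> V" "1 \<in> V" using c[of c] c[of 0] c[of 1] by simp_all
  show "V \<subseteq> S" "a \<in> V \<Longrightarrow> b \<in> V \<Longrightarrow> a + b \<in> V" "a \<in> V \<Longrightarrow> b \<in> V \<Longrightarrow> a * b \<in> V"
    "a \<in> V \<Longrightarrow> - a \<in> V" "z \<in> V \<Longrightarrow> z \<in> S"
    using assms unfolding place_def by blast+
  show "a - b \<in> V" if "a \<in> V" "b \<in> V"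
  proof -
    have "a + - b \<in> V" using that assms unfolding place_def by blast
    then show ?thesis by simp
  qed
  show "inverse z \<in> V" if "z \<in> S" "z \<notin> V"
    using that c[of 0] assms unfolding place_def by (cases "z = 0") auto
qed

lemma place_power: "place V \<Longrightarrow> z \<in> V \<Longrightarrow> z ^ n \<in> V"
  by (induct n) (auto simp: place_D)

lemma place_sum: "place V \<Longrightarrow> (\<And>i. i \<in> A \<Longrightarrow> f i \<in> V) \<Longrightarrow> sum f A \<in> V"
  by (induct A rule: infinite_finite_induct) (auto simp: place_D)

lemma place_prod: "place V \<Longrightarrow> (\<And>i. i \<in> A \<Longrightarrow> f i \<in> V) \<Longrightarrow> prod f A \<in> V"
  by (induct A rule: infinite_finite_induct) (auto simp: place_D)

lemma place_evp: "place V \<Longrightarrow> z \<in> V \<Longrightarrow> evp \<iota> z p \<in> V"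
  by (induct p) (auto simp: evp_0 evp_pCons rhom_iota place_D)

lemma mx_V: "z \<in> mx V \<Longrightarrow> z \<in> V" by (simp add: mx_def)

lemma mx_0: "place V \<Longrightarrow> 0 \<in> mx V" by (simp add: mx_def place_D)

lemma mx_const: "place V \<Longrightarrow> \<iota> c \<in> mx V \<longleftrightarrow> c = 0"
  using rhom_inverse(1)[OF rhom_iota, of c, symmetric] by (auto simp: mx_def place_D)

lemma mx_1: "place V \<Longrightarrow> 1 \<notin> mx V"
  using mx_const[of V 1] by simp

lemma mx_inverse: "place V \<Longrightarrow> z \<in> S \<Longrightarrow> z \<notin> V \<Longrightarrow> inverse z \<in> mx V"
  by (auto simp: mx_def place_D)

lemma unit_inverse: "z \<in> V \<Longrightarrow> z \<notin> mx V \<Longrightarrow> inverse z \<in> V" by (simp add: mx_def)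

lemma mx_mult:
  assumes "place V" "z \<in> V" "w \<in> mx V" shows "z * w \<in> mx V"
proof (rule ccontr)
  assume n: "z * w \<notin> mx V"
  have "z * w \<in> V" using place_D(6)[OF assms(1,2) mx_V[OF assms(3)]] .
  then have "z * w \<noteq> 0" and i: "inverse (z * w) \<in> V" using n by (auto simp: mx_def)
  have "z * inverse (z * w) \<in> V" using place_D(6)[OF assms(1,2) i] .
  moreover have "z * inverse (z * w) = inverse w" using \<open>z * w \<noteq> 0\<close> by (simp add: field_simps)
  ultimately have "inverse w \<in> V" by (simp only:)
  then show False using assms(3) \<open>z * w \<noteq> 0\<close> by (auto simp: mx_def)
qed

lemma mx_add:
  assumes V: "place V" and z: "z \<in> mx V" and w: "w \<in> mx V" shows "z + w \<in> mx V"
proof (cases "z = 0 \<or> w = 0")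
  case False
  have S: "z \<in> S" "w \<in> S" using z w mx_V place_D(10)[OF V] by auto
  have "z * inverse w \<in> V \<or> w * inverse z \<in> V"
    using place_D(9)[OF V, of "z * inverse w"] S by (auto simp: S_mult S_inverse mult.commute)
  then show ?thesis
  proof
    assume "z * inverse w \<in> V"
    then have "(1 + z * inverse w) * w \<in> mx V" using mx_mult[OF V _ w] V by (auto simp: place_D)
    then show ?thesis using False by (simp add: field_simps)
  next
    assume "w * inverse z \<in> V"
    then have "(1 + w * inverse z) * z \<in> mx V" using mx_mult[OF V _ z] V by (auto simp: place_D)
    then show ?thesis using False by (simp add: field_simps)
  qed
qed (use assms in auto)

lemma mx_minus: "place V \<Longrightarrow> z \<in> mx V \<Longrightarrow> - z \<in> mx V"
  using mx_mult[of V "- 1" z] place_D[of V] by force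

lemma mx_diff: "place V \<Longrightarrow> z \<in> mx V \<Longrightarrow> w \<in> mx V \<Longrightarrow> z - w \<in> mx V"
  using mx_add[of V z "- w"] mx_minus[of V w] by simp

lemma mx_sum: "place V \<Longrightarrow> (\<And>i. i \<in> A \<Longrightarrow> f i \<in> mx V) \<Longrightarrow> sum f A \<in> mx V"
  by (induct A rule: infinite_finite_induct) (auto simp: mx_0 mx_add)

lemma mx_mult2: "place V \<Longrightarrow> z \<in> mx V \<Longrightarrow> w \<in> V \<Longrightarrow> z * w \<in> mx V"
  using mx_mult[of V w z] by (simp add: mult.commute)

lemma mx_prime:
  assumes V: "place V" and "z \<in> V" "w \<in> V" "z * w \<in> mx V" shows "z \<in> mx V \<or> w \<in> mx V"
proof (rule ccontr)
  assume "\<not> ?thesis"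
  then have "inverse z \<in> V" "z \<noteq> 0" "w \<notin> mx V" using assms by (auto simp: mx_def)
  then have "inverse z * (z * w) \<in> mx V" using mx_mult V assms by blast
  then show False using \<open>z \<noteq> 0\<close> \<open>w \<notin> mx V\<close> by (simp add: mult.assoc[symmetric])
qed

lemma mx_prod:
  assumes V: "place V" and "finite A" "j \<in> A" "f j \<in> mx V" "\<And>i. i \<in> A \<Longrightarrow> f i \<in> V"
  shows "prod f A \<in> mx V"
  using mx_mult2[OF V assms(4), of "prod f (A - {j})"] place_prod[OF V, of "A - {j}" f] assms
  by (simp add: prod.remove)

lemma mx_prod_unit:
  assumes V: "place V" and "\<And>i. i \<in> A \<Longrightarrow> f i \<in> V \<and> f i \<notin> mx V"
  shows "prod f A \<notin> mx V"
  using assms(2)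
proof (induct A rule: infinite_finite_induct)
  case (insert x F)
  then show ?case using mx_prime[OF V, of "f x" "prod f F"] place_prod[OF V, of F f] by auto
qed (use mx_1[OF V] in auto)

text \<open>q splits into linear factors over k, and the maximal ideal is prime.\<close>

lemma mx_poly_root:
  assumes V: "place V" and z: "z \<in> V"
  shows "q \<noteq> 0 \<Longrightarrow> evp \<iota> z q \<in> mx V \<Longrightarrow> \<exists>r. poly q r = 0 \<and> z - \<iota> r \<in> mx V"
proof (induct "degree q" arbitrary: q rule: less_induct)
  case less
  show ?case
  proof (cases "degree q = 0")
    case True
    then obtain c where "q = [:c:]" by (rule degree_eq_zeroE)
    then show ?thesis using less mx_const[OF V] by (simp add: evp_const rhom_iota)
  next
    case False
    then obtain r where r: "poly q r = 0" using alg_closed_imp_poly_has_root by blast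
    then obtain q' where q': "q = [:- r, 1:] * q'" by (auto simp: poly_eq_0_iff_dvd)
    have e: "evp \<iota> z q = (z - \<iota> r) * evp \<iota> z q'"
      unfolding q' by (subst rhom_mult[OF rhom_evp[OF rhom_iota]]) (simp add: evp_pCons evp_0 rhom_iota)
    have "z - \<iota> r \<in> V" "evp \<iota> z q' \<in> V" using V z by (auto simp: place_D place_evp)
    then have "z - \<iota> r \<in> mx V \<or> evp \<iota> z q' \<in> mx V" using mx_prime[OF V] less(3) e by metis
    then show ?thesis
    proof
      assume "evp \<iota> z q' \<in> mx V"
      moreover have "q' \<noteq> 0" using less(2) q' by auto
      moreover have "degree q' < degree q" using \<open>q' \<noteq> 0\<close> unfolding q' by (subst degree_mult_eq) auto
      ultimately obtain r' where "poly q' r' = 0" "z - \<iota> r' \<in> mx V" using less(1) by blast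
      then show ?thesis by (auto simp: q')
    qed (use r in auto)
  qed
qed

lemma mx_evp: "place V \<Longrightarrow> t \<in> mx V \<Longrightarrow> evp \<iota> t p - \<iota> (poly p 0) \<in> mx V"
proof (cases p)
  case (pCons a q)
  assume "place V" "t \<in> mx V"
  then show ?thesis using mx_mult2[of V t "evp \<iota> t q"] place_evp[of V t q] mx_V
    by (auto simp: pCons evp_pCons rhom_iota)
qed

text \<open>If y had no residue in k, every nonzero p(y) would be a unit of V. An element z outside
  V is algebraic over k(y); its equation, divided by the top power of z, writes a unit as a sum of
  multiples of 1/z.\<close>

lemma residue_y:
  assumes V: "place V" and y: "y \<in> V" shows "\<exists>c. y - \<iota> c \<in> mx V"
proof (rule ccontr)
  assume no: "\<nexists>c. y - \<iota> c \<in> mx V"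
  have unit: "evp \<iota> y p \<notin> mx V" if "p \<noteq> 0" for p using mx_poly_root[OF V y that] no by blast
  obtain z where z: "z \<in> S" "z \<notin> V" using V by (auto simp: place_def)
  then have zi: "inverse z \<in> mx V" "z \<noteq> 0" using mx_inverse[OF V] place_D(3)[OF V] by auto
  obtain n :: nat where n: "\<forall>e. (\<forall>i\<le>n. e i \<in> S) \<longrightarrow>
    (\<exists>c. (\<exists>i\<le>n. poly (c i) 0 \<noteq> 0) \<and> (\<Sum>i\<le>n. evp \<iota> y (c i) * e i) = 0)"
    by (rule kdep0[OF kdep_y])
  have "\<exists>c. (\<exists>i\<le>n. poly (c i) 0 \<noteq> 0) \<and> (\<Sum>i\<le>n. evp \<iota> y (c i) * z ^ i) = 0"
    by (rule n[rule_format]) (use z S_power in auto)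
  then obtain c where c': "\<exists>i\<le>n. poly (c i) 0 \<noteq> 0" and c2: "(\<Sum>i\<le>n. evp \<iota> y (c i) * z ^ i) = 0" by blast
  have "\<exists>i\<le>n. c i \<noteq> 0" using c' by (metis poly_0)
  note c = this c2
  define j where "j = (GREATEST i. i \<le> n \<and> c i \<noteq> 0)"
  have j: "j \<le> n \<and> c j \<noteq> 0" unfolding j_def by (rule GreatestI_ex_nat[where b = n]) (use c in auto)
  have top: "c i = 0" if "i \<le> n" "i > j" for i
    using Greatest_le_nat[of "\<lambda>i. i \<le> n \<and> c i \<noteq> 0" i n] that unfolding j_def by fastforce
  have "(\<Sum>i\<le>j. evp \<iota> y (c i) * z ^ i) = (\<Sum>i\<le>n. evp \<iota> y (c i) * z ^ i)"
    by (rule sum.mono_neutral_left) (use j top in \<open>auto simp: evp_0\<close>)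
  then have s: "(\<Sum>i<j. evp \<iota> y (c i) * z ^ i) + evp \<iota> y (c j) * z ^ j = 0"
    using c(2) by (simp add: lessThan_Suc_atMost[symmetric])
  \<comment> \<open>Solving the relation for its top coefficient leaves only positive powers of 1/z,
    which lie in the maximal ideal.\<close>
  have "evp \<iota> y (c j) = - (\<Sum>i<j. evp \<iota> y (c i) * z ^ i) * inverse z ^ j"
  proof -
    have "evp \<iota> y (c j) * z ^ j = - (\<Sum>i<j. evp \<iota> y (c i) * z ^ i)" using s by (simp add: eq_neg_iff_add_eq_0 add.commute)
    then show ?thesis using zi(2) by (simp add: field_simps power_inverse)
  qed
  also have "\<dots> = - (\<Sum>i<j. evp \<iota> y (c i) * inverse z ^ (j - i))"
    unfolding sum_distrib_right sum_negf[symmetric]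
  proof (rule sum.cong)
    fix i assume "i \<in> {..<j}"
    then have "inverse z ^ j = inverse z ^ i * inverse z ^ (j - i)" by (simp flip: power_add)
    then have "z ^ i * inverse z ^ j = inverse z ^ (j - i)" using zi(2) by (simp add: power_inverse field_simps)
    then show "- (evp \<iota> y (c i) * z ^ i) * inverse z ^ j = - (evp \<iota> y (c i) * inverse z ^ (j - i))"
      by (simp add: mult.assoc)
  qed simp
  also have "\<dots> \<in> mx V"
  proof (intro mx_minus[OF V] mx_sum[OF V] mx_mult[OF V])
    fix i assume "i \<in> {..<j}"
    then obtain k where "j - i = Suc k" by (metis Suc_diff_Suc lessThan_iff)
    then show "inverse z ^ (j - i) \<in> mx V" using zi V mx_mult2 place_power mx_V by simp
  qed (use V y place_evp in auto)
  finally show False using unit j by blast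
qed

text \<open>The common starting point at every place: a function vanishing there over whose rational
  function field S is still finite.\<close>

lemma place_coordinate:
  assumes V: "place V"
  obtains t where "kdep t" "t \<in> mx V" "t = inverse y \<or> (\<exists>c. t = y - \<iota> c)"
proof (cases "y \<in> V")
  case True
  then show ?thesis using residue_y[OF V] kdep_shift[OF kdep_y] that by blast
next
  case False
  then show ?thesis using mx_inverse[OF V y_S] kdep_inverse[OF kdep_y] that by blast
qed

text \<open>Reducing a relation between the powers of z modulo t gives a nonzero polynomial q over k
  with q(z) in the maximal ideal, and q has a root that is the residue.\<close>

lemma residue_ex:
  assumes V: "place V" and z: "z \<in> V" shows "\<exists>c. z - \<iota> c \<in> mx V"
proof -
  obtain t where t: "kdep t" "t \<in> mx V" using place_coordinate[OF V] by metis
  obtain n :: nat where n: "\<forall>e. (\<forall>i\<le>n. e i \<in> S) \<longrightarrow>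
    (\<exists>c. (\<exists>i\<le>n. poly (c i) 0 \<noteq> 0) \<and> (\<Sum>i\<le>n. evp \<iota> t (c i) * e i) = 0)"
    by (rule kdep0[OF t(1)])
  have "\<exists>c. (\<exists>i\<le>n. poly (c i) 0 \<noteq> 0) \<and> (\<Sum>i\<le>n. evp \<iota> t (c i) * z ^ i) = 0"
    by (rule n[rule_format]) (use z V place_D S_power in auto)
  then obtain c where c: "\<exists>i\<le>n. poly (c i) 0 \<noteq> 0" "(\<Sum>i\<le>n. evp \<iota> t (c i) * z ^ i) = 0" by auto
  define q where "q = (\<Sum>i\<le>n. monom (poly (c i) 0) i)"
  have "coeff q i = poly (c i) 0" if "i \<le> n" for i
    using that by (simp add: q_def coeff_sum coeff_monom)
  then have q0: "q \<noteq> 0" using c(1) by force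
  have "(\<Sum>i\<le>n. (evp \<iota> t (c i) - \<iota> (poly (c i) 0)) * z ^ i) \<in> mx V"
    by (intro mx_sum[OF V] mx_mult2[OF V] mx_evp[OF V t(2)] place_power[OF V z])
  also have "(\<Sum>i\<le>n. (evp \<iota> t (c i) - \<iota> (poly (c i) 0)) * z ^ i) = - evp \<iota> z q"
    unfolding left_diff_distrib sum_subtractf c(2)
    by (simp add: q_def rhom_sum[OF rhom_evp[OF rhom_iota]] evp_monom rhom_iota)
  finally have "evp \<iota> z q \<in> mx V" using mx_minus[OF V] by fastforce
  then show ?thesis using mx_poly_root[OF V z q0] by blast
qed

definition res :: "'b \<Rightarrow> 'b set \<Rightarrow> 'a" where "res z V = (THE c. z - \<iota> c \<in> mx V)"

lemma res_eqI:
  assumes V: "place V" and c: "z - \<iota> c \<in> mx V" shows "res z V = c"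
  unfolding res_def
proof (rule the_equality)
  fix c' assume "z - \<iota> c' \<in> mx V"
  then have "(z - \<iota> c) - (z - \<iota> c') \<in> mx V" using mx_diff[OF V] c by blast
  then have "\<iota> (c' - c) \<in> mx V" by simp
  then show "c' = c" using mx_const[OF V, of "c' - c"] by (simp del: iota_simps(6))
qed (rule c)

lemma res_mx: "place V \<Longrightarrow> z \<in> V \<Longrightarrow> z - \<iota> (res z V) \<in> mx V"
  using residue_ex res_eqI by metis

lemma res_const: "place V \<Longrightarrow> res (\<iota> c) V = c"
  by (rule res_eqI) (auto simp: mx_0)

lemma res_add: "place V \<Longrightarrow> z \<in> V \<Longrightarrow> w \<in> V \<Longrightarrow> res (z + w) V = res z V + res w V"
  using mx_add[OF _ res_mx[of V z] res_mx[of V w]] by (intro res_eqI) (auto simp: algebra_simps)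

lemma res_mult:
  assumes V: "place V" "z \<in> V" "w \<in> V" shows "res (z * w) V = res z V * res w V"
proof (rule res_eqI[OF V(1)])
  have "z * (w - \<iota> (res w V)) + \<iota> (res w V) * (z - \<iota> (res z V)) \<in> mx V"
    by (intro mx_add mx_mult res_mx V place_D)
  then show "z * w - \<iota> (res z V * res w V) \<in> mx V" by (simp add: algebra_simps)
qed

lemma res_power: "place V \<Longrightarrow> z \<in> V \<Longrightarrow> res (z ^ n) V = res z V ^ n"
  using res_const[of V 1] by (induct n) (auto simp: res_mult place_power)

text \<open>Rests on residues in k: for f in W but not in V, some f - c lies in the maximal ideal of
  W, yet its inverse lies in V and hence in W.\<close>

lemma place_incomparable:
  assumes V: "place V" and W: "place W" and sub: "V \<subseteq> W" shows "V = W"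
proof (rule ccontr)
  assume "V \<noteq> W"
  then obtain f where f: "f \<in> W" "f \<notin> V" using sub by blast
  have fS: "f \<in> S" using place_D(10)[OF W f(1)] .
  obtain c where c: "f - \<iota> c \<in> mx W" using residue_ex[OF W f(1)] by blast
  have "f - \<iota> c \<notin> V"
  proof
    assume "f - \<iota> c \<in> V"
    then have "f - \<iota> c + \<iota> c \<in> V" using place_D(5)[OF V _ place_D(2)[OF V]] by blast
    then show False using f(2) by simp
  qed
  then have "inverse (f - \<iota> c) \<in> V" "f - \<iota> c \<noteq> 0"
    using place_D(9)[OF V S_diff[OF fS S_const]] place_D(3)[OF V] by auto
  then show False using c sub by (auto simp: mx_def)
qed

text \<open>Take a in V_i but not in V_j and c different from the finitely many residues of a. Then
  1/(a - c) is regular at all the places, zero at V_j and nonzero at V_i.\<close>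

lemma separate:
  fixes n i j :: nat
  assumes pl: "\<And>l. l \<le> n \<Longrightarrow> place (Vs l)" and ij: "i \<le> n" "j \<le> n" "Vs i \<noteq> Vs j"
  obtains g where "\<And>l. l \<le> n \<Longrightarrow> g \<in> Vs l" "g \<in> mx (Vs j)" "g \<notin> mx (Vs i)"
proof -
  obtain a where a: "a \<in> Vs i" "a \<notin> Vs j" using place_incomparable[OF pl[OF ij(1)] pl[OF ij(2)]] ij(3) by blast
  have aS: "a \<in> S" using place_D(10)[OF pl[OF ij(1)] a(1)] .
  have "\<exists>c. c \<notin> (\<lambda>l. res a (Vs l)) ` {..n}"
    by (rule ex_new_if_finite[OF infinite_alg_closed]) (rule finite_imageI, rule finite_atMost)
  then obtain c where c: "c \<notin> (\<lambda>l. res a (Vs l)) ` {..n}" ..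
  have nm: "a - \<iota> c \<notin> mx (Vs l)" if "l \<le> n" for l
    using res_eqI[OF pl[OF that], of a c] c that by auto
  have a0: "a - \<iota> c \<noteq> 0" using a(2) place_D(2)[OF pl[OF ij(2)], of c] by auto
  have in_iff: "a - \<iota> c \<in> Vs l \<longleftrightarrow> a \<in> Vs l" if "l \<le> n" for l
    using place_D(5)[OF pl[OF that], of "a - \<iota> c" "\<iota> c"] place_D(8)[OF pl[OF that], of a "\<iota> c"]
      place_D(2)[OF pl[OF that], of c] by auto
  show ?thesis
  proof (rule that[of "inverse (a - \<iota> c)"])
    show "inverse (a - \<iota> c) \<in> Vs l" if "l \<le> n" for l
      using nm[OF that] unit_inverse[of "a - \<iota> c" "Vs l"] place_D(9)[OF pl[OF that] S_diff[OF aS S_const[of c]]] by blast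
    show "inverse (a - \<iota> c) \<in> mx (Vs j)"
      using mx_inverse[OF pl[OF ij(2)] S_diff[OF aS S_const[of c]]] in_iff[OF ij(2)] a by blast
    show "inverse (a - \<iota> c) \<notin> mx (Vs i)"
      using in_iff[OF ij(1)] a a0 by (auto simp: mx_def)
  qed
qed

text \<open>At n + 1 zeros of t there are functions e_i, nonzero at V_i and zero at the other V_j.
  In a relation with c_i(0) \<noteq> 0, all terms but the i-th vanish at V_i, a contradiction; so
  the degree over k(t) bounds the number of zeros.\<close>

lemma finite_zeros_kdep:
  assumes t: "kdep t" shows "finite {V \<in> Pl. t \<in> mx V}"
proof (rule ccontr)
  assume inf: "infinite {V \<in> Pl. t \<in> mx V}"
  obtain n :: nat where n: "\<forall>e. (\<forall>i\<le>n. e i \<in> S) \<longrightarrow>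
    (\<exists>c. (\<exists>i\<le>n. poly (c i) 0 \<noteq> 0) \<and> (\<Sum>i\<le>n. evp \<iota> t (c i) * e i) = 0)"
    by (rule kdep0[OF t])
  obtain Vs :: "nat \<Rightarrow> 'b set" where Vs: "inj Vs" "range Vs \<subseteq> {V \<in> Pl. t \<in> mx V}"
    using infinite_countable_subset[OF inf] by blast
  have pl: "place (Vs l)" and tm: "t \<in> mx (Vs l)" for l using Vs(2) by (auto simp: Pl_def)
  have "\<forall>i j. \<exists>g. i \<le> n \<and> j \<le> n \<and> i \<noteq> j \<longrightarrow> (\<forall>l\<le>n. g \<in> Vs l) \<and> g \<in> mx (Vs j) \<and> g \<notin> mx (Vs i)"
    using separate[of n Vs, OF pl] injD[OF Vs(1)] by metis
  then obtain g where g: "\<And>i j. i \<le> n \<Longrightarrow> j \<le> n \<Longrightarrow> i \<noteq> j \<Longrightarrow> (\<forall>l\<le>n. g i j \<in> Vs l) \<and> g i j \<in> mx (Vs j) \<and> g i j \<notin> mx (Vs i)"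
    by metis
  define e where "e i = (\<Prod>j\<in>{..n} - {i}. g i j)" for i
  have eV: "e i \<in> Vs l" if "i \<le> n" "l \<le> n" for i l
    unfolding e_def by (rule place_prod[OF pl]) (use g that in auto)
  have em: "e i \<in> mx (Vs l)" if "i \<le> n" "l \<le> n" "l \<noteq> i" for i l
    unfolding e_def by (rule mx_prod[OF pl, of _ l]) (use g that in auto)
  have eu: "e i \<notin> mx (Vs i)" if "i \<le> n" for i
    unfolding e_def by (rule mx_prod_unit[OF pl]) (use g that in auto)
  have "\<exists>c. (\<exists>i\<le>n. poly (c i) 0 \<noteq> 0) \<and> (\<Sum>i\<le>n. evp \<iota> t (c i) * e i) = 0"
    by (rule n[rule_format]) (use eV place_D(10)[OF pl] in blast)
  then obtain c i where c: "(\<Sum>i\<le>n. evp \<iota> t (c i) * e i) = 0" and i: "i \<le> n" "poly (c i) 0 \<noteq> 0"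
    by blast
  have "evp \<iota> t (c i) * e i = - (\<Sum>j\<in>{..n} - {i}. evp \<iota> t (c j) * e j)"
    using c i(1) by (simp add: sum.remove[of "{..n}" i] add_eq_0_iff)
  also have "\<dots> \<in> mx (Vs i)"
    by (intro mx_minus[OF pl] mx_sum[OF pl] mx_mult[OF pl] place_evp[OF pl]) (use em i tm mx_V in auto)
  finally have "evp \<iota> t (c i) * e i \<in> mx (Vs i)" .
  then have "evp \<iota> t (c i) \<in> mx (Vs i)"
    using mx_prime[OF pl] place_evp[OF pl] mx_V[OF tm] eV[OF i(1) i(1)] eu[OF i(1)] by blast
  then have "evp \<iota> t (c i) - (evp \<iota> t (c i) - \<iota> (poly (c i) 0)) \<in> mx (Vs i)"
    using mx_diff[OF pl] mx_evp[OF pl tm] by blast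
  then show False using i(2) mx_const[OF pl] by simp
qed

text \<open>The lowest nonzero coefficient c_j(y) in an equation for z is a multiple of z. A zero of
  z is therefore a pole of y or a zero of y - r for a root r of c_j.\<close>

lemma finite_zeros:
  assumes z: "z \<in> S" "z \<noteq> 0" shows "finite {V \<in> Pl. z \<in> mx V}"
proof -
  obtain n :: nat where n: "\<forall>e. (\<forall>i\<le>n. e i \<in> S) \<longrightarrow>
    (\<exists>c. (\<exists>i\<le>n. poly (c i) 0 \<noteq> 0) \<and> (\<Sum>i\<le>n. evp \<iota> y (c i) * e i) = 0)"
    by (rule kdep0[OF kdep_y])
  have "\<exists>c. (\<exists>i\<le>n. poly (c i) 0 \<noteq> 0) \<and> (\<Sum>i\<le>n. evp \<iota> y (c i) * z ^ i) = 0"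
    by (rule n[rule_format]) (use z S_power in auto)
  then obtain c where c': "\<exists>i\<le>n. poly (c i) 0 \<noteq> 0" and c2: "(\<Sum>i\<le>n. evp \<iota> y (c i) * z ^ i) = 0" by blast
  have "\<exists>i. i \<le> n \<and> c i \<noteq> 0" using c' by (metis poly_0)
  note c = this c2
  define j where "j = (LEAST i. i \<le> n \<and> c i \<noteq> 0)"
  have j: "j \<le> n \<and> c j \<noteq> 0" unfolding j_def using c(1) by (rule LeastI_ex)
  have low: "c i = 0" if "i < j" for i using not_less_Least[of i "\<lambda>i. i \<le> n \<and> c i \<noteq> 0"] that j unfolding j_def by auto
  have "(\<Sum>i\<in>{j..n}. evp \<iota> y (c i) * z ^ i) = (\<Sum>i\<le>n. evp \<iota> y (c i) * z ^ i)"
    by (rule sum.mono_neutral_left) (use low in \<open>auto simp: evp_0\<close>)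
  then have s: "(\<Sum>i\<in>{j..n}. evp \<iota> y (c i) * z ^ i) = 0" using c(2) by simp
  have "(\<Sum>i\<in>{j..n}. evp \<iota> y (c i) * z ^ i) = z ^ j * (\<Sum>i\<in>{j..n}. evp \<iota> y (c i) * z ^ (i - j))"
    unfolding sum_distrib_left
    by (rule sum.cong) (auto simp: mult.left_commute simp flip: power_add)
  then have "(\<Sum>i\<in>{j..n}. evp \<iota> y (c i) * z ^ (i - j)) = 0" using s z(2) by simp
  then have e: "evp \<iota> y (c j) = - (\<Sum>i\<in>{Suc j..n}. evp \<iota> y (c i) * z ^ (i - j))"
    using j by (simp add: sum.atLeast_Suc_atMost[of j n] eq_neg_iff_add_eq_0)
  have "{V \<in> Pl. z \<in> mx V} \<subseteq> (\<Union>r\<in>{r. poly (c j) r = 0}. {V \<in> Pl. y - \<iota> r \<in> mx V}) \<union> {V \<in> Pl. inverse y \<in> mx V}"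
  proof
    fix V assume V': "V \<in> {V \<in> Pl. z \<in> mx V}"
    then have V: "place V" "z \<in> mx V" by (auto simp: Pl_def)
    show "V \<in> (\<Union>r\<in>{r. poly (c j) r = 0}. {V \<in> Pl. y - \<iota> r \<in> mx V}) \<union> {V \<in> Pl. inverse y \<in> mx V}"
    proof (cases "y \<in> V")
      case True
      have "evp \<iota> y (c j) \<in> mx V" unfolding e
      proof (intro mx_minus mx_sum mx_mult V(1) place_evp True)
        fix i assume "i \<in> {Suc j..n}"
        then have "i - j = Suc (i - j - 1)" by auto
        then show "z ^ (i - j) \<in> mx V" using mx_mult2[OF V] place_power[OF V(1) mx_V[OF V(2)]] by (metis power_Suc)
      qed
      then obtain r where "poly (c j) r = 0" "y - \<iota> r \<in> mx V"
        using mx_poly_root[OF V(1) True] j by blast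
      then show ?thesis using V' by auto
    next
      case False
      then show ?thesis using mx_inverse[OF V(1) y_S] V' by auto
    qed
  qed
  moreover have "finite {r. poly (c j) r = 0}" using j poly_roots_finite by blast
  ultimately show ?thesis
    using finite_zeros_kdep[OF kdep_shift[OF kdep_y]] finite_zeros_kdep[OF kdep_inverse[OF kdep_y]]
    by (elim finite_subset) auto
qed

lemma finite_poles:
  assumes "z \<in> S" shows "finite {V \<in> Pl. z \<notin> V}"
proof (cases "z = 0")
  case True
  then have "{V \<in> Pl. z \<notin> V} = {}" by (auto simp: Pl_def place_D)
  then show ?thesis by (simp only: finite.emptyI)
next
  case False
  have "{V \<in> Pl. z \<notin> V} \<subseteq> {V \<in> Pl. inverse z \<in> mx V}" using mx_inverse assms by (auto simp: Pl_def)
  then show ?thesis using finite_zeros[of "inverse z"] assms False S_inverse by (auto elim: finite_subset)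
qed

text \<open>A maximal subring of \<open>S\<close> containing \<open>k[t]\<close> but not \<open>1/t\<close> is a valuation ring.\<close>

lemma place_exists:
  assumes t: "t \<in> S" and tr: "\<And>p. evp \<iota> t p = 0 \<Longrightarrow> p = 0"
  obtains V where "place V" "t \<in> mx V"
proof -
  \<comment> \<open>The rings among which a maximal one is sought; excluding 1/t makes t a non-unit
    in all of them.\<close>
  define A where "A = {R. R \<subseteq> S \<and> range \<iota> \<subseteq> R \<and> t \<in> R \<and> inverse t \<notin> R \<and>
    (\<forall>a\<in>R. \<forall>b\<in>R. a + b \<in> R \<and> a * b \<in> R \<and> - a \<in> R)}"
  have t0: "t \<noteq> 0" using tr[of "[:0, 1:]"] by (auto simp: evp_var rhom_iota)
  have "range (evp \<iota> t) \<in> A"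
    unfolding A_def mem_Collect_eq
  proof (intro conjI ballI)
    show "range (evp \<iota> t) \<subseteq> S" using S_evp[OF t] by auto
    show "range \<iota> \<subseteq> range (evp \<iota> t)" using evp_const[OF rhom_iota, of t] by (metis image_subsetI rangeI)
    show "t \<in> range (evp \<iota> t)" using evp_var[OF rhom_iota, of t] by (metis rangeI)
    show "inverse t \<notin> range (evp \<iota> t)"
    proof
      assume "inverse t \<in> range (evp \<iota> t)"
      then obtain p where p: "inverse t = evp \<iota> t p" by blast
      have "evp \<iota> t (pCons (- 1) p) = 0" using t0 by (simp add: evp_pCons rhom_iota flip: p)
      then have "pCons (- 1) p = 0" by (rule tr)
      then show False by simp
    qed
    fix a b assume "a \<in> range (evp \<iota> t)" "b \<in> range (evp \<iota> t)"
    then obtain p q where pq: "a = evp \<iota> t p" "b = evp \<iota> t q" by blast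
    show "a + b \<in> range (evp \<iota> t)" unfolding pq rhom_add[OF rhom_evp[OF rhom_iota], symmetric] by (rule rangeI)
    show "a * b \<in> range (evp \<iota> t)" unfolding pq rhom_mult[OF rhom_evp[OF rhom_iota], symmetric] by (rule rangeI)
    show "- a \<in> range (evp \<iota> t)" unfolding pq rhom_minus[OF rhom_evp[OF rhom_iota], symmetric] by (rule rangeI)
  qed
  then have ne: "A \<noteq> {}" by blast
  have "\<exists>m\<in>A. \<forall>x\<in>A. (m \<subseteq> x \<longrightarrow> x = m)"
  proof (rule subset_Zorn_nonempty[OF ne])
    fix C assume C: "C \<noteq> {}" "subset.chain A C"
    then have CA: "\<And>R. R \<in> C \<Longrightarrow> R \<in> A" by (auto simp: subset.chain_def)
    have two: "\<exists>R\<in>C. a \<in> R \<and> b \<in> R" if "a \<in> \<Union>C" "b \<in> \<Union>C" for a b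
      using that C(2) unfolding subset_chain_def by (meson UnionE subsetD)
    show "\<Union>C \<in> A"
      unfolding A_def mem_Collect_eq
    proof (intro conjI ballI)
      show "\<Union>C \<subseteq> S" "inverse t \<notin> \<Union>C" using CA unfolding A_def by blast+
      show "range \<iota> \<subseteq> \<Union>C" "t \<in> \<Union>C" using CA C(1) unfolding A_def by blast+
      fix a b assume "a \<in> \<Union>C" "b \<in> \<Union>C"
      then obtain R where R: "R \<in> C" "a \<in> R" "b \<in> R" using two by blast
      then have "a + b \<in> R" "a * b \<in> R" "- a \<in> R" using CA[OF R(1)] by (auto simp: A_def)
      then show "a + b \<in> \<Union>C" "a * b \<in> \<Union>C" "- a \<in> \<Union>C" using R(1) by auto
    qed
  qed
  then obtain M where MA: "M \<in> A" and max: "\<And>N. N \<in> A \<Longrightarrow> M \<subseteq> N \<Longrightarrow> N = M" by blast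
  have M: "M \<subseteq> S" "range \<iota> \<subseteq> M" "t \<in> M" "inverse t \<notin> M"
    and Madd: "\<And>a b. a \<in> M \<Longrightarrow> b \<in> M \<Longrightarrow> a + b \<in> M"
    and Mmult: "\<And>a b. a \<in> M \<Longrightarrow> b \<in> M \<Longrightarrow> a * b \<in> M"
    and Mminus: "\<And>a. a \<in> M \<Longrightarrow> - a \<in> M"
    using MA by (auto simp: A_def)
  have M01: "0 \<in> M" "1 \<in> M" using M(2) rhom_0[OF rhom_iota] rhom_1[OF rhom_iota] by (metis range_subsetD)+
  have Mdiff: "\<And>a b. a \<in> M \<Longrightarrow> b \<in> M \<Longrightarrow> a - b \<in> M" using Madd Mminus by (metis diff_conv_add_uminus)
  have Mpow: "a ^ n \<in> M" if "a \<in> M" for a n by (induct n) (auto simp: M01 intro: Mmult that)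
  have Msum: "(\<And>i. i \<in> I \<Longrightarrow> f i \<in> M) \<Longrightarrow> sum f I \<in> M" for f :: "nat \<Rightarrow> 'b" and I
    by (induct I rule: infinite_finite_induct) (auto simp: M01 intro: Madd)
  \<comment> \<open>Elements 1 - t w with w in M are units of M: adjoining the inverse s keeps 1/t
    out, so maximality absorbs s. Indeed 1/t = a s ^ n, multiplied by (1 - t w) ^ n = 1 - t w',
    would give 1/t = a + w' in M.\<close>
  have unit: "inverse (1 - t * w) \<in> M" if w: "w \<in> M" for w
  proof -
    define s where "s = inverse (1 - t * w)"
    have nz: "1 - t * w \<noteq> 0"
    proof
      assume "1 - t * w = 0"
      then have "inverse t = w" using t0 by (simp add: field_simps)
      then show False using M(4) w by simp
    qed
    have ss: "s * (1 - t * w) = 1" using nz by (simp add: s_def)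
    have pw: "\<exists>w'\<in>M. (1 - t * w) ^ n = 1 - t * w'" for n
    proof (induct n)
      case 0 show ?case by (rule bexI[OF _ M01(1)]) simp
    next
      case (Suc n)
      then obtain w' where w': "w' \<in> M" "(1 - t * w) ^ n = 1 - t * w'" by blast
      have "(1 - t * w) ^ Suc n = 1 - t * (w + w' - w * (t * w'))" by (simp add: w'(2) algebra_simps)
      moreover have "w + w' - w * (t * w') \<in> M" by (intro Mdiff Madd Mmult w w'(1) M(3))
      ultimately show ?case by blast
    qed
    define N where "N = {a * s ^ n | a n. a \<in> M}"
    have lift: "\<exists>a'\<in>M. a * s ^ n = a' * s ^ (n + k)" if "a \<in> M" for a n k
    proof (rule bexI)
      have "(1 - t * w) ^ k * s ^ k = 1" using ss by (metis mult.commute power_mult_distrib power_one)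
      then show "a * s ^ n = a * (1 - t * w) ^ k * s ^ (n + k)" by (simp add: power_add algebra_simps)
      show "a * (1 - t * w) ^ k \<in> M" by (intro Mmult Mpow Mdiff M01 that M(3) w)
    qed
    have N: "N \<in> A"
      unfolding A_def mem_Collect_eq
    proof (intro conjI ballI)
      have sS: "s \<in> S" unfolding s_def using t w M(1) by (intro S_inverse S_diff S_mult) auto
      show "N \<subseteq> S" using sS M(1) by (auto simp: N_def intro!: S_mult S_power)
      have MN: "a \<in> N" if "a \<in> M" for a using that unfolding N_def by (intro CollectI exI[of _ a] exI[of _ 0]) simp
      show "range \<iota> \<subseteq> N" "t \<in> N" using MN M by auto
      show "inverse t \<notin> N"
      proof
        assume "inverse t \<in> N"
        then obtain a n where a: "a \<in> M" "inverse t = a * s ^ n" by (auto simp: N_def)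
        obtain w' where w': "w' \<in> M" "(1 - t * w) ^ n = 1 - t * w'" using pw by blast
        have "inverse t * (1 - t * w) ^ n = a * (s * (1 - t * w)) ^ n" unfolding a(2) by (simp add: power_mult_distrib)
        then have "inverse t * (1 - t * w') = a" using ss w'(2) by simp
        then have "inverse t = a + w'" using t0 by (simp add: field_simps)
        then show False using M(4) Madd a(1) w'(1) by simp
      qed
      fix a b assume "a \<in> N" "b \<in> N"
      then obtain a' n b' m where ab: "a = a' * s ^ n" "a' \<in> M" "b = b' * s ^ m" "b' \<in> M" by (auto simp: N_def)
      obtain a'' b'' where ab2: "a'' \<in> M" "a = a'' * s ^ (n + m)" "b'' \<in> M" "b = b'' * s ^ (m + n)"
        using lift[OF ab(2), of n m] lift[OF ab(4), of m n] ab by auto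
      have "a + b = (a'' + b'') * s ^ (n + m)" by (simp add: ab2 algebra_simps)
      then show "a + b \<in> N" using Madd ab2 unfolding N_def by blast
      have "a * b = (a' * b') * s ^ (n + m)" by (simp add: ab power_add)
      then show "a * b \<in> N" using Mmult ab unfolding N_def by blast
      have "- a = (- a') * s ^ n" by (simp add: ab)
      then show "- a \<in> N" using Mminus ab unfolding N_def by blast
    qed
    have "M \<subseteq> N" unfolding N_def by (auto intro!: exI[of _ "0::nat"])
    then have "N = M" using max N by blast
    moreover have "1 * s ^ 1 \<in> N" unfolding N_def using M01(2) by blast
    ultimately show ?thesis by (simp add: s_def)
  qed
  \<comment> \<open>\<open>P n z\<close> says that 1/t is a polynomial in z of degree at most n over
    M.\<close>
  define P where "P n z \<longleftrightarrow> (\<exists>a. (\<forall>i. a i \<in> M) \<and> 1 = t * (\<Sum>i\<le>n. a i * z ^ i))" for n :: nat and z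
  have P0: "\<not> P 0 z" for z
  proof
    assume "P 0 z"
    then obtain a where "\<forall>i::nat. a i \<in> M" "1 = t * a 0" by (auto simp: P_def)
    then have "inverse t = a 0" using t0 by (simp add: field_simps)
    then show False using M(4) \<open>\<forall>i. a i \<in> M\<close> by metis
  qed
  \<comment> \<open>Chevalley's reduction: the relation for 1/z, divided by the unit 1 - t b_0,
    expresses z ^ n through lower powers of z and so shortens the relation for z.\<close>
  have red: "P (n - 1) z" if z: "z \<noteq> 0" and n: "P n z" and m: "P m (inverse z)" and mn: "m \<le> n" for n m z
  proof -
    obtain a where a: "\<And>i. a i \<in> M" "1 = t * (\<Sum>i\<le>n. a i * z ^ i)" using n by (auto simp: P_def)
    obtain b where b: "\<And>i. b i \<in> M" "1 = t * (\<Sum>i\<le>m. b i * inverse z ^ i)" using m by (auto simp: P_def)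
    have m1: "1 \<le> m" using m P0 by (cases m) auto
    define u where "u = inverse (1 - t * b 0)"
    have uM: "u \<in> M" using unit b(1) by (simp add: u_def)
    have nz: "1 - t * b 0 \<noteq> 0"
    proof
      assume "1 - t * b 0 = 0"
      then have "inverse t = b 0" using t0 by (simp add: field_simps)
      then show False using M(4) b(1) by metis
    qed
    have "(\<Sum>i\<le>m. b i * inverse z ^ i) = b 0 + (\<Sum>i\<in>{1..m}. b i * inverse z ^ i)"
      by (simp add: atMost_atLeast0 sum.atLeast_Suc_atMost)
    then have tb: "1 - t * b 0 = t * (\<Sum>i\<in>{1..m}. b i * inverse z ^ i)" using b(2) by (simp add: algebra_simps)
    have "1 = u * (1 - t * b 0)" using nz by (simp add: u_def)
    then have one: "1 = u * (t * (\<Sum>i\<in>{1..m}. b i * inverse z ^ i))" by (simp only: tb)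
    have "z ^ n = (\<Sum>i\<in>{1..m}. u * t * b i * z ^ (n - i))"
    proof -
      have "z ^ n = z ^ n * (u * (t * (\<Sum>i\<in>{1..m}. b i * inverse z ^ i)))" using one by simp
      also have "\<dots> = (\<Sum>i\<in>{1..m}. u * t * b i * (z ^ n * inverse z ^ i))"
        by (simp add: sum_distrib_left algebra_simps)
      also have "\<dots> = (\<Sum>i\<in>{1..m}. u * t * b i * z ^ (n - i))"
      proof (rule sum.cong)
        fix i assume "i \<in> {1..m}"
        then have "z ^ n = z ^ (n - i) * z ^ i" using mn by (simp flip: power_add)
        then show "u * t * b i * (z ^ n * inverse z ^ i) = u * t * b i * z ^ (n - i)" using z by (simp add: power_inverse)
      qed simp
      finally show ?thesis .
    qed
    also have "\<dots> = (\<Sum>j\<in>{n - m..n - 1}. u * t * b (n - j) * z ^ j)"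
      by (rule sum.reindex_bij_witness[of _ "\<lambda>j. n - j" "\<lambda>i. n - i"]) (use mn m1 in auto)
    finally have zn: "z ^ n = (\<Sum>j\<in>{n - m..n - 1}. u * t * b (n - j) * z ^ j)" .
    define c where "c j = a j + (if n - m \<le> j then a n * (u * t * b (n - j)) else 0)" for j
    have "(\<Sum>i\<le>n. a i * z ^ i) = (\<Sum>i\<le>n - 1. a i * z ^ i) + a n * z ^ n"
      using m1 mn by (cases n) auto
    also have "a n * z ^ n = (\<Sum>j\<in>{n - m..n - 1}. a n * (u * t * b (n - j)) * z ^ j)"
      unfolding zn by (simp add: sum_distrib_left mult.assoc)
    also have "\<dots> = (\<Sum>j\<le>n - 1. (if n - m \<le> j then a n * (u * t * b (n - j)) else 0) * z ^ j)"
      by (rule sum.mono_neutral_cong_left) auto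
    finally have "(\<Sum>i\<le>n. a i * z ^ i) = (\<Sum>j\<le>n - 1. c j * z ^ j)"
      by (simp add: c_def sum.distrib distrib_right)
    then have "1 = t * (\<Sum>j\<le>n - 1. c j * z ^ j)" using a(2) by simp
    moreover have "c j \<in> M" for j unfolding c_def by (auto intro!: Madd Mmult a b uM M(3))
    ultimately show ?thesis unfolding P_def by blast
  qed
  \<comment> \<open>For z outside M, the ring M[z] is too large to belong to A, and the only
    condition it can violate is the exclusion of 1/t.\<close>
  have ex: "\<exists>n. P n z" if z: "z \<in> S" "z \<notin> M" for z
  proof -
    define N where "N = {w. \<exists>n a. (\<forall>i::nat. a i \<in> M) \<and> (\<forall>i>n. a i = 0) \<and> w = (\<Sum>i\<le>n. a i * z ^ i)}"
    have ev: "(\<Sum>i\<le>n. a i * z ^ i) = poly (Abs_poly a) z" if "\<forall>i>n. a i = 0" for n :: nat and a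
    proof -
      have c: "coeff (Abs_poly a) = a" using that by (intro coeff_Abs_poly) auto
      then have d: "degree (Abs_poly a) \<le> n" using that by (intro degree_le) auto
      have "(\<Sum>i\<le>n. a i * z ^ i) = (\<Sum>i\<le>degree (Abs_poly a). a i * z ^ i)"
        by (rule sum.mono_neutral_right) (use d c coeff_eq_0[of "Abs_poly a"] in auto)
      then show ?thesis unfolding poly_altdef c .
    qed
    have Nalt: "N = {poly p z | p. \<forall>i. coeff p i \<in> M}"
    proof (intro Set.set_eqI iffI)
      fix w assume "w \<in> N"
      then obtain n a where na: "\<forall>i::nat. a i \<in> M" "\<forall>i>n. a i = 0" "w = (\<Sum>i\<le>n. a i * z ^ i)" unfolding N_def by blast
      have "coeff (Abs_poly a) = a" using na(2) by (intro coeff_Abs_poly) auto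
      then show "w \<in> {poly p z | p. \<forall>i. coeff p i \<in> M}" using ev[OF na(2)] na by (intro CollectI exI[of _ "Abs_poly a"]) simp
    next
      fix w assume "w \<in> {poly p z | p. \<forall>i. coeff p i \<in> M}"
      then obtain p where p: "w = poly p z" "\<forall>i. coeff p i \<in> M" by blast
      then show "w \<in> N" unfolding N_def
        by (intro CollectI exI[of _ "degree p"] exI[of _ "coeff p"]) (auto simp: poly_altdef coeff_eq_0)
    qed
    have MN: "a \<in> N" if "a \<in> M" for a
      unfolding Nalt using that M01 by (intro CollectI exI[of _ "[:a:]"]) (auto simp: coeff_pCons split: nat.splits)
    have zN: "z \<in> N" unfolding Nalt using M01 by (intro CollectI exI[of _ "[:0, 1:]"]) (auto simp: coeff_pCons split: nat.splits)
    have "N \<notin> A"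
    proof
      assume "N \<in> A"
      then have "N = M" using max MN by blast
      then show False using zN z(2) by blast
    qed
    moreover have "N \<subseteq> S" unfolding N_def using M(1) z(1) by (auto intro!: S_sum S_mult S_power)
    moreover have "a + b \<in> N \<and> a * b \<in> N \<and> - a \<in> N" if ab: "a \<in> N" "b \<in> N" for a b
    proof -
      obtain p q where pq: "a = poly p z" "b = poly q z" "\<forall>i. coeff p i \<in> M" "\<forall>i. coeff q i \<in> M"
        using ab unfolding Nalt by blast
      have "a + b = poly (p + q) z \<and> (\<forall>i. coeff (p + q) i \<in> M)" using pq Madd by simp
      moreover have "a * b = poly (p * q) z \<and> (\<forall>i. coeff (p * q) i \<in> M)"
        using pq Mmult by (auto simp: coeff_mult intro!: Msum)
      moreover have "- a = poly (- p) z \<and> (\<forall>i. coeff (- p) i \<in> M)" using pq Mminus by simp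
      ultimately show ?thesis unfolding Nalt by blast
    qed
    ultimately have "inverse t \<in> N" using MN M unfolding A_def mem_Collect_eq by blast
    then obtain n a where "\<forall>i::nat. a i \<in> M" "inverse t = (\<Sum>i\<le>n. a i * z ^ i)" unfolding N_def by blast
    then have "P n z" unfolding P_def using t0 by (intro exI[of _ a]) (metis right_inverse)
    then show ?thesis ..
  qed
  have val: "z \<in> M \<or> inverse z \<in> M" if z: "z \<in> S" for z
  proof (rule ccontr)
    assume n: "\<not> ?thesis"
    then have z0: "z \<noteq> 0" using M01 by auto
    \<comment> \<open>If neither z nor 1/z were in M, take relations of least degree for both; the
      longer one could then be shortened.\<close>
    define n where "n = (LEAST n. P n z)"
    define m where "m = (LEAST m. P m (inverse z))"
    have Pn: "P n z" and Pm: "P m (inverse z)"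
      using ex[OF z] ex[OF S_inverse[OF z]] n unfolding n_def m_def by (auto intro: LeastI_ex)
    have n1: "n \<noteq> 0" "m \<noteq> 0" using Pn Pm P0 by metis+
    show False
    proof (cases "m \<le> n")
      case True
      then have "P (n - 1) z" using red[OF z0 Pn Pm] by blast
      then show False using not_less_Least[of "n - 1" "\<lambda>n. P n z"] n1 unfolding n_def by auto
    next
      case False
      then have "P (m - 1) (inverse z)" using red[of "inverse z" m n] z0 Pn Pm by simp
      then show False using not_less_Least[of "m - 1" "\<lambda>m. P m (inverse z)"] n1 unfolding m_def by auto
    qed
  qed
  have "place M"
    unfolding place_def using M val S_inverse[OF t] Madd Mmult Mminus by (auto simp del: iota_simps)
  moreover have "t \<in> mx M" using M by (simp add: mx_def)
  ultimately show ?thesis by (rule that)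
qed

text \<open>Every y - c has a zero, and the residue of y distinguishes these zeros for different
  c.\<close>

lemma infinite_places: "infinite Pl"
proof
  assume fin: "finite Pl"
  have "\<forall>c. \<exists>V. place V \<and> y - \<iota> c \<in> mx V"
  proof
    fix c
    have "kdep (y - \<iota> c)" by (rule kdep_shift[OF kdep_y])
    then show "\<exists>V. place V \<and> y - \<iota> c \<in> mx V" using place_exists[of "y - \<iota> c"] unfolding kdep_def by metis
  qed
  then obtain V where V: "\<And>c. place (V c)" "\<And>c. y - \<iota> c \<in> mx (V c)" by metis
  have "inj V"
  proof (rule injI)
    fix c c' assume e: "V c = V c'"
    have "c = res y (V c)" by (rule res_eqI[OF V(1) V(2), symmetric])
    also have "\<dots> = res y (V c')" by (rule arg_cong[OF e])
    also have "\<dots> = c'" by (rule res_eqI[OF V(1) V(2)])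
    finally show "c = c'" .
  qed
  moreover have "range V \<subseteq> Pl" using V(1) by (auto simp: Pl_def)
  then have "finite (range V)" using fin by (rule finite_subset)
  ultimately have "finite (UNIV :: 'a set)" using finite_imageD by metis
  then show False using infinite_alg_closed by metis
qed

text \<open>Otherwise f - g would vanish at all but finitely many of the infinitely many places. The
  exceptional set E absorbs poles when functions are compared.\<close>

lemma eq_if_eq_at_places:
  assumes "f \<in> S" "g \<in> S" "finite E" "\<And>V. V \<in> Pl - E \<Longrightarrow> f \<in> V \<Longrightarrow> g \<in> V \<Longrightarrow> res f V = res g V"
  shows "f = g"
proof (rule ccontr)
  assume "f \<noteq> g"
  have "Pl \<subseteq> {V \<in> Pl. f - g \<in> mx V} \<union> {V \<in> Pl. f \<notin> V} \<union> {V \<in> Pl. g \<notin> V} \<union> E"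
  proof
    fix V assume V: "V \<in> Pl"
    then have pl: "place V" by (simp add: Pl_def)
    have "f - g \<in> mx V" if "f \<in> V" "g \<in> V" "V \<notin> E"
    proof -
      have "(f - \<iota> (res f V)) - (g - \<iota> (res g V)) \<in> mx V" using that by (intro mx_diff res_mx pl)
      then show ?thesis using assms(4)[of V] that V by simp
    qed
    then show "V \<in> {V \<in> Pl. f - g \<in> mx V} \<union> {V \<in> Pl. f \<notin> V} \<union> {V \<in> Pl. g \<notin> V} \<union> E" using V by blast
  qed
  moreover have "finite \<dots>"
    using finite_zeros[of "f - g"] finite_poles assms \<open>f \<noteq> g\<close> S_diff by auto
  ultimately show False using infinite_places finite_subset by blast
qed

subsection \<open>Automorphisms\<close>

text \<open>Only the behaviour on S is constrained, so two automorphisms are the same when they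
  agree on S.\<close>

definition kaut :: "('b \<Rightarrow> 'b) \<Rightarrow> bool" where
  "kaut \<tau> \<longleftrightarrow> bij_betw \<tau> S S \<and> (\<forall>c. \<tau> (\<iota> c) = \<iota> c) \<and>
     (\<forall>a\<in>S. \<forall>b\<in>S. \<tau> (a + b) = \<tau> a + \<tau> b \<and> \<tau> (a * b) = \<tau> a * \<tau> b)"

lemma kaut_D:
  assumes "kaut \<tau>"
  shows "a \<in> S \<Longrightarrow> \<tau> a \<in> S" "\<tau> (\<iota> c) = \<iota> c" "a \<in> S \<Longrightarrow> b \<in> S \<Longrightarrow> \<tau> (a + b) = \<tau> a + \<tau> b"
    "a \<in> S \<Longrightarrow> b \<in> S \<Longrightarrow> \<tau> (a * b) = \<tau> a * \<tau> b" "a \<in> S \<Longrightarrow> b \<in> S \<Longrightarrow> \<tau> a = \<tau> b \<longleftrightarrow> a = b"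
    "\<tau> 0 = 0" "\<tau> 1 = 1" "a \<in> S \<Longrightarrow> \<tau> (- a) = - \<tau> a" "a \<in> S \<Longrightarrow> \<tau> (inverse a) = inverse (\<tau> a)"
    "a \<in> S \<Longrightarrow> b \<in> S \<Longrightarrow> \<tau> (a - b) = \<tau> a - \<tau> b" "a \<in> S \<Longrightarrow> \<tau> (a ^ n) = \<tau> a ^ n"
    "b \<in> S \<Longrightarrow> \<exists>a\<in>S. \<tau> a = b"
proof -
  have bij: "bij_betw \<tau> S S" and c: "\<And>c. \<tau> (\<iota> c) = \<iota> c"
    and add: "\<And>a b. a \<in> S \<Longrightarrow> b \<in> S \<Longrightarrow> \<tau> (a + b) = \<tau> a + \<tau> b"
    and mult: "\<And>a b. a \<in> S \<Longrightarrow> b \<in> S \<Longrightarrow> \<tau> (a * b) = \<tau> a * \<tau> b"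
    using assms by (auto simp: kaut_def)
  show S: "\<tau> a \<in> S" if "a \<in> S" for a using bij that by (auto simp: bij_betw_def)
  show inj: "\<tau> a = \<tau> b \<longleftrightarrow> a = b" if "a \<in> S" "b \<in> S" for a b
    using bij that by (auto simp: bij_betw_def inj_on_def)
  show "\<tau> (\<iota> c) = \<iota> c" by (rule c)
  show "\<tau> (a + b) = \<tau> a + \<tau> b" "\<tau> (a * b) = \<tau> a * \<tau> b" if "a \<in> S" "b \<in> S" using add mult that by auto
  show 0: "\<tau> 0 = 0" and 1: "\<tau> 1 = 1" using c[of 0] c[of 1] by auto
  show m: "\<tau> (- a) = - \<tau> a" if "a \<in> S" for a
    using add[OF that S_minus[OF that]] 0 by (simp add: add_eq_0_iff)
  show "\<tau> (inverse a) = inverse (\<tau> a)" if "a \<in> S" for a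
  proof (cases "a = 0")
    case False
    then have "\<tau> a * \<tau> (inverse a) = 1" using mult[OF that S_inverse[OF that]] 1 by simp
    then show ?thesis by (metis inverse_unique)
  qed (simp add: 0)
  show "\<tau> (a - b) = \<tau> a - \<tau> b" if "a \<in> S" "b \<in> S"
    using add[OF that(1) S_minus[OF that(2)]] m[OF that(2)] by simp
  show "\<tau> (a ^ n) = \<tau> a ^ n" if "a \<in> S" by (induct n) (auto simp: 1 mult that S_power)
  show "\<exists>a\<in>S. \<tau> a = b" if "b \<in> S" using bij that unfolding bij_betw_def by (metis imageE)
qed

lemma kaut_evp:
  assumes "kaut \<tau>" "a \<in> S" shows "\<tau> (evp \<iota> a p) = evp \<iota> (\<tau> a) p"
  by (induct p) (auto simp: evp_0 evp_pCons rhom_iota kaut_D[OF assms(1)] S_evp S_mult assms)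

lemma kaut_sum:
  assumes "kaut \<tau>" "\<And>i. i \<in> A \<Longrightarrow> f i \<in> S" shows "\<tau> (sum f A) = (\<Sum>i\<in>A. \<tau> (f i))"
  using assms(2) by (induct A rule: infinite_finite_induct) (auto simp: kaut_D[OF assms(1)] S_sum)

lemma kaut_comp: "kaut \<tau> \<Longrightarrow> kaut \<sigma> \<Longrightarrow> kaut (\<tau> \<circ> \<sigma>)"
  unfolding kaut_def by (auto intro: bij_betw_trans simp: bij_betwE)

lemma kaut_inv:
  assumes "kaut \<tau>" shows "kaut (inv_into S \<tau>)"
    "\<And>a. a \<in> S \<Longrightarrow> inv_into S \<tau> (\<tau> a) = a" "\<And>a. a \<in> S \<Longrightarrow> \<tau> (inv_into S \<tau> a) = a"
proof -
  have bij: "bij_betw \<tau> S S" using assms by (simp add: kaut_def)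
  show l: "inv_into S \<tau> (\<tau> a) = a" if "a \<in> S" for a using bij that by (auto simp: bij_betw_inv_into_left)
  show r: "\<tau> (inv_into S \<tau> a) = a" if "a \<in> S" for a using bij that by (auto simp: bij_betw_inv_into_right)
  have b: "bij_betw (inv_into S \<tau>) S S" by (rule bij_betw_inv_into[OF bij])
  have iS: "inv_into S \<tau> a \<in> S" if "a \<in> S" for a using b that by (auto simp: bij_betw_def)
  show "kaut (inv_into S \<tau>)"
    unfolding kaut_def
  proof (intro conjI allI ballI b)
    show "inv_into S \<tau> (\<iota> c) = \<iota> c" for c using l[of "\<iota> c"] kaut_D(2)[OF assms] by simp
    fix a b assume ab: "a \<in> S" "b \<in> S"
    show "inv_into S \<tau> (a + b) = inv_into S \<tau> a + inv_into S \<tau> b"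
      using l[OF S_add[OF iS[OF ab(1)] iS[OF ab(2)]]] kaut_D(3)[OF assms iS[OF ab(1)] iS[OF ab(2)]] r ab by simp
    show "inv_into S \<tau> (a * b) = inv_into S \<tau> a * inv_into S \<tau> b"
      using l[OF S_mult[OF iS[OF ab(1)] iS[OF ab(2)]]] kaut_D(4)[OF assms iS[OF ab(1)] iS[OF ab(2)]] r ab by simp
  qed
qed

lemma kaut_place:
  assumes k: "kaut \<tau>" and V: "place V" shows "place (\<tau> ` V)" "mx (\<tau> ` V) = \<tau> ` mx V"
proof -
  have VS: "V \<subseteq> S" by (rule place_D(1)[OF V])
  have im: "\<tau> z \<in> \<tau> ` V \<longleftrightarrow> z \<in> V" if "z \<in> S" for z
    using kaut_D(5)[OF k] that VS by (auto simp: subset_iff)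
  have inv: "inverse (\<tau> z) \<in> \<tau> ` V \<longleftrightarrow> inverse z \<in> V" if "z \<in> S" for z
    using im[OF S_inverse[OF that]] kaut_D(9)[OF k that] by simp
  show "place (\<tau> ` V)"
    unfolding place_def
  proof (intro conjI ballI)
    show "\<tau> ` V \<subseteq> S" using VS kaut_D(1)[OF k] by auto
    show "range \<iota> \<subseteq> \<tau> ` V" using place_D(2)[OF V] kaut_D(2)[OF k] by (metis image_subset_iff imageI image_eqI)
    obtain z where "z \<in> S" "z \<notin> V" using V VS by (auto simp: place_def)
    then show "\<tau> ` V \<noteq> S" using im kaut_D(1)[OF k] by metis
    show "z \<in> \<tau> ` V \<or> inverse z \<in> \<tau> ` V" if z: "z \<in> S - {0}" for z
    proof -
      obtain w where w: "w \<in> S" "\<tau> w = z" using kaut_D(12)[OF k] z by blast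
      then show ?thesis using im[OF w(1)] inv[OF w(1)] place_D(9)[OF V w(1)] by auto
    qed
    fix a b assume "a \<in> \<tau> ` V" "b \<in> \<tau> ` V"
    then obtain a' b' where ab: "a = \<tau> a'" "b = \<tau> b'" "a' \<in> V" "b' \<in> V" by blast
    have S: "a' \<in> S" "b' \<in> S" using ab VS by auto
    have "a + b = \<tau> (a' + b')" "a * b = \<tau> (a' * b')" "- a = \<tau> (- a')" using kaut_D[OF k] S ab by simp_all
    then show "a + b \<in> \<tau> ` V" "a * b \<in> \<tau> ` V" "- a \<in> \<tau> ` V" using place_D(5-7)[OF V] ab(3,4) by auto
  qed
  show "mx (\<tau> ` V) = \<tau> ` mx V"
  proof -
    have "\<tau> z \<in> mx (\<tau> ` V) \<longleftrightarrow> z \<in> mx V" if "z \<in> S" for z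
      using im[OF that] inv[OF that] kaut_D(5)[OF k that S_01(1)] kaut_D(6)[OF k] by (auto simp: mx_def)
    moreover have "mx V \<subseteq> V" "mx (\<tau> ` V) \<subseteq> \<tau> ` V" by (auto simp: mx_def)
    ultimately show ?thesis using VS by (auto 0 3 simp: subset_iff)
  qed
qed

lemma kaut_image_mem: "kaut \<tau> \<Longrightarrow> place V \<Longrightarrow> z \<in> S \<Longrightarrow> \<tau> z \<in> \<tau> ` V \<longleftrightarrow> z \<in> V"
  using kaut_D(5)[of \<tau>] place_D(1)[of V] by (auto simp: subset_iff)

lemma res_kaut:
  assumes k: "kaut \<tau>" and V: "place V" and z: "z \<in> V" shows "res (\<tau> z) (\<tau> ` V) = res z V"
proof (rule res_eqI[OF kaut_place(1)[OF k V]])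
  have "\<tau> (z - \<iota> (res z V)) \<in> mx (\<tau> ` V)"
    unfolding kaut_place(2)[OF k V] by (rule imageI) (rule res_mx[OF V z])
  then show "\<tau> z - \<iota> (res z V) \<in> mx (\<tau> ` V)"
    using kaut_D(2,10)[OF k] place_D(10)[OF V z] by simp
qed

definition reg :: "'b set set \<Rightarrow> ('b set \<Rightarrow> 'a) \<Rightarrow> bool" where
  "reg U g \<longleftrightarrow> (\<exists>f\<in>S. \<forall>V\<in>U. f \<in> V \<and> g V = res f V)"

text \<open>What a morphism of the normalization provides in terms of functions: g is the composite
  of f with \<sigma> wherever f is regular.\<close>

definition has_pullback :: "('b set \<Rightarrow> 'b set) \<Rightarrow> bool" where
  "has_pullback \<sigma> \<longleftrightarrow> (\<forall>f\<in>S. \<exists>g\<in>S. \<forall>V\<in>Pl. f \<in> \<sigma> V \<longrightarrow> g \<in> V \<and> res g V = res f (\<sigma> V))"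

text \<open>A pullback is determined by its values, so it respects sums, products and constants, and
  the pullback of the inverse makes it surjective. It maps the place \<sigma> V into V, and
  incomparability of places turns this inclusion into equality.\<close>

lemma kaut_of_pullback:
  assumes bij: "bij_betw \<sigma> Pl Pl" and p: "has_pullback \<sigma>" and p': "has_pullback (inv_into Pl \<sigma>)"
  obtains \<tau> where "kaut \<tau>" "\<And>V. V \<in> Pl \<Longrightarrow> \<sigma> V = \<tau> ` V"
proof -
  define \<sigma>' where "\<sigma>' = inv_into Pl \<sigma>"
  have bij': "bij_betw \<sigma>' Pl Pl" unfolding \<sigma>'_def by (rule bij_betw_inv_into[OF bij])
  have ss: "\<sigma>' (\<sigma> V) = V" "\<sigma> (\<sigma>' V) = V" "\<sigma> V \<in> Pl" "\<sigma>' V \<in> Pl" if "V \<in> Pl" for V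
    using that bij bij' by (auto simp: \<sigma>'_def bij_betw_inv_into_left bij_betw_inv_into_right bij_betwE)
  define pb where "pb \<sigma> f = (SOME g. g \<in> S \<and> (\<forall>V\<in>Pl. f \<in> \<sigma> V \<longrightarrow> g \<in> V \<and> res g V = res f (\<sigma> V)))" for \<sigma> f
  have pb: "pb \<sigma> f \<in> S \<and> (\<forall>V\<in>Pl. f \<in> \<sigma> V \<longrightarrow> pb \<sigma> f \<in> V \<and> res (pb \<sigma> f) V = res f (\<sigma> V))"
    if "has_pullback \<sigma>" "f \<in> S" for \<sigma> f
    unfolding pb_def by (rule someI_ex) (use that in \<open>auto simp: has_pullback_def\<close>)
  have pbS: "pb \<sigma> f \<in> S" if "f \<in> S" for f using pb[OF p that] by blast
  have pbV: "pb \<sigma> f \<in> V" "res (pb \<sigma> f) V = res f (\<sigma> V)" if "f \<in> S" "V \<in> Pl" "f \<in> \<sigma> V" for f V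
    using pb[OF p that(1)] that by blast+
  have fin: "finite {V \<in> Pl. f \<notin> \<sigma> V}" if "f \<in> S" for f
  proof -
    have "{V \<in> Pl. f \<notin> \<sigma> V} \<subseteq> \<sigma>' ` {V \<in> Pl. f \<notin> V}"
    proof
      fix V assume V: "V \<in> {V \<in> Pl. f \<notin> \<sigma> V}"
      then have "\<sigma>' (\<sigma> V) \<in> \<sigma>' ` {V \<in> Pl. f \<notin> V}" using ss(3) by (intro imageI) auto
      then show "V \<in> \<sigma>' ` {V \<in> Pl. f \<notin> V}" using ss(1) V by auto
    qed
    then show ?thesis using finite_poles[OF that] finite_subset by blast
  qed
  have pleq: "g = h" if "g \<in> S" "h \<in> S" "finite E" "\<And>V. V \<in> Pl - E \<Longrightarrow> res g V = res h V" for g h E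
    using eq_if_eq_at_places[of g h E] that by blast
  have Pp: "place V" "place (\<sigma> V)" if "V \<in> Pl" for V using that ss(3) by (auto simp: Pl_def)
  have padd: "pb \<sigma> (a + b) = pb \<sigma> a + pb \<sigma> b" if ab: "a \<in> S" "b \<in> S" for a b
  proof (rule pleq[of _ _ "{V \<in> Pl. a \<notin> \<sigma> V} \<union> {V \<in> Pl. b \<notin> \<sigma> V}"])
    fix V assume V: "V \<in> Pl - ({V \<in> Pl. a \<notin> \<sigma> V} \<union> {V \<in> Pl. b \<notin> \<sigma> V})"
    then have V': "V \<in> Pl" "a \<in> \<sigma> V" "b \<in> \<sigma> V" by auto
    have "a + b \<in> \<sigma> V" using place_D(5)[OF Pp(2)] V' by blast
    then show "res (pb \<sigma> (a + b)) V = res (pb \<sigma> a + pb \<sigma> b) V"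
      using pbV[OF ab(1) V'(1,2)] pbV[OF ab(2) V'(1,3)] pbV[OF S_add[OF ab] V'(1)] Pp[OF V'(1)] V' by (simp add: res_add)
  qed (use ab fin pbS S_add in auto)
  have pmult: "pb \<sigma> (a * b) = pb \<sigma> a * pb \<sigma> b" if ab: "a \<in> S" "b \<in> S" for a b
  proof (rule pleq[of _ _ "{V \<in> Pl. a \<notin> \<sigma> V} \<union> {V \<in> Pl. b \<notin> \<sigma> V}"])
    fix V assume V: "V \<in> Pl - ({V \<in> Pl. a \<notin> \<sigma> V} \<union> {V \<in> Pl. b \<notin> \<sigma> V})"
    then have V': "V \<in> Pl" "a \<in> \<sigma> V" "b \<in> \<sigma> V" by auto
    have "a * b \<in> \<sigma> V" using place_D(6)[OF Pp(2)] V' by blast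
    then show "res (pb \<sigma> (a * b)) V = res (pb \<sigma> a * pb \<sigma> b) V"
      using pbV[OF ab(1) V'(1,2)] pbV[OF ab(2) V'(1,3)] pbV[OF S_mult[OF ab] V'(1)] Pp[OF V'(1)] V' by (simp add: res_mult)
  qed (use ab fin pbS S_mult in auto)
  have pconst: "pb \<sigma> (\<iota> c) = \<iota> c" for c
  proof (rule pleq[of _ _ "{}"])
    fix V assume V: "V \<in> Pl - {}"
    then show "res (pb \<sigma> (\<iota> c)) V = res (\<iota> c) V"
      using pbV[OF S_const, of V c] place_D(2)[OF Pp(2)] Pp by (simp add: res_const)
  qed (use pbS in auto)
  have pinv: "pb \<sigma> (pb \<sigma>' f) = f" if f: "f \<in> S" for f
  proof -
    have p'': "has_pullback \<sigma>'" using p' by (simp add: \<sigma>'_def)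
    have gS: "pb \<sigma>' f \<in> S" using pb[OF p'' f] by blast
    show ?thesis
    proof (rule pleq[of _ _ "{V \<in> Pl. f \<notin> V}"])
      fix V assume "V \<in> Pl - {V \<in> Pl. f \<notin> V}"
      then have V: "V \<in> Pl" "f \<in> V" by auto
      have "f \<in> \<sigma>' (\<sigma> V)" using V ss by simp
      then have g: "pb \<sigma>' f \<in> \<sigma> V" "res (pb \<sigma>' f) (\<sigma> V) = res f V"
        using pb[OF p'' f] ss[OF V(1)] by auto
      then show "res (pb \<sigma> (pb \<sigma>' f)) V = res f V" using pbV[OF gS V(1)] by simp
    qed (use gS pbS f finite_poles in auto)
  qed
  have inj: "a = b" if "a \<in> S" "b \<in> S" "pb \<sigma> a = pb \<sigma> b" for a b
  proof -
    have "pb \<sigma> (a + (- 1) * b) = pb \<sigma> a + pb \<sigma> (- 1) * pb \<sigma> b"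
      unfolding padd[OF that(1) S_mult[OF S_minus[OF S_01(2)] that(2)]] pmult[OF S_minus[OF S_01(2)] that(2)] ..
    also have "pb \<sigma> (- 1) = - 1" using pconst[of "- 1"] by simp
    finally have z: "pb \<sigma> (a - b) = 0" using that(3) by simp
    show ?thesis
    proof (rule ccontr)
      assume "a \<noteq> b"
      have abS: "a - b \<in> S" using that S_diff by blast
      have "pb \<sigma> ((a - b) * inverse (a - b)) = 0" using pmult[OF abS S_inverse[OF abS]] z by simp
      then show False using \<open>a \<noteq> b\<close> pconst[of 1] by simp
    qed
  qed
  have "pb \<sigma> ` S = S"
  proof
    show "pb \<sigma> ` S \<subseteq> S" using pbS by auto
    show "S \<subseteq> pb \<sigma> ` S"
    proof
      fix f assume f: "f \<in> S"
      have "pb \<sigma>' f \<in> S" using pb[of \<sigma>' f] p' f by (auto simp: \<sigma>'_def)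
      then show "f \<in> pb \<sigma> ` S" using pinv[OF f] by (metis imageI)
    qed
  qed
  then have bijS: "bij_betw (pb \<sigma>) S S" using inj by (auto simp: bij_betw_def inj_on_def)
  have k: "kaut (pb \<sigma>)" unfolding kaut_def using bijS pconst padd pmult by blast
  show ?thesis
  \<comment> \<open>The pullback sends \<sigma> V to V, so its inverse is the automorphism that
    moves V to \<sigma> V.\<close>
  proof (rule that[of "inv_into S (pb \<sigma>)"])
    show "kaut (inv_into S (pb \<sigma>))" by (rule kaut_inv(1)[OF k])
    fix V assume V: "V \<in> Pl"
    have sub: "pb \<sigma> ` \<sigma> V \<subseteq> V" using pbV(1)[OF _ V] place_D(10)[OF Pp(2)[OF V]] by blast
    then have eq: "pb \<sigma> ` \<sigma> V = V"
      using place_incomparable[OF kaut_place(1)[OF k Pp(2)[OF V]] Pp(1)[OF V]] by blast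
    have "inv_into S (pb \<sigma>) ` pb \<sigma> ` \<sigma> V = \<sigma> V"
      using kaut_inv(2)[OF k] place_D(1)[OF Pp(2)[OF V]] by (force simp: image_image)
    then show "\<sigma> V = inv_into S (pb \<sigma>) ` V" using eq by simp
  qed
qed

definition pval :: "'b \<Rightarrow> 'b set \<Rightarrow> 'a option" where
  "pval f V = (if f \<in> V then Some (res f V) else None)"

lemma pval_kaut:
  assumes "kaut \<tau>" "place V" "z \<in> S" shows "pval (\<tau> z) (\<tau> ` V) = pval z V"
  using kaut_image_mem[OF assms] res_kaut[OF assms(1,2)] by (simp add: pval_def)

lemma pval_eqD:
  assumes "f \<in> S" "g \<in> S" "\<And>V. V \<in> Pl \<Longrightarrow> pval f V = pval g V" shows "f = g"
proof (rule eq_if_eq_at_places[OF assms(1,2), of "{}"])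
  fix V assume "V \<in> Pl - {}" "f \<in> V" "g \<in> V"
  then show "res f V = res g V" using assms(3)[of V] by (simp add: pval_def)
qed simp

end

section \<open>The function field inside the generic field\<close>

text \<open>A relation between n + 1 rows of length n with coefficients in the domain itself:
  fraction-free elimination, the pivot of the last column being moved into the last row by a
  transposition.\<close>

lemma idom_kernel:
  fixes A :: "nat \<Rightarrow> nat \<Rightarrow> 'c::idom"
  shows "\<exists>c. (\<exists>i\<le>n. c i \<noteq> 0) \<and> (\<forall>j<n. (\<Sum>i\<le>n. c i * A i j) = 0)"
proof (induct n arbitrary: A)
  case 0
  show ?case by (rule exI[of _ "\<lambda>_. 1"]) simp
next
  case (Suc n)
  have main: "\<exists>c. (\<exists>i\<le>Suc n. c i \<noteq> 0) \<and> (\<forall>j<Suc n. (\<Sum>i\<le>Suc n. c i * A i j) = 0)"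
    if a: "A (Suc n) n \<noteq> 0" for A :: "nat \<Rightarrow> nat \<Rightarrow> 'c"
  proof -
    obtain c where c: "\<exists>i\<le>n. c i \<noteq> 0"
      "\<And>j. j < n \<Longrightarrow> (\<Sum>i\<le>n. c i * (A (Suc n) n * A i j - A i n * A (Suc n) j)) = 0"
      using Suc[of "\<lambda>i j. A (Suc n) n * A i j - A i n * A (Suc n) j"] by blast
    \<comment> \<open>The last coefficient is chosen to cancel column n; the other columns then
      reduce to the relation of size n.\<close>
    define c' where "c' i = (if i \<le> n then A (Suc n) n * c i else - (\<Sum>i\<le>n. c i * A i n))" for i
    have s: "(\<Sum>i\<le>Suc n. c' i * A i j) = (\<Sum>i\<le>n. c i * (A (Suc n) n * A i j - A i n * A (Suc n) j))" for j
      by (simp add: c'_def sum_distrib_right sum_distrib_left right_diff_distrib sum_subtractf mult_ac)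
    have "(\<Sum>i\<le>Suc n. c' i * A i j) = 0" if "j < Suc n" for j
    proof (cases "j = n")
      case True
      then show ?thesis unfolding s by (simp add: mult.commute)
    next
      case False
      then show ?thesis unfolding s using c(2)[of j] that by simp
    qed
    moreover have "\<exists>i\<le>Suc n. c' i \<noteq> 0" using c(1) a by (auto simp: c'_def)
    ultimately show ?thesis by blast
  qed
  show ?case
  proof (cases "\<forall>i\<le>Suc n. A i n = 0")
    case True
    obtain c where c: "\<exists>i\<le>n. c i \<noteq> 0" "\<And>j. j < n \<Longrightarrow> (\<Sum>i\<le>n. c i * A i j) = 0" using Suc[of A] by blast
    have "(\<Sum>i\<le>Suc n. (if i \<le> n then c i else 0) * A i j) = 0" if "j < Suc n" for j
      using c(2)[of j] that True by (cases "j = n") auto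
    moreover have "\<exists>i\<le>Suc n. (if i \<le> n then c i else 0) \<noteq> 0" using c(1) by auto
    ultimately show ?thesis by (intro exI[of _ "\<lambda>i. if i \<le> n then c i else 0"] conjI allI impI) blast+
  next
    case False
    then obtain p where p: "p \<le> Suc n" "A p n \<noteq> 0" by blast
    let ?t = "Transposition.transpose p (Suc n)"
    obtain c where c: "\<exists>i\<le>Suc n. c i \<noteq> 0" "\<And>j. j < Suc n \<Longrightarrow> (\<Sum>i\<le>Suc n. c i * A (?t i) j) = 0"
      using main[of "\<lambda>i. A (?t i)"] p(2) by auto
    have b: "bij_betw ?t {..Suc n} {..Suc n}"
      using p(1) by (intro bij_betw_byWitness[where f' = ?t]) (auto simp: Transposition.transpose_def)
    have r: "(\<Sum>i\<le>Suc n. c (?t i) * A i j) = (\<Sum>i\<le>Suc n. c i * A (?t i) j)" for j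
      using sum.reindex_bij_betw[OF b, of "\<lambda>i. c (?t i) * A i j"] by simp
    obtain i where i: "i \<le> Suc n" "c i \<noteq> 0" using c(1) by blast
    have "\<exists>i\<le>Suc n. c (?t i) \<noteq> 0"
      using i p(1) by (intro exI[of _ "?t i"]) (auto simp: Transposition.transpose_def)
    then show ?thesis using c(2) r by (intro exI[of _ "\<lambda>i. c (?t i)"]) simp
  qed
qed

section \<open>Dehomogenisation with respect to Z, and homogenisation\<close>

definition dehom :: "'a::comm_ring_1 poly3 \<Rightarrow> 'a poly poly" where
  "dehom = map_poly (map_poly (\<lambda>r. poly r 1))"

lemma rhom_poly1: "rhom (\<lambda>r. poly r c)" by (auto simp: rhom_def)

lemma coeff_dehom:
  assumes "homogeneous d G"
  shows "coeff (coeff (dehom G) i) j =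
    (if i + j \<le> d then coeff (coeff (coeff G i) j) (d - i - j) else 0)"
proof -
  have z: "coeff (coeff (coeff G i) j) l = 0" if "i + j + l \<noteq> d" for l
    using assms that by (auto simp: homogeneous_def)
  have "coeff (coeff G i) j =
     (if i + j \<le> d then monom (coeff (coeff (coeff G i) j) (d - i - j)) (d - i - j) else 0)"
  proof (rule poly_eqI)
    fix l
    show "coeff (coeff (coeff G i) j) l = coeff
     (if i + j \<le> d then monom (coeff (coeff (coeff G i) j) (d - i - j)) (d - i - j) else 0) l"
      using z[of l] by (cases "i + j + l = d") (auto simp: coeff_monom)
  qed
  then have "poly (coeff (coeff G i) j) 1 =
    (if i + j \<le> d then coeff (coeff (coeff G i) j) (d - i - j) else 0)"
    by (metis mult.right_neutral poly_0 poly_monom power_one)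
  then show ?thesis by (simp add: dehom_def coeff_map_poly)
qed

lemma ev3_dehom:
  assumes h: "rhom h" shows "ev3 h (vector [a, b, 1]) G = evp (evp h b) a (dehom G)"
proof (rule rhom3_eqI[OF rhom_ev3[OF h]])
  show "rhom (\<lambda>G. evp (evp h b) a (dehom G))"
    unfolding dehom_def by (intro rhom_comp[OF rhom_evp[OF rhom_evp[OF h]] rhom_map_poly[OF rhom_map_poly[OF rhom_poly1]]])
  show "ev3 h (vector [a, b, 1]) (C3 c) = evp (evp h b) a (dehom (C3 c))" for c
    unfolding ev3_C3[OF h] using h by (simp add: C3_def dehom_def map_poly_pCons evp_const rhom_evp)
  show "ev3 h (vector [a, b, 1]) (X3 $ i) = evp (evp h b) a (dehom (X3 $ i))" for i
    unfolding ev3_X3[OF h] using exhaust_3[of i] h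
    by (auto simp: X3_def vector_3 dehom_def map_poly_pCons evp_const evp_var rhom_evp
        evp_pCons evp_0 rhom_0 rhom_1 simp flip: one_pCons)
qed

lemma ev3_homogeneous_dehom:
  fixes h :: "'a::comm_ring_1 \<Rightarrow> 'b::field" and v :: "'b^3"
  assumes h: "rhom h" and G: "homogeneous n G" and v: "v $ 3 \<noteq> 0"
  shows "ev3 h v G = v $ 3 ^ n * evp (evp h (v$2 / v$3)) (v$1 / v$3) (dehom G)"
proof -
  have "v = (\<chi> i. v $ 3 * (vector [v$1 / v$3, v$2 / v$3, 1] :: 'b^3) $ i)"
    using v by (simp add: vec_eq_iff forall_3 vector_3)
  then show ?thesis using ev3_homogeneous[OF G h] ev3_dehom[OF h] by metis
qed

lemma total_degree_ge:
  assumes "coeff (coeff f i) j \<noteq> 0" shows "i + j \<le> total_degree f"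
proof -
  have "{i + j | i j. coeff (coeff f i) j \<noteq> 0} \<subseteq>
    (\<lambda>(i, j). i + j) ` (SIGMA i:{..degree f}. {..degree (coeff f i)})"
  proof clarify
    fix i j assume a: "coeff (coeff f i) j \<noteq> 0"
    then have "i \<le> degree f" "j \<le> degree (coeff f i)"
      by (metis le_degree coeff_0, metis le_degree)
    then show "i + j \<in> (\<lambda>(i, j). i + j) ` (SIGMA i:{..degree f}. {..degree (coeff f i)})"
      by (intro image_eqI[of _ _ "(i, j)"]) auto
  qed
  then have "finite {i + j | i j. coeff (coeff f i) j \<noteq> 0}"
    by (rule finite_subset) auto
  then show ?thesis unfolding total_degree_def using assms by (intro Max_ge) auto
qed

lemma homogeneous_homogenization: "homogeneous (total_degree f) (homogenization f)"
  unfolding homogenization_def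
proof (intro homogeneous_sum)
  fix i j
  show "homogeneous (total_degree f) (term3 (coeff (coeff f i) j) i j (total_degree f - i - j))"
  proof (cases "coeff (coeff f i) j = 0")
    case True
    then show ?thesis by (simp add: term3_def homogeneous_zero)
  next
    case False
    then show ?thesis using homogeneous_term3[of i j "total_degree f - i - j"] total_degree_ge[OF False] by simp
  qed
qed

lemma dehom_homogenization: "dehom (homogenization f) = f"
proof -
  let ?h = "\<lambda>a. [:[:a:]:]"
  have h: "rhom ?h" by (rule rhom_comp[OF rhom_pconst rhom_pconst])
  have r: "rhom dehom" unfolding dehom_def by (intro rhom_map_poly rhom_poly1)
  have t: "dehom (term3 a i j l) = monom (monom a j) i" for a i j l
  proof (intro poly_eqI)
    fix i' j'
    have "map_poly (\<lambda>r. poly r 1) (monom (monom a l) j) = monom a j"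
      by (intro poly_eqI) (simp add: coeff_map_poly coeff_monom poly_monom)
    then show "coeff (coeff (dehom (term3 a i j l)) i') j' = coeff (coeff (monom (monom a j) i) i') j'"
      by (simp add: dehom_def term3_def coeff_map_poly coeff_monom poly_monom)
  qed
  have ms: "(\<Sum>j\<in>A. monom (g j) i) = monom (sum g A) i" for A :: "nat set" and g :: "nat \<Rightarrow> 'a poly" and i
    by (induct A rule: infinite_finite_induct) (auto simp: add_monom)
  have "dehom (homogenization f) = (\<Sum>i\<le>degree f. monom (\<Sum>j\<le>degree (coeff f i).
        monom (coeff (coeff f i) j) j) i)"
    unfolding homogenization_def rhom_sum[OF r] t ms ..
  also have "\<dots> = f" by (simp add: poly_as_sum_of_monoms)
  finally show ?thesis .
qed

lemma degree_homogenization: "degree (homogenization f) \<le> degree f"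
  unfolding homogenization_def term3_def
  by (intro degree_sum_le) (auto intro!: degree_sum_le order.trans[OF degree_monom_le])

lemma mv_inverse:
  fixes B :: "'a::field^3^3"
  assumes h: "rhom h" and B: "invertible B"
  shows "mv h B (mv h (matrix_inv B) v) = v" "mv h (matrix_inv B) (mv h B v) = v"
proof -
  have "matrix_inv B ** B = mat 1" "B ** matrix_inv B = mat 1"
    using B unfolding invertible_def matrix_inv_def by (metis (mono_tags, lifting) someI_ex)+
  then show "mv h B (mv h (matrix_inv B) v) = v" "mv h (matrix_inv B) (mv h B v) = v"
    by (simp_all add: mv_mult[OF h] mv_one[OF h])
qed

lemma linear_form_nonzero: "w \<noteq> 0 \<Longrightarrow> linear_form w \<noteq> 0"
proof
  assume w: "w \<noteq> 0" and l: "linear_form w = 0"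
  have "ev3 C3 (\<chi> j. if j = i then 1 else 0) (linear_form w) = C3 (w $ i)" for i
    by (simp add: ev3_linear_form rhom_C3 if_distrib cong: if_cong)
  then have "C3 (w $ i) = 0" for i using l by (metis rhom_0[OF rhom_ev3[OF rhom_C3]])
  then show False using w by (auto simp: C3_def vec_eq_iff)
qed

locale gcurve =
  fixes F :: "'a::alg_closed_field poly3" and d :: nat and v :: "'a generic_field^3"
  assumes irr: "Factorial_Ring.irreducible F" and hom: "homogeneous d F" and d3: "d \<ge> 3"
    and gen: "ev3 gconst v G = 0 \<longleftrightarrow> F dvd G"
begin

abbreviation E :: "'a poly3 \<Rightarrow> 'a generic_field" where "E \<equiv> ev3 gconst v"

lemma rhom_E: "rhom E" by (rule rhom_ev3[OF rhom_gconst])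

definition S :: "'a generic_field set" where
  "S = {E G / E H | G H n. homogeneous n G \<and> homogeneous n H \<and> \<not> F dvd H}"

definition lin :: "'a^3 \<Rightarrow> 'a generic_field" where "lin w = E (linear_form w)"

lemma lin_sum: "lin w = (\<Sum>i\<in>UNIV. gconst (w$i) * v$i)"
  by (simp add: lin_def ev3_linear_form rhom_gconst)

lemma not_dvd_linear: "w \<noteq> 0 \<Longrightarrow> \<not> F dvd linear_form w"
  using irreducible_homogeneous_dvd[OF irr hom homogeneous_linear_form linear_form_nonzero] d3 by fastforce

lemma lin_nonzero: "w \<noteq> 0 \<Longrightarrow> lin w \<noteq> 0"
  using not_dvd_linear gen by (simp add: lin_def)

lemma S_I: "homogeneous n G \<Longrightarrow> homogeneous n H \<Longrightarrow> E H \<noteq> 0 \<Longrightarrow> E G / E H \<in> S"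
  unfolding S_def using gen by blast

lemma S_E:
  assumes "z \<in> S" obtains G H n where "z = E G / E H" "homogeneous n G" "homogeneous n H" "E H \<noteq> 0"
  using assms unfolding S_def using gen by blast

lemma lin_S: "w \<noteq> 0 \<Longrightarrow> lin u / lin w \<in> S"
  using S_I[OF homogeneous_linear_form homogeneous_linear_form] lin_nonzero[of w] by (simp add: lin_def)

lemma const_S: "gconst c \<in> S"
  using S_I[OF homogeneous_C3[of c] homogeneous_C3[of 1]]
  by (simp add: ev3_C3 rhom_gconst rhom_1)

lemma add_S: assumes "a \<in> S" "b \<in> S" shows "a + b \<in> S"
proof -
  obtain G H n where a: "a = E G / E H" "homogeneous n G" "homogeneous n H" "E H \<noteq> 0" using assms(1) by (rule S_E)
  obtain G' H' m where b: "b = E G' / E H'" "homogeneous m G'" "homogeneous m H'" "E H' \<noteq> 0" using assms(2) by (rule S_E)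
  have "a + b = E (G * H' + G' * H) / E (H * H')"
    unfolding a(1) b(1) rhom_add[OF rhom_E] rhom_mult[OF rhom_E] using a(4) b(4) by (simp add: add_frac_eq)
  moreover have "homogeneous (n + m) (G * H' + G' * H)"
    using homogeneous_mult[OF a(2) b(3)] homogeneous_mult[OF b(2) a(3)] by (intro homogeneous_add) (simp_all add: add.commute)
  moreover have "homogeneous (n + m) (H * H')" by (rule homogeneous_mult[OF a(3) b(3)])
  ultimately show ?thesis using S_I[of "n + m" "G * H' + G' * H" "H * H'"] a(4) b(4) by (simp add: rhom_mult[OF rhom_E])
qed

lemma mult_S: assumes "a \<in> S" "b \<in> S" shows "a * b \<in> S"
proof -
  obtain G H n where a: "a = E G / E H" "homogeneous n G" "homogeneous n H" "E H \<noteq> 0" using assms(1) by (rule S_E)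
  obtain G' H' m where b: "b = E G' / E H'" "homogeneous m G'" "homogeneous m H'" "E H' \<noteq> 0" using assms(2) by (rule S_E)
  have "a * b = E (G * G') / E (H * H')" using a b by (simp add: rhom_mult[OF rhom_E])
  then show ?thesis using S_I[OF homogeneous_mult[OF a(2) b(2)] homogeneous_mult[OF a(3) b(3)]] a(4) b(4)
    by (simp add: rhom_mult[OF rhom_E])
qed

lemma inverse_S: assumes "a \<in> S" shows "inverse a \<in> S"
proof -
  obtain G H n where a: "a = E G / E H" "homogeneous n G" "homogeneous n H" "E H \<noteq> 0" using assms(1) by (rule S_E)
  show ?thesis
  proof (cases "E G = 0")
    case True
    then show ?thesis using a const_S[of 0] by (simp add: rhom_0[OF rhom_gconst])
  next
    case False
    then show ?thesis using S_I[OF a(3,2) False] a(1) by simp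
  qed
qed

definition vx :: "'a generic_field" where "vx = v$1 / v$3"
definition vy :: "'a generic_field" where "vy = v$2 / v$3"
definition ee :: "'a poly poly \<Rightarrow> 'a generic_field" where "ee = evp (evp gconst vy) vx"

abbreviation ey :: "'a poly \<Rightarrow> 'a generic_field" where "ey \<equiv> evp gconst vy"

lemma rhom_ey: "rhom ey" by (rule rhom_evp[OF rhom_gconst])
lemma rhom_ee: "rhom ee" unfolding ee_def by (rule rhom_evp[OF rhom_ey])

lemma ee_const: "ee [:p:] = ey p" by (simp add: ee_def evp_const rhom_ey)

lemma ee_smult: "ee (smult p q) = ey p * ee q"
  using rhom_mult[OF rhom_ee, of "[:p:]" q] by (simp add: ee_const)

lemma v_nonzero: "v $ i \<noteq> 0"
proof -
  have "lin (axis i 1) = v $ i"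
    by (simp add: lin_sum axis_def if_distrib rhom_0[OF rhom_gconst] rhom_1[OF rhom_gconst] if_distribR cong: if_cong)
  then show ?thesis using lin_nonzero[of "axis i 1"] by (simp add: axis_eq_0_iff)
qed

lemma E_dehom: "homogeneous n G \<Longrightarrow> E G = v $ 3 ^ n * ee (dehom G)"
  using ev3_homogeneous_dehom[OF rhom_gconst _ v_nonzero] by (simp add: ee_def vx_def vy_def)

lemma degree_F: "degree F \<noteq> 0"
  using homogeneous_irreducible_degree[OF irr hom] d3 by simp

text \<open>The homogenization of q vanishes at the generic point, hence is divisible by F, but its
  degree in X is too small. So the powers of x below \<open>degree F\<close> are independent over
  k[y].\<close>

lemma ee_zero_degree:
  assumes "ee q = 0" "degree q < degree F" shows "q = 0"
proof -
  have "E (homogenization q) = 0"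
    using E_dehom[OF homogeneous_homogenization] assms(1) by (simp add: dehom_homogenization)
  then have "F dvd homogenization q" using gen by simp
  then have "homogenization q = 0"
    using dvd_imp_degree_le[of F "homogenization q"] degree_homogenization[of q] assms(2) by fastforce
  then show ?thesis using dehom_homogenization[of q] by (simp add: dehom_def)
qed

lemma ey_zero: "ey p = 0 \<Longrightarrow> p = 0"
  using ee_zero_degree[of "[:p:]"] degree_F by (simp add: ee_const)

text \<open>In a form the exponent of Z is determined by the other two, so setting Z = 1 cancels
  nothing.\<close>

lemma degree_dehom_F: "degree (dehom F) = degree F"
proof (rule antisym)
  show "degree (dehom F) \<le> degree F" unfolding dehom_def by (rule map_poly_degree_leq)
  obtain j l where "coeff (coeff (lead_coeff F) j) l \<noteq> 0"
    using degree_F leading_coeff_neq_0 by (metis degree_0 poly_eqI coeff_0)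
  then have "coeff (coeff (dehom F) (degree F)) j \<noteq> 0"
    using hom unfolding coeff_dehom[OF hom] homogeneous_def by (metis add.commute add_diff_cancel_left' diff_diff_left le_add1)
  then show "degree F \<le> degree (dehom F)" by (intro le_degree) auto
qed

lemma ee_dehom_F: "ee (dehom F) = 0"
  using E_dehom[OF hom] v_nonzero[of 3] gen[of F] by simp

text \<open>Pseudo-division by the equation in x, whose leading coefficient is a polynomial in y; D
  is the power of it that has to be multiplied in.\<close>

lemma ee_reduce:
  obtains D a' where "D \<noteq> 0" "ey D * ee a = ee a'" "degree a' < degree F"
proof -
  have nz: "dehom F \<noteq> 0" using degree_dehom_F degree_F by auto
  obtain D q where D: "D \<noteq> 0" "smult D a = dehom F * q + pseudo_mod a (dehom F)"
    using pseudo_mod(1)[OF nz] by blast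
  have "ey D * ee a = ee (pseudo_mod a (dehom F))"
    unfolding ee_smult[symmetric] D(2) by (simp add: rhom_add[OF rhom_ee] rhom_mult[OF rhom_ee] ee_dehom_F)
  moreover have "degree (pseudo_mod a (dehom F)) < degree F"
    using pseudo_mod(2)[OF nz, of a] degree_dehom_F degree_F by auto
  ultimately show ?thesis using that D(1) by blast
qed

lemma ee_dep:
  "\<exists>c. (\<exists>i\<le>degree F. c i \<noteq> 0) \<and> (\<Sum>i\<le>degree F. ey (c i) * ee (e i)) = 0"
proof -
  let ?n = "degree F"
  have "\<forall>i. \<exists>D a'. D \<noteq> 0 \<and> ey D * ee (e i) = ee a' \<and> degree a' < ?n"
    using ee_reduce by metis
  then obtain D a where Da: "\<And>i. D i \<noteq> 0" "\<And>i. ey (D i) * ee (e i) = ee (a i)" "\<And>i. degree (a i) < ?n"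
    by metis
  obtain c where c: "\<exists>i\<le>?n. c i \<noteq> 0" "\<And>j. j < ?n \<Longrightarrow> (\<Sum>i\<le>?n. c i * coeff (a i) j) = 0"
    using idom_kernel[where A = "\<lambda>i j. coeff (a i) j" and n = ?n] by blast
  have "(\<Sum>i\<le>?n. smult (c i) (a i)) = 0"
  proof (rule poly_eqI)
    fix j
    show "coeff (\<Sum>i\<le>?n. smult (c i) (a i)) j = coeff 0 j"
    proof (cases "j < ?n")
      case True
      then show ?thesis using c(2) by (simp add: coeff_sum)
    next
      case False
      then have "coeff (a i) j = 0" for i using Da(3)[of i] by (intro coeff_eq_0) simp
      then show ?thesis by (simp add: coeff_sum)
    qed
  qed
  then have "ee (\<Sum>i\<le>?n. smult (c i) (a i)) = 0" by (simp add: rhom_0[OF rhom_ee])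
  then have "(\<Sum>i\<le>?n. ey (c i * D i) * ee (e i)) = 0"
    by (simp add: rhom_sum[OF rhom_ee] ee_smult Da(2)[symmetric] rhom_mult[OF rhom_ey] mult.assoc)
  moreover have "\<exists>i\<le>?n. c i * D i \<noteq> 0" using c(1) Da(1) by auto
  ultimately show ?thesis by (intro exI[of _ "\<lambda>i. c i * D i"] conjI)
qed

text \<open>The lowest nonzero coefficient in a relation between the powers of b is a multiple of b;
  this supplies denominators in k[y].\<close>

lemma ee_inverse:
  assumes b: "ee b \<noteq> 0" obtains D b' where "D \<noteq> 0" "ey D = ee b * ee b'"
proof -
  let ?n = "degree F"
  obtain c where c: "\<exists>i\<le>?n. c i \<noteq> 0" "(\<Sum>i\<le>?n. ey (c i) * ee (b ^ i)) = 0" using ee_dep[of "\<lambda>i. b ^ i"] by blast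
  define j where "j = (LEAST i. i \<le> ?n \<and> c i \<noteq> 0)"
  have j: "j \<le> ?n \<and> c j \<noteq> 0" unfolding j_def by (rule LeastI_ex) (use c(1) in blast)
  have low: "c i = 0" if "i < j" for i
    using not_less_Least[of i "\<lambda>i. i \<le> ?n \<and> c i \<noteq> 0"] that j unfolding j_def by auto
  have "(\<Sum>i\<le>?n. ey (c i) * ee (b ^ i)) = (\<Sum>i\<in>{j..?n}. ey (c i) * ee (b ^ i))"
    by (rule sum.mono_neutral_right) (auto simp: low evp_0)
  also have "\<dots> = (\<Sum>i\<in>{j..?n}. ee b ^ j * (ey (c i) * ee b ^ (i - j)))"
    by (rule sum.cong) (auto simp: rhom_power[OF rhom_ee] mult.left_commute simp flip: power_add)
  finally have "(\<Sum>i\<in>{j..?n}. ey (c i) * ee b ^ (i - j)) = 0" using c(2) b by (simp flip: sum_distrib_left)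
  then have e: "ey (c j) = - (\<Sum>i\<in>{Suc j..?n}. ey (c i) * ee b ^ (i - j))"
    using j by (simp add: sum.atLeast_Suc_atMost[of j ?n] eq_neg_iff_add_eq_0)
  also have "\<dots> = - (\<Sum>i\<in>{Suc j..?n}. ee b * (ey (c i) * ee b ^ (i - Suc j)))"
  proof (rule arg_cong[where f = uminus], rule sum.cong)
    fix i assume "i \<in> {Suc j..?n}"
    then have "i - j = Suc (i - Suc j)" by auto
    then show "ey (c i) * ee b ^ (i - j) = ee b * (ey (c i) * ee b ^ (i - Suc j))" by simp
  qed simp
  also have "\<dots> = ee b * ee (- (\<Sum>i\<in>{Suc j..?n}. smult (c i) (b ^ (i - Suc j))))"
    by (simp add: rhom_minus[OF rhom_ee] rhom_sum[OF rhom_ee] ee_smult rhom_power[OF rhom_ee] sum_distrib_left)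
  finally show ?thesis using that j by blast
qed

lemma S_reduced:
  assumes "z \<in> S"
  obtains D a where "D \<noteq> 0" "z * ey D = ee a" "degree a < degree F"
proof -
  obtain G H n where z: "z = E G / E H" "homogeneous n G" "homogeneous n H" "E H \<noteq> 0" using assms by (rule S_E)
  have h: "ee (dehom H) \<noteq> 0" using z(4) E_dehom[OF z(3)] by auto
  have z': "z = ee (dehom G) / ee (dehom H)" using z(1,4) E_dehom[OF z(2)] E_dehom[OF z(3)] v_nonzero[of 3] by simp
  obtain D b' where b: "D \<noteq> 0" "ey D = ee (dehom H) * ee b'" using ee_inverse[OF h] by metis
  obtain D' a where a: "D' \<noteq> 0" "ey D' * ee (dehom G * b') = ee a" "degree a < degree F"
    using ee_reduce by metis
  have "z * ey (D * D') = ee a"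
    using h by (simp add: z' rhom_mult[OF rhom_ey] b(2) a(2)[symmetric] rhom_mult[OF rhom_ee])
  then show ?thesis using that[of "D * D'" a] a(1,3) b(1) by simp
qed

lemma vx_S: "vx \<in> S" and vy_S: "vy \<in> S"
proof -
  have ax: "lin (axis i 1) = v $ i" for i
    by (simp add: lin_sum axis_def if_distrib rhom_0[OF rhom_gconst] rhom_1[OF rhom_gconst] if_distribR cong: if_cong)
  have "lin (axis i 1) / lin (axis 3 1) \<in> S" for i by (rule lin_S) (simp add: axis_eq_0_iff)
  then show "vx \<in> S" "vy \<in> S" unfolding vx_def vy_def by (simp_all only: ax)
qed

sublocale ff: func_field gconst S vy
proof
  show "rhom (gconst :: 'a \<Rightarrow> _)" by (rule rhom_gconst)
  show "\<exists>n::nat. \<forall>e. (\<forall>i\<le>n. e i \<in> S) \<longrightarrow> (\<exists>c. (\<exists>i\<le>n. c i \<noteq> 0) \<and> (\<Sum>i\<le>n. ey (c i) * e i) = 0)"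
  proof (intro exI[of _ "degree F"] allI impI)
    let ?n = "degree F"
    fix e assume e: "\<forall>i\<le>?n. e i \<in> S"
    have "\<forall>i. \<exists>D a. i \<le> ?n \<longrightarrow> D \<noteq> 0 \<and> e i * ey D = ee a" using S_reduced e by metis
    then obtain D a where Da: "\<And>i. i \<le> ?n \<Longrightarrow> D i \<noteq> 0 \<and> e i * ey (D i) = ee (a i)" by metis
    obtain c where c: "\<exists>i\<le>?n. c i \<noteq> 0" "(\<Sum>i\<le>?n. ey (c i) * ee (a i)) = 0" using ee_dep by blast
    have "(\<Sum>i\<le>?n. ey (c i * D i) * e i) = (\<Sum>i\<le>?n. ey (c i) * ee (a i))"
    proof (rule sum.cong)
      fix i assume "i \<in> {..?n}"
      then have "e i * ey (D i) = ee (a i)" using Da by simp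
      then show "ey (c i * D i) * e i = ey (c i) * ee (a i)" by (simp add: rhom_mult[OF rhom_ey] mult_ac)
    qed simp
    moreover have "\<exists>i\<le>?n. c i * D i \<noteq> 0" using c(1) Da by auto
    ultimately show "\<exists>c. (\<exists>i\<le>?n. c i \<noteq> 0) \<and> (\<Sum>i\<le>?n. ey (c i) * e i) = 0"
      using c(2) by (intro exI[of _ "\<lambda>i. c i * D i"] conjI) simp_all
  qed
qed (fact const_S add_S mult_S inverse_S vy_S ey_zero)+

text \<open>The pulled-back form at the inversely moved point takes the same values, so S is
  literally the same set. Adapted coordinates can thus be used without transporting automorphisms or
  places.\<close>

lemma gcurve_change:
  assumes B: "invertible B"
  shows "gcurve (subst3 B F) d (mv gconst (matrix_inv B) v)"
    and "gcurve.S (subst3 B F) (mv gconst (matrix_inv B) v) = S"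
proof -
  let ?v = "mv gconst (matrix_inv B) v"
  let ?F = "subst3 B F"
  have b: "bij (subst3 B)"
    by (rule o_bij[of "subst3 (matrix_inv B)"]) (auto simp: fun_eq_iff subst3_inverse[OF B])
  have ev: "ev3 gconst ?v (subst3 B G) = E G" for G
    by (simp add: ev3_subst3 rhom_gconst mv_inverse[OF rhom_gconst B])
  have dv: "?F dvd subst3 B G \<longleftrightarrow> F dvd G" for G by (rule bij_rhom_dvd_iff[OF rhom_subst3 b])
  have gen': "ev3 gconst ?v G = 0 \<longleftrightarrow> ?F dvd G" for G
    using ev[of "subst3 (matrix_inv B) G"] gen dv[of "subst3 (matrix_inv B) G"] by (simp add: subst3_inverse[OF B])
  show g: "gcurve ?F d ?v"
    using bij_rhom_irreducible[OF rhom_subst3 b irr] homogeneous_subst3[OF hom] d3 gen' by unfold_locales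
  have h: "homogeneous n (subst3 B G) \<longleftrightarrow> homogeneous n G" for n G
    using homogeneous_subst3[of n G B] homogeneous_subst3[of n "subst3 B G" "matrix_inv B"] by (auto simp: subst3_inverse[OF B])
  show "gcurve.S ?F ?v = S"
    unfolding gcurve.S_def[OF g] S_def
  proof (intro Set.set_eqI iffI)
    fix z assume "z \<in> {ev3 gconst ?v G / ev3 gconst ?v H | G H n. homogeneous n G \<and> homogeneous n H \<and> \<not> ?F dvd H}"
    then obtain G H n where z: "z = ev3 gconst ?v G / ev3 gconst ?v H" "homogeneous n G" "homogeneous n H" "\<not> ?F dvd H" by blast
    let ?G = "subst3 (matrix_inv B) G" and ?H = "subst3 (matrix_inv B) H"
    have "z = E ?G / E ?H" "homogeneous n ?G" "homogeneous n ?H" "\<not> F dvd ?H"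
      using z ev[of ?G] ev[of ?H] dv[of ?H] homogeneous_subst3 by (auto simp: subst3_inverse[OF B])
    then show "z \<in> {E G / E H | G H n. homogeneous n G \<and> homogeneous n H \<and> \<not> F dvd H}" by blast
  next
    fix z assume "z \<in> {E G / E H | G H n. homogeneous n G \<and> homogeneous n H \<and> \<not> F dvd H}"
    then obtain G H n where z: "z = E G / E H" "homogeneous n G" "homogeneous n H" "\<not> F dvd H" by blast
    then show "z \<in> {ev3 gconst ?v G / ev3 gconst ?v H | G H n. homogeneous n G \<and> homogeneous n H \<and> \<not> ?F dvd H}"
      by (intro CollectI exI[of _ "subst3 B G"] exI[of _ "subst3 B H"] exI[of _ n])
        (simp add: ev dv homogeneous_subst3)
  qed
qed

end

section \<open>The function field as a record and its normalization\<close>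

text \<open>Makes a record out of a subring of a type, so that quotients and isomorphisms of records
  apply to it.\<close>

definition set_ring :: "'c::comm_ring_1 set \<Rightarrow> 'c ring" where
  "set_ring T = \<lparr>carrier = T, mult = (*), one = 1, zero = 0, add = (+)\<rparr>"

lemma cring_set_ring:
  assumes "0 \<in> T" "1 \<in> T" "\<And>a b. a \<in> T \<Longrightarrow> b \<in> T \<Longrightarrow> a + b \<in> T" "\<And>a b. a \<in> T \<Longrightarrow> b \<in> T \<Longrightarrow> a * b \<in> T"
    "\<And>a. a \<in> T \<Longrightarrow> - a \<in> T"
  shows "cring (set_ring T)"
proof (rule cringI)
  show "abelian_group (set_ring T)"
    by (rule abelian_groupI) (use assms in \<open>auto simp: set_ring_def add.assoc add.commute intro: bexI[of _ "- _"]\<close>)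
  show "Group.comm_monoid (set_ring T)"
    by (rule Group.comm_monoidI) (use assms in \<open>auto simp: set_ring_def mult.assoc mult.commute\<close>)
qed (auto simp: set_ring_def distrib_right)

lemma field_set_ring:
  fixes T :: "'c::field set"
  assumes "0 \<in> T" "1 \<in> T" "\<And>a b. a \<in> T \<Longrightarrow> b \<in> T \<Longrightarrow> a + b \<in> T" "\<And>a b. a \<in> T \<Longrightarrow> b \<in> T \<Longrightarrow> a * b \<in> T"
    "\<And>a. a \<in> T \<Longrightarrow> - a \<in> T" "\<And>a. a \<in> T \<Longrightarrow> inverse a \<in> T"
  shows "Ring.field (set_ring T)"
proof -
  interpret cring "set_ring T" by (rule cring_set_ring[OF assms(1-5)])
  show ?thesis
  proof (rule cring_fieldI)
    show "Units (set_ring T) = carrier (set_ring T) - {\<zero>\<^bsub>set_ring T\<^esub>}"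
    proof (intro Set.set_eqI iffI)
      fix a assume "a \<in> Units (set_ring T)"
      then show "a \<in> carrier (set_ring T) - {\<zero>\<^bsub>set_ring T\<^esub>}" by (auto simp: Units_def set_ring_def)
    next
      fix a assume "a \<in> carrier (set_ring T) - {\<zero>\<^bsub>set_ring T\<^esub>}"
      then have a: "a \<in> T" "a \<noteq> 0" by (auto simp: set_ring_def)
      then show "a \<in> Units (set_ring T)"
        unfolding Units_def set_ring_def using assms(6)[OF a(1)] by (auto intro!: bexI[of _ "inverse a"])
    qed
  qed
qed

section \<open>The isomorphism from the function field k(C) to S, and the places on both
  sides\<close>

context gcurve
begin

text \<open>A fraction has many representations; cross-multiplication shows that all those with
  nonvanishing denominator give the same value (\<open>gv_Fract\<close>).\<close>

definition gv :: "'a poly3 fract \<Rightarrow> 'a generic_field" where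
  "gv q = (THE z. \<exists>G H. q = Fract G H \<and> E H \<noteq> 0 \<and> z = E G / E H)"

lemma gv_Fract:
  assumes H: "E H \<noteq> 0" shows "gv (Fract G H) = E G / E H"
  unfolding gv_def
proof (rule the_equality)
  show "\<exists>G' H'. Fract G H = Fract G' H' \<and> E H' \<noteq> 0 \<and> E G / E H = E G' / E H'" using H by blast
  fix z assume "\<exists>G' H'. Fract G H = Fract G' H' \<and> E H' \<noteq> 0 \<and> z = E G' / E H'"
  then obtain G' H' where z: "Fract G H = Fract G' H'" "E H' \<noteq> 0" "z = E G' / E H'" by blast
  have "H \<noteq> 0" "H' \<noteq> 0" using H z(2) rhom_0[OF rhom_E] by auto
  then have "G * H' = G' * H" using z(1) by (simp add: eq_fract)
  then have "E G * E H' = E G' * E H" by (simp flip: rhom_mult[OF rhom_E])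
  then have "E G' / E H' = E G / E H" using z(2) H by (simp add: frac_eq_eq)
  then show "z = E G / E H" using z(3) by simp
qed

abbreviation R where "R \<equiv> generic_local_ring F"
abbreviation K where "K \<equiv> function_field F"

definition RC :: "'a poly3 fract set" where
  "RC = {Fract G H | G H n. homogeneous n G \<and> homogeneous n H \<and> \<not> F dvd H}"

lemma R_eq: "R = set_ring RC" by (simp add: generic_local_ring_def set_ring_def RC_def)

lemma RC_I: "homogeneous n G \<Longrightarrow> homogeneous n H \<Longrightarrow> E H \<noteq> 0 \<Longrightarrow> Fract G H \<in> RC"
  using gen unfolding RC_def by blast

lemma RC_E:
  assumes "q \<in> RC" obtains G H n where "q = Fract G H" "homogeneous n G" "homogeneous n H" "E H \<noteq> 0" "H \<noteq> 0"
  using assms gen rhom_0[OF rhom_E] unfolding RC_def by blast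

lemma RC_add: assumes "a \<in> RC" "b \<in> RC" shows "a + b \<in> RC" "gv (a + b) = gv a + gv b"
proof -
  obtain G H n where a: "a = Fract G H" "homogeneous n G" "homogeneous n H" "E H \<noteq> 0" "H \<noteq> 0" using assms(1) by (rule RC_E)
  obtain G' H' m where b: "b = Fract G' H'" "homogeneous m G'" "homogeneous m H'" "E H' \<noteq> 0" "H' \<noteq> 0" using assms(2) by (rule RC_E)
  have ab: "a + b = Fract (G * H' + G' * H) (H * H')" using a b by simp
  have "homogeneous (n + m) (G * H' + G' * H)"
    using homogeneous_mult[OF a(2) b(3)] homogeneous_mult[OF b(2) a(3)] by (intro homogeneous_add) (simp_all add: add.commute)
  moreover have "homogeneous (n + m) (H * H')" by (rule homogeneous_mult[OF a(3) b(3)])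
  moreover have h: "E (H * H') \<noteq> 0" using a(4) b(4) by (simp add: rhom_mult[OF rhom_E])
  ultimately show "a + b \<in> RC" unfolding ab by (rule RC_I)
  show "gv (a + b) = gv a + gv b" unfolding ab gv_Fract[OF h] unfolding a(1) b(1) gv_Fract[OF a(4)] gv_Fract[OF b(4)]
    rhom_add[OF rhom_E] rhom_mult[OF rhom_E] using a(4) b(4) by (simp add: add_frac_eq)
qed

lemma RC_mult: assumes "a \<in> RC" "b \<in> RC" shows "a * b \<in> RC" "gv (a * b) = gv a * gv b"
proof -
  obtain G H n where a: "a = Fract G H" "homogeneous n G" "homogeneous n H" "E H \<noteq> 0" "H \<noteq> 0" using assms(1) by (rule RC_E)
  obtain G' H' m where b: "b = Fract G' H'" "homogeneous m G'" "homogeneous m H'" "E H' \<noteq> 0" "H' \<noteq> 0" using assms(2) by (rule RC_E)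
  have ab: "a * b = Fract (G * G') (H * H')" using a b by simp
  have h: "E (H * H') \<noteq> 0" using a(4) b(4) by (simp add: rhom_mult[OF rhom_E])
  show "a * b \<in> RC" unfolding ab by (rule RC_I[OF homogeneous_mult[OF a(2) b(2)] homogeneous_mult[OF a(3) b(3)] h])
  show "gv (a * b) = gv a * gv b" unfolding ab gv_Fract[OF h] unfolding a(1) b(1) gv_Fract[OF a(4)] gv_Fract[OF b(4)]
    rhom_mult[OF rhom_E] by simp
qed

lemma hom_one: "homogeneous 0 (1 :: 'a poly3)"
  using homogeneous_C3[of 1] by (simp add: rhom_1[OF rhom_C3])

lemma RC_01: "0 \<in> RC" "1 \<in> RC" "gv 0 = 0" "gv 1 = 1"
proof -
  have e: "E 1 \<noteq> 0" by (simp add: rhom_1[OF rhom_E])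
  show "0 \<in> RC" using RC_I[OF homogeneous_zero hom_one e] by (simp add: Zero_fract_def)
  show "1 \<in> RC" using RC_I[OF hom_one hom_one e] by (simp add: One_fract_def)
  show "gv 0 = 0" using gv_Fract[OF e, of 0] by (simp add: Zero_fract_def rhom_0[OF rhom_E])
  show "gv 1 = 1" using gv_Fract[OF e, of 1] e by (simp add: One_fract_def)
qed

lemma RC_minus: "a \<in> RC \<Longrightarrow> - a \<in> RC"
  by (erule RC_E) (use RC_I homogeneous_minus in fastforce)

lemma cring_R: "cring R" unfolding R_eq
  by (rule cring_set_ring) (use RC_01 RC_add RC_mult RC_minus in auto)

abbreviation SR where "SR \<equiv> set_ring S"

lemma field_SR: "Ring.field SR"
  by (rule field_set_ring) (use ff.S_add ff.S_mult ff.S_inverse ff.S_minus in auto)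

lemma gv_image: "gv ` RC = S"
proof
  show "gv ` RC \<subseteq> S" using S_I gv_Fract by (auto elim!: RC_E)
  show "S \<subseteq> gv ` RC"
  proof
    fix z assume "z \<in> S"
    then obtain G H n where z: "z = E G / E H" "homogeneous n G" "homogeneous n H" "E H \<noteq> 0" by (rule S_E)
    then show "z \<in> gv ` RC" using RC_I[OF z(2-4)] gv_Fract[OF z(4), of G] by (metis imageI)
  qed
qed

lemma ring_hom_gv: "ring_hom_ring R SR gv"
proof (rule ring_hom_ringI2)
  show "ring R" using cring_R by (rule cring.axioms(1))
  show "ring SR" using field_SR by (intro cring.axioms(1) domain.axioms(1) field.axioms(1))
  show "gv \<in> ring_hom R SR"
  proof (rule ring_hom_memI)
    fix a b assume "a \<in> carrier R" "b \<in> carrier R"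
    then have ab: "a \<in> RC" "b \<in> RC" by (simp_all add: R_eq set_ring_def)
    show "gv (a \<otimes>\<^bsub>R\<^esub> b) = gv a \<otimes>\<^bsub>SR\<^esub> gv b" "gv (a \<oplus>\<^bsub>R\<^esub> b) = gv a \<oplus>\<^bsub>SR\<^esub> gv b"
      using RC_add[OF ab] RC_mult[OF ab] by (simp_all add: R_eq set_ring_def)
  next
    fix a assume "a \<in> carrier R"
    then show "gv a \<in> carrier SR" using gv_image by (auto simp: R_eq set_ring_def)
  qed (simp_all add: R_eq set_ring_def RC_01)
qed

lemma kernel_gv: "a_kernel R SR gv = vanishing_ideal F"
proof -
  have "a_kernel R SR gv = {q \<in> RC. gv q = 0}" by (simp add: a_kernel_def' R_eq set_ring_def)
  also have "\<dots> = vanishing_ideal F"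
  proof (intro Set.set_eqI iffI)
    fix q assume "q \<in> {q \<in> RC. gv q = 0}"
    then have q: "q \<in> RC" "gv q = 0" by auto
    then obtain G H n where a: "q = Fract G H" "homogeneous n G" "homogeneous n H" "E H \<noteq> 0" by (metis RC_E)
    then have "E G = 0" using q(2) gv_Fract[OF a(4), of G] by simp
    then show "q \<in> vanishing_ideal F" using a gen unfolding vanishing_ideal_def by blast
  next
    fix q assume "q \<in> vanishing_ideal F"
    then obtain G H n where a: "q = Fract G H" "homogeneous n G" "homogeneous n H" "\<not> F dvd H" "F dvd G"
      unfolding vanishing_ideal_def by blast
    have h: "E H \<noteq> 0" "E G = 0" using a(4,5) gen by auto
    then have "gv q = 0" using gv_Fract[OF h(1), of G] a(1) by simp
    then show "q \<in> {q \<in> RC. gv q = 0}" using RC_I[OF a(2,3) h(1)] a(1) by simp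
  qed
  finally show ?thesis .
qed

text \<open>\<open>gv\<close> is constant on a coset of the vanishing ideal, so the image of the
  coset is a singleton; this is the map of the first isomorphism theorem.\<close>

definition psi :: "'a poly3 fract set \<Rightarrow> 'a generic_field" where "psi f = the_elem (gv ` f)"

lemma psi_iso: "psi \<in> ring_iso K SR"
proof -
  interpret ring_hom_ring R SR gv by (rule ring_hom_gv)
  have "gv ` carrier R = carrier SR" using gv_image by (simp add: R_eq set_ring_def)
  then have "(\<lambda>f. the_elem (gv ` f)) \<in> ring_iso (R Quot a_kernel R SR gv) SR" by (rule FactRing_iso_set)
  then show ?thesis unfolding kernel_gv function_field_def psi_def[abs_def] .
qed

lemma psi_rational: "homogeneous n G \<Longrightarrow> homogeneous n H \<Longrightarrow> E H \<noteq> 0 \<Longrightarrow> psi (rational_function F G H) = E G / E H"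
  and rational_carrier: "homogeneous n G \<Longrightarrow> homogeneous n H \<Longrightarrow> E H \<noteq> 0 \<Longrightarrow> rational_function F G H \<in> carrier K"
proof -
  assume h: "homogeneous n G" "homogeneous n H" "E H \<noteq> 0"
  interpret ring_hom_ring R SR gv by (rule ring_hom_gv)
  have c: "Fract G H \<in> carrier R" using RC_I[OF h] by (simp add: R_eq set_ring_def)
  show "psi (rational_function F G H) = E G / E H"
    unfolding psi_def rational_function_def kernel_gv[symmetric] using the_elem_simp[OF c] gv_Fract[OF h(3)] by simp
  show "rational_function F G H \<in> carrier K"
    unfolding rational_function_def kernel_gv[symmetric] function_field_def
    using c unfolding FactRing_def A_RCOSETS_def' by auto
qed

lemma field_K: "Ring.field K"
proof -
  interpret ring_hom_ring R SR gv by (rule ring_hom_gv)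
  have rK: "ring K" unfolding function_field_def kernel_gv[symmetric]
    by (rule ideal.quotient_is_ring[OF kernel_is_ideal])
  have i: "inv_into (carrier K) psi \<in> ring_iso SR K" by (rule ring_iso_set_sym[OF rK psi_iso])
  have f: "Ring.field (K\<lparr>zero := inv_into (carrier K) psi \<zero>\<^bsub>SR\<^esub>\<rparr>)"
    by (rule field.ring_iso_imp_img_field[OF field_SR i])
  have "psi \<zero>\<^bsub>K\<^esub> = \<zero>\<^bsub>SR\<^esub>"
    using ring_hom_zero[OF _ rK S.ring_axioms, of psi] psi_iso unfolding ring_iso_def by blast
  then have "inv_into (carrier K) psi \<zero>\<^bsub>SR\<^esub> = \<zero>\<^bsub>K\<^esub>"
    using ring_iso_memE(5)[OF psi_iso] ring.ring_simprules(2)[OF rK] by (metis bij_betw_inv_into_left)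
  then show ?thesis using f by simp
qed

sublocale K: field K by (rule field_K)

lemma psi_bij: "bij_betw psi (carrier K) S"
  using ring_iso_memE(5)[OF psi_iso] by (simp add: set_ring_def)

definition phi :: "'a generic_field \<Rightarrow> 'a poly3 fract set" where "phi = inv_into (carrier K) psi"

lemma phi: "z \<in> S \<Longrightarrow> phi z \<in> carrier K" "z \<in> S \<Longrightarrow> psi (phi z) = z" "f \<in> carrier K \<Longrightarrow> phi (psi f) = f"
  "f \<in> carrier K \<Longrightarrow> psi f \<in> S"
  using psi_bij bij_betwE[OF psi_bij] bij_betwE[OF bij_betw_inv_into[OF psi_bij]] unfolding phi_def
  by (auto simp: bij_betw_inv_into_left bij_betw_inv_into_right)

lemma psi_inj: "f \<in> carrier K \<Longrightarrow> g \<in> carrier K \<Longrightarrow> psi f = psi g \<longleftrightarrow> f = g"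
  using phi(3) by metis

lemma psi_01: "psi \<zero>\<^bsub>K\<^esub> = 0" "psi \<one>\<^bsub>K\<^esub> = 1"
proof -
  have "psi \<zero>\<^bsub>K\<^esub> + psi \<zero>\<^bsub>K\<^esub> = psi \<zero>\<^bsub>K\<^esub>"
    using ring_iso_memE(3)[OF psi_iso K.zero_closed K.zero_closed] K.r_zero[OF K.zero_closed] by (simp add: set_ring_def)
  then show "psi \<zero>\<^bsub>K\<^esub> = 0" by (metis add_cancel_left_left)
  show "psi \<one>\<^bsub>K\<^esub> = 1" using ring_iso_memE(4)[OF psi_iso] by (simp add: set_ring_def)
qed

lemma psi_ops:
  assumes "f \<in> carrier K" "g \<in> carrier K"
  shows "psi (f \<otimes>\<^bsub>K\<^esub> g) = psi f * psi g" "psi (f \<oplus>\<^bsub>K\<^esub> g) = psi f + psi g"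
    "psi (\<ominus>\<^bsub>K\<^esub> f) = - psi f" "psi (f \<ominus>\<^bsub>K\<^esub> g) = psi f - psi g"
proof -
  show m: "psi (f \<otimes>\<^bsub>K\<^esub> g) = psi f * psi g" and a: "psi (f \<oplus>\<^bsub>K\<^esub> g) = psi f + psi g"
    using ring_iso_memE(2,3)[OF psi_iso assms] by (simp_all add: set_ring_def)
  have z: "psi \<zero>\<^bsub>K\<^esub> = 0" by (rule psi_01)
  have mi: "psi (\<ominus>\<^bsub>K\<^esub> h) = - psi h" if h: "h \<in> carrier K" for h
  proof -
    have "psi (\<ominus>\<^bsub>K\<^esub> h \<oplus>\<^bsub>K\<^esub> h) = psi (\<ominus>\<^bsub>K\<^esub> h) + psi h"
      using ring_iso_memE(3)[OF psi_iso K.a_inv_closed[OF h] h] by (simp add: set_ring_def)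
    then show ?thesis using z K.l_neg[OF h] by (simp add: eq_neg_iff_add_eq_0)
  qed
  show "psi (\<ominus>\<^bsub>K\<^esub> f) = - psi f" by (rule mi[OF assms(1)])
  show "psi (f \<ominus>\<^bsub>K\<^esub> g) = psi f - psi g"
    using ring_iso_memE(3)[OF psi_iso assms(1) K.a_inv_closed[OF assms(2)]] mi[OF assms(2)]
    by (simp add: set_ring_def a_minus_def)
qed

lemma psi_zero_iff: "f \<in> carrier K \<Longrightarrow> psi f = 0 \<longleftrightarrow> f = \<zero>\<^bsub>K\<^esub>"
  using psi_inj[OF _ K.zero_closed] psi_01 by simp

lemma psi_inv:
  assumes "f \<in> carrier K" "f \<noteq> \<zero>\<^bsub>K\<^esub>" shows "psi (inv\<^bsub>K\<^esub> f) = inverse (psi f)" "inv\<^bsub>K\<^esub> f \<in> carrier K"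
proof -
  have u: "f \<in> Units K" using assms K.field_Units by simp
  then show "inv\<^bsub>K\<^esub> f \<in> carrier K" by (rule K.Units_inv_closed)
  then have "psi f * psi (inv\<^bsub>K\<^esub> f) = 1" using psi_ops(1)[OF assms(1)] K.Units_r_inv[OF u] psi_01 by metis
  then show "psi (inv\<^bsub>K\<^esub> f) = inverse (psi f)" by (metis inverse_unique)
qed

lemma const_fun: "constant_fun F c \<in> carrier K" "psi (constant_fun F c) = gconst c"
proof -
  have c: "homogeneous 0 [:[:[:c:]:]:]" using homogeneous_C3[of c] by (simp add: C3_def)
  have e: "E 1 \<noteq> 0" by (simp add: rhom_1[OF rhom_E])
  show "constant_fun F c \<in> carrier K" unfolding constant_fun_def by (rule rational_carrier[OF c hom_one e])
  show "psi (constant_fun F c) = gconst c" unfolding constant_fun_def psi_rational[OF c hom_one e]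
    using ev3_C3[OF rhom_gconst, of v c] by (simp add: C3_def rhom_1[OF rhom_E])
qed

abbreviation N where "N \<equiv> normalization F"

lemma psi_image_mem: "V \<subseteq> carrier K \<Longrightarrow> f \<in> carrier K \<Longrightarrow> psi f \<in> psi ` V \<longleftrightarrow> f \<in> V"
proof
  assume V: "V \<subseteq> carrier K" and f: "f \<in> carrier K" and "psi f \<in> psi ` V"
  then obtain g where "g \<in> V" "psi f = psi g" by (elim imageE) simp
  then show "f \<in> V" using psi_inj[OF f subsetD[OF V]] by simp
qed (rule imageI)

lemma N_subset: assumes "V \<in> N" shows "V \<subseteq> carrier K"
proof -
  have "subring V K" using assms by (simp add: normalization_def Let_def)
  then show ?thesis by (rule subringE(1))
qed

lemma N_place:
  assumes V: "V \<in> N" shows "ff.place (psi ` V)"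
proof -
  have sub: "subring V K" and c: "range (constant_fun F) \<subseteq> V" and ne: "V \<noteq> carrier K"
    and val: "\<And>f. f \<in> carrier K - {\<zero>\<^bsub>K\<^esub>} \<Longrightarrow> f \<in> V \<or> inv\<^bsub>K\<^esub> f \<in> V"
    using V unfolding normalization_def Let_def by blast+
  have VK: "V \<subseteq> carrier K" by (rule N_subset[OF V])
  note mem = psi_image_mem[OF VK]
  show ?thesis
    unfolding ff.place_def
  proof (intro conjI ballI)
    show "psi ` V \<subseteq> S" using VK phi(4) by auto
    show "range gconst \<subseteq> psi ` V" using c const_fun(2) by (metis image_subset_iff imageI rangeI)
    obtain f where "f \<in> carrier K" "f \<notin> V" using ne VK by blast
    then show "psi ` V \<noteq> S" using mem phi(4) by metis
    fix a b assume "a \<in> psi ` V" "b \<in> psi ` V"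
    then obtain f g where fg: "a = psi f" "b = psi g" "f \<in> V" "g \<in> V" by blast
    have fgK: "f \<in> carrier K" "g \<in> carrier K" using fg VK by auto
    show "a + b \<in> psi ` V" "a * b \<in> psi ` V" "- a \<in> psi ` V"
      using psi_ops[OF fgK] subringE(5-7)[OF sub] fg by (metis imageI)+
  next
    fix z assume z: "z \<in> S - {0}"
    have p: "phi z \<in> carrier K" "psi (phi z) = z" using z phi by auto
    then have nz: "phi z \<noteq> \<zero>\<^bsub>K\<^esub>" using psi_01 z by auto
    then have "phi z \<in> V \<or> inv\<^bsub>K\<^esub> (phi z) \<in> V" using val p by blast
    then show "z \<in> psi ` V \<or> inverse z \<in> psi ` V" using psi_inv[OF p(1) nz] p by (metis imageI)
  qed
qed

lemma place_N:
  assumes W: "ff.place W" shows "phi ` W \<in> N" "psi ` phi ` W = W"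
proof -
  have WS: "W \<subseteq> S" by (rule ff.place_D(1)[OF W])
  have "psi ` phi ` W = (\<lambda>z. z) ` W"
    unfolding image_image by (rule image_cong) (use phi(2) subsetD[OF WS] in simp_all)
  then show im: "psi ` phi ` W = W" by simp
  have PK: "phi ` W \<subseteq> carrier K" using phi(1) WS by auto
  have mem: "f \<in> phi ` W \<longleftrightarrow> psi f \<in> W" if "f \<in> carrier K" for f
    using psi_image_mem[OF PK that] im by simp
  note WD = ff.place_D[OF W]
  have "subring (phi ` W) K"
  proof (rule K.subringI[OF PK])
    show "\<one>\<^bsub>K\<^esub> \<in> phi ` W" using mem[OF K.one_closed] psi_01 WD by simp
    fix f assume f: "f \<in> phi ` W"
    then have fK: "f \<in> carrier K" using PK by auto
    show "\<ominus>\<^bsub>K\<^esub> f \<in> phi ` W" using mem[OF K.a_inv_closed[OF fK]] psi_ops(3)[OF fK fK] WD(7) mem[OF fK] f by simp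
    fix g assume g: "g \<in> phi ` W"
    then have gK: "g \<in> carrier K" using PK by auto
    show "f \<otimes>\<^bsub>K\<^esub> g \<in> phi ` W" using mem[OF K.m_closed[OF fK gK]] psi_ops(1)[OF fK gK] WD(6) mem[OF fK] mem[OF gK] f g by simp
    show "f \<oplus>\<^bsub>K\<^esub> g \<in> phi ` W" using mem[OF K.a_closed[OF fK gK]] psi_ops(2)[OF fK gK] WD(5) mem[OF fK] mem[OF gK] f g by simp
  qed
  moreover have "range (constant_fun F) \<subseteq> phi ` W" using mem const_fun WD(2) by auto
  moreover have "phi ` W \<noteq> carrier K"
  proof
    assume "phi ` W = carrier K"
    then have "W = S" using im psi_bij by (simp add: bij_betw_def)
    then show False using W by (simp add: ff.place_def)
  qed
  moreover have "f \<in> phi ` W \<or> inv\<^bsub>K\<^esub> f \<in> phi ` W" if f: "f \<in> carrier K - {\<zero>\<^bsub>K\<^esub>}" for f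
    using mem[of f] mem[of "inv\<^bsub>K\<^esub> f"] psi_inv[of f] WD(9)[of "psi f"] phi(4)[of f] f by auto
  ultimately show "phi ` W \<in> N" unfolding normalization_def Let_def by blast
qed

lemma phi_psi_image: assumes "V \<in> N" shows "phi ` psi ` V = V"
proof -
  have "phi ` psi ` V = (\<lambda>f. f) ` V"
    unfolding image_image by (rule image_cong) (use phi(3) subsetD[OF N_subset[OF assms]] in simp_all)
  then show ?thesis by simp
qed

lemma place_ideal_iff:
  assumes V: "V \<in> N" and f: "f \<in> carrier K" shows "f \<in> place_ideal F V \<longleftrightarrow> psi f \<in> ff.mx (psi ` V)"
proof -
  have i: "inv\<^bsub>K\<^esub> f \<in> V \<longleftrightarrow> inverse (psi f) \<in> psi ` V" if "f \<noteq> \<zero>\<^bsub>K\<^esub>"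
    using psi_image_mem[OF N_subset[OF V] psi_inv(2)[OF f that]] psi_inv(1)[OF f that] by simp
  show ?thesis unfolding place_ideal_def Let_def ff.mx_def
    using psi_image_mem[OF N_subset[OF V] f] psi_zero_iff[OF f] i by auto
qed

lemma residue_at_eq:
  assumes V: "V \<in> N" and f: "f \<in> carrier K" shows "residue_at F f V = ff.res (psi f) (psi ` V)"
  unfolding residue_at_def ff.res_def
  using place_ideal_iff[OF V K.minus_closed[OF f const_fun(1)]] psi_ops(4)[OF f const_fun(1)] const_fun(2) by simp

lemma value_at_eq:
  assumes V: "V \<in> N" and f: "f \<in> carrier K" shows "value_at F f V = ff.pval (psi f) (psi ` V)"
  unfolding value_at_def ff.pval_def using residue_at_eq[OF assms] psi_image_mem[OF N_subset[OF V] f] by simp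

section \<open>Automorphisms of the normalization\<close>

text \<open>\<tau> moves the valuation ring V to \<tau> V. The restriction to N makes the map
  extensional, as members of \<open>Bij\<close> are.\<close>

definition act :: "('a generic_field \<Rightarrow> 'a generic_field) \<Rightarrow> 'a place \<Rightarrow> 'a place" where
  "act \<tau> = (\<lambda>V\<in>N. phi ` \<tau> ` psi ` V)"

lemma act_N: "ff.kaut \<tau> \<Longrightarrow> V \<in> N \<Longrightarrow> act \<tau> V \<in> N" "ff.kaut \<tau> \<Longrightarrow> V \<in> N \<Longrightarrow> psi ` act \<tau> V = \<tau> ` psi ` V"
  using place_N[OF ff.kaut_place(1)[OF _ N_place]] by (auto simp: act_def)

lemma N_eqI: "V \<in> N \<Longrightarrow> W \<in> N \<Longrightarrow> psi ` V = psi ` W \<Longrightarrow> V = W"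
  using phi_psi_image by metis

lemma act_comp:
  assumes "ff.kaut \<tau>" "ff.kaut \<rho>" "V \<in> N" shows "act \<tau> (act \<rho> V) = act (\<tau> \<circ> \<rho>) V"
  using assms by (intro N_eqI) (auto simp: act_N ff.kaut_comp image_comp)

lemma act_id: assumes "V \<in> N" "\<And>z. z \<in> S \<Longrightarrow> \<tau> z = z" shows "act \<tau> V = V"
proof -
  have "\<tau> ` psi ` V = (\<lambda>z. z) ` psi ` V"
    by (rule image_cong) (use assms(2) subsetD[OF N_subset[OF assms(1)]] phi(4) in auto)
  then have "\<tau> ` psi ` V = psi ` V" by simp
  then show ?thesis using assms(1) by (simp add: act_def phi_psi_image)
qed

lemma act_Bij:
  assumes k: "ff.kaut \<tau>" shows "act \<tau> \<in> Bij N" "V \<in> N \<Longrightarrow> inv_into N (act \<tau>) V = act (inv_into S \<tau>) V"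
proof -
  note k' = ff.kaut_inv(1)[OF k]
  have 1: "act (inv_into S \<tau>) (act \<tau> V) = V" "act \<tau> (act (inv_into S \<tau>) V) = V" if "V \<in> N" for V
    using that by (auto simp: act_comp k k' intro!: act_id ff.kaut_inv(2,3)[OF k])
  have b: "bij_betw (act \<tau>) N N"
    by (rule bij_betw_byWitness[where f' = "act (inv_into S \<tau>)"]) (use 1 act_N k k' in auto)
  then show "act \<tau> \<in> Bij N" by (simp add: Bij_def act_def)
  show "inv_into N (act \<tau>) V = act (inv_into S \<tau>) V" if "V \<in> N"
    using b 1(2)[OF that] act_N(1)[OF k' that] by (metis bij_betw_inv_into_left)
qed

lemma self_morphism_act:
  assumes k: "ff.kaut \<tau>" and \<sigma>: "\<And>V. V \<in> N \<Longrightarrow> \<sigma> V = act \<tau> V" shows "self_morphism F \<sigma>"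
  unfolding self_morphism_def
proof (intro conjI allI impI)
  note k' = ff.kaut_inv[OF k]
  show "\<sigma> \<in> N \<rightarrow> N" using \<sigma> act_N(1)[OF k] by auto
  have inj: "inj_on \<sigma> N"
    using act_Bij(1)[OF k] \<sigma> by (auto simp: Bij_def bij_betw_def inj_on_def)
  fix U assume U: "open_in_normalization F U"
  show "open_in_normalization F (\<sigma> -` U \<inter> N)"
    unfolding open_in_normalization_def
  proof (intro conjI)
    show "\<sigma> -` U \<inter> N = {} \<or> finite (N - (\<sigma> -` U \<inter> N))"
    proof (cases "U = {}")
      case False
      then have "finite (\<sigma> -` (N - U) \<inter> N)"
        using U inj by (intro finite_vimage_IntI) (auto simp: open_in_normalization_def)
      moreover have "N - (\<sigma> -` U \<inter> N) \<subseteq> \<sigma> -` (N - U) \<inter> N" using \<sigma> act_N(1)[OF k] by auto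
      ultimately show ?thesis using finite_subset by blast
    qed simp
  qed simp
  fix g assume "regular_function_on F U g"
  then obtain f where f: "f \<in> carrier K" "\<And>V. V \<in> U \<Longrightarrow> f \<in> V \<and> g V = residue_at F f V"
    unfolding regular_function_on_def by blast
  \<comment> \<open>A function f composed with V \<mapsto> \<tau> V is the inverse image of f under
    \<tau>.\<close>
  define z where "z = inv_into S \<tau> (psi f)"
  have z: "z \<in> S" "\<tau> z = psi f" using k'(3) phi(4)[OF f(1)] ff.kaut_D(1)[OF k'(1)] by (auto simp: z_def)
  show "regular_function_on F (\<sigma> -` U \<inter> N) (g \<circ> \<sigma>)"
    unfolding regular_function_on_def
  proof (intro bexI ballI)
    show fz: "phi z \<in> carrier K" using phi z by blast
    fix V assume "V \<in> \<sigma> -` U \<inter> N"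
    then have V: "V \<in> N" "\<sigma> V \<in> U" "\<sigma> V \<in> N" using \<sigma> act_N(1)[OF k] by auto
    have im: "psi ` \<sigma> V = \<tau> ` psi ` V" using \<sigma>[OF V(1)] act_N(2)[OF k V(1)] by simp
    have "psi f \<in> psi ` \<sigma> V" using f(2)[OF V(2)] by blast
    then have "\<tau> z \<in> \<tau> ` psi ` V" using im z(2) by simp
    then have zV: "z \<in> psi ` V" using ff.kaut_image_mem[OF k N_place[OF V(1)] z(1)] by simp
    have "g (\<sigma> V) = ff.res (psi f) (psi ` \<sigma> V)" using f(2)[OF V(2)] residue_at_eq[OF V(3) f(1)] by simp
    also have "\<dots> = ff.res z (psi ` V)" unfolding im z(2)[symmetric] by (rule ff.res_kaut[OF k N_place[OF V(1)] zV])
    also have "\<dots> = residue_at F (phi z) V" using residue_at_eq[OF V(1) fz] phi(2)[OF z(1)] by simp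
    finally show "phi z \<in> V \<and> (g \<circ> \<sigma>) V = residue_at F (phi z) V"
      using zV psi_image_mem[OF N_subset[OF V(1)] fz] phi(2)[OF z(1)] by simp
  qed
qed

lemma act_Aut: "ff.kaut \<tau> \<Longrightarrow> act \<tau> \<in> carrier (Aut_X F)"
  unfolding Aut_X_def using act_Bij[of \<tau>] self_morphism_act[of \<tau> "act \<tau>"]
    self_morphism_act[OF ff.kaut_inv(1), of \<tau> "inv_into N (act \<tau>)"] by simp

lemma finite_N_poles:
  assumes f: "f \<in> carrier K" shows "finite (N - {V \<in> N. f \<in> V})"
proof -
  have "N - {V \<in> N. f \<in> V} \<subseteq> (\<lambda>W. phi ` W) ` {W \<in> ff.Pl. psi f \<notin> W}"
  proof
    fix V assume "V \<in> N - {V \<in> N. f \<in> V}"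
    then have V: "V \<in> N" "f \<notin> V" by auto
    show "V \<in> (\<lambda>W. phi ` W) ` {W \<in> ff.Pl. psi f \<notin> W}"
      by (rule image_eqI[of _ _ "psi ` V"])
        (use V phi_psi_image psi_image_mem[OF N_subset f] N_place in \<open>auto simp: ff.Pl_def\<close>)
  qed
  then show ?thesis using ff.finite_poles[OF phi(4)[OF f]] finite_subset by blast
qed

text \<open>The definition of a morphism is applied to the open set of all places where f is
  regular, with f itself as the regular function on it; openness is the finiteness of the
  poles.\<close>

lemma self_morphism_pullback:
  assumes m: "self_morphism F \<sigma>" and \<sigma>': "\<And>W. ff.place W \<Longrightarrow> \<sigma>' W = psi ` \<sigma> (phi ` W)"
  shows "ff.has_pullback \<sigma>'"
  unfolding ff.has_pullback_def
proof
  fix z assume z: "z \<in> S"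
  let ?f = "phi z" and ?U = "{V \<in> N. phi z \<in> V}"
  have f: "?f \<in> carrier K" "psi ?f = z" using phi z by auto
  have "open_in_normalization F ?U"
    unfolding open_in_normalization_def using finite_N_poles[OF f(1)] by blast
  moreover have "regular_function_on F ?U (residue_at F ?f)"
    unfolding regular_function_on_def using f by blast
  ultimately have "regular_function_on F (\<sigma> -` ?U \<inter> N) (residue_at F ?f \<circ> \<sigma>)" and \<sigma>N: "\<sigma> \<in> N \<rightarrow> N"
    using m unfolding self_morphism_def by blast+
  then obtain g where g: "g \<in> carrier K" "\<And>V. V \<in> \<sigma> -` ?U \<inter> N \<Longrightarrow> g \<in> V \<and> residue_at F ?f (\<sigma> V) = residue_at F g V"
    unfolding regular_function_on_def by auto
  show "\<exists>g\<in>S. \<forall>W\<in>ff.Pl. z \<in> \<sigma>' W \<longrightarrow> g \<in> W \<and> ff.res g W = ff.res z (\<sigma>' W)"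
  proof (intro bexI ballI impI)
    show "psi g \<in> S" by (rule phi(4)[OF g(1)])
    fix W assume W: "W \<in> ff.Pl" "z \<in> \<sigma>' W"
    then have pl: "ff.place W" by (simp add: ff.Pl_def)
    have V: "phi ` W \<in> N" "psi ` phi ` W = W" using place_N[OF pl] by auto
    have sV: "\<sigma> (phi ` W) \<in> N" using \<sigma>N V(1) by auto
    have "?f \<in> \<sigma> (phi ` W)" using W(2) \<sigma>'[OF pl] psi_image_mem[OF N_subset[OF sV] f(1)] f(2) by simp
    then have "phi ` W \<in> \<sigma> -` ?U \<inter> N" using V sV by simp
    then have gg: "g \<in> phi ` W" "residue_at F ?f (\<sigma> (phi ` W)) = residue_at F g (phi ` W)" using g(2) by auto
    show "psi g \<in> W \<and> ff.res (psi g) W = ff.res z (\<sigma>' W)"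
      using gg residue_at_eq[OF sV f(1)] residue_at_eq[OF V(1) g(1)] f(2) \<sigma>'[OF pl] V(2)
        psi_image_mem[OF N_subset[OF V(1)] g(1)] by simp
  qed
qed

text \<open>\<sigma> and its inverse are carried over to the places of S, where both have pullbacks
  and \<open>kaut_of_pullback\<close> yields \<tau>.\<close>

lemma Aut_act:
  assumes "\<sigma> \<in> carrier (Aut_X F)" obtains \<tau> where "ff.kaut \<tau>" "\<sigma> = act \<tau>"
proof -
  have \<sigma>: "\<sigma> \<in> Bij N" "self_morphism F \<sigma>" "self_morphism F (inv_into N \<sigma>)"
    using assms by (auto simp: Aut_X_def)
  have b: "bij_betw \<sigma> N N" using \<sigma>(1) by (simp add: Bij_def)
  define \<sigma>' where "\<sigma>' W = psi ` \<sigma> (phi ` W)" for W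
  define \<rho>' where "\<rho>' W = psi ` inv_into N \<sigma> (phi ` W)" for W
  have Pl: "W \<in> ff.Pl \<longleftrightarrow> ff.place W" for W by (simp add: ff.Pl_def)
  have sN: "\<sigma> V \<in> N" "inv_into N \<sigma> V \<in> N" if "V \<in> N" for V
    using that b bij_betw_inv_into[OF b] by (auto dest: bij_betwE)
  have i1: "\<rho>' (\<sigma>' W) = W" "\<sigma>' (\<rho>' W) = W" "\<sigma>' W \<in> ff.Pl" "\<rho>' W \<in> ff.Pl" if "W \<in> ff.Pl" for W
    using that place_N[of W] sN[of "phi ` W"] b N_place
    by (auto simp: Pl \<sigma>'_def \<rho>'_def phi_psi_image bij_betw_inv_into_left bij_betw_inv_into_right)
  have b': "bij_betw \<sigma>' ff.Pl ff.Pl"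
    by (rule bij_betw_byWitness[where f' = \<rho>']) (use i1 in auto)
  have inv: "inv_into ff.Pl \<sigma>' W = \<rho>' W" if "W \<in> ff.Pl" for W
    using bij_betw_inv_into_left[OF b' i1(4)[OF that]] i1(2)[OF that] by simp
  have "ff.has_pullback \<sigma>'" by (rule self_morphism_pullback[OF \<sigma>(2)]) (simp add: \<sigma>'_def)
  moreover have "ff.has_pullback (inv_into ff.Pl \<sigma>')"
    by (rule self_morphism_pullback[OF \<sigma>(3)]) (simp add: inv[unfolded Pl] \<rho>'_def)
  ultimately obtain \<tau> where \<tau>: "ff.kaut \<tau>" "\<And>W. W \<in> ff.Pl \<Longrightarrow> \<sigma>' W = \<tau> ` W"
    using ff.kaut_of_pullback[OF b'] by metis
  have "\<sigma> = act \<tau>"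
  proof (rule extensionalityI[of _ N])
    show "\<sigma> \<in> extensional N" "act \<tau> \<in> extensional N" using \<sigma>(1) by (auto simp: Bij_def act_def)
    fix V assume V: "V \<in> N"
    have "psi ` \<sigma> V = \<sigma>' (psi ` V)" by (simp add: \<sigma>'_def phi_psi_image[OF V])
    also have "\<dots> = \<tau> ` psi ` V" using \<tau>(2) N_place[OF V] by (simp add: Pl)
    finally show "\<sigma> V = act \<tau> V" using act_N[OF \<tau>(1) V] sN(1)[OF V] by (intro N_eqI) auto
  qed
  then show ?thesis using \<tau>(1) that by blast
qed

lemma mult_act:
  assumes "ff.kaut \<tau>" "ff.kaut \<rho>" shows "act \<tau> \<otimes>\<^bsub>Aut_X F\<^esub> act \<rho> = act (\<tau> \<circ> \<rho>)"
proof -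
  have "act \<tau> \<otimes>\<^bsub>Aut_X F\<^esub> act \<rho> = compose N (act \<tau>) (act \<rho>)"
    using act_Bij(1)[OF assms(1)] act_Bij(1)[OF assms(2)] by (simp add: Aut_X_def BijGroup_def)
  also have "\<dots> = act (\<tau> \<circ> \<rho>)"
    by (rule extensionalityI[of _ N]) (auto simp: compose_def act_comp assms, auto simp: act_def)
  finally show ?thesis .
qed

lemma kaut_id: "ff.kaut id"
  by (simp add: ff.kaut_def bij_betw_def)

lemma one_act: "\<one>\<^bsub>Aut_X F\<^esub> = act id"
proof -
  have "\<one>\<^bsub>Aut_X F\<^esub> = (\<lambda>V\<in>N. V)" by (simp add: Aut_X_def BijGroup_def)
  also have "\<dots> = act id" by (rule extensionalityI[of _ N]) (auto simp: act_id, auto simp: act_def)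
  finally show ?thesis .
qed

lemma act_cong: "(\<And>z. z \<in> S \<Longrightarrow> \<tau> z = \<rho> z) \<Longrightarrow> act \<tau> = act \<rho>"
proof -
  assume e: "\<And>z. z \<in> S \<Longrightarrow> \<tau> z = \<rho> z"
  have "\<tau> ` psi ` V = \<rho> ` psi ` V" if "V \<in> N" for V
    using e N_subset[OF that] phi(4) by (intro image_cong) auto
  then show ?thesis by (auto simp: act_def restrict_def fun_eq_iff)
qed

lemma group_Aut: "group (Aut_X F)"
proof -
  interpret B: group "BijGroup N" by (rule group_BijGroup)
  have sub: "carrier (Aut_X F) \<subseteq> carrier (BijGroup N)" by (auto simp: Aut_X_def BijGroup_def)
  have m: "f \<otimes>\<^bsub>Aut_X F\<^esub> g = f \<otimes>\<^bsub>BijGroup N\<^esub> g" and o: "\<one>\<^bsub>Aut_X F\<^esub> = \<one>\<^bsub>BijGroup N\<^esub>" for f g by (simp_all add: Aut_X_def)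
  show ?thesis
  proof (rule groupI)
    fix f g assume "f \<in> carrier (Aut_X F)" "g \<in> carrier (Aut_X F)"
    then show "f \<otimes>\<^bsub>Aut_X F\<^esub> g \<in> carrier (Aut_X F)" by (auto elim!: Aut_act simp: mult_act act_Aut ff.kaut_comp)
  next
    show "\<one>\<^bsub>Aut_X F\<^esub> \<in> carrier (Aut_X F)" by (simp add: one_act act_Aut kaut_id)
  next
    fix f g h assume "f \<in> carrier (Aut_X F)" "g \<in> carrier (Aut_X F)" "h \<in> carrier (Aut_X F)"
    then show "f \<otimes>\<^bsub>Aut_X F\<^esub> g \<otimes>\<^bsub>Aut_X F\<^esub> h = f \<otimes>\<^bsub>Aut_X F\<^esub> (g \<otimes>\<^bsub>Aut_X F\<^esub> h)"
      using sub unfolding m by (intro B.m_assoc) auto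
  next
    fix f assume f: "f \<in> carrier (Aut_X F)"
    then show "\<one>\<^bsub>Aut_X F\<^esub> \<otimes>\<^bsub>Aut_X F\<^esub> f = f" using sub unfolding m o by auto
    obtain \<tau> where \<tau>: "ff.kaut \<tau>" "f = act \<tau>" using f by (rule Aut_act)
    have "act (inv_into S \<tau>) \<otimes>\<^bsub>Aut_X F\<^esub> f = act (inv_into S \<tau> \<circ> \<tau>)" using mult_act[OF ff.kaut_inv(1)[OF \<tau>(1)] \<tau>(1)] \<tau>(2) by simp
    also have "\<dots> = act id" by (rule act_cong) (simp add: ff.kaut_inv(2)[OF \<tau>(1)])
    finally show "\<exists>g\<in>carrier (Aut_X F). g \<otimes>\<^bsub>Aut_X F\<^esub> f = \<one>\<^bsub>Aut_X F\<^esub>"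
      using act_Aut[OF ff.kaut_inv(1)[OF \<tau>(1)]] one_act by metis
  qed
qed

end

section \<open>Galois points\<close>

lemma dot_matrix_inv:
  fixes B :: "'a::field^3^3"
  assumes "invertible B"
  shows "(\<Sum>l\<in>UNIV. matrix_inv B $ i $ l * B $ l $ j) = (if i = j then 1 else 0)"
    and "(\<Sum>l\<in>UNIV. B $ i $ l * matrix_inv B $ l $ j) = (if i = j then 1 else 0)"
proof -
  have "matrix_inv B ** B = mat 1" "B ** matrix_inv B = mat 1"
    using assms unfolding invertible_def matrix_inv_def by (metis (mono_tags, lifting) someI_ex)+
  then show "(\<Sum>l\<in>UNIV. matrix_inv B $ i $ l * B $ l $ j) = (if i = j then 1 else 0)"
    "(\<Sum>l\<in>UNIV. B $ i $ l * matrix_inv B $ l $ j) = (if i = j then 1 else 0)"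
    by (auto simp: matrix_matrix_mult_def mat_def vec_eq_iff)
qed

lemma span_pair: "w \<in> vec.span {a, b} \<longleftrightarrow> (\<exists>s t. w = s *s a + t *s b)"
  for a b w :: "'a::field^'n"
proof
  assume "w \<in> vec.span {a, b}"
  then obtain k where "w - k *s a \<in> vec.span {b}" using vec.span_insert[of a "{b}"] by blast
  then obtain l where "w - k *s a = l *s b" by (auto simp: vec.span_singleton)
  then show "\<exists>s t. w = s *s a + t *s b" by (metis add.commute diff_add_cancel)
next
  assume "\<exists>s t. w = s *s a + t *s b"
  then show "w \<in> vec.span {a, b}" by (auto intro: vec.span_add vec.span_scale vec.span_base)
qed

text \<open>The rows of the inverse of B are the dual basis of its columns, so the two rows other
  than the k-th span the linear forms that vanish on column k.\<close>

lemma projection_forms_basis: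
  fixes B :: "'a::field^3^3"
  assumes B: "invertible B" and ijk: "i \<noteq> j" "i \<noteq> k" "j \<noteq> k"
  shows "(matrix_inv B $ i, matrix_inv B $ j) \<in> projection_forms (vec.span {column k B})"
proof -
  let ?C = "matrix_inv B"
  note d = dot_matrix_inv[OF B]
  have U: "(UNIV :: 3 set) = {i, j, k}"
    by (rule card_subset_eq[symmetric]) (use ijk in auto)
  have s: "(\<Sum>l\<in>UNIV. f l) = f i + f j + f k" for f :: "3 \<Rightarrow> 'a" unfolding U using ijk by simp
  have nC: "?C $ i \<notin> vec.span {?C $ j}"
  proof
    assume "?C $ i \<in> vec.span {?C $ j}"
    then obtain c where c: "?C $ i = c *s ?C $ j" by (auto simp: vec.span_singleton)
    then have "(\<Sum>l\<in>UNIV. ?C $ i $ l * B $ l $ i) = c * (\<Sum>l\<in>UNIV. ?C $ j $ l * B $ l $ i)"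
      by (simp add: sum_distrib_left mult.assoc)
    then show False using d(1)[of i i] d(1)[of j i] ijk by simp
  qed
  have "?C $ j \<noteq> 0" using d(1)[of j j] by auto
  then have "vec.independent {?C $ i, ?C $ j}"
    using nC by (intro vec.independent_insertI) (auto intro!: vec.independent_insertI simp: vec.independent_empty)
  moreover have "?C $ i \<noteq> ?C $ j" using nC vec.span_base by blast
  moreover have "vec.span {?C $ i, ?C $ j} = {w. \<forall>v\<in>vec.span {column k B}. (\<Sum>l\<in>UNIV. w $ l * v $ l) = 0}"
  proof (intro Set.set_eqI iffI)
    fix w assume "w \<in> vec.span {?C $ i, ?C $ j}"
    then obtain a b where w: "w = a *s ?C $ i + b *s ?C $ j" using span_pair by metis
    have "(\<Sum>l\<in>UNIV. w $ l * (c *s column k B) $ l) = c * (a * (\<Sum>l\<in>UNIV. ?C $ i $ l * B $ l $ k) + b * (\<Sum>l\<in>UNIV. ?C $ j $ l * B $ l $ k))" for c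
      unfolding w by (simp add: column_def s algebra_simps)
    then show "w \<in> {w. \<forall>v\<in>vec.span {column k B}. (\<Sum>l\<in>UNIV. w $ l * v $ l) = 0}"
      using d(1)[of i k] d(1)[of j k] ijk by (auto simp: vec.span_singleton)
  next
    fix w assume "w \<in> {w. \<forall>v\<in>vec.span {column k B}. (\<Sum>l\<in>UNIV. w $ l * v $ l) = 0}"
    then have "(\<Sum>l\<in>UNIV. w $ l * column k B $ l) = 0" using vec.span_base by blast
    then have w0: "(\<Sum>l\<in>UNIV. w $ l * B $ l $ k) = 0" by (simp add: column_def)
    have wm: "w $ m = (\<Sum>l\<in>UNIV. w $ l * B $ l $ i) * ?C $ i $ m + (\<Sum>l\<in>UNIV. w $ l * B $ l $ j) * ?C $ j $ m" for m
    proof -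
      have "w $ m = (\<Sum>l\<in>UNIV. w $ l * (if l = m then 1 else 0))" by (simp add: if_distrib cong: if_cong)
      also have "\<dots> = (\<Sum>l\<in>UNIV. w $ l * (\<Sum>n\<in>UNIV. B $ l $ n * ?C $ n $ m))" by (simp only: d(2))
      also have "\<dots> = (\<Sum>n\<in>UNIV. (\<Sum>l\<in>UNIV. w $ l * B $ l $ n) * ?C $ n $ m)"
        unfolding sum_distrib_left sum_distrib_right mult.assoc by (rule sum.swap)
      also have "\<dots> = (\<Sum>l\<in>UNIV. w $ l * B $ l $ i) * ?C $ i $ m + (\<Sum>l\<in>UNIV. w $ l * B $ l $ j) * ?C $ j $ m"
        by (simp only: s[of "\<lambda>n. (\<Sum>l\<in>UNIV. w $ l * B $ l $ n) * ?C $ n $ m"] w0) simp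
      finally show ?thesis .
    qed
    have "w = (\<Sum>l\<in>UNIV. w $ l * B $ l $ i) *s ?C $ i + (\<Sum>l\<in>UNIV. w $ l * B $ l $ j) *s ?C $ j"
      by (rule vec_eq_iff[THEN iffD2], rule allI, unfold vector_add_component vector_smult_component, rule wm)
    then show "w \<in> vec.span {?C $ i, ?C $ j}" unfolding span_pair by (intro exI)
  qed
  ultimately show ?thesis unfolding projection_forms_def by blast
qed

context gcurve
begin

definition ratf :: "'a generic_field \<Rightarrow> 'a generic_field set" where
  "ratf t = {evp gconst t a / evp gconst t b | a b. evp gconst t b \<noteq> 0}"

lemma ratf_I: "evp gconst t b \<noteq> 0 \<Longrightarrow> evp gconst t a / evp gconst t b \<in> ratf t"
  by (auto simp: ratf_def)

lemma ratf_evp: "evp gconst t a \<in> ratf t"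
  using ratf_I[of t 1 a] by (simp add: rhom_1[OF rhom_evp[OF rhom_gconst]])

lemma ratf_const: "gconst c \<in> ratf t"
  using ratf_evp[of t "[:c:]"] by (simp add: evp_const rhom_gconst)

lemma ratf_var: "t \<in> ratf t"
  using ratf_evp[of t "[:0, 1:]"] by (simp add: evp_var rhom_gconst)

lemma ratf_mult: "x \<in> ratf t \<Longrightarrow> y \<in> ratf t \<Longrightarrow> x * y \<in> ratf t"
  unfolding ratf_def
proof clarify
  fix a b c d assume nz: "evp gconst t b \<noteq> 0" "evp gconst t d \<noteq> 0"
  show "\<exists>a' b'. evp gconst t a / evp gconst t b * (evp gconst t c / evp gconst t d) = evp gconst t a' / evp gconst t b' \<and> evp gconst t b' \<noteq> 0"
    by (intro exI[of _ "a * c"] exI[of _ "b * d"]) (use nz in \<open>simp add: rhom_mult[OF rhom_evp[OF rhom_gconst]]\<close>)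
qed

lemma ratf_add: "x \<in> ratf t \<Longrightarrow> y \<in> ratf t \<Longrightarrow> x + y \<in> ratf t"
  unfolding ratf_def
proof clarify
  fix a b c d assume nz: "evp gconst t b \<noteq> 0" "evp gconst t d \<noteq> 0"
  show "\<exists>a' b'. evp gconst t a / evp gconst t b + (evp gconst t c / evp gconst t d) = evp gconst t a' / evp gconst t b' \<and> evp gconst t b' \<noteq> 0"
    by (intro exI[of _ "a * d + c * b"] exI[of _ "b * d"])
      (use nz in \<open>simp add: rhom_mult[OF rhom_evp[OF rhom_gconst]] rhom_add[OF rhom_evp[OF rhom_gconst]] add_frac_eq\<close>)
qed

lemma ratf_minus: "x \<in> ratf t \<Longrightarrow> - x \<in> ratf t"
  using ratf_mult[OF ratf_const[of "- 1"]] by (simp add: rhom_minus[OF rhom_gconst] rhom_1[OF rhom_gconst])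

lemma ratf_inverse: "x \<in> ratf t \<Longrightarrow> inverse x \<in> ratf t"
proof -
  assume "x \<in> ratf t"
  then obtain a b where x: "x = evp gconst t a / evp gconst t b" "evp gconst t b \<noteq> 0" by (auto simp: ratf_def)
  show ?thesis
  proof (cases "evp gconst t a = 0")
    case True
    then show ?thesis using x ratf_const[of 0 t] by (simp add: rhom_0[OF rhom_gconst])
  next
    case False
    then show ?thesis using ratf_I[of t a b] x by simp
  qed
qed

lemma ratf_sub:
  assumes "t \<in> S" shows "ratf t \<subseteq> S"
  unfolding ratf_def using ff.S_evp[OF assms] ff.S_mult ff.S_inverse by (auto simp: divide_inverse)

lemma kaut_ratf:
  assumes "ff.kaut \<tau>" "t \<in> S" "\<tau> t = t" "z \<in> ratf t" shows "\<tau> z = z"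
proof -
  obtain a b where z: "z = evp gconst t a / evp gconst t b" using assms(4) by (auto simp: ratf_def)
  have "\<tau> (evp gconst t c) = evp gconst t c" for c using ff.kaut_evp[OF assms(1,2)] assms(3) by simp
  then show ?thesis unfolding z divide_inverse
    using ff.kaut_D(4,9)[OF assms(1)] ff.S_evp[OF assms(2)] ff.S_inverse by simp
qed

definition proj_t :: "('a^3) \<times> ('a^3) \<Rightarrow> 'a generic_field" where
  "proj_t w = lin (fst w) / lin (snd w)"

lemma projection_forms_nonzero: "w \<in> projection_forms R' \<Longrightarrow> snd w \<noteq> 0"
  unfolding projection_forms_def using vec.dependent_zero[of "{fst w, snd w}"] by auto

lemma proj_t_S: "w \<in> projection_forms R' \<Longrightarrow> proj_t w \<in> S"
  by (simp add: proj_t_def lin_S[OF projection_forms_nonzero])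

lemma psi_projection_function:
  assumes "w \<in> projection_forms R'"
  shows "psi (projection_function F w) = proj_t w" "projection_function F w \<in> carrier K"
proof -
  have nz: "E (linear_form (snd w)) \<noteq> 0" using lin_nonzero[OF projection_forms_nonzero[OF assms]] by (simp add: lin_def)
  show "psi (projection_function F w) = proj_t w"
    using psi_rational[OF homogeneous_linear_form homogeneous_linear_form nz, of "fst w"]
    by (cases w) (simp add: projection_function_def proj_t_def lin_def)
  show "projection_function F w \<in> carrier K"
    using rational_carrier[OF homogeneous_linear_form homogeneous_linear_form nz, of "fst w"]
    by (cases w) (simp add: projection_function_def)
qed

text \<open>Another basis of the same space of forms changes the projection by a fractional linear
  transformation.\<close>

lemma proj_t_ratf:
  assumes w: "w \<in> projection_forms R'" and u: "u \<in> projection_forms R'" shows "proj_t u \<in> ratf (proj_t w)"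
proof -
  have sp: "vec.span {fst u, snd u} = vec.span {fst w, snd w}"
    using w u unfolding projection_forms_def by auto
  have lw: "lin (snd w) \<noteq> 0" "lin (snd u) \<noteq> 0"
    using lin_nonzero projection_forms_nonzero[OF w] projection_forms_nonzero[OF u] by auto
  have *: "\<exists>p. lin z = lin (snd w) * evp gconst (proj_t w) p" if "z \<in> {fst u, snd u}" for z
  proof -
    have "z \<in> vec.span {fst w, snd w}" using that sp vec.span_base by blast
    then obtain a b where z: "z = a *s fst w + b *s snd w" using span_pair by metis
    have "lin z = gconst a * lin (fst w) + gconst b * lin (snd w)"
      unfolding z lin_sum by (simp add: sum_3 rhom_add[OF rhom_gconst] rhom_mult[OF rhom_gconst] algebra_simps)
    also have "\<dots> = lin (snd w) * evp gconst (proj_t w) [:b, a:]"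
      using lw(1) by (simp add: evp_pCons evp_0 rhom_gconst proj_t_def distrib_left mult.commute)
    finally show ?thesis by (rule exI)
  qed
  obtain p q where pq: "lin (fst u) = lin (snd w) * evp gconst (proj_t w) p" "lin (snd u) = lin (snd w) * evp gconst (proj_t w) q"
    using *[of "fst u"] *[of "snd u"] by auto
  then have "proj_t u = evp gconst (proj_t w) p / evp gconst (proj_t w) q" "evp gconst (proj_t w) q \<noteq> 0"
    using lw by (auto simp: proj_t_def)
  then show ?thesis using ratf_I by simp
qed

lemma projection_field_eq:
  assumes w: "w \<in> projection_forms R'"
  shows "psi ` projection_field F R' = ratf (proj_t w)" "subfield (projection_field F R') K"
proof -
  let ?H = "range (constant_fun F) \<union> projection_function F ` projection_forms R'"
  have H: "?H \<subseteq> carrier K" using const_fun(1) psi_projection_function(2) by auto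
  show sub: "subfield (projection_field F R') K"
    unfolding projection_field_def by (rule K.generate_field_is_subfield[OF H])
  have L: "projection_field F R' = generate_field K ?H" by (simp add: projection_field_def)
  show "psi ` projection_field F R' = ratf (proj_t w)"
  proof
    have "h \<in> carrier K \<and> psi h \<in> ratf (proj_t w)" if "h \<in> generate_field K ?H" for h
      using that
    proof (induct rule: generate_field.induct)
      case one then show ?case using psi_01 ratf_const[of 1] by (simp add: rhom_1[OF rhom_gconst])
    next
      case (incl h) then show ?case using const_fun psi_projection_function ratf_const proj_t_ratf[OF w] by auto
    next
      case (a_inv h) then show ?case using psi_ops(3)[of h h] ratf_minus by simp
    next
      case (m_inv h) then show ?case using psi_inv[of h] ratf_inverse by simp
    next
      case (eng_add h1 h2) then show ?case using psi_ops(2)[of h1 h2] ratf_add by simp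
    next
      case (eng_mult h1 h2) then show ?case using psi_ops(1)[of h1 h2] ratf_mult by simp
    qed
    then show "psi ` projection_field F R' \<subseteq> ratf (proj_t w)" unfolding L by blast
    let ?T = "psi ` projection_field F R'"
    have LK: "h \<in> carrier K" if "h \<in> projection_field F R'" for h
      using that K.generate_field_in_carrier[OF H] by (simp add: L)
    have Tc: "gconst c \<in> ?T" for c
      using const_fun(2)[of c] generate_field.incl[of "constant_fun F c" ?H K] unfolding L by (metis UnI1 imageI rangeI)
    have Tt: "proj_t w \<in> ?T"
      using psi_projection_function(1)[OF w] generate_field.incl[of "projection_function F w" ?H K] w unfolding L
      by (metis UnI2 imageI)
    have Tadd: "a + b \<in> ?T" "a * b \<in> ?T" if ab: "a \<in> ?T" "b \<in> ?T" for a b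
    proof -
      obtain f g where fg: "a = psi f" "b = psi g" "f \<in> projection_field F R'" "g \<in> projection_field F R'" using ab by blast
      have "psi (f \<oplus>\<^bsub>K\<^esub> g) = a + b" "psi (f \<otimes>\<^bsub>K\<^esub> g) = a * b" using psi_ops[OF LK LK, OF fg(3,4)] fg by auto
      moreover have "f \<oplus>\<^bsub>K\<^esub> g \<in> projection_field F R'" "f \<otimes>\<^bsub>K\<^esub> g \<in> projection_field F R'"
        using fg generate_field.intros(5,6)[of f K ?H g] by (simp_all add: L)
      ultimately show "a + b \<in> ?T" "a * b \<in> ?T" by (metis imageI)+
    qed
    have Tev: "evp gconst (proj_t w) p \<in> ?T" for p
      by (induct p) (use Tc[of 0] in \<open>auto simp: evp_0 evp_pCons rhom_gconst rhom_0[OF rhom_gconst] intro!: Tadd Tc Tt\<close>)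
    show "ratf (proj_t w) \<subseteq> ?T"
    proof
      fix z assume "z \<in> ratf (proj_t w)"
      then obtain a b where z: "z = evp gconst (proj_t w) a * inverse (evp gconst (proj_t w) b)" "evp gconst (proj_t w) b \<noteq> 0"
        by (auto simp: ratf_def divide_inverse)
      obtain g where g: "evp gconst (proj_t w) b = psi g" "g \<in> projection_field F R'" using Tev[of b] by blast
      have "g \<noteq> \<zero>\<^bsub>K\<^esub>" using z(2) g(1) psi_01 by auto
      then have "inverse (psi g) = psi (inv\<^bsub>K\<^esub> g)" "inv\<^bsub>K\<^esub> g \<in> projection_field F R'"
        using psi_inv(1)[OF LK[OF g(2)]] generate_field.m_inv[of g K ?H] g(2) by (auto simp: L)
      then show "z \<in> ?T" unfolding z(1) g(1) using Tadd(2)[OF Tev] by blast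
    qed
  qed
qed

text \<open>The group is defined through values of the projection at places, and functions with
  equal values are equal. So preserving the map means fixing the function \<open>proj_t w\<close>,
  and one choice of w suffices.\<close>

lemma galois_group_at_eq:
  assumes w: "w \<in> projection_forms R'"
  shows "galois_group_at F R' = act ` {\<tau>. ff.kaut \<tau> \<and> \<tau> (proj_t w) = proj_t w}"
proof (intro Set.set_eqI iffI)
  have pm: "projection_map F u V = ff.pval (proj_t u) (psi ` V)" if "u \<in> projection_forms R'" "V \<in> N" for u V
    using value_at_eq[OF that(2) psi_projection_function(2)[OF that(1)]] psi_projection_function(1)[OF that(1)]
    by (simp add: projection_map_def)
  fix \<sigma>
  {
    assume "\<sigma> \<in> galois_group_at F R'"
    then have c: "\<sigma> \<in> carrier (Aut_X F)" and m: "\<And>V. V \<in> N \<Longrightarrow> projection_map F w (\<sigma> V) = projection_map F w V"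
      using w by (auto simp: galois_group_at_def)
    obtain \<tau> where \<tau>: "ff.kaut \<tau>" "\<sigma> = act \<tau>" using c by (rule Aut_act)
    have "\<tau> (proj_t w) = proj_t w"
    proof (rule ff.pval_eqD)
      show "\<tau> (proj_t w) \<in> S" "proj_t w \<in> S" using proj_t_S[OF w] ff.kaut_D(1)[OF \<tau>(1)] by auto
      fix W assume W: "W \<in> ff.Pl"
      note k' = ff.kaut_inv(1)[OF \<tau>(1)]
      \<comment> \<open>The place that \<tau> carries to W; invariance of the projection is tested
        there.\<close>
      define W' where "W' = inv_into S \<tau> ` W"
      have pl: "ff.place W" "ff.place W'" using W ff.kaut_place(1)[OF k'] by (auto simp: ff.Pl_def W'_def)
      have "\<tau> ` W' = (\<lambda>z. z) ` W" unfolding W'_def image_image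
        by (rule image_cong) (use ff.kaut_inv(3)[OF \<tau>(1)] ff.place_D(10)[OF pl(1)] in auto)
      then have WW: "\<tau> ` W' = W" by simp
      let ?V = "phi ` W'"
      have V: "?V \<in> N" "psi ` ?V = W'" using place_N[OF pl(2)] by auto
      have "ff.pval (proj_t w) (psi ` act \<tau> ?V) = ff.pval (proj_t w) W'"
        using m[OF V(1)] pm[OF w V(1)] pm[OF w act_N(1)[OF \<tau>(1) V(1)]] V(2) by (simp add: \<tau>(2))
      then show "ff.pval (\<tau> (proj_t w)) W = ff.pval (proj_t w) W"
        using ff.pval_kaut[OF \<tau>(1) pl(2) proj_t_S[OF w]] act_N(2)[OF \<tau>(1) V(1)] V(2) WW by simp
    qed
    then show "\<sigma> \<in> act ` {\<tau>. ff.kaut \<tau> \<and> \<tau> (proj_t w) = proj_t w}" using \<tau> by blast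
  }
  {
    assume "\<sigma> \<in> act ` {\<tau>. ff.kaut \<tau> \<and> \<tau> (proj_t w) = proj_t w}"
    then obtain \<tau> where \<tau>: "ff.kaut \<tau>" "\<tau> (proj_t w) = proj_t w" "\<sigma> = act \<tau>" by blast
    have "projection_map F u (\<sigma> V) = projection_map F u V" if u: "u \<in> projection_forms R'" and V: "V \<in> N" for u V
    proof -
      have "\<tau> (proj_t u) = proj_t u" using kaut_ratf[OF \<tau>(1) proj_t_S[OF w] \<tau>(2) proj_t_ratf[OF w u]] .
      then show ?thesis using pm[OF u V] pm[OF u act_N(1)[OF \<tau>(1) V]] act_N(2)[OF \<tau>(1) V]
          ff.pval_kaut[OF \<tau>(1) N_place[OF V] proj_t_S[OF u]] by (simp add: \<tau>(3))
    qed
    then show "\<sigma> \<in> galois_group_at F R'" using act_Aut[OF \<tau>(1)] by (auto simp: galois_group_at_def \<tau>(3))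
  }
qed

lemma kaut_of_ring_iso:
  assumes \<theta>: "\<theta> \<in> ring_iso K K" and c: "\<And>c. \<theta> (constant_fun F c) = constant_fun F c"
  shows "ff.kaut (\<lambda>z. psi (\<theta> (phi z)))"
  unfolding ff.kaut_def
proof (intro conjI allI ballI)
  have "bij_betw (psi \<circ> \<theta> \<circ> phi) S S"
    using bij_betw_inv_into[OF psi_bij] ring_iso_memE(5)[OF \<theta>] psi_bij unfolding phi_def
    by (blast intro: bij_betw_trans)
  then show "bij_betw (\<lambda>z. psi (\<theta> (phi z))) S S" by (simp add: comp_def)
  show "psi (\<theta> (phi (gconst x))) = gconst x" for x
    using phi(3)[OF const_fun(1)] const_fun(2) c by metis
  fix a b assume ab: "a \<in> S" "b \<in> S"
  have p: "phi (a + b) = phi a \<oplus>\<^bsub>K\<^esub> phi b" "phi (a * b) = phi a \<otimes>\<^bsub>K\<^esub> phi b"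
    using phi ab psi_ops[OF phi(1) phi(1), OF ab] K.a_closed K.m_closed by metis+
  have t: "\<theta> (phi a) \<in> carrier K" "\<theta> (phi b) \<in> carrier K" using ring_iso_memE(1)[OF \<theta>] phi(1) ab by auto
  show "psi (\<theta> (phi (a + b))) = psi (\<theta> (phi a)) + psi (\<theta> (phi b))"
    unfolding p ring_iso_memE(3)[OF \<theta> phi(1) phi(1), OF ab] by (rule psi_ops(2)[OF t])
  show "psi (\<theta> (phi (a * b))) = psi (\<theta> (phi a)) * psi (\<theta> (phi b))"
    unfolding p ring_iso_memE(2)[OF \<theta> phi(1) phi(1), OF ab] by (rule psi_ops(1)[OF t])
qed

lemma ring_iso_of_kaut:
  assumes \<tau>: "ff.kaut \<tau>" shows "(\<lambda>f. phi (\<tau> (psi f))) \<in> ring_iso K K"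
proof (rule ring_iso_memI)
  have tS: "\<tau> (psi f) \<in> S" if "f \<in> carrier K" for f using phi(4)[OF that] ff.kaut_D(1)[OF \<tau>] by blast
  fix f g assume fg: "f \<in> carrier K" "g \<in> carrier K"
  show "phi (\<tau> (psi f)) \<in> carrier K" using phi(1) tS fg by blast
  have e: "phi z = h" if "h \<in> carrier K" "psi h = z" for h z using phi(3) that by auto
  show "phi (\<tau> (psi (f \<otimes>\<^bsub>K\<^esub> g))) = phi (\<tau> (psi f)) \<otimes>\<^bsub>K\<^esub> phi (\<tau> (psi g))"
    using fg tS phi psi_ops(1) ff.kaut_D(4)[OF \<tau>] by (intro e) auto
  show "phi (\<tau> (psi (f \<oplus>\<^bsub>K\<^esub> g))) = phi (\<tau> (psi f)) \<oplus>\<^bsub>K\<^esub> phi (\<tau> (psi g))"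
    using fg tS phi psi_ops(2) ff.kaut_D(3)[OF \<tau>] by (intro e) auto
next
  show "phi (\<tau> (psi \<one>\<^bsub>K\<^esub>)) = \<one>\<^bsub>K\<^esub>" using psi_01 ff.kaut_D(7)[OF \<tau>] phi(3)[OF K.one_closed] by metis
  have "bij_betw (phi \<circ> \<tau> \<circ> psi) (carrier K) (carrier K)"
    using bij_betw_inv_into[OF psi_bij] \<tau> psi_bij unfolding phi_def ff.kaut_def
    by (blast intro: bij_betw_trans)
  then show "bij_betw (\<lambda>f. phi (\<tau> (psi f))) (carrier K) (carrier K)" by (simp add: comp_def)
qed

text \<open>An automorphism of K fixing L fixes the constants and \<open>proj_t w\<close>, hence is
  a k-automorphism of S fixing \<open>proj_t w\<close>, and conversely; L itself corresponds to
  k(t).\<close>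

lemma galois_extension_iff:
  assumes w: "w \<in> projection_forms R'"
  shows "galois_extension K (projection_field F R') \<longleftrightarrow>
    K.finite_dimension (projection_field F R') (carrier K) \<and>
    (\<forall>z\<in>S. (\<forall>\<tau>. ff.kaut \<tau> \<and> \<tau> (proj_t w) = proj_t w \<longrightarrow> \<tau> z = z) \<longrightarrow> z \<in> ratf (proj_t w))"
proof -
  let ?L = "projection_field F R'" and ?t = "proj_t w"
  note pf = projection_field_eq[OF w]
  have LK: "?L \<subseteq> carrier K" using subfieldE(3)[OF pf(2)] .
  have memL: "f \<in> ?L \<longleftrightarrow> psi f \<in> ratf ?t" if "f \<in> carrier K" for f
    using psi_image_mem[OF LK that] pf(1) by simp
  have fix_iff: "(\<forall>\<theta>\<in>ring_iso K K. (\<forall>y\<in>?L. \<theta> y = y) \<longrightarrow> \<theta> f = f) \<longleftrightarrow>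
      (\<forall>\<tau>. ff.kaut \<tau> \<and> \<tau> ?t = ?t \<longrightarrow> \<tau> (psi f) = psi f)" if f: "f \<in> carrier K" for f
  proof (intro iffI allI impI ballI)
    fix \<tau> assume a: "\<forall>\<theta>\<in>ring_iso K K. (\<forall>y\<in>?L. \<theta> y = y) \<longrightarrow> \<theta> f = f" and \<tau>: "ff.kaut \<tau> \<and> \<tau> ?t = ?t"
    have "\<forall>y\<in>?L. phi (\<tau> (psi y)) = y"
    proof
      fix y assume y: "y \<in> ?L"
      then have "psi y \<in> ratf ?t" using memL LK by blast
      then have "\<tau> (psi y) = psi y" using kaut_ratf proj_t_S[OF w] \<tau> by blast
      then show "phi (\<tau> (psi y)) = y" using phi(3) y LK by auto
    qed
    then have "phi (\<tau> (psi f)) = f" using bspec[OF a ring_iso_of_kaut[OF conjunct1[OF \<tau>]]] by (rule rev_mp)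
    then show "\<tau> (psi f) = psi f" using phi(2)[OF ff.kaut_D(1)[OF _ phi(4)[OF f]], of \<tau>] \<tau> by simp
  next
    fix \<theta> assume a: "\<forall>\<tau>. ff.kaut \<tau> \<and> \<tau> ?t = ?t \<longrightarrow> \<tau> (psi f) = psi f" and \<theta>: "\<theta> \<in> ring_iso K K" "\<forall>y\<in>?L. \<theta> y = y"
    have c: "constant_fun F c \<in> ?L" for c using memL[OF const_fun(1)] ratf_const const_fun(2) by simp
    have k: "ff.kaut (\<lambda>z. psi (\<theta> (phi z)))" by (rule kaut_of_ring_iso[OF \<theta>(1)]) (use \<theta>(2) c in blast)
    have "phi ?t \<in> ?L" using memL[OF phi(1)[OF proj_t_S[OF w]]] phi(2)[OF proj_t_S[OF w]] ratf_var by simp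
    then have "psi (\<theta> (phi ?t)) = ?t" using \<theta>(2) phi(2)[OF proj_t_S[OF w]] by simp
    then have "psi (\<theta> (phi (psi f))) = psi f" using a k by blast
    then show "\<theta> f = f" using phi(3)[OF f] psi_inj[OF ring_iso_memE(1)[OF \<theta>(1) f] f] by simp
  qed
  have fixL: "\<theta> f = f" if "f \<in> ?L" "\<theta> \<in> ring_iso K K" "\<forall>y\<in>?L. \<theta> y = y" for \<theta> f using that by blast
  define D where "D = {f \<in> carrier K. \<forall>\<theta>\<in>ring_iso K K. (\<forall>y\<in>?L. \<theta> y = y) \<longrightarrow> \<theta> f = f}"
  have "?L \<subseteq> D" unfolding D_def using LK by auto
  then have "D = ?L \<longleftrightarrow> D \<subseteq> ?L" by auto
  also have "\<dots> \<longleftrightarrow>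
    (\<forall>f\<in>carrier K. (\<forall>\<tau>. ff.kaut \<tau> \<and> \<tau> ?t = ?t \<longrightarrow> \<tau> (psi f) = psi f) \<longrightarrow> psi f \<in> ratf ?t)"
  proof (intro iffI ballI impI subsetI)
    fix f assume "D \<subseteq> ?L" and f: "f \<in> carrier K" and c: "\<forall>\<tau>. ff.kaut \<tau> \<and> \<tau> ?t = ?t \<longrightarrow> \<tau> (psi f) = psi f"
    have "f \<in> D" unfolding D_def using f iffD2[OF fix_iff[OF f] c] by simp
    then show "psi f \<in> ratf ?t" using \<open>D \<subseteq> ?L\<close> memL[OF f] by blast
  next
    fix f assume a: "\<forall>f\<in>carrier K. (\<forall>\<tau>. ff.kaut \<tau> \<and> \<tau> ?t = ?t \<longrightarrow> \<tau> (psi f) = psi f) \<longrightarrow> psi f \<in> ratf ?t" and f: "f \<in> D"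
    have fK: "f \<in> carrier K" and c: "\<forall>\<theta>\<in>ring_iso K K. (\<forall>y\<in>?L. \<theta> y = y) \<longrightarrow> \<theta> f = f" using f by (auto simp: D_def)
    then show "f \<in> ?L" using bspec[OF a fK, THEN mp, OF iffD1[OF fix_iff[OF fK] c]] memL[OF fK] by simp
  qed
  also have "\<dots> \<longleftrightarrow> (\<forall>z\<in>S. (\<forall>\<tau>. ff.kaut \<tau> \<and> \<tau> ?t = ?t \<longrightarrow> \<tau> z = z) \<longrightarrow> z \<in> ratf ?t)"
  proof (intro iffI ballI)
    fix z assume a: "\<forall>f\<in>carrier K. (\<forall>\<tau>. ff.kaut \<tau> \<and> \<tau> ?t = ?t \<longrightarrow> \<tau> (psi f) = psi f) \<longrightarrow> psi f \<in> ratf ?t" and z: "z \<in> S"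
    show "(\<forall>\<tau>. ff.kaut \<tau> \<and> \<tau> ?t = ?t \<longrightarrow> \<tau> z = z) \<longrightarrow> z \<in> ratf ?t"
      using bspec[OF a phi(1)[OF z]] unfolding phi(2)[OF z] .
  next
    fix f assume a: "\<forall>z\<in>S. (\<forall>\<tau>. ff.kaut \<tau> \<and> \<tau> ?t = ?t \<longrightarrow> \<tau> z = z) \<longrightarrow> z \<in> ratf ?t" and f: "f \<in> carrier K"
    show "(\<forall>\<tau>. ff.kaut \<tau> \<and> \<tau> ?t = ?t \<longrightarrow> \<tau> (psi f) = psi f) \<longrightarrow> psi f \<in> ratf ?t"
      by (rule bspec[OF a phi(4)[OF f]])
  qed
  finally show ?thesis unfolding galois_extension_def D_def using pf(2) by simp
qed

lemma finite_dimension_of_span: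
  assumes w: "w \<in> projection_forms R'" and u: "\<And>i::nat. u i \<in> S"
    and sp: "\<And>z. z \<in> S \<Longrightarrow> \<exists>c. (\<forall>i. c i \<in> ratf (proj_t w)) \<and> z = (\<Sum>i<n. c i * u i)"
  shows "K.finite_dimension (projection_field F R') (carrier K)"
proof -
  let ?L = "projection_field F R'"
  note pf = projection_field_eq[OF w]
  have LK: "?L \<subseteq> carrier K" using subfieldE(3)[OF pf(2)] .
  define Us where "Us = map (\<lambda>i. phi (u i)) [0..<n]"
  have Us: "set Us \<subseteq> carrier K" using phi(1) u by (auto simp: Us_def)
  have "f \<in> K.Span ?L Us" if f: "f \<in> carrier K" for f
  proof -
    obtain c where c: "\<And>i. c i \<in> ratf (proj_t w)" "psi f = (\<Sum>i<n. c i * u i)" using sp[OF phi(4)[OF f]] by blast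
    have cS: "c i \<in> S" for i using c(1) ratf_sub[OF proj_t_S[OF w]] by blast
    have cL: "phi (c i) \<in> ?L" for i
      using c(1)[of i] psi_image_mem[OF LK phi(1)[OF cS]] phi(2)[OF cS] pf(1) by simp
    have part: "\<exists>g\<in>K.Span ?L Us. psi g = (\<Sum>i<k. c i * u i)" if "k \<le> n" for k
      using that
    proof (induct k)
      case 0
      show ?case using K.Span_subgroup_props(2)[OF pf(2) Us] psi_01 by auto
    next
      case (Suc k)
      then obtain g where g: "g \<in> K.Span ?L Us" "psi g = (\<Sum>i<k. c i * u i)" by auto
      have gK: "g \<in> carrier K" using K.Span_subgroup_props(1)[OF pf(2) Us] g(1) by blast
      have "phi (u k) \<in> set Us" using Suc(2) by (auto simp: Us_def)
      then have uS: "phi (u k) \<in> K.Span ?L Us" using K.Span_base_incl[OF pf(2) Us] by blast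
      have m: "phi (c k) \<otimes>\<^bsub>K\<^esub> phi (u k) \<in> K.Span ?L Us" by (rule K.Span_smult_closed[OF pf(2) Us cL uS])
      have "psi (g \<oplus>\<^bsub>K\<^esub> phi (c k) \<otimes>\<^bsub>K\<^esub> phi (u k)) = (\<Sum>i<Suc k. c i * u i)"
        using psi_ops(2)[OF gK K.m_closed[OF phi(1)[OF cS] phi(1)[OF u]]] psi_ops(1)[OF phi(1)[OF cS] phi(1)[OF u]]
          phi(2)[OF cS] phi(2)[OF u] g(2) by simp
      then show ?case using K.Span_subgroup_props(3)[OF pf(2) Us g(1) m] by blast
    qed
    then obtain g where g: "g \<in> K.Span ?L Us" "psi g = psi f" using c(2) by auto
    have "g \<in> carrier K" using K.Span_subgroup_props(1)[OF pf(2) Us] g(1) by blast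
    then show ?thesis using psi_inj[OF _ f] g by auto
  qed
  then have "carrier K = K.Span ?L Us" using K.Span_subgroup_props(1)[OF pf(2) Us] by blast
  then show ?thesis using K.Span_finite_dimension[OF pf(2) Us] by simp
qed

end

section \<open>Polynomials invariant under affine substitutions\<close>

lemma poly_fun_eqI:
  fixes p q :: "'a::alg_closed_field poly"
  assumes "\<And>x. poly p x = poly q x" shows "p = q"
proof (rule ccontr)
  assume "p \<noteq> q"
  then have "p - q \<noteq> 0" by simp
  then obtain x where "poly (p - q) x \<noteq> 0" by (rule poly_nonroot_ex)
  then show False using assms by simp
qed

text \<open>The derivative of an additive polynomial is translation invariant, hence constant, so
  every exponent from 2 on is divisible by p. Then L = a X + R(X ^ p) with R additive of smaller
  degree. In characteristic 0 the only admissible exponent is 0 ^ 0 = 1.\<close>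

lemma additive_poly_support:
  fixes L :: "'a::alg_closed_field poly"
  assumes "\<And>a b. poly L (a + b) = poly L a + poly L b" "coeff L j \<noteq> 0"
  shows "\<exists>i. j = CHAR('a) ^ i"
  using assms
proof (induct "degree L" arbitrary: L j rule: less_induct)
  case less
  let ?p = "CHAR('a)"
  note add = less(2)
  have L0: "coeff L 0 = 0" using add[of 0 0] by (metis add_cancel_left_left add_0 poly_0_coeff_0)
  have der: "poly (pderiv L) b = poly (pderiv L) 0" for b
  proof -
    have "pcompose L [:b, 1:] = L + [:poly L b:]"
      by (rule poly_fun_eqI) (simp add: poly_pcompose add add.commute)
    then have "pderiv (pcompose L [:b, 1:]) = pderiv L" by (simp add: pderiv_add pderiv_pCons)
    then have "pcompose (pderiv L) [:b, 1:] = pderiv L" by (simp add: pderiv_pcompose pderiv_pCons)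
    then have "poly (pcompose (pderiv L) [:b, 1:]) 0 = poly (pderiv L) 0" by simp
    then show ?thesis by (simp add: poly_pcompose)
  qed
  define k0 where "k0 = poly (pderiv L) 0"
  have k0: "pderiv L = [:k0:]" by (rule poly_fun_eqI) (use der in \<open>simp add: k0_def\<close>)
  have c: "of_nat (Suc n) * coeff L (Suc n) = 0" if "n > 0" for n
    using that coeff_pderiv[of L n] unfolding k0 by (cases n) auto
  have dv: "?p dvd k" if "k \<ge> 2" "coeff L k \<noteq> 0" for k
    using c[of "k - 1"] that by (simp add: of_nat_eq_0_iff_char_dvd del: of_nat_Suc)
  show ?case
  proof (cases "j = 1")
    case True
    then show ?thesis by (intro exI[of _ 0]) simp
  next
    case False
    then have j2: "j \<ge> 2" using L0 less(3) by (cases "j = 0") auto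
    have pj: "?p dvd j" using dv[OF j2 less(3)] .
    then have p0: "?p > 0" using j2 by (cases "?p = 0") auto
    then have pr: "Factorial_Ring.prime ?p" by (rule prime_CHAR_semidom)
    then have p2: "?p \<ge> 2" by (rule prime_ge_2_nat)
    define R where "R = (\<Sum>i\<le>degree L div ?p. monom (coeff L (?p * i)) i)"
    have cR: "coeff R i = coeff L (?p * i)" for i
    proof (cases "i \<le> degree L div ?p")
      case False
      then have "?p * i > degree L" using p0 by (simp add: not_le div_less_iff_less_mult mult.commute)
      then show ?thesis using False by (simp add: R_def coeff_sum coeff_monom coeff_eq_0)
    qed (simp add: R_def coeff_sum coeff_monom)
    have dR: "degree R \<le> degree L div ?p"
      unfolding R_def by (intro degree_sum_le) (auto intro: order.trans[OF degree_monom_le])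
    have jL: "j \<le> degree L" using less(3) by (rule le_degree)
    have dlt: "degree R < degree L"
      using dR p2 j2 jL by (meson div_less_dividend le_less_trans less_le_trans pos2 one_less_numeral_iff semiring_norm(76))
    have LR: "poly L x = coeff L 1 * x + poly R (x ^ ?p)" for x
    proof -
      have "L = monom (coeff L 1) 1 + pcompose R (monom 1 ?p)"
      proof (rule poly_eqI)
        fix k
        have pm: "pcompose R (monom 1 ?p) = (\<Sum>i\<le>degree L div ?p. monom (coeff L (?p * i)) (?p * i))"
        proof -
          have "pcompose (monom a i) (monom 1 ?p) = monom a (?p * i)" for a :: 'a and i
            by (rule poly_fun_eqI) (simp add: poly_pcompose poly_monom power_mult)
          then show ?thesis by (simp add: R_def pcompose_sum)
        qed
        have "coeff (pcompose R (monom 1 ?p)) k = (if ?p dvd k then coeff L k else 0)"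
        proof (cases "?p dvd k")
          case True
          then obtain i where k: "k = ?p * i" by (rule dvdE)
          have "coeff (pcompose R (monom 1 ?p)) k =
             (\<Sum>i'\<le>degree L div ?p. if i' = i then coeff L (?p * i') else 0)"
            unfolding pm coeff_sum using p0 by (intro sum.cong) (auto simp: coeff_monom k)
          also have "\<dots> = (if i \<le> degree L div ?p then coeff L (?p * i) else 0)" by simp
          also have "\<dots> = coeff L k"
            using cR[of i] by (auto simp: k R_def coeff_sum coeff_monom)
          finally show ?thesis using True by simp
        next
          case False
          then show ?thesis unfolding pm coeff_sum by (auto simp: coeff_monom intro!: sum.neutral)
        qed
        moreover have "\<not> ?p dvd 1" using p2 by auto
        ultimately show "coeff L k = coeff (monom (coeff L 1) 1 + pcompose R (monom 1 ?p)) k"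
          using dv[of k] L0 p2 by (cases "k = 0"; cases "k = 1") (auto simp: coeff_monom)
      qed
      then have "poly L x = poly (monom (coeff L 1) 1 + pcompose R (monom 1 ?p)) x" by simp
      then show ?thesis by (simp add: poly_monom poly_pcompose)
    qed
    have "poly R (a + b) = poly R a + poly R b" for a b
    proof -
      \<comment> \<open>Additivity passes to R because every element of k is a p-th power.\<close>
      obtain a' b' where ab: "a = a' ^ ?p" "b = b' ^ ?p" using nth_root_exists[OF p0] by metis
      have "(a' + b') ^ ?p = a + b" using freshmans_dream[OF pr refl] ab by metis
      then show ?thesis using LR[of "a' + b'"] LR[of a'] LR[of b'] add[of a' b'] ab by (simp add: algebra_simps)
    qed
    moreover obtain i' where i': "j = ?p * i'" using pj by (rule dvdE)
    moreover have "coeff R i' \<noteq> 0" using less(3) by (simp add: cR i')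
    ultimately obtain i where "i' = ?p ^ i" using less(1)[OF dlt] by blast
    then show ?thesis using i' by (intro exI[of _ "Suc i"]) simp
  qed
qed

lemma pcompose_monom_power: "pcompose (monom c i) q = smult c (q ^ i)"
  by (induct i) (simp_all add: monom_0 monom_Suc pcompose_pCons)

lemma coeff_pcompose_affine:
  fixes p :: "'a::idom poly"
  assumes "degree p \<le> n"
  shows "coeff (pcompose p [:b, a:]) k = (\<Sum>i\<in>{k..n}. coeff p i * (of_nat (i choose k) * a ^ k * b ^ (i - k)))"
proof -
  have c: "coeff ([:b, a:] ^ i) k = (if k \<le> i then of_nat (i choose k) * a ^ k * b ^ (i - k) else 0)" for i
  proof (cases "k \<le> i")
    case False
    have "degree ([:b, a:] ^ i) \<le> degree [:b, a:] * i" by (rule degree_power_le)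
    also have "\<dots> \<le> 1 * i" by (rule mult_le_mono1) simp
    finally have "degree ([:b, a:] ^ i) \<le> i" by simp
    then show ?thesis using False by (simp add: coeff_eq_0)
  qed (simp add: coeff_linear_poly_power)
  have "p = (\<Sum>i\<le>n. monom (coeff p i) i)"
    using poly_as_sum_of_monoms'[OF assms] by simp
  then have "pcompose p [:b, a:] = (\<Sum>i\<le>n. smult (coeff p i) ([:b, a:] ^ i))"
    using pcompose_sum[of "\<lambda>i. monom (coeff p i) i" "{..n}" "[:b, a:]"]
    by (simp only: pcompose_monom_power)
  then have "coeff (pcompose p [:b, a:]) k = (\<Sum>i\<le>n. coeff p i * coeff ([:b, a:] ^ i) k)"
    by (simp add: coeff_sum)
  also have "\<dots> = (\<Sum>i\<in>{k..n}. coeff p i * (of_nat (i choose k) * a ^ k * b ^ (i - k)))"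
    by (rule sum.mono_neutral_cong_right) (auto simp: c)
  finally show ?thesis .
qed

text \<open>After centring at t0 the invariant affine maps become scalings by the elements of A. A
  coefficient of degree j with 0 < j < n would make all of A roots of X ^ j = 1, too many for that
  degree.\<close>

lemma centered_power:
  fixes G :: "'a::alg_closed_field poly"
  assumes n: "degree G = n" "n \<ge> 1" "of_nat n \<noteq> (0::'a)"
    and A: "finite A" "card A \<ge> n" "\<And>\<alpha>. \<alpha> \<in> A \<Longrightarrow> \<exists>\<beta>. pcompose G [:\<beta>, \<alpha>:] = G"
  obtains t0 c c' where "c \<noteq> 0" "G = smult c ([:- t0, 1:] ^ n) + [:c':]"
proof -
  define l where "l = coeff G n"
  have l0: "l \<noteq> 0" using n by (auto simp: l_def)
  \<comment> \<open>The translation that removes the coefficient of degree n - 1; it divides by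
    n.\<close>
  define t0 where "t0 = - coeff G (n - 1) / (of_nat n * l)"
  define G1 where "G1 = pcompose G [:t0, 1:]"
  have dG1: "degree G1 \<le> n" unfolding G1_def using degree_pcompose[of G "[:t0, 1:]"] n by simp
  have kn: "coeff (pcompose p [:b, a:]) (n - 1) = a ^ (n - 1) * (coeff p (n - 1) + of_nat n * b * coeff p n)"
    "coeff (pcompose p [:b, a:]) n = a ^ n * coeff p n" if "degree p \<le> n" for p :: "'a poly" and a b
  proof -
    obtain n' where n': "n = Suc n'" using n(2) by (cases n) auto
    show "coeff (pcompose p [:b, a:]) (n - 1) = a ^ (n - 1) * (coeff p (n - 1) + of_nat n * b * coeff p n)"
      unfolding coeff_pcompose_affine[OF that] by (simp add: n' algebra_simps)
    show "coeff (pcompose p [:b, a:]) n = a ^ n * coeff p n"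
      unfolding coeff_pcompose_affine[OF that] by (simp add: mult.commute)
  qed
  have g1: "coeff G1 n = l" "coeff G1 (n - 1) = 0"
    using kn[of G t0 1] n l0 by (simp_all add: G1_def t0_def l_def field_simps)
  have inv: "pcompose G1 [:0, \<alpha>:] = G1" if "\<alpha> \<in> A" for \<alpha>
  proof -
    obtain \<beta> where \<beta>: "pcompose G [:\<beta>, \<alpha>:] = G" using A(3)[OF \<open>\<alpha> \<in> A\<close>] by blast
    \<comment> \<open>The constant term of the affine map in the coordinate centred at t0; it
      vanishes because the coefficient of degree n - 1 does.\<close>
    define \<beta>' where "\<beta>' = \<alpha> * t0 + \<beta> - t0"
    have e: "pcompose G1 [:\<beta>', \<alpha>:] = G1"
    proof (rule poly_fun_eqI)
      fix s
      have "poly G (\<alpha> * (s + t0) + \<beta>) = poly G (s + t0)"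
        using arg_cong[OF \<beta>, of "\<lambda>p. poly p (s + t0)"] by (simp add: poly_pcompose algebra_simps)
      then show "poly (pcompose G1 [:\<beta>', \<alpha>:]) s = poly G1 s"
        by (simp add: G1_def poly_pcompose \<beta>'_def algebra_simps)
    qed
    have "\<alpha> ^ n * l = l" using kn(2)[OF dG1, of \<beta>' \<alpha>] g1 e by simp
    then have "\<alpha> \<noteq> 0" using l0 n(2) by (auto simp: power_0_left)
    then have "\<beta>' = 0" using kn(1)[OF dG1, of \<beta>' \<alpha>] g1 e n(3) l0 by simp
    then show ?thesis using e by simp
  qed
  have z: "coeff G1 j = 0" if "0 < j" "j < n" for j
  proof (rule ccontr)
    assume nz: "coeff G1 j \<noteq> 0"
    have "poly (monom 1 j - 1) \<alpha> = 0" if "\<alpha> \<in> A" for \<alpha>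
    proof -
      have "\<alpha> ^ j * coeff G1 j = coeff G1 j"
        using arg_cong[OF inv[OF that], of "\<lambda>p. coeff p j"] by (simp add: coeff_pcompose_linear)
      then show ?thesis using nz by (simp add: poly_monom)
    qed
    then have sub: "A \<subseteq> {x. poly (monom 1 j - 1) x = 0}" by blast
    have ne: "monom 1 j - 1 \<noteq> (0 :: 'a poly)"
    proof
      assume "monom 1 j - 1 = (0 :: 'a poly)"
      then have "coeff (monom 1 j - 1 :: 'a poly) 0 = 0" by simp
      then show False using \<open>0 < j\<close> by (simp add: coeff_monom)
    qed
    have "card A \<le> card {x. poly (monom 1 j - 1 :: 'a poly) x = 0}"
      by (rule card_mono[OF poly_roots_finite[OF ne] sub])
    also have "\<dots> \<le> degree (monom 1 j - 1 :: 'a poly)" by (rule card_poly_roots_bound[OF ne])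
    also have "\<dots> \<le> j" by (intro degree_diff_le) (auto simp: degree_monom_eq)
    finally show False using A(2) \<open>j < n\<close> by simp
  qed
  have G1: "G1 = monom l n + [:coeff G1 0:]"
  proof (rule poly_eqI)
    fix j
    show "coeff G1 j = coeff (monom l n + [:coeff G1 0:]) j"
      using z[of j] g1 n(2) coeff_eq_0[of G1 j] dG1 by (cases "j = 0"; cases "j < n"; cases "j = n") (auto simp: coeff_monom coeff_pCons split: nat.splits)
  qed
  have "G = smult l ([:- t0, 1:] ^ n) + [:coeff G1 0:]"
  proof (rule poly_fun_eqI)
    fix s
    have "poly G1 (s - t0) = poly (monom l n + [:coeff G1 0:]) (s - t0)" using G1 by simp
    then show "poly G s = poly (smult l ([:- t0, 1:] ^ n) + [:coeff G1 0:]) s"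
      by (simp add: G1_def poly_pcompose poly_monom)
  qed
  then show ?thesis using that l0 by blast
qed

lemma prod_linear_dvd:
  fixes p :: "'a::field poly"
  assumes "finite V" "\<And>v. v \<in> V \<Longrightarrow> poly p v = 0" shows "(\<Prod>v\<in>V. [:- v, 1:]) dvd p"
  using assms
proof (induct V)
  case (insert v V)
  then obtain s where s: "p = (\<Prod>v\<in>V. [:- v, 1:]) * s" by (metis dvdE insertCI)
  have "poly (\<Prod>v\<in>V. [:- v, 1:]) v \<noteq> 0" using insert(1,2) by (auto simp: poly_prod)
  moreover have "poly p v = 0" using insert(4) by blast
  ultimately have "poly s v = 0" using s by simp
  then obtain s' where "s = [:- v, 1:] * s'" by (metis dvdE poly_eq_0_iff_dvd)
  then have "p = (\<Prod>w\<in>insert v V. [:- w, 1:]) * s'"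
    unfolding prod.insert[OF insert(1,2)] using s by (simp only: mult_ac)
  then show ?case by (rule dvdI)
qed simp

lemma degree_prod_linear: "finite V \<Longrightarrow> degree (\<Prod>v\<in>V. [:- v, 1 :: 'a::field:]) = card V"
  by (subst degree_prod_eq_sum_degree) auto

lemma lead_prod_linear: "finite V \<Longrightarrow> coeff (\<Prod>v\<in>V. [:- v, 1 :: 'a::field:]) (card V) = 1"
  using degree_prod_linear[of V] lead_coeff_prod[of "\<lambda>v. [:- v, 1:]" V] by simp

text \<open>g - g(0) vanishes on V, so L divides it; the quotient is again invariant under V and of
  smaller degree.\<close>

lemma invariant_poly_factor:
  fixes g :: "'a::alg_closed_field poly"
  assumes V: "finite V" "0 \<in> V" "\<And>v w. v \<in> V \<Longrightarrow> w \<in> V \<Longrightarrow> v - w \<in> V"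
    and L: "L = (\<Prod>v\<in>V. [:- v, 1:])"
    and Linv: "\<And>v x. v \<in> V \<Longrightarrow> poly L (x + v) = poly L x"
    and g: "\<And>v x. v \<in> V \<Longrightarrow> poly g (x + v) = poly g x"
  shows "\<exists>G. g = pcompose G L"
  using g
proof (induct "degree g" arbitrary: g rule: less_induct)
  case less
  have "poly (g - [:poly g 0:]) v = 0" if "v \<in> V" for v using less(2)[OF that, of 0] by simp
  then have "L dvd g - [:poly g 0:]" unfolding L by (rule prod_linear_dvd[OF V(1)])
  then obtain g1 where g1: "g - [:poly g 0:] = L * g1" by (rule dvdE)
  show ?case
  proof (cases "g1 = 0")
    case True
    then have "g = [:poly g 0:]" using g1 by simp
    then show ?thesis by (metis pcompose_const)
  next
    case False
    have dL: "degree L = card V" unfolding L by (rule degree_prod_linear[OF V(1)])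
    have L0: "L \<noteq> 0" unfolding L using V(1) by (auto simp: prod_zero_iff)
    have cV: "card V > 0" using V(1,2) by (auto simp: card_gt_0_iff)
    have "degree (g - [:poly g 0:]) = card V + degree g1"
      unfolding g1 using degree_mult_eq[OF L0 False] dL by simp
    moreover have "degree (g - [:poly g 0:]) \<le> degree g" by (intro degree_diff_le) auto
    ultimately have dlt: "degree g1 < degree g" using cV by simp
    have "poly g1 (x + v) = poly g1 x" if v: "v \<in> V" for v x
    proof -
      have "pcompose (L * g1) [:v, 1:] = L * g1"
        unfolding g1[symmetric] by (rule poly_fun_eqI) (use less(2)[OF v] in \<open>simp add: poly_pcompose add.commute\<close>)
      moreover have "pcompose L [:v, 1:] = L"
        by (rule poly_fun_eqI) (use Linv[OF v] in \<open>simp add: poly_pcompose add.commute\<close>)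
      ultimately have "L * pcompose g1 [:v, 1:] = L * g1" by (simp add: pcompose_mult)
      then have "pcompose g1 [:v, 1:] = g1" using L0 by simp
      then have "poly (pcompose g1 [:v, 1:]) x = poly g1 x" by simp
      then show ?thesis by (simp add: poly_pcompose add.commute)
    qed
    then obtain G1 where "g1 = pcompose G1 L" using less(1)[OF dlt] by blast
    then have "g = pcompose (pCons (poly g 0) G1) L" using g1 by (simp add: pcompose_pCons algebra_simps)
    then show ?thesis by blast
  qed
qed

text \<open>M is a group of affine maps, as large as the degree of g. Its translations V have order
  q and its multipliers \<mu> order m, with d = q m. The polynomial L vanishing on V is additive, so
  q = p ^ e and g = G(L); G has degree m and is invariant under m affine maps, hence is a centred
  m-th power up to constants.\<close>

lemma affine_invariant_poly:
  fixes g :: "'a::alg_closed_field poly"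
  assumes d: "degree g = d" "d \<ge> 1"
    and M: "finite M" "card M = d" "\<And>\<alpha> \<beta>. (\<alpha>, \<beta>) \<in> M \<longleftrightarrow> \<alpha> \<noteq> 0 \<and> pcompose g [:\<beta>, \<alpha>:] = g"
  obtains e m a y0 c c' where "d = CHAR('a) ^ e * m" "\<not> CHAR('a) dvd m" "m dvd CHAR('a) ^ e - 1" "a e \<noteq> 0" "a 0 \<noteq> 0" "c \<noteq> 0"
    "g = smult c (pcompose (\<Sum>i\<in>{i. i \<le> e \<and> m dvd CHAR('a) ^ i - 1}. monom (a i) (CHAR('a) ^ i)) [:- y0, 1:] ^ m) + [:c':]"
proof -
  let ?p = "CHAR('a)"
  define V where "V = {v. (1, v) \<in> M}"
  define \<mu> where "\<mu> = fst ` M"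
  define q where "q = card V"
  define m where "m = card \<mu>"
  have finV: "finite V" unfolding V_def by (rule finite_subset[OF _ finite_imageI[OF M(1), of snd]]) force
  have fin\<mu>: "finite \<mu>" unfolding \<mu>_def using M(1) by simp
  have ev: "(\<alpha>, \<beta>) \<in> M \<longleftrightarrow> \<alpha> \<noteq> 0 \<and> (\<forall>x. poly g (\<alpha> * x + \<beta>) = poly g x)" for \<alpha> \<beta>
    unfolding M(3)
  proof (intro iffI conjI)
    assume a: "\<alpha> \<noteq> 0 \<and> pcompose g [:\<beta>, \<alpha>:] = g"
    show "\<forall>x. poly g (\<alpha> * x + \<beta>) = poly g x"
    proof
      fix x
      have "poly (pcompose g [:\<beta>, \<alpha>:]) x = poly g x" using a by simp
      then show "poly g (\<alpha> * x + \<beta>) = poly g x" by (simp add: poly_pcompose algebra_simps)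
    qed
  next
    assume a: "\<alpha> \<noteq> 0 \<and> (\<forall>x. poly g (\<alpha> * x + \<beta>) = poly g x)"
    show "pcompose g [:\<beta>, \<alpha>:] = g" by (rule poly_fun_eqI) (use a in \<open>simp add: poly_pcompose algebra_simps\<close>)
  qed auto
  have Vev: "v \<in> V \<longleftrightarrow> (\<forall>x. poly g (x + v) = poly g x)" for v by (simp add: V_def ev)
  have V0: "0 \<in> V" by (simp add: Vev)
  have Vdiff: "v - w \<in> V" if "v \<in> V" "w \<in> V" for v w
  proof -
    have "poly g (x + (v - w)) = poly g x" for x
      using that Vev[of v] Vev[of w] by (metis add.commute diff_add_cancel add_diff_eq)
    then show ?thesis by (simp add: Vev)
  qed
  have Vadd: "v + w \<in> V" if "v \<in> V" "w \<in> V" for v w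
    using Vdiff[OF that(1) Vdiff[OF V0 that(2)]] by simp
  have \<mu>V: "\<alpha> * v \<in> V" if \<alpha>\<mu>: "\<alpha> \<in> \<mu>" and vV: "v \<in> V" for \<alpha> v
  proof -
    obtain \<beta> where "(\<alpha>, \<beta>) \<in> M" using \<alpha>\<mu> by (auto simp: \<mu>_def)
    then have \<beta>: "\<alpha> \<noteq> 0" "\<And>x. poly g (\<alpha> * x + \<beta>) = poly g x" by (auto simp: ev)
    have "poly g (x + \<alpha> * v) = poly g x" for x
    proof -
      define s where "s = (x - \<beta>) / \<alpha>"
      have s: "x = \<alpha> * s + \<beta>" using \<beta>(1) by (simp add: s_def)
      have "poly g (x + \<alpha> * v) = poly g (\<alpha> * (s + v) + \<beta>)" by (simp add: s algebra_simps)
      also have "\<dots> = poly g x" using \<beta>(2) vV by (simp add: Vev s)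
      finally show ?thesis .
    qed
    then show ?thesis by (simp add: Vev)
  qed
  have \<mu>0: "\<alpha> \<noteq> 0" if "\<alpha> \<in> \<mu>" for \<alpha> using that by (auto simp: \<mu>_def ev)
  have \<mu>mult: "\<alpha> * \<alpha>' \<in> \<mu>" if \<alpha>s: "\<alpha> \<in> \<mu>" "\<alpha>' \<in> \<mu>" for \<alpha> \<alpha>'
  proof -
    obtain \<beta> \<beta>' where b: "(\<alpha>, \<beta>) \<in> M" "(\<alpha>', \<beta>') \<in> M" using \<alpha>s by (auto simp: \<mu>_def)
    have "poly g (\<alpha> * \<alpha>' * x + (\<alpha> * \<beta>' + \<beta>)) = poly g x" for x
    proof -
      have "poly g (\<alpha> * \<alpha>' * x + (\<alpha> * \<beta>' + \<beta>)) = poly g (\<alpha> * (\<alpha>' * x + \<beta>') + \<beta>)" by (simp add: algebra_simps)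
      then show ?thesis using b by (simp add: ev)
    qed
    then have "(\<alpha> * \<alpha>', \<alpha> * \<beta>' + \<beta>) \<in> M" using b by (simp add: ev)
    then show ?thesis unfolding \<mu>_def by force
  qed
  have one: "1 \<in> \<mu>" unfolding \<mu>_def using V0 V_def by force
  have m1: "m \<ge> 1" using fin\<mu> one by (auto simp: m_def Suc_le_eq card_gt_0_iff)
  have q1: "q \<ge> 1" using finV V0 by (auto simp: q_def Suc_le_eq card_gt_0_iff)
  \<comment> \<open>The affine maps with a given multiplier form a coset of V.\<close>
  have dqm: "d = q * m"
  proof -
    have "\<forall>\<alpha>\<in>\<mu>. \<exists>\<beta>. (\<alpha>, \<beta>) \<in> M" by (auto simp: \<mu>_def)
    then have "\<exists>b. \<forall>\<alpha>\<in>\<mu>. (\<alpha>, b \<alpha>) \<in> M" by (rule bchoice)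
    then obtain b where "\<forall>\<alpha>\<in>\<mu>. (\<alpha>, b \<alpha>) \<in> M" ..
    then have b: "\<And>\<alpha>. \<alpha> \<in> \<mu> \<Longrightarrow> (\<alpha>, b \<alpha>) \<in> M" by blast
    have "bij_betw (\<lambda>(\<alpha>, v). (\<alpha>, b \<alpha> + v)) (\<mu> \<times> V) M"
    proof (rule bij_betw_byWitness[where f' = "\<lambda>(\<alpha>, \<beta>). (\<alpha>, \<beta> - b \<alpha>)"])
      show "(\<lambda>(\<alpha>, v). (\<alpha>, b \<alpha> + v)) ` (\<mu> \<times> V) \<subseteq> M"
      proof clarify
        fix \<alpha> v assume "\<alpha> \<in> \<mu>" "v \<in> V"
        then have "poly g (\<alpha> * x + b \<alpha> + v) = poly g x" for x using b[of \<alpha>] by (simp add: ev Vev)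
        then show "(\<alpha>, b \<alpha> + v) \<in> M" using \<mu>0[OF \<open>\<alpha> \<in> \<mu>\<close>] by (simp add: ev add.assoc)
      qed
      show "(\<lambda>(\<alpha>, \<beta>). (\<alpha>, \<beta> - b \<alpha>)) ` M \<subseteq> \<mu> \<times> V"
      proof clarify
        fix \<alpha> \<beta> assume a: "(\<alpha>, \<beta>) \<in> M"
        then have \<alpha>: "\<alpha> \<in> \<mu>" unfolding \<mu>_def by force
        have "poly g (x + (\<beta> - b \<alpha>)) = poly g x" for x
        proof -
          define s where "s = (x - b \<alpha>) / \<alpha>"
          have s: "x = \<alpha> * s + b \<alpha>" using \<mu>0[OF \<alpha>] by (simp add: s_def)
          have "poly g (x + (\<beta> - b \<alpha>)) = poly g (\<alpha> * s + \<beta>)" by (simp add: s)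
          then show ?thesis using a b[OF \<alpha>] by (simp add: ev s)
        qed
        then show "\<alpha> \<in> \<mu> \<and> \<beta> - b \<alpha> \<in> V" using \<alpha> by (simp add: Vev)
      qed
    qed auto
    then show ?thesis using M(2) bij_betw_same_card[of _ "\<mu> \<times> V" M] by (simp add: card_cartesian_product q_def m_def mult.commute)
  qed
  \<comment> \<open>Multiplication by \<alpha> permutes \<mu>; compare the products of all
    elements.\<close>
  have pow_m: "\<alpha> ^ m = 1" if a: "\<alpha> \<in> \<mu>" for \<alpha>
  proof -
    have inj: "inj_on ((*) \<alpha>) \<mu>" using \<mu>0[OF a] by (auto simp: inj_on_def)
    have im: "(*) \<alpha> ` \<mu> = \<mu>" by (rule endo_inj_surj[OF fin\<mu> _ inj]) (use \<mu>mult a in auto)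
    have "prod (\<lambda>x. x) \<mu> = prod (\<lambda>x. x) ((*) \<alpha> ` \<mu>)" by (simp only: im)
    also have "\<dots> = (\<Prod>x\<in>\<mu>. \<alpha> * x)" by (subst prod.reindex[OF inj]) simp
    also have "\<dots> = \<alpha> ^ m * prod (\<lambda>x. x) \<mu>" by (simp add: prod.distrib m_def)
    finally show ?thesis using \<mu>0 fin\<mu> by auto
  qed
  have pow_bound: "m \<le> r" if "r > 0" "\<And>\<alpha>. \<alpha> \<in> \<mu> \<Longrightarrow> \<alpha> ^ r = 1" for r
  proof -
    have ne: "monom 1 r - 1 \<noteq> (0 :: 'a poly)"
    proof
      assume "monom 1 r - 1 = (0 :: 'a poly)"
      then have "coeff (monom 1 r - 1 :: 'a poly) 0 = 0" by simp
      then show False using that(1) by (simp add: coeff_monom)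
    qed
    have "card \<mu> \<le> card {x. poly (monom 1 r - 1 :: 'a poly) x = 0}"
      by (rule card_mono[OF poly_roots_finite[OF ne]]) (use that(2) in \<open>auto simp: poly_monom\<close>)
    also have "\<dots> \<le> degree (monom 1 r - 1 :: 'a poly)" by (rule card_poly_roots_bound[OF ne])
    also have "\<dots> \<le> r" by (intro degree_diff_le) (auto simp: degree_monom_eq)
    finally show ?thesis by (simp add: m_def)
  qed
  \<comment> \<open>If p divided m, the exponent m/p would already kill \<mu>, since 1 is the only
    p-th root of 1 in characteristic p.\<close>
  have pm: "\<not> ?p dvd m"
  proof
    assume "?p dvd m"
    then obtain r where r: "m = ?p * r" by (rule dvdE)
    then have pr: "Factorial_Ring.prime ?p" and r0: "r > 0" using m1 by (auto intro!: prime_CHAR_semidom)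
    have "\<alpha> ^ r = 1" if a: "\<alpha> \<in> \<mu>" for \<alpha>
    proof -
      have "(\<alpha> ^ r - 1 + 1) ^ ?p = (\<alpha> ^ r - 1) ^ ?p + 1 ^ ?p" by (rule freshmans_dream[OF pr refl])
      moreover have "(\<alpha> ^ r) ^ ?p = 1" using pow_m[OF a] r by (metis mult.commute power_mult)
      ultimately have "(\<alpha> ^ r - 1) ^ ?p = 0" by simp
      then show ?thesis by simp
    qed
    then have "m \<le> r" using pow_bound r0 by blast
    then show False using r r0 prime_ge_2_nat[OF pr] by (metis less_le_not_le mult.commute n_less_n_mult_m numeral_2_eq_2 Suc_le_eq One_nat_def)
  qed
  \<comment> \<open>Multiplication by \<alpha> also permutes the nonzero elements of V. This gives m
    dvd q - 1.\<close>
  have pow_q: "\<alpha> ^ (q - 1) = 1" if a: "\<alpha> \<in> \<mu>" for \<alpha>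
  proof -
    have inj: "inj_on ((*) \<alpha>) (V - {0})" using \<mu>0[OF a] by (auto simp: inj_on_def)
    have im: "(*) \<alpha> ` (V - {0}) = V - {0}" by (rule endo_inj_surj[OF _ _ inj]) (use \<mu>V a \<mu>0 finV in auto)
    have "prod (\<lambda>x. x) (V - {0}) = prod (\<lambda>x. x) ((*) \<alpha> ` (V - {0}))" by (simp only: im)
    also have "\<dots> = (\<Prod>x\<in>V - {0}. \<alpha> * x)" by (subst prod.reindex[OF inj]) simp
    also have "\<dots> = \<alpha> ^ (q - 1) * prod (\<lambda>x. x) (V - {0})" using finV V0 by (simp add: prod.distrib q_def)
    finally show ?thesis using finV by auto
  qed
  have m_dvd: "m dvd r" if "\<And>\<alpha>. \<alpha> \<in> \<mu> \<Longrightarrow> \<alpha> ^ r = 1" for r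
  proof (rule ccontr)
    assume "\<not> m dvd r"
    then have "r mod m > 0" by (simp add: dvd_eq_mod_eq_0)
    moreover have "\<alpha> ^ (r mod m) = 1" if a: "\<alpha> \<in> \<mu>" for \<alpha>
    proof -
      have "\<alpha> ^ (m * (r div m)) = 1" using pow_m[OF a] by (simp add: power_mult)
      then show ?thesis using \<open>\<And>\<alpha>. \<alpha> \<in> \<mu> \<Longrightarrow> \<alpha> ^ r = 1\<close>[OF a] by (metis mult_div_mod_eq mult_1 power_add)
    qed
    ultimately have "m \<le> r mod m" using pow_bound by blast
    then show False using m1 mod_less_divisor[of m r] by linarith
  qed
  define L where "L = (\<Prod>v\<in>V. [:- v, 1:])"
  have pL: "poly L x = (\<Prod>v\<in>V. x - v)" for x by (simp add: L_def poly_prod)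
  have dL: "degree L = q" unfolding L_def q_def by (rule degree_prod_linear[OF finV])
  have lL: "coeff L q = 1" unfolding L_def q_def by (rule lead_prod_linear[OF finV])
  have Lroot: "poly L v = 0" if "v \<in> V" for v unfolding pL using that finV by auto
  have Linv: "poly L (x + v) = poly L x" if v: "v \<in> V" for x v
  proof -
    have "bij_betw (\<lambda>w. w + v) V V"
      by (rule bij_betw_byWitness[where f' = "\<lambda>w. w - v"]) (use v Vadd Vdiff in auto)
    then have "(\<Prod>w\<in>V. x + v - w) = (\<Prod>w\<in>V. x + v - (w + v))"
      using prod.reindex_bij_betw[of "\<lambda>w. w + v" V V "\<lambda>w. x + v - w"] by simp
    then show ?thesis by (simp add: pL)
  qed
  \<comment> \<open>L(x + w) and L(x) + L(w) are monic of degree q in x and agree at the q points of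
    V.\<close>
  have Ladd: "poly L (x + w) = poly L x + poly L w" for x w
  proof -
    have "pcompose L [:w, 1:] = L + [:poly L w:]"
    proof (rule poly_eqI_degree_lead_coeff[where n = q and A = V])
      show "coeff (pcompose L [:w, 1:]) q = coeff (L + [:poly L w:]) q"
        using coeff_pcompose_affine[of L q w 1 q] dL lL q1 by (cases q) auto
      show "q \<le> card V" by (simp add: q_def)
      show "degree (pcompose L [:w, 1:]) \<le> q" using degree_pcompose[of L "[:w, 1:]"] dL by simp
      show "degree (L + [:poly L w:]) \<le> q" using dL by (intro degree_add_le) auto
      show "poly (pcompose L [:w, 1:]) z = poly (L + [:poly L w:]) z" if "z \<in> V" for z
        using Linv[OF that, of w] Lroot[OF that] by (simp add: poly_pcompose)
    qed
    then have "poly (pcompose L [:w, 1:]) x = poly (L + [:poly L w:]) x" by simp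
    then show ?thesis by (simp add: poly_pcompose add.commute)
  qed
  have supp: "\<exists>i. j = ?p ^ i" if "coeff L j \<noteq> 0" for j by (rule additive_poly_support[OF Ladd that])
  then obtain e where e: "q = ?p ^ e" using lL by (metis zero_neq_one)
  have Lscale: "poly L (\<alpha> * x) = \<alpha> * poly L x" if a: "\<alpha> \<in> \<mu>" for \<alpha> x
  proof -
    have inj: "inj_on ((*) \<alpha>) V" using \<mu>0[OF a] by (auto simp: inj_on_def)
    have im: "(*) \<alpha> ` V = V" by (rule endo_inj_surj[OF finV _ inj]) (use \<mu>V a in auto)
    have "poly L (\<alpha> * x) = (\<Prod>v\<in>(*) \<alpha> ` V. \<alpha> * x - v)" by (simp only: im pL)
    also have "\<dots> = (\<Prod>v\<in>V. \<alpha> * (x - v))" by (subst prod.reindex[OF inj]) (simp add: right_diff_distrib)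
    also have "\<dots> = \<alpha> ^ q * poly L x" by (simp add: prod.distrib pL q_def)
    also have "\<alpha> ^ q = \<alpha>" using pow_q[OF a] q1 by (cases q) auto
    finally show ?thesis .
  qed
  \<comment> \<open>L commutes with scaling by \<alpha>, so a nonzero coefficient in degree j forces
    \<alpha> ^ j = \<alpha> on all of \<mu>.\<close>
  have supp_m: "m dvd j - 1" if "coeff L j \<noteq> 0" for j
  proof (rule m_dvd)
    fix \<alpha> assume a: "\<alpha> \<in> \<mu>"
    have "pcompose L [:0, \<alpha>:] = smult \<alpha> L"
      by (rule poly_fun_eqI) (use Lscale[OF a] in \<open>simp add: poly_pcompose mult.commute\<close>)
    then have "\<alpha> ^ j * coeff L j = \<alpha> * coeff L j" by (metis coeff_pcompose_linear coeff_smult)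
    then have "\<alpha> ^ j = \<alpha>" using that by simp
    moreover have "j \<noteq> 0" using Lroot[OF V0] that by (metis poly_0_coeff_0)
    ultimately show "\<alpha> ^ (j - 1) = 1" using \<mu>0[OF a] by (cases j) auto
  qed
  define a where "a i = coeff L (?p ^ i)" for i
  \<comment> \<open>In characteristic 0, q = 0 ^ e is positive only for e = 0.\<close>
  have p_cases: "(?p = 0 \<and> e = 0) \<or> ?p \<ge> 2"
    using e q1 prime_ge_2_nat prime_CHAR_semidom by (cases "?p = 0"; cases e) auto
  have Lsum: "L = (\<Sum>i\<in>{i. i \<le> e \<and> m dvd ?p ^ i - 1}. monom (a i) (?p ^ i))"
  proof (rule poly_eqI)
    fix j
    let ?I = "{i. i \<le> e \<and> m dvd ?p ^ i - 1}"
    have c: "coeff (\<Sum>i\<in>?I. monom (a i) (?p ^ i)) j = (\<Sum>i\<in>?I. if ?p ^ i = j then coeff L j else 0)"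
      unfolding coeff_sum by (rule sum.cong) (auto simp: coeff_monom a_def)
    show "coeff L j = coeff (\<Sum>i\<in>?I. monom (a i) (?p ^ i)) j"
    proof (cases "coeff L j = 0")
      case True
      then show ?thesis unfolding c by (simp add: sum.neutral)
    next
      case False
      obtain i where i0: "j = ?p ^ i" using supp[OF False] by blast
      have jq: "j \<le> q" using le_degree[OF False] dL by simp
      obtain i where i: "j = ?p ^ i" "i \<le> e"
      proof (cases "?p = 0")
        case True
        then have "q = 1" using p_cases e by auto
        moreover have "j \<noteq> 0" using Lroot[OF V0] False by (metis poly_0_coeff_0)
        ultimately have "j = ?p ^ 0" using jq by simp
        then show ?thesis using that by blast
      next
        case pn: False
        then have "i \<le> e" using p_cases jq i0 e power_le_imp_le_exp[of ?p i e] by auto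
        then show ?thesis using that i0 by blast
      qed
      have uniq: "i' = i" if "?p ^ i' = j" "i' \<le> e" for i'
        using p_cases that i power_inject_exp[of ?p i' i] by auto
      have "(\<Sum>i'\<in>?I. if ?p ^ i' = j then coeff L j else 0) = (\<Sum>i'\<in>{i}. coeff L j)"
      proof (rule sum.mono_neutral_cong_right)
        show "finite ?I" by (rule finite_subset[of _ "{..e}"]) auto
        show "{i} \<subseteq> ?I" using i(2) supp_m[OF False] unfolding i(1) by simp
        show "\<forall>i'\<in>?I - {i}. (if ?p ^ i' = j then coeff L j else 0) = 0" using uniq by auto
        show "(if ?p ^ i' = j then coeff L j else 0) = coeff L j" if "i' \<in> {i}" for i'
          using that i(1) by simp
      qed
      then show ?thesis unfolding c by simp
    qed
  qed
  obtain G where G: "g = pcompose G L"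
  proof -
    have "\<exists>G. g = pcompose G L"
      by (rule invariant_poly_factor[OF finV V0 Vdiff L_def Linv]) (simp_all add: Vev)
    then show ?thesis using that by (elim exE)
  qed
  have dG: "degree G = m"
  proof -
    have "degree G * q = m * q" using degree_pcompose[of G L] d(1) by (simp add: G dL dqm mult.commute)
    then show ?thesis using q1 by simp
  qed
  have surj: "\<exists>x. poly L x = s" for s
  proof -
    have "degree (L + [:- s:]) > 0" using dL q1 by (subst degree_add_eq_left) auto
    then obtain x where "poly (L + [:- s:]) x = 0" using alg_closed_imp_poly_has_root by blast
    then show ?thesis by (intro exI[of _ x]) simp
  qed
  \<comment> \<open>On s = L(x) the map x \<mapsto> \<alpha> x + \<beta> acts as s \<mapsto>
    \<alpha> s + L(\<beta>), and every s is of this form.\<close>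
  have Ginv: "\<exists>\<beta>. pcompose G [:\<beta>, \<alpha>:] = G" if \<alpha>: "\<alpha> \<in> \<mu>" for \<alpha>
  proof -
    obtain \<beta> where \<beta>: "(\<alpha>, \<beta>) \<in> M" using \<alpha> by (auto simp: \<mu>_def)
    have "pcompose G [:poly L \<beta>, \<alpha>:] = G"
    proof (rule poly_fun_eqI)
      fix s
      obtain x where x: "poly L x = s" using surj by blast
      have "poly g (\<alpha> * x + \<beta>) = poly g x" using \<beta> by (simp add: ev)
      then have "poly G (poly L (\<alpha> * x + \<beta>)) = poly G s" using x by (simp add: G poly_pcompose)
      then show "poly (pcompose G [:poly L \<beta>, \<alpha>:]) s = poly G s"
        using Ladd Lscale[OF \<alpha>] x by (simp add: poly_pcompose add.commute mult.commute)
    qed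
    then show ?thesis by blast
  qed
  have mk: "of_nat m \<noteq> (0::'a)" using pm by (simp add: of_nat_eq_0_iff_char_dvd)
  obtain t0 c c' where t0: "c \<noteq> 0" "G = smult c ([:- t0, 1:] ^ m) + [:c':]"
    using centered_power[OF dG m1 mk fin\<mu> _ Ginv] by (metis m_def order_refl)
  obtain y0 where y0: "poly L y0 = t0" using surj by blast
  have gform: "g = smult c (pcompose L [:- y0, 1:] ^ m) + [:c':]"
  proof (rule poly_fun_eqI)
    fix x
    have "poly L (x - y0) = poly L x - t0" using Ladd[of "x - y0" y0] y0 by simp
    then show "poly g x = poly (smult c (pcompose L [:- y0, 1:] ^ m) + [:c':]) x"
      by (simp add: G t0(2) poly_pcompose)
  qed
  \<comment> \<open>0 is a simple root of L, so the linear coefficient is the product of the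
    negatives of the other roots.\<close>
  have a0: "a 0 \<noteq> 0"
  proof -
    have "L = [:0, 1:] * (\<Prod>v\<in>V - {0}. [:- v, 1:])"
      unfolding L_def using prod.remove[OF finV V0, of "\<lambda>v. [:- v, 1:]"] by simp
    then have "coeff L 1 = coeff (\<Prod>v\<in>V - {0}. [:- v, 1:]) 0" by simp
    also have "\<dots> = (\<Prod>v\<in>V - {0}. - v)" by (simp add: poly_0_coeff_0[symmetric] poly_prod)
    also have "\<dots> \<noteq> 0" using finV by auto
    finally show ?thesis by (simp add: a_def)
  qed
  show ?thesis
  proof (rule that[of e m a c y0 c'])
    show "d = ?p ^ e * m" using dqm e by simp
    show "m dvd ?p ^ e - 1" using m_dvd[of "q - 1"] pow_q e by simp
    show "a e \<noteq> 0" using lL e by (simp add: a_def)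
    show "g = smult c (pcompose (\<Sum>i\<in>{i. i \<le> e \<and> m dvd ?p ^ i - 1}. monom (a i) (?p ^ i)) [:- y0, 1:] ^ m) + [:c':]"
      using gform Lsum by simp
  qed (use pm a0 t0(1) in auto)
qed

section \<open>Curves with an inner and an outer Galois point: the action on the projections\<close>

lemma eval3_axis:
  fixes G :: "'a::field poly3"
  assumes "homogeneous n G"
  shows "eval3 G (axis 1 1) = coeff (coeff (coeff G n) 0) 0"
    and "eval3 G (axis 2 1) = coeff (coeff (coeff G 0) n) 0"
proof -
  have z: "coeff (coeff (coeff G i) j) l = 0" if "i + j + l \<noteq> n" for i j l
    using assms that by (auto simp: homogeneous_def)
  have one: "[:1:] = (1 :: 'c poly)" for dummy :: "'c::comm_ring_1" by (simp add: one_pCons)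
  have p1: "poly p 1 = (\<Sum>i\<le>degree p. coeff p i)" for p :: "'c::comm_ring_1 poly"
    by (simp add: poly_altdef)
  have "eval3 G (axis 1 1) = (\<Sum>i\<le>degree G. coeff (coeff (coeff G i) 0) 0)"
    by (simp add: eval3_def axis_def one p1 poly_0_coeff_0 coeff_sum)
  also have "\<dots> = (\<Sum>i\<in>(if n \<le> degree G then {n} else {}). coeff (coeff (coeff G i) 0) 0)"
    by (rule sum.mono_neutral_right) (use z in \<open>auto split: if_splits\<close>)
  finally show "eval3 G (axis 1 1) = coeff (coeff (coeff G n) 0) 0"
    by (auto simp: coeff_eq_0 split: if_splits)
  have "eval3 G (axis 2 1) = (\<Sum>j\<le>degree (coeff G 0). coeff (coeff (coeff G 0) j) 0)"
    by (simp add: eval3_def axis_def one p1 poly_0_coeff_0 coeff_sum)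
  also have "\<dots> = (\<Sum>j\<in>(if n \<le> degree (coeff G 0) then {n} else {}). coeff (coeff (coeff G 0) j) 0)"
    by (rule sum.mono_neutral_right) (use z in \<open>auto split: if_splits\<close>)
  finally show "eval3 G (axis 2 1) = coeff (coeff (coeff G 0) n) 0"
    by (auto simp: coeff_eq_0 split: if_splits)
qed

lemma degree_homogeneous_le:
  assumes "homogeneous n G" shows "degree G \<le> n"
proof (rule degree_le, intro allI impI)
  fix i assume "n < i"
  then have "coeff (coeff (coeff G i) j) l = 0" for j l
    using assms[unfolded homogeneous_def, rule_format, of i j l] by linarith
  then show "coeff G i = 0" by (intro poly_eqI) simp
qed

lemma total_degree_le:
  assumes "\<And>i j. coeff (coeff f i) j \<noteq> 0 \<Longrightarrow> i + j \<le> n"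
  shows "total_degree f \<le> n"
proof -
  have "finite {i + j | i j. coeff (coeff f i) j \<noteq> 0}"
    by (rule finite_subset[of _ "{..n}"]) (use assms in auto)
  then show ?thesis unfolding total_degree_def using assms by (intro Max.boundedI) auto
qed

definition swap12 :: "'a::field^3^3" where
  "swap12 = vector [vector [0, 1, 0], vector [1, 0, 0], vector [0, 0, 1]]"

lemma invertible_swap12: "invertible swap12"
proof -
  have "swap12 ** swap12 = (mat 1 :: 'a::field^3^3)"
    by (simp add: swap12_def matrix_matrix_mult_def mat_def vec_eq_iff forall_3 sum_3 vector_3)
  then show ?thesis unfolding invertible_def by blast
qed

lemma mv_swap12:
  "rhom h \<Longrightarrow> mv h swap12 w $ 1 = w $ 2" "rhom h \<Longrightarrow> mv h swap12 w $ 2 = w $ 1" "rhom h \<Longrightarrow> mv h swap12 w $ 3 = w $ 3"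
  by (simp_all add: mv_def swap12_def sum_3 vector_3 rhom_0 rhom_1)

context gcurve
begin

lemma ratf_coprime:
  assumes "z \<in> ratf t"
  obtains a b where "z = evp gconst t a / evp gconst t b" "evp gconst t b \<noteq> 0" "\<forall>c. poly b c = 0 \<longrightarrow> poly a c \<noteq> 0"
proof -
  have "\<exists>a b. z = evp gconst t a / evp gconst t b \<and> evp gconst t b \<noteq> 0 \<and> (\<forall>c. poly b c = 0 \<longrightarrow> poly a c \<noteq> 0)"
    if "z = evp gconst t a0 / evp gconst t b0" "evp gconst t b0 \<noteq> 0" for a0 b0
    using that
  proof (induct "degree b0" arbitrary: a0 b0 rule: less_induct)
    case less
    show ?case
    proof (cases "\<exists>c. poly b0 c = 0 \<and> poly a0 c = 0")
      case False
      then show ?thesis using less(2,3) by (intro exI[of _ a0] exI[of _ b0]) blast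
    next
      case True
      then obtain c where "poly b0 c = 0" "poly a0 c = 0" by blast
      then obtain a1 b1 where ab: "b0 = [:- c, 1:] * b1" "a0 = [:- c, 1:] * a1" by (metis dvdE poly_eq_0_iff_dvd)
      have r: "evp gconst t ([:- c, 1:] * p) = evp gconst t [:- c, 1:] * evp gconst t p" for p
        by (rule rhom_mult[OF rhom_evp[OF rhom_gconst]])
      have nz: "evp gconst t [:- c, 1:] \<noteq> 0" "evp gconst t b1 \<noteq> 0" using less(3) unfolding ab r by auto
      have "b1 \<noteq> 0" using nz(2) by (auto simp: evp_0)
      then have "degree b1 < degree b0" unfolding ab by (subst degree_mult_eq) auto
      moreover have "z = evp gconst t a1 / evp gconst t b1" using less(2) nz(1) unfolding ab r by simp
      ultimately show ?thesis using less(1) nz(2) by blast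
    qed
  qed
  then show ?thesis using assms that unfolding ratf_def by blast
qed

lemma kaut_ee:
  assumes k: "ff.kaut \<tau>" and ab: "a \<in> S" "b \<in> S"
  shows "\<tau> (evp (evp gconst b) a q) = evp (evp gconst (\<tau> b)) (\<tau> a) q"
proof -
  have S: "evp (evp gconst b) a q \<in> S" for q
    by (induct q) (auto simp: evp_0 evp_pCons rhom_evp rhom_gconst intro!: add_S mult_S ab ff.S_evp)
  show ?thesis
    by (induct q) (auto simp: evp_0 evp_pCons rhom_evp rhom_gconst ff.kaut_D[OF k] ff.kaut_evp[OF k] S ab ff.S_evp mult_S)
qed

text \<open>Independence of the powers of x, extended from k[y] to k(y) by the common denominator
  D.\<close>

lemma ratf_ee_zero:
  assumes q: "\<And>i. coeff q i \<in> ratf vy" "degree q < degree F" "poly q vx = 0"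
  shows "q = 0"
proof -
  let ?n = "degree F"
  have "\<forall>i. \<exists>a b. coeff q i = ey a / ey b \<and> ey b \<noteq> 0" using q(1) unfolding ratf_def by blast
  then obtain a b where ab: "\<And>i. coeff q i = ey (a i) / ey (b i)" "\<And>i. ey (b i) \<noteq> 0" by metis
  define D where "D = (\<Prod>i<?n. b i)"
  have D0: "ey D \<noteq> 0" unfolding D_def rhom_prod[OF rhom_ey] using ab(2) by simp
  define g where "g = (\<Sum>i<?n. monom (a i * (\<Prod>j\<in>{..<?n} - {i}. b j)) i)"
  have e: "ey (a i * (\<Prod>j\<in>{..<?n} - {i}. b j)) = ey D * coeff q i" if "i < ?n" for i
  proof -
    have "ey D = ey (b i) * ey (\<Prod>j\<in>{..<?n} - {i}. b j)"
      unfolding D_def rhom_mult[OF rhom_ey, symmetric] using that by (simp add: prod.remove[of "{..<?n}" i])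
    then show ?thesis using ab[of i] by (simp add: rhom_mult[OF rhom_ey])
  qed
  have "ee g = (\<Sum>i<?n. ey D * coeff q i * vx ^ i)"
    unfolding g_def rhom_sum[OF rhom_ee] by (rule sum.cong) (simp_all add: ee_def evp_monom rhom_ey e)
  also have "\<dots> = ey D * (\<Sum>i<?n. coeff q i * vx ^ i)" by (simp add: sum_distrib_left mult.assoc)
  also have "(\<Sum>i<?n. coeff q i * vx ^ i) = poly q vx"
    unfolding poly_altdef by (rule sum.mono_neutral_right) (use q(2) in \<open>auto simp: coeff_eq_0\<close>)
  finally have "ee g = 0" using q(3) by simp
  moreover have "degree g < ?n"
  proof -
    have "degree g \<le> ?n - 1" unfolding g_def
      by (intro degree_sum_le) (auto intro!: order.trans[OF degree_monom_le])
    then show ?thesis using degree_F by simp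
  qed
  ultimately have g0: "g = 0" by (rule ee_zero_degree)
  show ?thesis
  proof (rule poly_eqI)
    fix i
    show "coeff q i = coeff 0 i"
    proof (cases "i < ?n")
      case True
      have "coeff g i = a i * (\<Prod>j\<in>{..<?n} - {i}. b j)" using True by (simp add: g_def coeff_sum coeff_monom)
      then have "ey (a i * (\<Prod>j\<in>{..<?n} - {i}. b j)) = ey 0" unfolding g0 by (simp only: coeff_0)
      then have "ey D * coeff q i = 0" using e[OF True] by (simp only: evp_0)
      then show ?thesis using D0 by simp
    next
      case False
      then show ?thesis using q(2) by (simp add: coeff_eq_0)
    qed
  qed
qed

text \<open>The conjugates of x over k(y): the orbit of x under the automorphisms that fix
  y.\<close>

definition Cy :: "'a generic_field set" where "Cy = {\<tau> vx | \<tau>. ff.kaut \<tau> \<and> \<tau> vy = vy}"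

lemma Cy_S: "Cy \<subseteq> S" using ff.kaut_D(1) vx_S by (auto simp: Cy_def)

lemma ey_inj: "ey p = ey q \<longleftrightarrow> p = q"
  using ey_zero[of "p - q"] by (auto simp: rhom_diff[OF rhom_ey])

lemma ey_eq_0: "ey p = 0 \<longleftrightarrow> p = 0"
  using ey_zero[of p] by (auto simp: evp_0)

lemma Cy_root: "c \<in> Cy \<Longrightarrow> evp ey c (dehom F) = 0"
proof -
  assume "c \<in> Cy"
  then obtain \<tau> where \<tau>: "ff.kaut \<tau>" "\<tau> vy = vy" "c = \<tau> vx" by (auto simp: Cy_def)
  show ?thesis using kaut_ee[OF \<tau>(1) vx_S vy_S, of "dehom F"] ee_dehom_F ff.kaut_D(6)[OF \<tau>(1)] \<tau> by (simp add: ee_def)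
qed

lemma Cy_finite: "finite Cy" "card Cy \<le> degree F"
proof -
  let ?p = "map_poly ey (dehom F)"
  have deg: "degree ?p = degree F"
    using degree_dehom_F by (subst degree_map_poly) (auto simp: ey_eq_0)
  then have nz: "?p \<noteq> 0" using degree_F by auto
  have sub: "Cy \<subseteq> {c. poly ?p c = 0}" using Cy_root by (auto simp: evp_def[of ey])
  show "finite Cy" by (rule finite_subset[OF sub poly_roots_finite[OF nz]])
  have "card Cy \<le> card {c. poly ?p c = 0}" by (rule card_mono[OF poly_roots_finite[OF nz] sub])
  then show "card Cy \<le> degree F" using card_poly_roots_bound[OF nz] deg by simp
qed

lemma kaut_prod_linear:
  assumes k: "ff.kaut \<tau>" and A: "finite A" "A \<subseteq> S"
  shows "(\<forall>i. coeff (\<Prod>c\<in>A. [:- c, 1:]) i \<in> S \<and>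
     \<tau> (coeff (\<Prod>c\<in>A. [:- c, 1:]) i) = coeff (\<Prod>c\<in>A. [:- \<tau> c, 1:]) i)"
  using A
proof (induct A)
  case empty
  show ?case using ff.kaut_D(6,7)[OF k] by (auto simp: coeff_1)
next
  case (insert c A)
  let ?p = "\<Prod>c\<in>A. [:- c, 1:]" and ?p' = "\<Prod>c\<in>A. [:- \<tau> c, 1:]"
  have IH: "coeff ?p i \<in> S" "\<tau> (coeff ?p i) = coeff ?p' i" for i
    using insert by auto
  have cS: "c \<in> S" using insert by auto
  have e: "coeff ([:- u, 1:] * p) i = (case i of 0 \<Rightarrow> 0 | Suc j \<Rightarrow> coeff p j) - u * coeff p i"
    for u :: "'a generic_field" and p i by (cases i) simp_all
  show ?case
    unfolding prod.insert[OF insert(1,2)] e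
  proof (intro allI conjI)
    fix i
    show "(case i of 0 \<Rightarrow> 0 | Suc j \<Rightarrow> coeff ?p j) - c * coeff ?p i \<in> S"
      using IH cS by (cases i) (auto intro!: ff.S_diff ff.S_minus mult_S)
    show "\<tau> ((case i of 0 \<Rightarrow> 0 | Suc j \<Rightarrow> coeff ?p j) - c * coeff ?p i) =
      (case i of 0 \<Rightarrow> 0 | Suc j \<Rightarrow> coeff ?p' j) - \<tau> c * coeff ?p' i"
      using IH cS by (cases i) (auto simp: ff.kaut_D[OF k] mult_S)
  qed
qed

text \<open>The product of all T - c over the orbit has coefficients fixed by the group, hence in
  k(y), and x is a root of it. A smaller orbit would contradict the independence of the powers of
  x.\<close>

lemma Cy_card:
  assumes fixP: "\<And>z. z \<in> S \<Longrightarrow> (\<And>\<tau>. ff.kaut \<tau> \<Longrightarrow> \<tau> vy = vy \<Longrightarrow> \<tau> z = z) \<Longrightarrow> z \<in> ratf vy"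
  shows "card Cy = degree F"
proof (rule ccontr)
  assume "card Cy \<noteq> degree F"
  then have lt: "card Cy < degree F" using Cy_finite(2) by simp
  let ?q = "\<Prod>c\<in>Cy. [:- c, 1:]"
  have deg: "degree ?q = card Cy" by (rule degree_prod_linear[OF Cy_finite(1)])
  have "coeff ?q i \<in> ratf vy" for i
  proof (rule fixP)
    show "coeff ?q i \<in> S" using kaut_prod_linear[OF kaut_id Cy_finite(1) Cy_S] by blast
    fix \<tau> assume \<tau>: "ff.kaut \<tau>" "\<tau> vy = vy"
    have inj: "inj_on \<tau> Cy" using ff.kaut_D(5)[OF \<tau>(1)] Cy_S by (auto simp: inj_on_def)
    have "\<tau> ` Cy \<subseteq> Cy"
    proof
      fix c assume "c \<in> \<tau> ` Cy"
      then obtain \<rho> where \<rho>: "ff.kaut \<rho>" "\<rho> vy = vy" "c = \<tau> (\<rho> vx)" by (auto simp: Cy_def)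
      have "ff.kaut (\<tau> \<circ> \<rho>)" by (rule ff.kaut_comp[OF \<tau>(1) \<rho>(1)])
      then show "c \<in> Cy" unfolding Cy_def using \<rho> \<tau>(2) by (intro CollectI exI[of _ "\<tau> \<circ> \<rho>"]) simp
    qed
    then have im: "\<tau> ` Cy = Cy" by (rule endo_inj_surj[OF Cy_finite(1) _ inj])
    have "\<tau> (coeff ?q i) = coeff (\<Prod>c\<in>Cy. [:- \<tau> c, 1:]) i"
      using kaut_prod_linear[OF \<tau>(1) Cy_finite(1) Cy_S] by blast
    also have "(\<Prod>c\<in>Cy. [:- \<tau> c, 1:]) = (\<Prod>c\<in>\<tau> ` Cy. [:- c, 1:])" by (subst prod.reindex[OF inj]) simp
    also have "\<dots> = ?q" by (simp only: im)
    finally show "\<tau> (coeff ?q i) = coeff ?q i" .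
  qed
  moreover have "vx \<in> Cy" unfolding Cy_def using kaut_id by (intro CollectI exI[of _ id]) simp
  then have "poly ?q vx = 0" unfolding poly_prod using Cy_finite(1) by auto
  ultimately have "?q = 0" using ratf_ee_zero[of ?q] deg lt by simp
  then show False using Cy_finite(1) by (auto simp: prod_zero_iff)
qed

lemma ey_pcompose: "ey (pcompose q p) = evp gconst (ey p) q"
  by (rule evp_pcompose[OF rhom_gconst])

lemma ey_affine_roots:
  assumes "0 < degree g"
  shows "finite {z. evp gconst z g = ey g}" "card {z. evp gconst z g = ey g} \<le> degree g"
proof -
  let ?q = "map_poly gconst g - [:ey g:]"
  have c: "coeff ?q (degree g) = gconst (lead_coeff g)"
    using assms by (cases "degree g") (simp_all add: coeff_map_poly rhom_0[OF rhom_gconst])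
  have "gconst (lead_coeff g) \<noteq> gconst 0" using assms rhom_inj[OF rhom_gconst] by auto
  then have q0: "?q \<noteq> 0" using c rhom_0[OF rhom_gconst] by (metis coeff_0)
  have r: "poly ?q z = 0 \<longleftrightarrow> evp gconst z g = ey g" for z by (simp add: evp_def[of gconst z])
  have "degree ?q \<le> degree g" by (intro degree_diff_le) (auto intro: map_poly_degree_leq)
  then show "finite {z. evp gconst z g = ey g}" "card {z. evp gconst z g = ey g} \<le> degree g"
    using poly_roots_finite[OF q0] card_poly_roots_bound[OF q0] unfolding r by auto
qed

text \<open>Exchanging X and Y turns the statements about S over k(y) into statements about S over
  k(x), without new proofs.\<close>

lemma swapped:
  obtains F' v' where "gcurve F' d v'" "gcurve.S F' v' = S" "gcurve.vx v' = vy" "gcurve.vy v' = vx"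
    "eval3 F (axis 2 1) \<noteq> 0 \<Longrightarrow> degree F' = d"
proof -
  let ?F = "subst3 swap12 F" and ?v = "mv gconst (matrix_inv swap12) v"
  note g = gcurve_change[OF invertible_swap12]
  interpret g2: gcurve ?F d ?v by (rule g(1))
  have "mv gconst swap12 ?v = v" by (rule mv_inverse(1)[OF rhom_gconst invertible_swap12])
  then have v: "?v $ 2 = v $ 1" "?v $ 1 = v $ 2" "?v $ 3 = v $ 3"
    using mv_swap12[OF rhom_gconst, of ?v] by auto
  show ?thesis
  proof (rule that[OF g])
    show "g2.vx = vy" "g2.vy = vx" by (simp_all add: g2.vx_def g2.vy_def vx_def vy_def v)
    assume nz: "eval3 F (axis 2 1) \<noteq> 0"
    have "swap12 *v axis 1 1 = (axis 2 1 :: 'a^3)"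
      by (simp add: swap12_def matrix_vector_mult_def axis_def vec_eq_iff forall_3 sum_3 vector_3)
    then have "eval3 ?F (axis 1 1) \<noteq> 0" using nz by (simp add: eval3_subst3)
    then have "coeff ?F d \<noteq> 0" using eval3_axis(1)[OF g2.hom] by auto
    then show "degree ?F = d" using degree_homogeneous_le[OF g2.hom] le_degree[of ?F d] by simp
  qed
qed

lemma swapped_reduced:
  assumes "eval3 F (axis 2 1) \<noteq> 0"
  shows "evp gconst vx p = 0 \<Longrightarrow> p = 0"
    and "z \<in> S \<Longrightarrow> \<exists>D a. D \<noteq> 0 \<and> z * evp gconst vx D = evp (evp gconst vx) vy a \<and> degree a < d"
    and "ff.kdep vx"
proof -
  obtain F' v' where g: "gcurve F' d v'" "gcurve.S F' v' = S" "gcurve.vx v' = vy" "gcurve.vy v' = vx"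
    "degree F' = d" using swapped assms by metis
  interpret g2: gcurve F' d v' by (rule g(1))
  note e = g(2-5)
  show "evp gconst vx p = 0 \<Longrightarrow> p = 0" using g2.ey_zero[of p] by (simp add: e)
  show "z \<in> S \<Longrightarrow> \<exists>D a. D \<noteq> 0 \<and> z * evp gconst vx D = evp (evp gconst vx) vy a \<and> degree a < d"
    using g2.S_reduced[of z] unfolding e g2.ee_def by metis
  show "ff.kdep vx" using g2.ff.kdep_y by (simp add: e)
qed

end

text \<open>\<open>deg_X\<close> records that P = (1:0:0) is a smooth point of C,
  \<open>outer\<close> that Q = (0:1:0) is off C. \<open>fixP\<close> and \<open>fixQ\<close> are
  the Galois conditions for k(y) and k(x), and \<open>normal\<close> is the trace of the normality
  of G_P.\<close>

locale gal_curve = gcurve +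
  assumes deg_X: "degree F = d - 1"
    and outer: "eval3 F (axis 2 1) \<noteq> 0"
    and fixP: "z \<in> S \<Longrightarrow> (\<And>\<tau>. ff.kaut \<tau> \<Longrightarrow> \<tau> vy = vy \<Longrightarrow> \<tau> z = z) \<Longrightarrow> z \<in> ratf vy"
    and fixQ: "z \<in> S \<Longrightarrow> (\<And>\<tau>. ff.kaut \<tau> \<Longrightarrow> \<tau> vx = vx \<Longrightarrow> \<tau> z = z) \<Longrightarrow> z \<in> ratf vx"
    and normal: "ff.kaut \<tau> \<Longrightarrow> \<tau> vy = vy \<Longrightarrow> ff.kaut \<sigma> \<Longrightarrow> \<sigma> vx = vx \<Longrightarrow> \<tau> (\<sigma> vy) = \<sigma> vy"
    and tame: "of_nat (d - 1) \<noteq> (0 :: 'a)"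
begin

abbreviation ex :: "'a poly \<Rightarrow> 'a generic_field" where "ex \<equiv> evp gconst vx"

definition f :: "nat \<Rightarrow> 'a poly" where "f i = coeff (dehom F) i"

definition Cx :: "'a generic_field set" where "Cx = {\<sigma> vy | \<sigma>. ff.kaut \<sigma> \<and> \<sigma> vx = vx}"

lemmas ex_zero = swapped_reduced(1)[OF outer]
lemmas S_reduced_x = swapped_reduced(2)[OF outer]
lemmas kdep_x = swapped_reduced(3)[OF outer]

lemma Cx_card: "finite Cx" "card Cx = d"
proof -
  obtain F' v' where g: "gcurve F' d v'" "gcurve.S F' v' = S" "gcurve.vx v' = vy" "gcurve.vy v' = vx"
    "degree F' = d" using swapped outer by metis
  interpret g2: gcurve F' d v' by (rule g(1))
  note e = g(2-5)
  have C: "g2.Cy = Cx" by (simp add: g2.Cy_def Cx_def e)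
  show "finite Cx" using g2.Cy_finite(1) C by simp
  have "card g2.Cy = degree F'"
    by (rule g2.Cy_card) (unfold e, erule fixQ)
  then show "card Cx = d" using C e by simp
qed

lemma degree_f: "degree (f i) \<le> d - i"
  unfolding f_def by (rule degree_le) (auto simp: coeff_dehom[OF hom])

lemma f_large: "i \<ge> d \<Longrightarrow> f i = 0"
  unfolding f_def using degree_dehom_F deg_X d3 by (intro coeff_eq_0) simp

lemma f0: "coeff (f 0) d \<noteq> 0" "degree (f 0) = d" "f 0 \<noteq> 0"
proof -
  show c: "coeff (f 0) d \<noteq> 0" using outer eval3_axis(2)[OF hom] coeff_dehom[OF hom, of 0 d] by (simp add: f_def)
  then show "degree (f 0) = d" using degree_f[of 0] le_degree[OF c] by simp
  show "f 0 \<noteq> 0" using c by auto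
qed

text \<open>The coefficient of x ^ (d - 1): the affine equation of the tangent line of C at P,
  constant when that tangent is the line at infinity.\<close>

definition l where "l = f (d - 1)"

lemma l: "l \<noteq> 0" "degree l \<le> 1"
proof -
  show "l \<noteq> 0" unfolding l_def f_def
    using degree_dehom_F deg_X degree_F leading_coeff_neq_0[of "dehom F"] by fastforce
  have "d - (d - 1) = 1" using d3 by simp
  then show "degree l \<le> 1" using degree_f[of "d - 1"] by (simp add: l_def)
qed

lemma ee_sum: "degree q < d \<Longrightarrow> ee q = (\<Sum>i<d. ey (coeff q i) * vx ^ i)"
proof -
  assume a: "degree q < d"
  then have "{..<d} = {..d - 1}" by auto
  then show ?thesis unfolding ee_def using evp_sum_le[OF rhom_ey, of q "d - 1" vx] a by simp
qed

lemma ee_f: "(\<Sum>i<d. ey (f i) * vx ^ i) = 0"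
  using ee_sum[of "dehom F"] ee_dehom_F degree_dehom_F deg_X d3 by (simp add: f_def)

text \<open>Relations of degree below d in x are proportional to f. Cross-multiplying by the top
  coefficients removes x ^ (d - 1), and what remains has too small a degree to be nonzero.\<close>

lemma eliminate:
  assumes "(\<Sum>i<d. ey (u i) * vx ^ i) = 0" "i < d"
  shows "l * u i = u (d - 1) * f i"
proof -
  define q where "q = (\<Sum>i<d. monom (l * u i - u (d - 1) * f i) i)"
  have cq: "coeff q i = (if i < d then l * u i - u (d - 1) * f i else 0)" for i
    by (simp add: q_def coeff_sum coeff_monom)
  have "degree q \<le> d - 2"
  proof (rule degree_le, intro allI impI)
    fix j assume "d - 2 < j"
    then have "j = d - 1 \<or> d \<le> j" by auto
    then show "coeff q j = 0" unfolding cq by (auto simp: l_def)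
  qed
  then have dq: "degree q < d - 1" using d3 by simp
  then have "ee q = (\<Sum>i<d. ey (coeff q i) * vx ^ i)" by (intro ee_sum) simp
  also have "\<dots> = (\<Sum>i<d. ey l * (ey (u i) * vx ^ i) - ey (u (d - 1)) * (ey (f i) * vx ^ i))"
    by (rule sum.cong) (simp_all add: cq rhom_diff[OF rhom_ey] rhom_mult[OF rhom_ey] algebra_simps)
  also have "\<dots> = ey l * (\<Sum>i<d. ey (u i) * vx ^ i) - ey (u (d - 1)) * (\<Sum>i<d. ey (f i) * vx ^ i)"
    by (simp add: sum_subtractf sum_distrib_left)
  also have "\<dots> = 0" using assms(1) ee_f by simp
  finally have "q = 0" using ee_zero_degree dq deg_X by simp
  then have "coeff q i = 0" by simp
  then show ?thesis using cq[of i] assms(2) by simp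
qed

text \<open>A common root c would split off the line y = c: after division by y - c an equation of
  total degree at most d - 1 would still vanish on C.\<close>

lemma no_common_root: "\<exists>i<d. poly (f i) c \<noteq> 0"
proof (rule ccontr)
  assume "\<not> ?thesis"
  then have r: "poly (f i) c = 0" for i using f_large[of i] by (cases "i < d") auto
  let ?m = "[:- c, 1:]"
  define g where "g i = f i div ?m" for i
  have fg: "f i = ?m * g i" for i
    unfolding g_def by (rule dvd_mult_div_cancel[symmetric]) (use r[of i] in \<open>simp only: poly_eq_0_iff_dvd\<close>)
  define q where "q = (\<Sum>i<d. monom (g i) i)"
  have g0: "g i = 0" if "i \<ge> d" for i using f_large[OF that] by (simp add: g_def)
  have cq: "coeff q i = g i" for i using g0[of i] by (cases "i < d") (simp_all add: q_def coeff_sum coeff_monom)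
  have dq: "degree q < d"
  proof -
    have "degree q \<le> d - 1" by (rule degree_le) (use cq g0 in auto)
    then show ?thesis using d3 by simp
  qed
  have "ey ?m * ee q = (\<Sum>i<d. ey (f i) * vx ^ i)"
    unfolding ee_sum[OF dq] cq sum_distrib_left fg rhom_mult[OF rhom_ey] by (simp only: mult.assoc)
  then have "ee q = 0" using ee_f ey_zero[of ?m] by auto
  then have "E (homogenization q) = 0"
    using E_dehom[OF homogeneous_homogenization] by (simp add: dehom_homogenization)
  then have dv: "F dvd homogenization q" using gen by simp
  have q0: "q \<noteq> 0" using cq[of 0] fg[of 0] f0(3) by auto
  have nz: "homogenization q \<noteq> 0"
  proof
    assume "homogenization q = 0"
    then have "dehom (homogenization q) = 0" by (simp add: dehom_def)
    then show False using q0 by (simp add: dehom_homogenization)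
  qed
  have "total_degree q \<le> d - 1"
  proof (rule total_degree_le)
    fix i j assume nz: "coeff (coeff q i) j \<noteq> 0"
    then have gi: "g i \<noteq> 0" "j \<le> degree (g i)" using cq le_degree by auto
    have "degree (f i) = 1 + degree (g i)" unfolding fg[of i] by (subst degree_mult_eq) (use gi in auto)
    moreover have "i < d" using g0[of i] gi(1) by (cases "i < d") auto
    ultimately show "i + j \<le> d - 1" using degree_f[of i] gi(2) by linarith
  qed
  moreover have "d \<le> total_degree q"
    by (rule irreducible_homogeneous_dvd[OF irr hom homogeneous_homogenization nz dv])
  ultimately show False using d3 by simp
qed

lemma sigma_root:
  assumes \<sigma>: "ff.kaut \<sigma>" "\<sigma> vx = vx"
  shows "(\<Sum>i<d. evp gconst (\<sigma> vy) (f i) * vx ^ i) = 0"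
proof -
  have "\<sigma> (\<Sum>i<d. ey (f i) * vx ^ i) = (\<Sum>i<d. evp gconst (\<sigma> vy) (f i) * vx ^ i)"
    by (subst ff.kaut_sum[OF \<sigma>(1)])
      (auto simp: ff.kaut_D[OF \<sigma>(1)] ff.kaut_evp[OF \<sigma>(1)] \<sigma>(2) vx_S vy_S mult_S ff.S_evp ff.S_power)
  then show ?thesis using ee_f ff.kaut_D(6)[OF \<sigma>(1)] by simp
qed

text \<open>\<sigma> y = A(y)/B(y) because it is fixed by G_P. Substituting it into the equation
  gives a relation in x proportional to f, which excludes first roots of B and then degrees of A
  other than 1.\<close>

lemma sigma_form:
  assumes \<sigma>: "ff.kaut \<sigma>" "\<sigma> vx = vx"
  obtains \<alpha> \<beta> where "\<alpha> \<noteq> 0" "\<sigma> vy = ey [:\<beta>, \<alpha>:]" "\<forall>i<d. l * pcompose (f i) [:\<beta>, \<alpha>:] = pcompose l [:\<beta>, \<alpha>:] * f i"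
proof -
  have "\<sigma> vy \<in> ratf vy" by (rule fixP[OF ff.kaut_D(1)[OF \<sigma>(1) vy_S]]) (rule normal[OF _ _ \<sigma>])
  then obtain A B where AB: "\<sigma> vy = ey A / ey B" "ey B \<noteq> 0" "\<forall>c. poly B c = 0 \<longrightarrow> poly A c \<noteq> 0"
    by (rule ratf_coprime)
  \<comment> \<open>H_i = B ^ d f_i(A/B), the coefficients with denominators cleared.\<close>
  define H where "H i = (\<Sum>j\<le>d. smult (coeff (f i) j) (A ^ j * B ^ (d - j)))" for i
  have es: "ey (smult c p) = gconst c * ey p" for c p by (rule ff.evp_smult)
  have eH: "ey (H i) = ey B ^ d * evp gconst (\<sigma> vy) (f i)" for i
  proof -
    have "evp gconst (\<sigma> vy) (f i) = (\<Sum>j\<le>d. gconst (coeff (f i) j) * (\<sigma> vy) ^ j)"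
      by (rule evp_sum_le[OF rhom_gconst]) (use degree_f[of i] in simp)
    then have "ey B ^ d * evp gconst (\<sigma> vy) (f i) = (\<Sum>j\<le>d. gconst (coeff (f i) j) * (ey B ^ d * (\<sigma> vy) ^ j))"
      by (simp add: sum_distrib_left mult_ac)
    also have "\<dots> = ey (H i)"
      unfolding H_def rhom_sum[OF rhom_ey] es
    proof (rule sum.cong)
      fix j assume "j \<in> {..d}"
      then have "ey B ^ d = ey B ^ j * ey B ^ (d - j)" by (simp flip: power_add)
      then have "ey B ^ d * (\<sigma> vy) ^ j = ey A ^ j * ey B ^ (d - j)" using AB(1,2) by (simp add: power_divide)
      then show "gconst (coeff (f i) j) * (ey B ^ d * \<sigma> vy ^ j) = gconst (coeff (f i) j) * ey (A ^ j * B ^ (d - j))"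
        by (simp only: rhom_mult[OF rhom_ey] rhom_power[OF rhom_ey])
    qed simp
    finally show ?thesis by simp
  qed
  have "(\<Sum>i<d. ey (H i) * vx ^ i) = ey B ^ d * (\<Sum>i<d. evp gconst (\<sigma> vy) (f i) * vx ^ i)"
    unfolding eH sum_distrib_left by (simp only: mult.assoc)
  then have "(\<Sum>i<d. ey (H i) * vx ^ i) = 0" using sigma_root[OF \<sigma>] by simp
  from eliminate[OF this, of 0] have H0: "l * H 0 = H (d - 1) * f 0" using d3 by simp
  \<comment> \<open>f_{d-1} = l has degree at most 1, so B ^ (d - 1) remains as a factor.\<close>
  have Hd: "H (d - 1) = B ^ (d - 1) * (smult (coeff l 0) B + smult (coeff l 1) A)"
  proof -
    have "H (d - 1) = (\<Sum>j\<in>{0, 1}. smult (coeff l j) (A ^ j * B ^ (d - j)))"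
      unfolding H_def l_def[symmetric]
      by (rule sum.mono_neutral_right) (use d3 l(2) in \<open>auto intro!: coeff_eq_0\<close>)
    also have "\<dots> = smult (coeff l 0) (B ^ Suc (d - 1)) + smult (coeff l 1) (A * B ^ (d - 1))"
      using d3 by simp
    finally show ?thesis by (simp add: algebra_simps)
  qed
  \<comment> \<open>At a root c of B, H_0 is nonzero because A(c) \<noteq> 0 and f_0 has degree
    exactly d. But l H_0 = H_{d-1} f_0 vanishes at c to order at least d - 1 \<ge> 2, while l has at
    most a simple zero.\<close>
  have noroot: False if c: "poly B c = 0" for c
  proof -
    have "poly (H 0) c = (\<Sum>j\<le>d. coeff (f 0) j * (poly A c ^ j * 0 ^ (d - j)))"
      unfolding H_def poly_sum using c by simp
    also have "\<dots> = (\<Sum>j\<in>{d}. coeff (f 0) j * (poly A c ^ j * 0 ^ (d - j)))"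
      by (rule sum.mono_neutral_right) auto
    finally have "poly (H 0) c = coeff (f 0) d * poly A c ^ d" by simp
    then have H0c: "poly (H 0) c \<noteq> 0" using f0(1) AB(3)[rule_format, OF c] by simp
    obtain B1 where B1: "B = [:- c, 1:] * B1" using c by (auto simp: poly_eq_0_iff_dvd)
    have "poly l c * poly (H 0) c = 0" using arg_cong[OF H0, of "\<lambda>p. poly p c"] Hd c d3 by simp
    then have lc: "poly l c = 0" using H0c by simp
    then obtain l1 where l1: "l = [:- c, 1:] * l1" by (auto simp: poly_eq_0_iff_dvd)
    have l10: "l1 \<noteq> 0" using l(1) l1 by auto
    have "degree l = 1 + degree l1" unfolding l1 by (subst degree_mult_eq) (use l10 in auto)
    then have "degree l1 = 0" using l(2) by simp
    then obtain k where k: "l1 = [:k:]" "k \<noteq> 0" using l10 by (metis degree_eq_zeroE pCons_0_0)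
    let ?W = "smult (coeff l 0) B + smult (coeff l 1) A"
    obtain d' where d': "d - 1 = Suc (Suc d')" using d3 by (metis Suc_diff_Suc numeral_3_eq_3 Suc_le_lessD diff_Suc_1 le_Suc_ex plus_nat.simps(2))
    have "l * H 0 = B * B ^ Suc d' * ?W * f 0" using H0 Hd unfolding d' power_Suc[of B "Suc d'"] by (simp only: mult.assoc)
    then have "([:- c, 1:] * l1) * H 0 = ([:- c, 1:] * B1) * B ^ Suc d' * ?W * f 0" by (simp only: l1[symmetric] B1[symmetric])
    then have "[:- c, 1:] * (l1 * H 0) = [:- c, 1:] * (B1 * B ^ Suc d' * ?W * f 0)" by (simp only: mult.assoc)
    then have "l1 * H 0 = B1 * B ^ Suc d' * ?W * f 0" by (simp only: mult_cancel_left) simp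
    then have "poly (l1 * H 0) c = 0" using c by simp
    then show False using H0c k by simp
  qed
  have "degree B = 0" using noroot alg_closed_imp_poly_has_root[of B] by (cases "degree B") auto
  then obtain k where k: "B = [:k:]" by (rule degree_eq_zeroE)
  have k0: "k \<noteq> 0" using AB(2) k by (auto simp: evp_0)
  define A' where "A' = smult (inverse k) A"
  have \<sigma>A: "\<sigma> vy = ey A'"
    using AB(1) k k0 by (simp add: A'_def es evp_const rhom_gconst rhom_inverse[OF rhom_gconst] divide_inverse mult.commute)
  note pc = ey_pcompose[symmetric]
  have "(\<Sum>i<d. ey (pcompose (f i) A') * vx ^ i) = 0" using sigma_root[OF \<sigma>] unfolding \<sigma>A pc .
  note el = eliminate[OF this, folded l_def]
  have A1: "degree A' \<noteq> 0"
  proof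
    assume "degree A' = 0"
    then obtain k' where "A' = [:k':]" by (rule degree_eq_zeroE)
    then have "\<sigma> vy = \<sigma> (gconst k')" using \<sigma>A ff.kaut_D(2)[OF \<sigma>(1)] by (simp add: evp_const rhom_gconst)
    then have "vy = gconst k'" using ff.kaut_D(5)[OF \<sigma>(1) vy_S const_S] by simp
    then have "ey [:- k', 1:] = 0" by (simp add: evp_pCons evp_0 rhom_gconst rhom_minus[OF rhom_gconst] rhom_1[OF rhom_gconst])
    then show False using ey_zero by fastforce
  qed
  have nz: "pcompose l A' \<noteq> 0" "pcompose (f 0) A' \<noteq> 0" using l(1) f0(3) A1 pcompose_eq_0[of _ A'] by auto
  have "degree (l * pcompose (f 0) A') = degree l + d * degree A'"
    using l(1) nz(2) f0(2) by (simp add: degree_mult_eq degree_pcompose)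
  moreover have "degree (pcompose l A' * f 0) = degree l * degree A' + d"
    using nz(1) f0(2,3) by (simp add: degree_mult_eq degree_pcompose)
  moreover have "l * pcompose (f 0) A' = pcompose l A' * f 0" using el[of 0] d3 by simp
  ultimately have dd: "degree l + d * degree A' = degree l * degree A' + d" by simp
  \<comment> \<open>The equation of degrees leaves only degree 1, as \<open>degree l\<close> is at
    most 1 and d is at least 3.\<close>
  have "degree A' = 1"
  proof -
    have "degree l = 0 \<or> degree l = 1" using l(2) by linarith
    then show ?thesis
    proof
      assume "degree l = 0"
      then show ?thesis using dd d3 by simp
    next
      assume l1: "degree l = 1"
      obtain a' where a': "degree A' = Suc a'" using A1 by (cases "degree A'") auto
      have "d * a' = a'" using dd unfolding l1 a' by simp
      then show ?thesis using a' d3 by simp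
    qed
  qed
  then obtain \<alpha> \<beta> where ab: "A' = [:\<beta>, \<alpha>:]" "\<alpha> \<noteq> 0"
    by (rule degree1_coeffs)
  show ?thesis using that[OF ab(2)] \<sigma>A el unfolding ab(1) by simp
qed

end

section \<open>Poles of the coordinate functions\<close>

context func_field
begin

definition un :: "'b set \<Rightarrow> 'b \<Rightarrow> bool" where "un V z \<longleftrightarrow> z \<in> V \<and> z \<notin> mx V"

lemma un_nonzero: "place V \<Longrightarrow> un V z \<Longrightarrow> z \<noteq> 0"
  using mx_0 by (auto simp: un_def)

lemma un_mult: "place V \<Longrightarrow> un V a \<Longrightarrow> un V b \<Longrightarrow> un V (a * b)"
  unfolding un_def using mx_prime place_D(6) by metis

lemma un_inverse: "place V \<Longrightarrow> un V a \<Longrightarrow> un V (inverse a)"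
  unfolding un_def using unit_inverse[of a V] by (auto simp: mx_def)

lemma un_1: "place V \<Longrightarrow> un V 1"
  using mx_1 place_D(4) by (auto simp: un_def)

lemma un_power: "place V \<Longrightarrow> un V a \<Longrightarrow> un V (a ^ n)"
  by (induct n) (auto intro: un_1 un_mult)

lemma un_const: "place V \<Longrightarrow> c \<noteq> 0 \<Longrightarrow> un V (\<iota> c)"
  using mx_const place_D(2) by (auto simp: un_def)

lemma mx_power: "place V \<Longrightarrow> z \<in> mx V \<Longrightarrow> 0 < n \<Longrightarrow> z ^ n \<in> mx V"
  by (cases n) (auto intro: mx_mult2 place_power mx_V)

lemma un_add_mx:
  assumes V: "place V" and a: "a - b \<in> mx V" and b: "un V b" shows "un V a"
proof -
  have e: "a = (a - b) + b" "b = a - (a - b)" by simp_all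
  have "a \<in> V" by (subst e(1)) (rule place_D(5)[OF V], use mx_V[OF a] b in \<open>auto simp: un_def\<close>)
  moreover have "a \<notin> mx V"
  proof
    assume "a \<in> mx V"
    then have "a - (a - b) \<in> mx V" using mx_diff[OF V _ a] by blast
    then show False using b by (simp add: un_def)
  qed
  ultimately show ?thesis by (simp add: un_def)
qed

text \<open>Valuation rings are integrally closed; this allows orders to be compared after raising
  to the d-th power.\<close>

lemma root_V:
  assumes V: "place V" and z: "z \<in> S" "z ^ n \<in> V" "0 < n" shows "z \<in> V"
proof (rule ccontr)
  assume nz: "z \<notin> V"
  then have z0: "z \<noteq> 0" using place_D(3)[OF V] by auto
  have "inverse z ^ n \<in> mx V" by (rule mx_power[OF V mx_inverse[OF V z(1) nz] z(3)])
  then have "z ^ n * inverse z ^ n \<in> mx V" by (rule mx_mult[OF V z(2)])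
  then show False using z0 mx_1[OF V] by (simp add: power_mult_distrib[symmetric])
qed

lemma root_mx:
  assumes V: "place V" and z: "z \<in> S" "z ^ n \<in> mx V" "0 < n" shows "z \<in> mx V"
proof (rule ccontr)
  assume nz: "z \<notin> mx V"
  have "z \<in> V" by (rule root_V[OF V z(1) mx_V[OF z(2)] z(3)])
  then show False using un_power[OF V, of z n] nz z(2) by (auto simp: un_def)
qed

lemma root_un:
  assumes V: "place V" and z: "z \<in> S" "un V (z ^ n)" "0 < n" shows "un V z"
  using root_V[OF V z(1) _ z(3)] mx_power[OF V _ z(3), of z] z(2) by (auto simp: un_def)

text \<open>At a pole of z the leading term of p(z) dominates.\<close>

lemma evp_pole:
  assumes V: "place V" and w: "inverse z \<in> mx V" "z \<noteq> 0" and p: "degree p \<le> n"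
  shows "evp \<iota> z p * inverse z ^ n - \<iota> (coeff p n) \<in> mx V"
proof -
  have e: "z ^ i * inverse z ^ n = inverse z ^ (n - i)" if "i \<le> n" for i
  proof -
    have "inverse z ^ n = inverse z ^ i * inverse z ^ (n - i)" using that by (simp flip: power_add)
    then show ?thesis using w(2) by (simp add: power_mult_distrib[symmetric] flip: mult.assoc)
  qed
  have "evp \<iota> z p * inverse z ^ n = (\<Sum>i\<le>n. \<iota> (coeff p i) * (z ^ i * inverse z ^ n))"
    unfolding evp_sum_le[OF rhom_iota p] by (simp add: sum_distrib_right mult.assoc)
  also have "\<dots> = (\<Sum>i\<le>n. \<iota> (coeff p i) * inverse z ^ (n - i))"
    by (rule sum.cong) (simp_all add: e)
  also have "\<dots> = (\<Sum>i\<in>{..n} - {n}. \<iota> (coeff p i) * inverse z ^ (n - i)) + \<iota> (coeff p n)"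
    by (subst sum.remove[of _ n]) auto
  finally have "evp \<iota> z p * inverse z ^ n - \<iota> (coeff p n) = (\<Sum>i\<in>{..n} - {n}. \<iota> (coeff p i) * inverse z ^ (n - i))"
    by simp
  also have "\<dots> \<in> mx V"
    by (intro mx_sum[OF V] mx_mult[OF V] place_D(2)[OF V] mx_power[OF V w(1)]) auto
  finally show ?thesis .
qed

lemma evp_pole_un:
  assumes V: "place V" and w: "inverse z \<in> mx V" "z \<noteq> 0" and p: "p \<noteq> 0" "degree p = n"
  shows "un V (evp \<iota> z p * inverse z ^ n)"
  by (rule un_add_mx[OF V evp_pole[OF V w]]) (use p in \<open>auto intro!: un_const[OF V]\<close>)

text \<open>If p(z) = q(z'), then n ord z = m ord z' at a pole of z. The unit quotient of powers is
  the form in which such equalities of orders are stated and used.\<close>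

lemma pole_un:
  assumes V: "place V" and w: "inverse z \<in> mx V" "z \<noteq> 0" and z': "z' \<in> S"
    and p: "p \<noteq> 0" "degree p = n" "0 < n" and q: "q \<noteq> 0" "degree q = m"
    and e: "evp \<iota> z p = evp \<iota> z' q"
  shows "inverse z' \<in> mx V" "z' \<noteq> 0" "un V (z' ^ m * inverse z ^ n)"
proof -
  have u: "un V (evp \<iota> z p * inverse z ^ n)" by (rule evp_pole_un[OF V w p(1,2)])
  have "z' \<notin> V"
  proof
    assume "z' \<in> V"
    then have "evp \<iota> z p \<in> V" unfolding e by (rule place_evp[OF V])
    then have "evp \<iota> z p * inverse z ^ n \<in> mx V" by (rule mx_mult[OF V _ mx_power[OF V w(1) p(3)]])
    then show False using u by (simp add: un_def)
  qed
  then show w': "inverse z' \<in> mx V" "z' \<noteq> 0" using mx_inverse[OF V z'] place_D(3)[OF V] by auto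
  have u': "un V (evp \<iota> z' q * inverse z' ^ m)" by (rule evp_pole_un[OF V w' q])
  then have nz: "evp \<iota> z' q \<noteq> 0" using un_nonzero[OF V u'] by auto
  have "un V ((evp \<iota> z p * inverse z ^ n) * inverse (evp \<iota> z' q * inverse z' ^ m))"
    by (rule un_mult[OF V u un_inverse[OF V u']])
  moreover have "(evp \<iota> z p * inverse z ^ n) * inverse (evp \<iota> z' q * inverse z' ^ m) = z' ^ m * inverse z ^ n"
  proof -
    have "z' ^ m * inverse z' ^ m = 1" using w'(2) by (simp add: power_mult_distrib[symmetric])
    then have "inverse (inverse z' ^ m) = z' ^ m" by (metis inverse_unique mult.commute)
    then show ?thesis unfolding e using nz by (simp add: inverse_mult_distrib mult.assoc mult.left_commute)
  qed
  ultimately show "un V (z' ^ m * inverse z ^ n)" by (simp only:)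
qed

text \<open>The orders of the nonzero terms are pairwise distinct, so the term of least order dominates.\<close>

lemma distinct_orders_mx:
  fixes A :: "nat \<Rightarrow> nat"
  assumes V: "place V" and w: "w \<in> mx V" "w \<noteq> 0" and d: "0 < d" and J: "finite J" "inj_on A J"
    and s: "\<And>j. j \<in> J \<Longrightarrow> s j \<in> S" "\<And>j. j \<in> J \<Longrightarrow> s j \<noteq> 0 \<Longrightarrow> \<exists>u. un V u \<and> s j ^ d * w ^ A j = u * w ^ B"
    and sum: "sum s J \<in> V" and j: "j \<in> J" "A j \<noteq> B"
  shows "s j \<in> mx V"
proof (cases "s j = 0")
  case True
  then show ?thesis using mx_0[OF V] by simp
next
  case False
  define J' where "J' = {j \<in> J. s j \<noteq> 0}"
  have J': "finite J'" "J' \<noteq> {}" "j \<in> J'" using J j False by (auto simp: J'_def)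
  have "Max (A ` J') \<in> A ` J'" by (rule Max_in) (use J' in auto)
  then obtain k where kM: "k \<in> J'" "A k = Max (A ` J')" by (metis imageE)
  have k: "k \<in> J'" "\<And>i. i \<in> J' \<Longrightarrow> A i \<le> A k" unfolding kM(2) using kM(1) J'(1) by auto
  have u: "\<exists>u. un V u \<and> s i ^ d * w ^ A i = u * w ^ B" if "i \<in> J'" for i using s(2) that by (auto simp: J'_def)
  have wn: "w ^ i \<noteq> 0" for i using w(2) by simp
  show ?thesis
  \<comment> \<open>The hypothesis reads d ord(s_j) = (B - A j) ord(w), so k, with the largest A,
    has the least order. If A k \<le> B, no term has a pole and those with A j \<noteq> B vanish at
    V.\<close>
  proof (cases "A k \<le> B")
    case True
    obtain u where u: "un V u" "s j ^ d * w ^ A j = u * w ^ B" using u[OF J'(3)] by blast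
    have lt: "A j < B" using k(2)[OF J'(3)] True j(2) by linarith
    then have "w ^ B = w ^ (B - A j) * w ^ A j" by (simp flip: power_add)
    then have "s j ^ d * w ^ A j = (u * w ^ (B - A j)) * w ^ A j" using u(2) by simp
    then have "s j ^ d = u * w ^ (B - A j)" by (rule iffD1[OF mult_right_cancel[OF wn[of "A j"]]])
    then have "s j ^ d \<in> mx V" using mx_mult[OF V _ mx_power[OF V w(1)], of u "B - A j"] lt u(1) by (simp add: un_def)
    then show ?thesis using root_mx[OF V s(1)[OF j(1)] _ d] by blast
  next
    case False
    \<comment> \<open>Here s k has a pole stronger than those of the other terms, so the sum would
      have a pole as well; dividing by s k puts 1 into the maximal ideal.\<close>
    obtain u0 where u0: "un V u0" "s k ^ d * w ^ A k = u0 * w ^ B" using u[OF k(1)] by blast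
    have k0: "s k \<noteq> 0" "s k \<in> S" "k \<in> J" using k(1) s(1) by (auto simp: J'_def)
    have u00: "u0 \<noteq> 0" by (rule un_nonzero[OF V u0(1)])
    have iu: "inverse u0 \<in> V" using un_inverse[OF V u0(1)] by (simp add: un_def)
    have "w ^ A k = w ^ (A k - B) * w ^ B" using False by (simp flip: power_add)
    then have "(s k ^ d * w ^ (A k - B)) * w ^ B = u0 * w ^ B" using u0(2) by (simp add: mult.assoc)
    then have "s k ^ d * w ^ (A k - B) = u0" by (rule iffD1[OF mult_right_cancel[OF wn]])
    then have "inverse (s k) ^ d = inverse u0 * w ^ (A k - B)"
      using w(2) u00 k0(1) by (auto simp: field_simps power_inverse)
    then have "inverse (s k) ^ d \<in> mx V" using mx_mult[OF V iu mx_power[OF V w(1)], of "A k - B"] False by simp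
    then have ik: "inverse (s k) \<in> mx V" using root_mx[OF V S_inverse[OF k0(2)] _ d] by blast
    have small: "s i * inverse (s k) \<in> mx V" if i: "i \<in> J'" "i \<noteq> k" for i
    proof -
      obtain u1 where u1: "un V u1" "s i ^ d * w ^ A i = u1 * w ^ B" using u[OF i(1)] by blast
      have "A i \<noteq> A k" using inj_onD[OF J(2), of i k] i k(1) by (auto simp: J'_def)
      then have lt: "A i < A k" using k(2)[OF i(1)] by simp
      have "w ^ A k = w ^ (A k - A i) * w ^ A i" using lt by (simp flip: power_add)
      then have e1: "s k ^ d * w ^ (A k - A i) * w ^ A i = u0 * w ^ B" using u0(2) by (simp add: mult.assoc)
      have "u0 * (s i ^ d * w ^ A i) = u1 * (u0 * w ^ B)" using u1(2) by simp
      also have "\<dots> = (u1 * (s k ^ d * w ^ (A k - A i))) * w ^ A i" unfolding e1[symmetric] by simp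
      finally have "(u0 * s i ^ d) * w ^ A i = (u1 * (s k ^ d * w ^ (A k - A i))) * w ^ A i" by (simp add: mult.assoc)
      then have "u0 * s i ^ d = u1 * (s k ^ d * w ^ (A k - A i))" by (rule iffD1[OF mult_right_cancel[OF wn[of "A i"]]])
      then have "(s i * inverse (s k)) ^ d = (u1 * inverse u0) * w ^ (A k - A i)"
        using u00 k0(1) by (simp add: field_simps)
      moreover have "u1 * inverse u0 \<in> V" using u1(1) iu place_D(6)[OF V] by (simp add: un_def)
      ultimately have "(s i * inverse (s k)) ^ d \<in> mx V" using mx_mult[OF V _ mx_power[OF V w(1)], of _ "A k - A i"] lt by simp
      then show ?thesis using root_mx[OF V _ _ d] S_mult[OF s(1) S_inverse[OF k0(2)]] i(1) by (auto simp: J'_def)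
    qed
    have "sum s J = sum s J'" unfolding J'_def by (rule sum.mono_neutral_right) (use J(1) in auto)
    also have "\<dots> = s k + sum s (J' - {k})" by (rule sum.remove) (use J'(1) k(1) in auto)
    finally have "sum s J * inverse (s k) = 1 + (\<Sum>i\<in>J' - {k}. s i * inverse (s k))"
      using k0(1) by (simp add: distrib_right sum_distrib_right)
    then have "1 = sum s J * inverse (s k) - (\<Sum>i\<in>J' - {k}. s i * inverse (s k))" by simp
    also have "\<dots> \<in> mx V"
      by (intro mx_diff[OF V] mx_mult[OF V sum ik] mx_sum[OF V] small) auto
    finally show ?thesis using mx_1[OF V] by blast
  qed
qed

text \<open>a and b are roots of h(T) = h(z) with the same leading coefficient r at a pole of z.
  Dividing h(a) - h(b) = 0 by a - b leaves a sum whose top term has leading coefficient n r ^ (n -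
  1) times that of h, which is nonzero.\<close>

lemma tame_roots_separated:
  assumes V: "place V" and w: "inverse z \<in> mx V" "z \<noteq> 0" and h: "degree h = n" "of_nat n \<noteq> (0::'a)"
    and z: "a \<in> S" "b \<in> S" "evp \<iota> a h = evp \<iota> z h" "evp \<iota> b h = evp \<iota> z h"
    and ab: "(a - b) * inverse z \<in> mx V"
  shows "a = b"
proof (rule ccontr)
  assume ne: "a \<noteq> b"
  have n: "0 < n" "h \<noteq> 0" using h by (auto intro!: gr0I)
  define W where "W = inverse z"
  have W: "W \<in> mx V" "W \<in> V" using w mx_V by (auto simp: W_def)
  have "un V (a ^ n * W ^ n)" unfolding W_def by (rule pole_un(3)[OF V w z(1) n(2) h(1) n(1) n(2) h(1) z(3)[symmetric]])
  then have ua: "un V (a * W)" using root_un[OF V S_mult[OF z(1)] _ n(1), of W] W place_D(1)[OF V] by (auto simp: power_mult_distrib)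
  have "un V (b ^ n * W ^ n)" unfolding W_def by (rule pole_un(3)[OF V w z(2) n(2) h(1) n(1) n(2) h(1) z(4)[symmetric]])
  then have ub: "un V (b * W)" using root_un[OF V S_mult[OF z(2)] _ n(1), of W] W place_D(1)[OF V] by (auto simp: power_mult_distrib)
  define r where "r = res (a * W) V"
  have ra: "a * W - \<iota> r \<in> mx V" unfolding r_def by (rule res_mx[OF V]) (use ua in \<open>simp add: un_def\<close>)
  have "b * W - \<iota> r = (a * W - \<iota> r) - (a - b) * W" by (simp add: algebra_simps)
  then have rb: "b * W - \<iota> r \<in> mx V" using mx_diff[OF V ra, of "(a - b) * W"] ab unfolding W_def by (simp only:)
  have r0: "r \<noteq> 0"
  proof
    assume "r = 0"
    then show False using ra ua by (simp add: un_def)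
  qed
  have raV: "a * W \<in> V" "b * W \<in> V" using ua ub by (auto simp: un_def)
  \<comment> \<open>The quotient of a ^ i - b ^ i by a - b.\<close>
  define Q where "Q i = (\<Sum>j<i. b ^ (i - Suc j) * a ^ j)" for i
  have dQ: "a ^ i - b ^ i = (a - b) * Q i" for i unfolding Q_def using power_diff_sumr2[of a i b] by simp
  have "(\<Sum>i\<le>n. \<iota> (coeff h i) * (a ^ i - b ^ i)) = evp \<iota> a h - evp \<iota> b h"
    unfolding evp_sum[OF rhom_iota] h(1) by (simp add: sum_subtractf right_diff_distrib)
  then have "(a - b) * (\<Sum>i\<le>n. \<iota> (coeff h i) * Q i) = 0"
    unfolding dQ z(3,4) by (simp add: sum_distrib_left mult.left_commute)
  then have z0: "(\<Sum>i\<le>n. \<iota> (coeff h i) * Q i) = 0" using ne by simp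
  have QW: "Q i * W ^ (i - 1) = (\<Sum>j<i. (b * W) ^ (i - Suc j) * (a * W) ^ j)" for i
    unfolding Q_def sum_distrib_right
  proof (rule sum.cong)
    fix j assume "j \<in> {..<i}"
    then have "i - 1 = (i - Suc j) + j" by auto
    then have "W ^ (i - 1) = W ^ (i - Suc j) * W ^ j" by (simp only: power_add)
    then show "b ^ (i - Suc j) * a ^ j * W ^ (i - 1) = (b * W) ^ (i - Suc j) * (a * W) ^ j" by (simp add: power_mult_distrib)
  qed simp
  have QV: "Q i * W ^ (i - 1) \<in> V" for i
    unfolding QW by (intro place_sum[OF V] place_D(6)[OF V] place_power[OF V] raV)
  have pw: "(b * W) ^ (n - Suc j) * (a * W) ^ j - \<iota> (r ^ (n - 1)) \<in> mx V" if "j < n" for j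
  proof -
    have "res ((b * W) ^ (n - Suc j) * (a * W) ^ j) V = r ^ (n - Suc j) * r ^ j"
      by (simp add: res_mult[OF V] place_power[OF V] raV res_power[OF V] res_eqI[OF V ra] res_eqI[OF V rb])
    also have "\<dots> = r ^ (n - 1)" using that by (simp flip: power_add)
    finally show ?thesis using res_mx[OF V place_D(6)[OF V place_power[OF V raV(2)] place_power[OF V raV(1)], of "n - Suc j" j]] by simp
  qed
  have isum: "\<iota> (of_nat n * r ^ (n - 1)) = (\<Sum>j<n. \<iota> (r ^ (n - 1)))"
    using rhom_sum[OF rhom_iota, of "\<lambda>_. r ^ (n - 1)" "{..<n}"] by simp
  have "Q n * W ^ (n - 1) - \<iota> (of_nat n * r ^ (n - 1)) = (\<Sum>j<n. (b * W) ^ (n - Suc j) * (a * W) ^ j - \<iota> (r ^ (n - 1)))"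
    unfolding QW isum by (simp only: sum_subtractf)
  also have "\<dots> \<in> mx V" by (intro mx_sum[OF V] pw) auto
  finally have Qn: "un V (Q n * W ^ (n - 1))"
    by (rule un_add_mx[OF V _ un_const[OF V]]) (use h(2) r0 in simp)
  have "0 = (\<Sum>i\<le>n. \<iota> (coeff h i) * Q i) * W ^ (n - 1)" unfolding z0 by simp
  also have "\<dots> = (\<Sum>i\<le>n. \<iota> (coeff h i) * (Q i * W ^ (n - 1)))" by (simp add: sum_distrib_right mult.assoc)
  also have "\<dots> = (\<Sum>i\<in>{..n} - {n}. \<iota> (coeff h i) * (Q i * W ^ (n - 1))) + \<iota> (coeff h n) * (Q n * W ^ (n - 1))"
    by (subst sum.remove[of _ n]) auto
  finally have e: "\<iota> (coeff h n) * (Q n * W ^ (n - 1)) = - (\<Sum>i\<in>{..n} - {n}. \<iota> (coeff h i) * (Q i * W ^ (n - 1)))"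
    by (simp add: eq_neg_iff_add_eq_0 add.commute)
  have sm: "Q i * W ^ (n - 1) \<in> mx V" if i: "i \<in> {..n} - {n}" for i
  proof (cases "i = 0")
    case True
    then show ?thesis using mx_0[OF V] by (simp add: Q_def)
  next
    case False
    then have "n - 1 = (i - 1) + (n - i)" using i by auto
    then have "Q i * W ^ (n - 1) = (Q i * W ^ (i - 1)) * W ^ (n - i)" by (simp only: power_add mult.assoc)
    then show ?thesis using mx_mult[OF V QV[of i] mx_power[OF V W(1), of "n - i"]] i by (auto simp: mult.assoc)
  qed
  have "\<iota> (coeff h n) * (Q n * W ^ (n - 1)) \<in> mx V"
    unfolding e by (rule mx_minus[OF V], rule mx_sum[OF V], rule mx_mult[OF V place_D(2)[OF V] sm])
  moreover have "un V (\<iota> (coeff h n) * (Q n * W ^ (n - 1)))"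
    using n h(1) by (intro un_mult[OF V un_const[OF V] Qn]) auto
  ultimately show False by (simp add: un_def)
qed

end

context gal_curve
begin

lemma Cx_mem: "y' \<in> Cx \<Longrightarrow> \<exists>\<sigma>. ff.kaut \<sigma> \<and> \<sigma> vx = vx \<and> y' = \<sigma> vy"
  by (auto simp: Cx_def)

text \<open>The tangent at P is the line through P and Q. Otherwise every \<sigma> would fix the
  root c0 of l, so \<beta> is determined by \<alpha>, and comparing the y ^ d terms gives \<alpha> ^
  (d - 1) = 1: at most d - 1 conjugates instead of d.\<close>

lemma degree_l: "degree l = 0"
proof (rule ccontr)
  assume "degree l \<noteq> 0"
  then have "degree l = 1" using l(2) by simp
  then obtain a b where lab: "l = [:b, a:]" "a \<noteq> 0" by (rule degree1_coeffs)
  define c0 where "c0 = - b / a"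
  have b: "b = - (a * c0)" using lab(2) by (simp add: c0_def)
  define U where "U = {\<alpha>::'a. \<alpha> ^ (d - 1) = 1}"
  let ?p = "monom 1 (d - 1) - 1 :: 'a poly"
  have "coeff ?p (d - 1) = 1" using d3 by (simp add: coeff_monom coeff_1)
  then have p0: "?p \<noteq> 0" by (metis coeff_0 zero_neq_one)
  have "degree ?p \<le> d - 1" by (intro degree_diff_le) (auto intro: degree_monom_le)
  then have cU: "finite U" "card U \<le> d - 1"
    using poly_roots_finite[OF p0] card_poly_roots_bound[OF p0] by (auto simp: U_def poly_monom)
  have "Cx \<subseteq> (\<lambda>\<alpha>. ey [:c0 - \<alpha> * c0, \<alpha>:]) ` U"
  proof
    fix y' assume "y' \<in> Cx"
    then obtain \<sigma> where \<sigma>: "ff.kaut \<sigma>" "\<sigma> vx = vx" "y' = \<sigma> vy" using Cx_mem by blast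
    obtain \<alpha> \<beta> where ab: "\<alpha> \<noteq> 0" "\<sigma> vy = ey [:\<beta>, \<alpha>:]"
      "\<forall>i<d. l * pcompose (f i) [:\<beta>, \<alpha>:] = pcompose l [:\<beta>, \<alpha>:] * f i" by (rule sigma_form[OF \<sigma>(1,2)])
    \<comment> \<open>Some f_i is nonzero at c0, so proportionality forces l to vanish at the image
      of c0 as well.\<close>
    obtain i where i: "i < d" "poly (f i) c0 \<noteq> 0" using no_common_root by blast
    have "poly l c0 = 0" by (simp add: lab b)
    then have "poly l (\<beta> + \<alpha> * c0) * poly (f i) c0 = 0"
      using arg_cong[OF ab(3)[rule_format, OF i(1)], of "\<lambda>p. poly p c0"] by (simp add: poly_pcompose mult.commute)
    then have "poly l (\<beta> + \<alpha> * c0) = 0" using i(2) by simp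
    then have "a * (\<beta> + \<alpha> * c0) = a * c0" by (simp add: lab b algebra_simps)
    then have \<beta>: "\<beta> = c0 - \<alpha> * c0" using lab(2) by (simp add: eq_diff_eq)
    have "pcompose l [:\<beta>, \<alpha>:] = smult \<alpha> l" by (simp add: lab b pcompose_pCons \<beta> algebra_simps)
    then have "l * pcompose (f 0) [:\<beta>, \<alpha>:] = l * smult \<alpha> (f 0)" using ab(3)[rule_format, of 0] d3 by simp
    then have "pcompose (f 0) [:\<beta>, \<alpha>:] = smult \<alpha> (f 0)" by (rule iffD1[OF mult_left_cancel[OF l(1)]])
    then have "coeff (f 0) d * \<alpha> ^ d = \<alpha> * coeff (f 0) d"
      using coeff_pcompose_affine[of "f 0" d \<beta> \<alpha>] f0(2) by (simp add: mult.commute)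
    then have "\<alpha> ^ d = \<alpha>" using f0(1) by simp
    moreover have "\<alpha> ^ d = \<alpha> * \<alpha> ^ (d - 1)" using d3 by (simp flip: power_Suc)
    ultimately have "\<alpha> \<in> U" using ab(1) by (simp add: U_def)
    then show "y' \<in> (\<lambda>\<alpha>. ey [:c0 - \<alpha> * c0, \<alpha>:]) ` U" using \<sigma>(3) ab(2) \<beta> by blast
  qed
  then have "card Cx \<le> card U" by (rule surj_card_le[OF cU(1)])
  then show False using cU(2) Cx_card(2) d3 by simp
qed

lemma sigma_affine:
  assumes "y' \<in> Cx"
  obtains \<alpha> \<beta> where "\<alpha> \<noteq> 0" "y' = ey [:\<beta>, \<alpha>:]" "\<forall>i<d. pcompose (f i) [:\<beta>, \<alpha>:] = f i"
proof -
  obtain \<sigma> where \<sigma>: "ff.kaut \<sigma>" "\<sigma> vx = vx" "y' = \<sigma> vy" using Cx_mem assms by blast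
  obtain \<alpha> \<beta> where ab: "\<alpha> \<noteq> 0" "\<sigma> vy = ey [:\<beta>, \<alpha>:]"
    "\<forall>i<d. l * pcompose (f i) [:\<beta>, \<alpha>:] = pcompose l [:\<beta>, \<alpha>:] * f i" by (rule sigma_form[OF \<sigma>(1,2)])
  obtain k where "l = [:k:]" using degree_l by (rule degree_eq_zeroE)
  then have "pcompose l [:\<beta>, \<alpha>:] = l" by simp
  then have "pcompose (f i) [:\<beta>, \<alpha>:] = f i" if "i < d" for i
    using ab(3)[rule_format, OF that] mult_left_cancel[OF l(1)] by metis
  then show ?thesis using that ab(1,2) \<sigma>(3) by metis
qed

lemma Cx_roots: "i < d \<Longrightarrow> Cx \<subseteq> {z. evp gconst z (f i) = ey (f i)}"
proof
  fix y' assume i: "i < d" and y': "y' \<in> Cx"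
  obtain \<alpha> \<beta> where "\<alpha> \<noteq> 0" "y' = ey [:\<beta>, \<alpha>:]" "\<forall>i<d. pcompose (f i) [:\<beta>, \<alpha>:] = f i"
    by (rule sigma_affine[OF y'])
  then show "y' \<in> {z. evp gconst z (f i) = ey (f i)}" using ey_pcompose[of "f i" "[:\<beta>, \<alpha>:]"] i by simp
qed

text \<open>All d conjugates of y are roots of f_i(T) = f_i(y), whose degree is at most d - i < d
  unless f_i is constant.\<close>

lemma degree_f_0: assumes "1 \<le> i" "i < d" shows "degree (f i) = 0"
proof (rule ccontr)
  assume "degree (f i) \<noteq> 0"
  then have "0 < degree (f i)" by simp
  from ey_affine_roots[OF this] have "card Cx \<le> degree (f i)"
    using card_mono[OF _ Cx_roots[OF assms(2)]] by linarith
  then show False using Cx_card(2) degree_f[of i] assms by simp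
qed

text \<open>Evaluated at y, the affine maps preserving f_0 inject into the roots of f_0(T) = f_0(y),
  at most d of them, and they include all d conjugates of y. So their number equals the degree of
  f_0.\<close>

lemma f0_form:
  obtains e m a y0 c c' where "d = CHAR('a) ^ e * m" "\<not> CHAR('a) dvd m" "m dvd CHAR('a) ^ e - 1" "a e \<noteq> 0" "a 0 \<noteq> 0" "c \<noteq> 0"
    "f 0 = smult c (pcompose (\<Sum>i\<in>{i. i \<le> e \<and> m dvd CHAR('a) ^ i - 1}. monom (a i) (CHAR('a) ^ i)) [:- y0, 1:] ^ m) + [:c':]"
proof -
  define M where "M = {(\<alpha>, \<beta>). \<alpha> \<noteq> 0 \<and> pcompose (f 0) [:\<beta>, \<alpha>:] = f 0}"
  let ?e = "\<lambda>(\<alpha>, \<beta>). ey [:\<beta>, \<alpha>:]"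
  have inj: "inj_on ?e M" by (auto simp: inj_on_def ey_inj)
  have sub: "?e ` M \<subseteq> {z. evp gconst z (f 0) = ey (f 0)}"
    by (auto simp: M_def ey_pcompose[symmetric])
  have d0: "0 < degree (f 0)" "1 \<le> d" using f0(2) d3 by auto
  note r = ey_affine_roots[OF d0(1)]
  have fin: "finite M" by (rule finite_imageD[OF finite_subset[OF sub r(1)] inj])
  have "card (?e ` M) \<le> d" using card_mono[OF r(1) sub] r(2) f0(2) by linarith
  moreover have "Cx \<subseteq> ?e ` M"
  proof
    fix y' assume "y' \<in> Cx"
    then obtain \<alpha> \<beta> where "\<alpha> \<noteq> 0" "y' = ey [:\<beta>, \<alpha>:]" "\<forall>i<d. pcompose (f i) [:\<beta>, \<alpha>:] = f i"
      by (rule sigma_affine)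
    then show "y' \<in> ?e ` M" using d0(2) by (intro image_eqI[of _ _ "(\<alpha>, \<beta>)"]) (auto simp: M_def)
  qed
  then have "d \<le> card (?e ` M)" using card_mono[OF finite_imageI[OF fin]] Cx_card(2) by metis
  ultimately have "card M = d" using card_image[OF inj] by simp
  then show ?thesis
    by (rule affine_invariant_poly[OF f0(2) d0(2) fin]) (auto simp: M_def intro: that)
qed

definition h where "h = (\<Sum>i\<in>{1..<d}. monom (coeff (f i) 0) i)"

lemma coeff_h: "coeff h i = (if 1 \<le> i \<and> i < d then coeff (f i) 0 else 0)"
  by (simp add: h_def coeff_sum coeff_monom)

lemma h_props: "coeff h (d - 1) \<noteq> 0" "degree h = d - 1" "h \<noteq> 0"
proof -
  obtain k where "l = [:k:]" using degree_l by (rule degree_eq_zeroE)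
  then show c: "coeff h (d - 1) \<noteq> 0" using l(1) d3 by (auto simp: coeff_h l_def)
  then show "h \<noteq> 0" by auto
  have "degree h \<le> d - 1" by (rule degree_le) (auto simp: coeff_h)
  then show "degree h = d - 1" using le_degree[OF c] by simp
qed

lemma relation: "ex h = ey (- f 0)"
proof -
  have s: "{..<d} = insert 0 {1..<d}" using d3 by auto
  have "ex h = (\<Sum>i\<in>{1..<d}. ey (f i) * vx ^ i)"
    unfolding h_def rhom_sum[OF rhom_evp[OF rhom_gconst]]
  proof (rule sum.cong)
    fix i assume "i \<in> {1..<d}"
    then have "degree (f i) = 0" using degree_f_0 by simp
    then obtain k where "f i = [:k:]" by (rule degree_eq_zeroE)
    then show "ex (monom (coeff (f i) 0) i) = ey (f i) * vx ^ i"
      by (simp add: evp_monom[OF rhom_gconst] evp_const[OF rhom_gconst])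
  qed simp
  then show ?thesis using ee_f unfolding s rhom_minus[OF rhom_ey] by (simp add: eq_neg_iff_add_eq_0 add.commute)
qed

lemma Cy_h: "x' \<in> Cy \<Longrightarrow> evp gconst x' h = ex h"
proof -
  assume "x' \<in> Cy"
  then obtain \<tau> where \<tau>: "ff.kaut \<tau>" "\<tau> vy = vy" "x' = \<tau> vx" by (auto simp: Cy_def)
  have "evp gconst x' h = \<tau> (ex h)" using ff.kaut_evp[OF \<tau>(1) vx_S] \<tau>(3) by simp
  also have "\<dots> = ex h" unfolding relation using ff.kaut_evp[OF \<tau>(1) vy_S] \<tau>(2) by simp
  finally show ?thesis .
qed

text \<open>At a pole of x, x'/x is a unit and y ^ d x ^ (1 - d) is a unit. In the expansion of x'/x
  in powers of y over k(x), all terms with j \<ge> 1 vanish at the place, so \<sigma>, which alters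
  only these, keeps the leading coefficient of x'. Tameness then separates the roots of h.\<close>

lemma Cy_fixed:
  assumes x': "x' \<in> Cy" and \<sigma>: "ff.kaut \<sigma>" "\<sigma> vx = vx"
  shows "\<sigma> x' = x'"
proof -
  have x0: "vx \<noteq> 0" using ex_zero[of "[:0, 1:]"] by (auto simp: evp_var rhom_gconst)
  define w where "w = inverse vx"
  have "ff.kdep w" unfolding w_def by (rule ff.kdep_inverse[OF kdep_x])
  then have "w \<in> S" "\<And>p. evp gconst w p = 0 \<Longrightarrow> p = 0" by (auto simp: ff.kdep_def)
  then obtain V where V: "ff.place V" "w \<in> ff.mx V" by (rule ff.place_exists)
  have w: "inverse vx \<in> ff.mx V" "vx \<noteq> 0" "w \<noteq> 0" "w \<in> S" using V(2) x0 \<open>w \<in> S\<close> by (auto simp: w_def)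
  have d1: "0 < d - 1" "0 < d" using d3 by auto
  have x'S: "x' \<in> S" using x' Cy_S by blast
  have "ff.un V (x' ^ (d - 1) * inverse vx ^ (d - 1))"
    by (rule ff.pole_un(3)[OF V(1) w(1,2) x'S h_props(3,2) d1(1) h_props(3,2) Cy_h[OF x', symmetric]])
  then have "ff.un V ((x' * w) ^ (d - 1))" by (simp add: w_def power_mult_distrib)
  from ff.root_un[OF V(1) mult_S[OF x'S w(4)] this d1(1)] have ux': "ff.un V (x' * w)" .
  have mf0: "- f 0 \<noteq> 0" "degree (- f 0) = d" using f0 by auto
  note yp = ff.pole_un[OF V(1) w(1,2) vy_S h_props(3,2) d1(1) mf0 relation, folded w_def]
  obtain D a where D: "D \<noteq> 0" "x' * ex D = evp ex vy a" "degree a < d" using S_reduced_x[OF x'S] by blast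
  have D0: "ex D \<noteq> 0" using ex_zero D(1) by blast
  define s where "s j = ex (coeff a j) * vy ^ j * inverse (ex D) * w" for j
  have rex: "rhom ex" by (rule rhom_evp[OF rhom_gconst])
  have dd: "{..d - 1} = {..<d}" using d3 by auto
  have "evp ex vy a = (\<Sum>j<d. ex (coeff a j) * vy ^ j)"
    using evp_sum_le[OF rex, of a "d - 1" vy] D(3) unfolding dd by simp
  then have x'D: "x' = (\<Sum>j<d. ex (coeff a j) * vy ^ j * inverse (ex D))"
    using D(2) D0 unfolding sum_distrib_right[symmetric] by (simp add: divide_inverse[symmetric] eq_divide_eq)
  have sx: "(\<Sum>j<d. s j) = x' * w" unfolding x'D s_def by (simp add: sum_distrib_right)
  \<comment> \<open>With w = 1/x and y ^ d w ^ (d - 1) a unit, the d-th power of s_j has order B - A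
    j in terms of w. Since A j \<equiv> -j and B \<equiv> 0 modulo d, the values A j are distinct
    and differ from B for 1 \<le> j < d.\<close>
  define A where "A j = d * degree (coeff a j) + (d - 1) * j" for j
  define B where "B = d * degree D + d"
  have A': "A j + j = d * (degree (coeff a j) + j)" for j
    using d3 by (cases d) (simp_all add: A_def algebra_simps)
  have inj: "inj_on A {..<d}"
  proof (rule inj_onI)
    fix i j assume ij: "i \<in> {..<d}" "j \<in> {..<d}" "A i = A j"
    have "d * (degree (coeff a i) + i) + j = d * (degree (coeff a j) + j) + i"
      using A'[of i] A'[of j] ij(3) by simp
    then have "(d * (degree (coeff a i) + i) + j) mod d = (d * (degree (coeff a j) + j) + i) mod d"
      by simp
    then show "i = j" using ij(1,2) by simp
  qed
  have AB: "A j \<noteq> B" if "1 \<le> j" "j < d" for j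
  proof
    assume "A j = B"
    then have "d * (degree (coeff a j) + j) = d * (degree D + 1) + j"
      using A'[of j] by (simp add: B_def)
    then have "(d * (degree (coeff a j) + j)) mod d = (d * (degree D + 1) + j) mod d" by simp
    then show False using that by (simp only: mod_mult_self4 mod_mult_self1_is_0) simp
  qed
  have exS: "ex p \<in> S" for p by (rule ff.S_evp[OF vx_S])
  have sS: "s j \<in> S" for j unfolding s_def
    by (intro mult_S exS ff.S_power vy_S inverse_S w(4))
  have su: "\<exists>u. ff.un V u \<and> s j ^ d * w ^ A j = u * w ^ B" if "s j \<noteq> 0" for j
  proof -
    let ?P = "coeff a j"
    have P0: "?P \<noteq> 0" using that by (auto simp: s_def evp_0)
    have u1: "ff.un V (ex ?P * w ^ degree ?P)" unfolding w_def by (rule ff.evp_pole_un[OF V(1) w(1,2) P0 refl])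
    have u2: "ff.un V (ex D * w ^ degree D)" unfolding w_def by (rule ff.evp_pole_un[OF V(1) w(1,2) D(1) refl])
    let ?u = "(ex ?P * w ^ degree ?P) ^ d * (vy ^ d * w ^ (d - 1)) ^ j * inverse (ex D * w ^ degree D) ^ d"
    have "ff.un V ?u"
      by (intro ff.un_mult[OF V(1)] ff.un_power[OF V(1)] ff.un_inverse[OF V(1)] u1 u2 yp(3))
    moreover have "s j ^ d * w ^ A j = ?u * w ^ B"
    proof -
      have e1: "inverse (ex D * w ^ degree D) ^ d * w ^ B = inverse (ex D) ^ d * w ^ d"
      proof -
        have wB: "w ^ B = (w ^ degree D) ^ d * w ^ d" unfolding B_def power_add by (simp only: power_mult[symmetric] mult.commute)
        have i: "inverse (ex D * w ^ degree D) * w ^ degree D = inverse (ex D)"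
          using w(3) by (simp add: inverse_mult_distrib mult.assoc)
        show ?thesis unfolding wB mult.assoc[symmetric] power_mult_distrib[symmetric] i ..
      qed
      have "s j ^ d * w ^ A j = ((ex ?P * w ^ degree ?P) ^ d * (vy ^ d * w ^ (d - 1)) ^ j) * (inverse (ex D) ^ d * w ^ d)"
        by (simp add: s_def A_def power_add power_mult_distrib power_mult[symmetric] mult_ac)
      then show ?thesis unfolding e1[symmetric] by (simp only: mult.assoc)
    qed
    ultimately show ?thesis by blast
  qed
  have sumV: "sum s {..<d} \<in> V" using ux' by (simp add: sx ff.un_def)
  have smx: "s j \<in> ff.mx V" if "1 \<le> j" "j < d" for j
    by (rule ff.distinct_orders_mx[OF V w(3) d1(2) _ inj sS su sumV _ AB[OF that]]) (use that in auto)
  have "\<sigma> vy \<in> Cx" unfolding Cx_def using \<sigma> by blast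
  then obtain \<alpha> \<beta> where ab: "\<sigma> vy = ey [:\<beta>, \<alpha>:]" using sigma_affine by metis
  have y0: "vy \<noteq> 0" by (rule yp(2))
  \<comment> \<open>\<sigma> y / y = \<alpha> + \<beta>/y is regular at the pole, and \<sigma>
    multiplies the j-th term by r ^ j.\<close>
  define r where "r = \<sigma> vy * inverse vy"
  have "r = gconst \<beta> * inverse vy + gconst \<alpha>"
    unfolding r_def ab using y0 by (simp add: evp_pCons evp_0 rhom_gconst rhom_0 distrib_right)
  then have rV: "r \<in> V"
    using ff.place_D(5)[OF V(1) ff.place_D(6)[OF V(1) ff.place_D(2)[OF V(1)] ff.mx_V[OF yp(1)]] ff.place_D(2)[OF V(1)]] by simp
  have kex: "\<sigma> (ex p) = ex p" for p using ff.kaut_evp[OF \<sigma>(1) vx_S] \<sigma>(2) by simp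
  have trm: "\<sigma> (ex (coeff a j) * vy ^ j * inverse (ex D)) = ex (coeff a j) * \<sigma> vy ^ j * inverse (ex D)" for j
    by (simp add: ff.kaut_D[OF \<sigma>(1)] exS vy_S mult_S inverse_S ff.S_power kex)
  have "\<sigma> x' = (\<Sum>j<d. ex (coeff a j) * \<sigma> vy ^ j * inverse (ex D))"
    unfolding x'D by (subst ff.kaut_sum[OF \<sigma>(1)]) (auto simp: trm intro!: mult_S exS vy_S inverse_S ff.S_power)
  then have "\<sigma> x' * w = (\<Sum>j<d. ex (coeff a j) * \<sigma> vy ^ j * inverse (ex D) * w)" by (simp add: sum_distrib_right)
  also have "\<dots> = (\<Sum>j<d. s j * r ^ j)"
  proof (rule sum.cong)
    fix j
    have "\<sigma> vy = vy * r" using y0 by (simp add: r_def)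
    then have "\<sigma> vy ^ j = vy ^ j * r ^ j" by (simp only: power_mult_distrib)
    then show "ex (coeff a j) * \<sigma> vy ^ j * inverse (ex D) * w = s j * r ^ j" by (simp add: s_def mult_ac)
  qed simp
  finally have "(\<sigma> x' - x') * w = (\<Sum>j<d. s j * (r ^ j - 1))"
    using sx by (simp add: left_diff_distrib right_diff_distrib sum_subtractf)
  also have "\<dots> \<in> ff.mx V"
  proof (rule ff.mx_sum[OF V(1)])
    fix j assume j: "j \<in> {..<d}"
    show "s j * (r ^ j - 1) \<in> ff.mx V"
    proof (cases "j = 0")
      case True
      then show ?thesis using ff.mx_0[OF V(1)] by simp
    next
      case False
      then show ?thesis using j by (intro ff.mx_mult2[OF V(1) smx] ff.place_D(8)[OF V(1)] ff.place_power[OF V(1)] rV ff.place_D(4)[OF V(1)]) auto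
    qed
  qed
  finally have small: "(\<sigma> x' - x') * inverse vx \<in> ff.mx V" by (simp add: w_def)
  have "evp gconst (\<sigma> x') h = ex h" using ff.kaut_evp[OF \<sigma>(1) x'S, of h] Cy_h[OF x'] kex by simp
  then show ?thesis
    by (rule ff.tame_roots_separated[OF V(1) w(1,2) h_props(2) tame ff.kaut_D(1)[OF \<sigma>(1) x'S] x'S _ Cy_h[OF x'] small])
qed

text \<open>Fixed by G_Q, x' is a rational function A(x)/B(x). In B ^ n h(x) = B ^ n h(A/B) the
  right side is nonzero at a root of B, so B is constant, and comparing degrees makes A
  linear.\<close>

lemma Cy_affine:
  assumes x': "x' \<in> Cy"
  obtains \<alpha> \<beta> where "x' = ex [:\<beta>, \<alpha>:]" "pcompose h [:\<beta>, \<alpha>:] = h"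
proof -
  have "x' \<in> ratf vx" by (rule fixQ) (use x' Cy_S Cy_fixed in auto)
  then obtain A B where AB: "x' = ex A / ex B" "ex B \<noteq> 0" "\<forall>c. poly B c = 0 \<longrightarrow> poly A c \<noteq> 0"
    by (rule ratf_coprime)
  note rex = rhom_evp[OF rhom_gconst]
  have exi: "ex p = ex q \<longleftrightarrow> p = q" for p q using ex_zero[of "p - q"] by (auto simp: rhom_diff[OF rex])
  define n where "n = d - 1"
  have n: "0 < n" "degree h = n" "coeff h n \<noteq> 0" using d3 h_props by (auto simp: n_def)
  define H where "H = (\<Sum>j\<le>n. smult (coeff h j) (A ^ j * B ^ (n - j)))"
  have es: "ex (smult c p) = gconst c * ex p" for c p by (rule ff.evp_smult)
  have "ex (B ^ n * h) = ex B ^ n * evp gconst x' h"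
    by (simp only: rhom_mult[OF rex] rhom_power[OF rex] Cy_h[OF x'])
  also have "\<dots> = (\<Sum>j\<le>n. gconst (coeff h j) * (ex B ^ n * x' ^ j))"
    unfolding evp_sum[OF rhom_gconst, of x' h] n(2) by (simp add: sum_distrib_left mult_ac)
  also have "\<dots> = ex H"
    unfolding H_def rhom_sum[OF rex] es
  proof (rule sum.cong)
    fix j assume "j \<in> {..n}"
    then have "ex B ^ n = ex B ^ j * ex B ^ (n - j)" by (simp flip: power_add)
    then have "ex B ^ n * x' ^ j = ex A ^ j * ex B ^ (n - j)" using AB(1,2) by (simp add: power_divide)
    then show "gconst (coeff h j) * (ex B ^ n * x' ^ j) = gconst (coeff h j) * ex (A ^ j * B ^ (n - j))"
      by (simp only: rhom_mult[OF rex] rhom_power[OF rex])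
  qed simp
  finally have BH: "B ^ n * h = H" by (simp only: exi)
  have noroot: False if c: "poly B c = 0" for c
  proof -
    have "poly H c = (\<Sum>j\<le>n. coeff h j * (poly A c ^ j * 0 ^ (n - j)))"
      unfolding H_def poly_sum using c by simp
    also have "\<dots> = (\<Sum>j\<in>{n}. coeff h j * (poly A c ^ j * 0 ^ (n - j)))"
      by (rule sum.mono_neutral_right) auto
    finally have "poly H c \<noteq> 0" using AB(3) c n(3) by simp
    then show False using c n(1) by (simp add: BH[symmetric])
  qed
  have "degree B = 0" using noroot alg_closed_imp_poly_has_root[of B] by (cases "degree B") auto
  then obtain k where k: "B = [:k:]" by (rule degree_eq_zeroE)
  have k0: "k \<noteq> 0" using AB(2) k by (auto simp: evp_0)
  define A' where "A' = smult (inverse k) A"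
  have x'A: "x' = ex A'"
    using AB(1) k k0 by (simp add: A'_def es evp_const rhom_gconst rhom_inverse[OF rhom_gconst] divide_inverse mult.commute)
  note pc = evp_pcompose[OF rhom_gconst, of vx, symmetric]
  have hA: "pcompose h A' = h" using Cy_h[OF x'] unfolding x'A pc exi .
  have "degree A' = 1" using arg_cong[OF hA, of degree] n by (simp add: degree_pcompose)
  then obtain \<alpha> \<beta> where "A' = [:\<beta>, \<alpha>:]" "\<alpha> \<noteq> 0" by (rule degree1_coeffs)
  then show ?thesis using that x'A hA by simp
qed

text \<open>Two conjugates with the same \<alpha> differ by a constant, which is negligible against
  x at a pole of x, so they coincide. Hence d - 1 different multipliers occur, enough for
  \<open>centered_power\<close>.\<close>

lemma h_form:
  obtains x0 c c' where "c \<noteq> 0" "h = smult c ([:- x0, 1:] ^ (d - 1)) + [:c':]"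
proof -
  have "\<forall>x'\<in>Cy. \<exists>\<alpha> \<beta>. x' = ex [:\<beta>, \<alpha>:] \<and> pcompose h [:\<beta>, \<alpha>:] = h" using Cy_affine by metis
  then obtain al be where ab: "\<And>x'. x' \<in> Cy \<Longrightarrow> x' = ex [:be x', al x':]" "\<And>x'. x' \<in> Cy \<Longrightarrow> pcompose h [:be x', al x':] = h"
    by metis
  have x0: "vx \<noteq> 0" using ex_zero[of "[:0, 1:]"] by (auto simp: evp_var rhom_gconst)
  have "ff.kdep (inverse vx)" by (rule ff.kdep_inverse[OF kdep_x])
  then have "inverse vx \<in> S" "\<And>p. evp gconst (inverse vx) p = 0 \<Longrightarrow> p = 0" by (auto simp: ff.kdep_def)
  then obtain V where V: "ff.place V" "inverse vx \<in> ff.mx V" by (rule ff.place_exists)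
  have "inj_on al Cy"
  proof (rule inj_onI)
    fix x1 x2 assume x: "x1 \<in> Cy" "x2 \<in> Cy" "al x1 = al x2"
    have "(x1 - x2) = gconst (be x1 - be x2)"
      using x(3) by (subst (1 2) ab(1)) (simp_all add: x evp_pCons evp_0 rhom_gconst rhom_diff[OF rhom_gconst])
    then have small: "(x1 - x2) * inverse vx \<in> ff.mx V" using ff.mx_mult[OF V(1) ff.place_D(2)[OF V(1)] V(2)] by (simp only:)
    show "x1 = x2"
      by (rule ff.tame_roots_separated[OF V x0 h_props(2) tame _ _ Cy_h[OF x(1)] Cy_h[OF x(2)] small]) (use x Cy_S in auto)
  qed
  then have card: "card (al ` Cy) = d - 1" using card_image Cy_card fixP deg_X by metis
  show ?thesis
  proof (rule centered_power[OF h_props(2) _ tame, of "al ` Cy"])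
    show "1 \<le> d - 1" using d3 by simp
    show "finite (al ` Cy)" using Cy_finite(1) by simp
    show "d - 1 \<le> card (al ` Cy)" using card by simp
    show "\<exists>\<beta>. pcompose h [:\<beta>, \<alpha>:] = h" if "\<alpha> \<in> al ` Cy" for \<alpha> using that ab(2) by blast
  qed (rule that)
qed

lemma dehom_h: "dehom F = map_poly (\<lambda>c. [:c:]) h + [:f 0:]"
proof (rule poly_eqI)
  fix i
  show "coeff (dehom F) i = coeff (map_poly (\<lambda>c. [:c:]) h + [:f 0:]) i"
  proof (cases "1 \<le> i \<and> i < d")
    case True
    then obtain k where "f i = [:k:]" using degree_f_0 by (metis degree_eq_zeroE)
    then show ?thesis using True by (cases i) (simp_all add: coeff_map_poly coeff_h f_def)
  next
    case False
    then show ?thesis using f_large[of i] by (cases i) (simp_all add: coeff_map_poly coeff_h f_def)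
  qed
qed

lemma normal_form:
  obtains e m a y0 x0 c1 c2 c3 where "d = CHAR('a) ^ e * m" "\<not> CHAR('a) dvd m" "m dvd CHAR('a) ^ e - 1"
    "a e \<noteq> 0" "a 0 \<noteq> 0" "c1 \<noteq> 0" "c2 \<noteq> 0"
    "dehom F = map_poly (\<lambda>c. [:c:]) (smult c1 ([:- x0, 1:] ^ (d - 1))) +
      [:smult c2 (pcompose (\<Sum>i\<in>{i. i \<le> e \<and> m dvd CHAR('a) ^ i - 1}. monom (a i) (CHAR('a) ^ i)) [:- y0, 1:] ^ m) + [:c3:]:]"
proof -
  obtain e m a y0 c c' where 1: "d = CHAR('a) ^ e * m" "\<not> CHAR('a) dvd m" "m dvd CHAR('a) ^ e - 1" "a e \<noteq> 0" "a 0 \<noteq> 0" "c \<noteq> 0"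
    "f 0 = smult c (pcompose (\<Sum>i\<in>{i. i \<le> e \<and> m dvd CHAR('a) ^ i - 1}. monom (a i) (CHAR('a) ^ i)) [:- y0, 1:] ^ m) + [:c':]"
    by (rule f0_form)
  obtain x0 c1 k where 2: "c1 \<noteq> 0" "h = smult c1 ([:- x0, 1:] ^ (d - 1)) + [:k:]" by (rule h_form)
  have "map_poly (\<lambda>c. [:c:]) [:k:] = ([:[:k:]:] :: 'a poly poly)" by (simp add: map_poly_pCons)
  then have "dehom F = map_poly (\<lambda>c. [:c:]) (smult c1 ([:- x0, 1:] ^ (d - 1))) + ([:[:k:]:] + [:f 0:])"
    unfolding dehom_h 2(2) rhom_add[OF rhom_map_poly[OF rhom_pconst]] by (simp only: add.assoc)
  also have "[:[:k:]:] + [:f 0:] = [:smult c (pcompose (\<Sum>i\<in>{i. i \<le> e \<and> m dvd CHAR('a) ^ i - 1}. monom (a i) (CHAR('a) ^ i)) [:- y0, 1:] ^ m) + [:k + c':]:]"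
    unfolding 1(7) by simp
  finally show ?thesis by (rule that[OF 1(1-5) 2(1) 1(6)])
qed

end

section \<open>Tangent directions and projective changes of coordinates\<close>

text \<open>The directional derivative, as the coefficient of \<epsilon> in G(a + \<epsilon> u).
  Unlike the partial derivatives it is transported directly by linear substitutions
  (\<open>dd_subst3\<close>).\<close>

definition dd :: "'a::comm_ring_1 poly3 \<Rightarrow> 'a^3 \<Rightarrow> 'a^3 \<Rightarrow> 'a" where
  "dd G a u = coeff (ev3 (\<lambda>c. [:c:]) (\<chi> i. [:a$i, u$i:]) G) 1"

lemma rhom_coeff_0: "rhom (\<lambda>p. coeff p 0)"
  by (auto simp: rhom_def coeff_mult)

lemma coeff_evp_linear:
  assumes h: "rhom h"
  shows "coeff (evp h [:a, u:] p) 0 = evp (\<lambda>c. coeff (h c) 0) a p"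
    and "coeff (evp h [:a, u:] p) 1 =
      poly (map_poly (\<lambda>c. coeff (h c) 1) p) a + u * evp (\<lambda>c. coeff (h c) 0) a (pderiv p)"
proof -
  have h0: "rhom (\<lambda>c. coeff (h c) 0)" by (rule rhom_comp[OF rhom_coeff_0 h])
  have z: "h 0 = 0" by (rule rhom_0[OF h])
  show e0: "coeff (evp h [:a, u:] p) 0 = evp (\<lambda>c. coeff (h c) 0) a p" for p
    by (induct p) (simp_all add: evp_0 evp_pCons h h0 mult_pCons_left)
  show "coeff (evp h [:a, u:] p) 1 =
      poly (map_poly (\<lambda>c. coeff (h c) 1) p) a + u * evp (\<lambda>c. coeff (h c) 0) a (pderiv p)"
  proof (induct p)
    case 0
    then show ?case by (simp add: evp_0)
  next
    case (pCons c p)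
    have m: "poly (map_poly (\<lambda>c. coeff (h c) 1) (pCons c p)) a
        = coeff (h c) 1 + a * poly (map_poly (\<lambda>c. coeff (h c) 1) p) a"
      by (cases "c = 0 \<and> p = 0") (simp_all add: map_poly_pCons z)
    have d: "evp (\<lambda>c. coeff (h c) 0) a (pderiv (pCons c p)) =
        evp (\<lambda>c. coeff (h c) 0) a p + a * evp (\<lambda>c. coeff (h c) 0) a (pderiv p)"
      by (simp add: pderiv_pCons rhom_add[OF rhom_evp[OF h0]] evp_pCons h0 z)
    have pq: "coeff ([:a, u:] * q) 1 = a * coeff q 1 + u * coeff q 0" for q
      by (simp add: mult_pCons_left)
    then show ?case unfolding evp_pCons[OF h] coeff_add pq m d pCons e0 by (simp add: algebra_simps)
  qed
qed

lemma dd_partials: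
  "dd G a u = u$1 * eval3 (pderiv G) a + u$2 * eval3 (map_poly pderiv G) a
     + u$3 * eval3 (map_poly (map_poly pderiv) G) a"
proof -
  let ?h1 = "evp (\<lambda>c. [:c:]) [:a$3, u$3:]" and ?h2 = "evp (evp (\<lambda>c. [:c:]) [:a$3, u$3:]) [:a$2, u$2:]"
  let ?i = "\<lambda>x::'a. x"
  have r1: "rhom ?h1" by (rule rhom_evp[OF rhom_pconst])
  have r2: "rhom ?h2" by (rule rhom_evp[OF r1])
  have z1: "(\<lambda>c. coeff (?h1 c) 0) = evp ?i (a$3)"
    using coeff_evp_linear(1)[OF rhom_pconst, of "a$3" "u$3"] by (simp add: fun_eq_iff)
  have z2: "(\<lambda>c. coeff (?h2 c) 0) = evp (evp ?i (a$3)) (a$2)"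
    using coeff_evp_linear(1)[OF r1, of "a$2" "u$2"] by (simp add: fun_eq_iff z1)
  have m0: "map_poly (\<lambda>c::'a. 0) p = (0 :: 'a poly)" for p by (rule poly_eqI) (simp add: coeff_map_poly)
  have o1: "coeff (?h1 c) 1 = u$3 * evp ?i (a$3) (pderiv c)" for c
    using coeff_evp_linear(2)[OF rhom_pconst, of "a$3" "u$3" c] by (simp add: m0)
  have sm: "poly (map_poly (\<lambda>c. s * f (g c)) q) b = s * evp f b (map_poly g q)"
    if "f (g 0) = 0" "f 0 = 0" "g 0 = 0" for s b and f :: "'c::comm_ring_1 \<Rightarrow> 'a" and g :: "'c \<Rightarrow> 'c" and q
  proof -
    have "map_poly (\<lambda>c. s * f (g c)) q = smult s (map_poly f (map_poly g q))"
      by (rule poly_eqI) (simp add: coeff_map_poly that)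
    then show ?thesis by (simp add: evp_def)
  qed
  have o2: "coeff (?h2 c) 1 = u$3 * evp (evp ?i (a$3)) (a$2) (map_poly pderiv c) + u$2 * evp (evp ?i (a$3)) (a$2) (pderiv c)" for c
    using coeff_evp_linear(2)[OF r1, of "a$2" "u$2" c] unfolding o1 z1 by (subst (asm) sm) (auto simp: evp_0)
  have "dd G a u = coeff (evp ?h2 [:a$1, u$1:] G) 1" by (simp add: dd_def ev3_def)
  also have "\<dots> = poly (map_poly (\<lambda>c. u$3 * evp (evp ?i (a$3)) (a$2) (map_poly pderiv c) + u$2 * evp (evp ?i (a$3)) (a$2) (pderiv c)) G) (a$1)
      + u$1 * evp (evp (evp ?i (a$3)) (a$2)) (a$1) (pderiv G)"
    using coeff_evp_linear(2)[OF r2, of "a$1" "u$1" G] unfolding o2 z2 .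
  also have "map_poly (\<lambda>c. u$3 * evp (evp ?i (a$3)) (a$2) (map_poly pderiv c) + u$2 * evp (evp ?i (a$3)) (a$2) (pderiv c)) G
     = map_poly (\<lambda>c. u$3 * evp (evp ?i (a$3)) (a$2) (map_poly pderiv c)) G + map_poly (\<lambda>c. u$2 * evp (evp ?i (a$3)) (a$2) (pderiv c)) G"
    by (rule poly_eqI) (simp add: coeff_map_poly evp_0)
  finally show ?thesis unfolding poly_add eval3_eq_ev3 ev3_def
    by (subst (asm) (1 2) sm) (auto simp: evp_0)
qed

lemma dd_subst3: "dd (subst3 B G) a u = dd G (B *v a) (B *v u)"
proof -
  have "mv (\<lambda>c. [:c:]) B (\<chi> i. [:a$i, u$i:]) = (\<chi> i. [:(B *v a)$i, (B *v u)$i:])"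
    by (simp add: mv_def matrix_vector_mult_def vec_eq_iff sum_3)
  then show ?thesis by (simp add: dd_def ev3_subst3 rhom_pconst)
qed

lemma partials_iff:
  "eval3 (pderiv G) a = 0 \<and> eval3 (map_poly pderiv G) a = 0 \<and> eval3 (map_poly (map_poly pderiv) G) a = 0
   \<longleftrightarrow> (\<forall>u. dd G a u = 0)"
proof
  assume "\<forall>u. dd G a u = 0"
  then have "dd G a (axis 1 1) = 0" "dd G a (axis 2 1) = 0" "dd G a (axis 3 1) = 0" by blast+
  then show "eval3 (pderiv G) a = 0 \<and> eval3 (map_poly pderiv G) a = 0 \<and> eval3 (map_poly (map_poly pderiv) G) a = 0"
    by (simp add: dd_partials axis_def)
qed (simp add: dd_partials)

text \<open>A point is a subspace of k^3 and \<open>singular_points\<close> ranges over all its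
  vectors, including 0. There G(\<epsilon> u) = \<epsilon> ^ n G(u) has no linear term because n
  \<ge> 2.\<close>

lemma partials_scale:
  fixes G :: "'a::field poly3"
  assumes G: "homogeneous n G" "n \<ge> 2" and a: "\<forall>u. dd G a u = 0"
  shows "dd G (k *s a) u = 0"
proof (cases "k = 0")
  case True
  have "(\<chi> i. [:(k *s a)$i, u$i:]) = (\<chi> i. [:0, 1:] * (\<chi> i. [:u$i:]) $ i)" by (simp add: vec_eq_iff True)
  then have "dd G (k *s a) u = coeff ([:0, 1:] ^ n * ev3 (\<lambda>c. [:c:]) (\<chi> i. [:u$i:]) G) 1"
    unfolding dd_def by (simp only: ev3_homogeneous[OF G(1) rhom_pconst])
  moreover obtain m where "n = Suc (Suc m)" using G(2) by (metis add_2_eq_Suc le_Suc_ex)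
  ultimately show ?thesis by (simp add: mult.assoc mult_pCons_left)
next
  case False
  have "(\<chi> i. [:(k *s a)$i, u$i:]) = (\<chi> i. [:k:] * (\<chi> i. [:a$i, (inverse k *s u)$i:]) $ i)"
    using False by (simp add: vec_eq_iff)
  then have "dd G (k *s a) u = coeff ([:k:] ^ n * ev3 (\<lambda>c. [:c:]) (\<chi> i. [:a$i, (inverse k *s u)$i:]) G) 1"
    unfolding dd_def by (simp only: ev3_homogeneous[OF G(1) rhom_pconst])
  also have "[:k:] ^ n = [:k ^ n:]" by (induct n) (simp_all add: one_pCons)
  finally show ?thesis using a[unfolded dd_def, rule_format, of "inverse k *s u"] by (simp add: dd_def)
qed

lemma singular_span_iff:
  fixes F :: "'a::field poly3"
  assumes "homogeneous n F" "n \<ge> 2"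
  shows "vec.span {p} \<in> singular_points F \<longleftrightarrow> vec.span {p} \<in> curve F \<and> (\<forall>u. dd F p u = 0)"
proof -
  have "(\<forall>v\<in>vec.span {p}. \<forall>u. dd F v u = 0) \<longleftrightarrow> (\<forall>u. dd F p u = 0)"
    using partials_scale[OF assms, of p] bspec[OF _ vec.span_base[of p "{p}"], of "\<lambda>v. \<forall>u. dd F v u = 0"]
    unfolding vec.span_singleton by (intro iffI) (auto simp only: insert_iff rangeE)
  then show ?thesis unfolding singular_points_def partials_iff mem_Collect_eq by blast
qed

lemma homogeneous_partials:
  fixes G :: "'a::idom poly3"
  assumes "homogeneous n G"
  shows "homogeneous (n - 1) (pderiv G)" "homogeneous (n - 1) (map_poly pderiv G)" "homogeneous (n - 1) (map_poly (map_poly pderiv) G)"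
proof -
  have c: "coeff (of_nat k * q) l = of_nat k * coeff q l" for k q l and dummy :: "'x::comm_ring_1"
    by (simp add: of_nat_poly)
  note a = assms[unfolded homogeneous_def, rule_format]
  show "homogeneous (n - 1) (pderiv G)"
    unfolding homogeneous_def coeff_pderiv
  proof (intro allI impI)
    fix i j l assume "coeff (coeff (of_nat (Suc i) * coeff G (Suc i)) j) l \<noteq> 0"
    then have "coeff (coeff (coeff G (Suc i)) j) l \<noteq> 0" by (auto simp: of_nat_poly simp del: of_nat_Suc)
    from a[OF this] show "i + j + l = n - 1" by simp
  qed
  show "homogeneous (n - 1) (map_poly pderiv G)"
    unfolding homogeneous_def
  proof (intro allI impI)
    fix i j l assume "coeff (coeff (coeff (map_poly pderiv G) i) j) l \<noteq> 0"
    then have "coeff (coeff (coeff G i) (Suc j)) l \<noteq> 0"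
      by (auto simp: coeff_map_poly coeff_pderiv of_nat_poly simp del: of_nat_Suc)
    from a[OF this] show "i + j + l = n - 1" by simp
  qed
  show "homogeneous (n - 1) (map_poly (map_poly pderiv) G)"
    unfolding homogeneous_def
  proof (intro allI impI)
    fix i j l assume "coeff (coeff (coeff (map_poly (map_poly pderiv) G) i) j) l \<noteq> 0"
    then have "coeff (coeff (coeff G i) j) (Suc l) \<noteq> 0"
      by (auto simp: coeff_map_poly coeff_pderiv simp del: of_nat_Suc)
    from a[OF this] show "i + j + l = n - 1" by simp
  qed
qed

text \<open>The coefficient of X ^ (n - 1) is a linear form in Y and Z, and it is the differential
  of F at (1:0:0).\<close>

lemma smooth_at_axis:
  fixes F :: "'a::field poly3"
  assumes F: "homogeneous n F" "n \<ge> 2" "eval3 F (axis 1 1) = 0"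
  shows "(\<exists>u. dd F (axis 1 1) u \<noteq> 0) \<longleftrightarrow> coeff F (n - 1) \<noteq> 0"
proof -
  note ax = eval3_axis(1)[OF homogeneous_partials(1)[OF F(1)]] eval3_axis(1)[OF homogeneous_partials(2)[OF F(1)]]
    eval3_axis(1)[OF homogeneous_partials(3)[OF F(1)]]
  have n: "Suc (n - 1) = n" using F(2) by simp
  have "coeff (coeff (coeff F n) 0) 0 = 0" using eval3_axis(1)[OF F(1)] F(3) by simp
  then have e1: "eval3 (pderiv F) (axis 1 1) = 0" unfolding ax(1) coeff_pderiv n by (simp add: of_nat_poly)
  have e2: "eval3 (map_poly pderiv F) (axis 1 1) = coeff (coeff (coeff F (n - 1)) 1) 0"
    unfolding ax(2) by (simp add: coeff_map_poly coeff_pderiv)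
  have e3: "eval3 (map_poly (map_poly pderiv) F) (axis 1 1) = coeff (coeff (coeff F (n - 1)) 0) 1"
    unfolding ax(3) by (simp add: coeff_map_poly coeff_pderiv)
  have "coeff F (n - 1) = 0 \<longleftrightarrow> coeff (coeff (coeff F (n - 1)) 1) 0 = 0 \<and>
      coeff (coeff (coeff F (n - 1)) 0) 1 = 0"
  proof (intro iffI)
    assume a: "coeff (coeff (coeff F (n - 1)) 1) 0 = 0 \<and>
      coeff (coeff (coeff F (n - 1)) 0) 1 = 0"
    have "coeff (coeff (coeff F (n - 1)) j) l = 0" for j l
    proof (rule ccontr)
      assume nz: "coeff (coeff (coeff F (n - 1)) j) l \<noteq> 0"
      then have "n - 1 + j + l = n" using F(1) by (auto simp: homogeneous_def)
      then have "(j = 1 \<and> l = 0) \<or> (j = 0 \<and> l = 1)" using F(2) by linarith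
      then show False using nz a by auto
    qed
    then show "coeff F (n - 1) = 0" by (intro poly_eqI) simp
  qed simp
  then show ?thesis using partials_iff[of F "axis 1 1"] e1 e2 e3 by auto
qed

lemma matrix_inv_invertible:
  fixes A :: "'a::field^3^3"
  assumes "invertible A"
  shows "matrix_inv A ** A = mat 1" "A ** matrix_inv A = mat 1" "invertible (matrix_inv A)" "matrix_inv (matrix_inv A) = A"
proof -
  show i: "matrix_inv A ** A = mat 1" "A ** matrix_inv A = mat 1"
    using assms unfolding invertible_def matrix_inv_def by (metis (mono_tags, lifting) someI_ex)+
  then show i2: "invertible (matrix_inv A)" unfolding invertible_def by blast
  have "matrix_inv A ** matrix_inv (matrix_inv A) = mat 1"
    using i2 unfolding invertible_def matrix_inv_def[of "matrix_inv A"] by (metis (mono_tags, lifting) someI_ex)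
  then show "matrix_inv (matrix_inv A) = A" using i(2) by (metis matrix_mul_assoc matrix_mul_lid matrix_mul_rid)
qed

lemma image_span: "(\<lambda>v. A *v v) ` vec.span {p} = vec.span {A *v p}" for A :: "'a::field^3^3"
  by (auto simp: vec.span_singleton vector_scalar_commute image_iff)

lemma curve_image:
  fixes F :: "'a::field poly3"
  assumes A: "invertible A"
  shows "(\<lambda>R. (\<lambda>v. A *v v) ` R) ` curve F = curve (subst3 (matrix_inv A) F)"
proof -
  note i = matrix_inv_invertible[OF A]
  have inv1: "matrix_inv A *v (A *v u) = u" "A *v (matrix_inv A *v u) = u" for u
    using i(1,2) by (simp_all add: matrix_vector_mul_assoc)
  have pp: "(\<lambda>v. B *v v) ` R \<in> proj_plane" if R: "R \<in> proj_plane" and B: "\<And>u. C *v (B *v u) = u" for R :: "('a^3) set" and B C :: "'a^3^3"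
  proof -
    obtain p where p: "R = vec.span {p}" "p \<noteq> 0" using R by (auto simp: proj_plane_def)
    have "B *v p \<noteq> 0" using B[of p] p(2) by (metis matrix_vector_mult_0_right)
    then show ?thesis unfolding p(1) image_span proj_plane_def by blast
  qed
  show ?thesis
  proof (intro Set.set_eqI iffI)
    fix Q assume "Q \<in> (\<lambda>R. (\<lambda>v. A *v v) ` R) ` curve F"
    then obtain R where R: "R \<in> proj_plane" "\<forall>v\<in>R. eval3 F v = 0" "Q = (\<lambda>v. A *v v) ` R" by (auto simp: curve_def)
    then show "Q \<in> curve (subst3 (matrix_inv A) F)"
      using pp[OF R(1) inv1(1)] by (auto simp: curve_def eval3_subst3 inv1)
  next
    fix Q assume "Q \<in> curve (subst3 (matrix_inv A) F)"
    then have Q: "Q \<in> proj_plane" "\<forall>v\<in>Q. eval3 F (matrix_inv A *v v) = 0" by (auto simp: curve_def eval3_subst3)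
    have "(\<lambda>v. matrix_inv A *v v) ` Q \<in> curve F" using pp[OF Q(1) inv1(2)] Q(2) by (auto simp: curve_def)
    moreover have "Q = (\<lambda>v. A *v v) ` (\<lambda>v. matrix_inv A *v v) ` Q" by (auto simp: image_image inv1)
    ultimately show "Q \<in> (\<lambda>R. (\<lambda>v. A *v v) ` R) ` curve F" by blast
  qed
qed

lemma basis_extension:
  fixes p q :: "'a::field^3"
  assumes "p \<noteq> 0" "\<And>k. q \<noteq> k *s p"
  obtains B :: "'a^3^3" where "invertible B" "column 1 B = p" "column 2 B = q"
proof -
  \<comment> \<open>The cross product of p and q. Where its i-th entry is nonzero, the i-th unit
    vector completes the basis, the determinant being that entry.\<close>
  define c :: "'a^3" where "c = vector [p$2 * q$3 - p$3 * q$2, p$3 * q$1 - p$1 * q$3, p$1 * q$2 - p$2 * q$1]"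
  have "c \<noteq> 0"
  proof
    assume c0: "c = 0"
    then have z: "p$2 * q$3 = p$3 * q$2" "p$3 * q$1 = p$1 * q$3" "p$1 * q$2 = p$2 * q$1"
      by (simp_all add: c_def vec_eq_iff forall_3 vector_3)
    obtain i where i: "p $ i \<noteq> 0" using assms(1) by (auto simp: vec_eq_iff)
    have "p $ i * q $ j = p $ j * q $ i" for i j
      using exhaust_3[of i] exhaust_3[of j] z by (auto simp: mult.commute)
    then have "q = (q $ i / p $ i) *s p" using i by (simp add: vec_eq_iff field_simps)
    then show False using assms(2) by blast
  qed
  then obtain i where i: "c $ i \<noteq> 0" by (auto simp: vec_eq_iff)
  define r :: "'a^3" where "r = axis i 1"
  define B :: "'a^3^3" where "B = (\<chi> k. vector [p $ k, q $ k, r $ k])"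
  have "det B = c $ i"
    using exhaust_3[of i] by (auto simp: det_3 B_def r_def c_def vector_3 axis_def algebra_simps)
  then have "invertible B" using i by (simp add: invertible_det_nz)
  moreover have "column 1 B = p" "column 2 B = q" by (simp_all add: column_def B_def vector_3 vec_eq_iff)
  ultimately show ?thesis by (rule that)
qed

section \<open>The affine equations\<close>

lemma of_nat_coprime_CHAR:
  assumes "CHAR('a::semiring_1) = 0 \<or> coprime n CHAR('a)" "n > 0" "(1::'a) \<noteq> 0"
  shows "of_nat n \<noteq> (0::'a)"
proof
  assume "of_nat n = (0::'a)"
  then have dv: "CHAR('a) dvd n" by (simp add: of_nat_eq_0_iff_char_dvd)
  then have "CHAR('a) \<noteq> 0" using assms(2) by auto
  then have "is_unit CHAR('a)" using assms(1) dv coprime_common_divisor[of n "CHAR('a)" "CHAR('a)"] by simp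
  then have "of_nat 1 = (0::'a)" by (subst of_nat_eq_0_iff_char_dvd) simp
  then show False using assms(3) by simp
qed

lemma rhom_affine_const: "rhom affine_const"
  by (auto simp: rhom_def affine_const_def one_pCons)

lemma rhom_dehom: "rhom dehom"
  unfolding dehom_def by (intro rhom_map_poly rhom_poly1)

lemma dehom_C3: "dehom (C3 c) = affine_const c"
  by (simp add: C3_def dehom_def map_poly_pCons affine_const_def)

lemma dehom_eq_ev3: "dehom G = ev3 affine_const (vector [affine_x, affine_y, 1]) G"
proof (rule rhom3_eqI[OF rhom_dehom rhom_ev3[OF rhom_affine_const]])
  show "dehom (C3 c) = ev3 affine_const (vector [affine_x, affine_y, 1]) (C3 c)" for c
    by (simp add: dehom_C3 ev3_C3 rhom_affine_const)
  show "dehom (X3 $ i) = ev3 affine_const (vector [affine_x, affine_y, 1]) (X3 $ i)" for i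
    unfolding ev3_X3[OF rhom_affine_const] using exhaust_3[of i]
    by (auto simp: X3_def vector_3 dehom_def map_poly_pCons affine_x_def affine_y_def simp flip: one_pCons)
qed

lemma dehom_inj: "homogeneous d G \<Longrightarrow> homogeneous d H \<Longrightarrow> dehom G = dehom H \<Longrightarrow> G = H"
proof (intro poly_eqI)
  fix i j l assume h: "homogeneous d G" "homogeneous d H" "dehom G = dehom H"
  show "coeff (coeff (coeff G i) j) l = coeff (coeff (coeff H i) j) l"
  proof (cases "i + j + l = d")
    case True
    then have "i + j \<le> d" "l = d - i - j" by auto
    then show ?thesis using coeff_dehom[OF h(1), of i j] coeff_dehom[OF h(2), of i j] h(3) by simp
  next
    case False
    then show ?thesis using h(1,2) unfolding homogeneous_def by metis
  qed
qed

lemma evp_map_pconst: "rhom g \<Longrightarrow> evp g a (map_poly (\<lambda>c. [:c:]) p) = evp (\<lambda>c. g [:c:]) a p"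
  using rhom_comp[OF _ rhom_pconst, of g]
  by (induct p) (simp_all add: map_poly_pCons evp_0 evp_pCons)

definition lpoly :: "nat \<Rightarrow> nat \<Rightarrow> (nat \<Rightarrow> 'a::comm_ring_1) \<Rightarrow> 'a poly" where
  "lpoly e m \<alpha> = (\<Sum>i\<in>{i. i \<le> e \<and> m dvd CHAR('a) ^ i - 1}. monom (\<alpha> i) (CHAR('a) ^ i))"

lemma char_dvd_equation_eq:
  "char_dvd_equation d e m \<alpha> c = monom 1 (d - 1) + [:lpoly e m \<alpha> ^ m + [:c:]:]"
proof -
  have p: "[:0, 1::'x::comm_ring_1:] ^ n = monom 1 n" for n
    by (simp add: monom_altdef)
  have q: "[:p:] ^ n = [:p ^ n:]" for p :: "'x::comm_ring_1" and n
    by (induct n) (auto simp: one_pCons)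
  have t: "affine_const a * affine_y ^ n = [:monom a n:]" for a :: 'a and n
    by (simp add: affine_const_def affine_y_def q p smult_monom)
  have s: "(\<Sum>i\<in>A. [:g i:]) = [:sum g A:]" for A :: "nat set" and g :: "nat \<Rightarrow> 'a poly"
    by (rule rhom_sum[OF rhom_pconst, symmetric])
  show ?thesis unfolding char_dvd_equation_def t s q lpoly_def by (simp add: affine_x_def p affine_const_def)
qed

text \<open>For e = 0 only the index i = 0 remains, so the two families of the classification share
  one equation; the normalization \<alpha> 0 = 1 makes the inner sum equal to y.\<close>

lemma prime_to_char_equation_eq:
  fixes \<alpha> :: "nat \<Rightarrow> 'a::comm_ring_1"
  assumes "\<alpha> 0 = 1"
  shows "char_dvd_equation d 0 m \<alpha> c = affine_x ^ (d - 1) + affine_y ^ m + affine_const c"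
proof -
  have "{i. i \<le> 0 \<and> m dvd CHAR('a) ^ i - 1} = {0}" by auto
  moreover have "affine_const (1 :: 'a) = 1" by (rule rhom_1[OF rhom_affine_const])
  ultimately show ?thesis using assms by (simp add: char_dvd_equation_def)
qed

lemma lpoly_degree:
  fixes \<alpha> :: "nat \<Rightarrow> 'a::idom"
  assumes d: "CHAR('a) ^ e * m = d" "d > 0" and m: "m dvd CHAR('a) ^ e - 1" and a: "\<alpha> e \<noteq> 0"
  shows "degree (lpoly e m \<alpha>) = CHAR('a) ^ e" "lpoly e m \<alpha> \<noteq> 0"
proof -
  have p: "e = 0 \<or> CHAR('a) \<ge> 2"
  proof (cases "CHAR('a) = 0")
    case True
    then show ?thesis using d by (cases e) auto
  next
    case False
    then show ?thesis using CHAR_not_1[where ?'a = 'a] by linarith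
  qed
  have inj: "i = e" if "i \<le> e" "CHAR('a) ^ i = CHAR('a) ^ e" for i
    using p
  proof
    assume "CHAR('a) \<ge> 2"
    then have "1 < CHAR('a)" by linarith
    then show ?thesis using that(2) power_inject_exp by blast
  qed (use that(1) in simp)
  have fin: "finite {i. i \<le> e \<and> m dvd CHAR('a) ^ i - 1}" by simp
  have "coeff (lpoly e m \<alpha>) (CHAR('a) ^ e) = (\<Sum>i\<in>{i. i \<le> e \<and> m dvd CHAR('a) ^ i - 1}. if i = e then \<alpha> e else 0)"
    unfolding lpoly_def coeff_sum by (rule sum.cong) (auto simp: coeff_monom dest: inj)
  also have "\<dots> = \<alpha> e" using fin m by (simp add: sum.delta)
  finally have c: "coeff (lpoly e m \<alpha>) (CHAR('a) ^ e) \<noteq> 0" using a by simp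
  then show "lpoly e m \<alpha> \<noteq> 0" by auto
  have le: "CHAR('a) ^ i \<le> CHAR('a) ^ e" if "i \<le> e" for i
    using p
  proof
    assume "CHAR('a) \<ge> 2"
    then show ?thesis using that by (intro power_increasing) auto
  qed (use that in simp)
  have "degree (lpoly e m \<alpha>) \<le> CHAR('a) ^ e"
    unfolding lpoly_def by (rule degree_sum_le) (auto intro: order.trans[OF degree_monom_le] le)
  then show "degree (lpoly e m \<alpha>) = CHAR('a) ^ e" using le_degree[OF c] by simp
qed

lemma equation_poly_degree:
  fixes \<alpha> :: "nat \<Rightarrow> 'a::idom"
  assumes d: "CHAR('a) ^ e * m = d" "d > 0" and m: "m dvd CHAR('a) ^ e - 1" and a: "\<alpha> e \<noteq> 0"
  shows "degree (lpoly e m \<alpha> ^ m + [:c:]) = d"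
proof -
  have "degree (lpoly e m \<alpha> ^ m) = d" using lpoly_degree[where \<alpha> = \<alpha>, OF assms] d by (simp add: degree_power_eq mult.commute)
  then show ?thesis using d(2) by (subst degree_add_eq_left) auto
qed

lemma total_degree_equation:
  fixes \<alpha> :: "nat \<Rightarrow> 'a::idom"
  assumes d: "CHAR('a) ^ e * m = d" "d \<ge> 3" and m: "m dvd CHAR('a) ^ e - 1" and a: "\<alpha> e \<noteq> 0"
  shows "total_degree (char_dvd_equation d e m \<alpha> c) = d"
proof -
  let ?g = "lpoly e m \<alpha> ^ m + [:c:]"
  have d0: "d > 0" using d(2) by simp
  have g: "degree ?g = d" by (rule equation_poly_degree[where \<alpha> = \<alpha>, OF d(1) d0 m a])
  have cf: "coeff (char_dvd_equation d e m \<alpha> c) i = (if i = 0 then ?g else if i = d - 1 then 1 else 0)" for i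
    using d(2) by (cases i) (auto simp: char_dvd_equation_eq coeff_monom)
  show ?thesis
  proof (rule antisym)
    show "total_degree (char_dvd_equation d e m \<alpha> c) \<le> d"
    proof (rule total_degree_le)
      fix i j assume nz: "coeff (coeff (char_dvd_equation d e m \<alpha> c) i) j \<noteq> 0"
      show "i + j \<le> d"
      proof (cases "i = 0")
        case True
        then show ?thesis using nz le_degree[of ?g j] g by (simp add: cf)
      next
        case False
        then have "i = d - 1" "j = 0" using nz by (auto simp: cf coeff_1 split: if_splits)
        then show ?thesis by simp
      qed
    qed
    have "coeff ?g d \<noteq> 0" using g d0 leading_coeff_neq_0[of ?g] by fastforce
    then have "coeff (coeff (char_dvd_equation d e m \<alpha> c) 0) d \<noteq> 0" by (simp add: cf)
    then show "d \<le> total_degree (char_dvd_equation d e m \<alpha> c)" using total_degree_ge by fastforce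
  qed
qed

context gal_curve
begin

lemma normalized:
  obtains M :: "'a^3^3" and e m \<alpha> c \<kappa> where "invertible M" "d = CHAR('a) ^ e * m" "\<not> CHAR('a) dvd m" "m dvd CHAR('a) ^ e - 1"
    "\<alpha> e \<noteq> 0" "\<alpha> 0 = (1::'a)" "c \<in> {0, 1}" "\<kappa> \<noteq> 0" "subst3 M F = C3 \<kappa> * homogenization (char_dvd_equation d e m \<alpha> c)"
proof -
  obtain e m a y0 x0 c1 c2 c3 where nf: "d = CHAR('a) ^ e * m" "\<not> CHAR('a) dvd m" "m dvd CHAR('a) ^ e - 1"
    "a e \<noteq> 0" "a 0 \<noteq> 0" "c1 \<noteq> 0" "c2 \<noteq> 0"
    "dehom F = map_poly (\<lambda>c. [:c:]) (smult c1 ([:- x0, 1:] ^ (d - 1))) +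
      [:smult c2 (pcompose (\<Sum>i\<in>{i. i \<le> e \<and> m dvd CHAR('a) ^ i - 1}. monom (a i) (CHAR('a) ^ i)) [:- y0, 1:] ^ m) + [:c3:]:]"
    by (rule normal_form)
  define n where "n = d - 1"
  have n0: "n > 0" and m0: "m > 0" using d3 nf(1) by (auto simp: n_def intro: gr0I)
  \<comment> \<open>Scaling x by s makes the constant term equal to the coefficient of the x-power,
    unless it is 0.\<close>
  obtain s c where s: "s \<noteq> 0" "c \<in> {0, 1}" "c1 * s ^ n * c = c3"
  proof (cases "c3 = 0")
    case True
    then show ?thesis using that[of 1 0] by simp
  next
    case False
    obtain s where s: "s ^ n = c3 / c1" using nth_root_exists[OF n0] by blast
    have "s \<noteq> 0"
    proof
      assume "s = 0"
      then show False using s False nf(6) n0 by (simp add: power_0_left)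
    qed
    then show ?thesis using that[of s 1] s nf(6) by simp
  qed
  define \<kappa> where "\<kappa> = c1 * s ^ n"
  have \<kappa>0: "\<kappa> \<noteq> 0" using nf(6) s(1) by (simp add: \<kappa>_def)
  \<comment> \<open>The m-th root absorbs the remaining factor c2/\<kappa> into the inner
    sum.\<close>
  obtain \<rho> where \<rho>: "\<rho> ^ m = c2 / \<kappa>" using nth_root_exists[OF m0] by blast
  have \<rho>0: "\<rho> \<noteq> 0" using \<rho> nf(7) \<kappa>0 m0 by (auto simp: power_0_left)
  \<comment> \<open>Scaling y by t makes the linear coefficient \<rho> a_0 t equal to 1.\<close>
  define t where "t = inverse (\<rho> * a 0)"
  have t0: "t \<noteq> 0" using \<rho>0 nf(5) by (simp add: t_def)
  define \<alpha> where "\<alpha> i = \<rho> * a i * t ^ (CHAR('a) ^ i)" for i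
  define M :: "'a^3^3" where "M = vector [vector [s, 0, x0], vector [0, t, y0], vector [0, 0, 1]]"
  have "det M = s * t" by (simp add: det_3 M_def vector_3)
  then have M: "invertible M" using s(1) t0 by (simp add: invertible_det_nz)
  let ?h = "affine_const :: 'a \<Rightarrow> _"
  let ?I = "{i. i \<le> e \<and> m dvd CHAR('a) ^ i - 1}"
  note rh = rhom_affine_const[where ?'a = 'a]
  note hs = rhom_0[OF rh] rhom_1[OF rh] rhom_add[OF rh] rhom_mult[OF rh] rhom_power[OF rh] rhom_minus[OF rh]
  define xx where "xx = ?h s * affine_x + ?h x0"
  define yy where "yy = ?h t * affine_y + ?h y0"
  have mvM: "mv ?h M (vector [affine_x, affine_y, 1]) = vector [xx, yy, 1]"
    by (simp add: mv_def M_def vec_eq_iff forall_3 sum_3 vector_3 xx_def yy_def hs)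
  have rhy: "rhom (evp ?h yy)" by (rule rhom_evp[OF rh])
  have smh: "evp ?h b (smult k p) = ?h k * evp ?h b p" for b k p
    using rhom_mult[OF rhom_evp[OF rh, of b], of "[:k:]" p] by (simp add: evp_const[OF rh])
  note pch = evp_pcompose[OF rh]
  have lin: "evp ?h b [:- k, 1:] = b - ?h k" for b k by (simp add: evp_pCons[OF rh] evp_0 hs)
  have ehc: "(\<lambda>c. evp ?h yy [:c:]) = ?h" by (simp add: evp_const[OF rh])
  have "dehom (subst3 M F) = ev3 ?h (vector [xx, yy, 1]) F"
    by (simp add: dehom_eq_ev3 ev3_subst3[OF rh] mvM)
  also have "\<dots> = evp (evp ?h yy) xx (dehom F)" by (rule ev3_dehom[OF rh])
  also have "\<dots> = ?h c1 * (xx - ?h x0) ^ n + (?h c2 * evp ?h (yy - ?h y0) (\<Sum>i\<in>?I. monom (a i) (CHAR('a) ^ i)) ^ m + ?h c3)"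
    unfolding nf(8) rhom_add[OF rhom_evp[OF rhy]] evp_map_pconst[OF rhy] ehc evp_const[OF rhy] smh
      rhom_power[OF rhom_evp[OF rh]] lin rhom_add[OF rhy] rhom_power[OF rhy] pch evp_const[OF rh] n_def ..
  also have "\<dots> = ?h c1 * (?h s * affine_x) ^ n + (?h c2 * (\<Sum>i\<in>?I. ?h (a i) * (?h t * affine_y) ^ (CHAR('a) ^ i)) ^ m + ?h c3)"
    by (simp add: xx_def yy_def rhom_sum[OF rhom_evp[OF rh]] evp_monom[OF rh])
  also have "\<dots> = ?h \<kappa> * char_dvd_equation d e m \<alpha> c"
  proof -
    have "(\<Sum>i\<in>?I. ?h (\<alpha> i) * affine_y ^ (CHAR('a) ^ i)) = ?h \<rho> * (\<Sum>i\<in>?I. ?h (a i) * (?h t * affine_y) ^ (CHAR('a) ^ i))"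
      unfolding sum_distrib_left by (rule sum.cong) (simp_all add: \<alpha>_def hs power_mult_distrib mult_ac)
    then have "?h \<kappa> * (\<Sum>i\<in>?I. ?h (\<alpha> i) * affine_y ^ (CHAR('a) ^ i)) ^ m
      = ?h (\<kappa> * \<rho> ^ m) * (\<Sum>i\<in>?I. ?h (a i) * (?h t * affine_y) ^ (CHAR('a) ^ i)) ^ m"
      by (simp only: power_mult_distrib hs mult.assoc)
    also have "\<kappa> * \<rho> ^ m = c2" using \<rho> \<kappa>0 by simp
    finally have e1: "?h c2 * (\<Sum>i\<in>?I. ?h (a i) * (?h t * affine_y) ^ (CHAR('a) ^ i)) ^ m
      = ?h \<kappa> * (\<Sum>i\<in>?I. ?h (\<alpha> i) * affine_y ^ (CHAR('a) ^ i)) ^ m" ..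
    have e2: "?h c1 * (?h s * affine_x) ^ n = ?h \<kappa> * affine_x ^ n"
      by (simp only: \<kappa>_def hs power_mult_distrib mult.assoc)
    have e3: "?h c3 = ?h \<kappa> * ?h c" unfolding s(3)[symmetric] by (simp only: \<kappa>_def hs)
    show ?thesis unfolding char_dvd_equation_def e1 e2 e3 n_def[symmetric] by (simp only: distrib_left add.assoc)
  qed
  finally have dh: "dehom (subst3 M F) = dehom (C3 \<kappa> * homogenization (char_dvd_equation d e m \<alpha> c))"
    by (simp only: rhom_mult[OF rhom_dehom] dehom_C3 dehom_homogenization)
  have ae: "\<alpha> e \<noteq> 0" using nf(4) t0 \<rho>0 by (simp add: \<alpha>_def)
  have "\<rho> * a 0 * inverse (\<rho> * a 0) = 1" by (rule right_inverse) (use nf(5) \<rho>0 in simp)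
  then have a0: "\<alpha> 0 = 1" by (simp only: \<alpha>_def t_def power_0 power_one_right)
  have td: "total_degree (char_dvd_equation d e m \<alpha> c) = d" by (rule total_degree_equation[where \<alpha> = \<alpha>, OF nf(1)[symmetric] d3 nf(3) ae])
  have "homogeneous d (C3 \<kappa> * homogenization (char_dvd_equation d e m \<alpha> c))"
    using homogeneous_mult[OF homogeneous_C3[of \<kappa>] homogeneous_homogenization[of "char_dvd_equation d e m \<alpha> c"]] td by simp
  from dehom_inj[OF homogeneous_subst3[OF hom] this dh] show ?thesis
    by (rule that[OF M nf(1-3) ae a0 s(2) \<kappa>0])
qed

end

section \<open>Frames given by a pair of Galois points\<close>

context gcurve
begin

text \<open>The action on places is faithful: equal images of places force equal values of \<alpha>
  z and \<beta> z everywhere.\<close>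

lemma act_inj:
  assumes a: "ff.kaut \<alpha>" and b: "ff.kaut \<beta>" and e: "act \<alpha> = act \<beta>" and z: "z \<in> S"
  shows "\<alpha> z = \<beta> z"
proof (rule ff.pval_eqD)
  show "\<alpha> z \<in> S" "\<beta> z \<in> S" using ff.kaut_D(1) a b z by auto
  fix W assume "W \<in> ff.Pl"
  then have W: "ff.place W" by (simp add: ff.Pl_def)
  let ?V = "inv_into S \<alpha> ` W"
  have V: "ff.place ?V" by (rule ff.kaut_place(1)[OF ff.kaut_inv(1)[OF a] W])
  have aV: "\<alpha> ` ?V = W"
    unfolding image_image using ff.kaut_inv(3)[OF a] ff.place_D(10)[OF W] by force
  have "\<alpha> ` ?V = psi ` act \<alpha> (phi ` ?V)" using act_N(2)[OF a place_N(1)[OF V]] place_N(2)[OF V] by simp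
  also have "\<dots> = \<beta> ` ?V" unfolding e using act_N(2)[OF b place_N(1)[OF V]] place_N(2)[OF V] by simp
  finally have bV: "\<beta> ` ?V = W" using aV by simp
  show "ff.pval (\<alpha> z) W = ff.pval (\<beta> z) W"
    using ff.pval_kaut[OF a V z] ff.pval_kaut[OF b V z] aV bV by simp
qed

lemma frame:
  assumes B: "invertible B"
  defines "v' \<equiv> mv gconst (matrix_inv B) v"
  shows "(matrix_inv B $ 2, matrix_inv B $ 3) \<in> projection_forms (vec.span {column 1 B})"
    "(matrix_inv B $ 1, matrix_inv B $ 3) \<in> projection_forms (vec.span {column 2 B})"
    "proj_t (matrix_inv B $ 2, matrix_inv B $ 3) = gcurve.vy v'"
    "proj_t (matrix_inv B $ 1, matrix_inv B $ 3) = gcurve.vx v'"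
proof -
  interpret g: gcurve "subst3 B F" d v' unfolding v'_def by (rule gcurve_change(1)[OF B])
  have l: "lin (matrix_inv B $ i) = v' $ i" for i by (simp add: lin_sum v'_def mv_def)
  show "proj_t (matrix_inv B $ 2, matrix_inv B $ 3) = g.vy" "proj_t (matrix_inv B $ 1, matrix_inv B $ 3) = g.vx"
    by (simp_all add: proj_t_def l g.vy_def g.vx_def)
qed (rule projection_forms_basis[OF B]; simp)+

text \<open>Right and left cosets of G_P by \<sigma> agree, so \<tau> \<sigma> = \<sigma> \<tau>'
  with \<tau>' fixing y; apply both sides to y.\<close>

lemma semidirect_commute:
  assumes P: "galois_group_at F P = act ` {\<tau>. ff.kaut \<tau> \<and> \<tau> y = y}"
    and Q: "galois_group_at F Q = act ` {\<sigma>. ff.kaut \<sigma> \<and> \<sigma> x = x}"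
    and sd: "internal_semidirect_product (Aut_X F) (galois_group_at F P) (galois_group_at F Q)"
    and y: "y \<in> S" and \<tau>: "ff.kaut \<tau>" "\<tau> y = y" and \<sigma>: "ff.kaut \<sigma>" "\<sigma> x = x"
  shows "\<tau> (\<sigma> y) = \<sigma> y"
proof -
  let ?A = "Aut_X F" and ?P = "galois_group_at F P" and ?Q = "galois_group_at F Q"
  interpret A: group ?A by (rule group_Aut)
  have n: "?P \<lhd> ?A\<lparr>carrier := ?P <#>\<^bsub>?A\<^esub> ?Q\<rparr>" using sd by (simp add: internal_semidirect_product_def)
  have "act id \<in> ?P" unfolding P using kaut_id by auto
  moreover have "act \<sigma> \<in> ?Q" unfolding Q using \<sigma> by blast
  ultimately have "act id \<otimes>\<^bsub>?A\<^esub> act \<sigma> \<in> ?P <#>\<^bsub>?A\<^esub> ?Q" unfolding set_mult_def by blast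
  then have "act \<sigma> \<in> ?P <#>\<^bsub>?A\<^esub> ?Q" using one_act A.l_one[OF act_Aut[OF \<sigma>(1)]] by simp
  then have "?P #>\<^bsub>?A\<^esub> act \<sigma> = act \<sigma> <#\<^bsub>?A\<^esub> ?P"
    using normal.coset_eq[OF n] by (simp add: r_coset_def l_coset_def)
  moreover have "act \<tau> \<otimes>\<^bsub>?A\<^esub> act \<sigma> \<in> ?P #>\<^bsub>?A\<^esub> act \<sigma>" unfolding r_coset_def P using \<tau> by blast
  ultimately have "act \<tau> \<otimes>\<^bsub>?A\<^esub> act \<sigma> \<in> act \<sigma> <#\<^bsub>?A\<^esub> ?P" by simp
  then obtain \<tau>' where \<tau>': "ff.kaut \<tau>'" "\<tau>' y = y" "act \<tau> \<otimes>\<^bsub>?A\<^esub> act \<sigma> = act \<sigma> \<otimes>\<^bsub>?A\<^esub> act \<tau>'"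
    unfolding l_coset_def P by blast
  have "act (\<tau> \<circ> \<sigma>) = act (\<sigma> \<circ> \<tau>')" using \<tau>'(3) mult_act[OF \<tau>(1) \<sigma>(1)] mult_act[OF \<sigma>(1) \<tau>'(1)] by simp
  from act_inj[OF ff.kaut_comp[OF \<tau>(1) \<sigma>(1)] ff.kaut_comp[OF \<sigma>(1) \<tau>'(1)] this y] show ?thesis using \<tau>'(2) by simp
qed

lemma equation_of_semidirect:
  assumes tame: "CHAR('a) = 0 \<or> coprime (d - 1) CHAR('a)"
    and P: "inner_galois_point F P" and Q: "outer_galois_point F Q"
    and sd: "internal_semidirect_product (Aut_X F) (galois_group_at F P) (galois_group_at F Q)"
  obtains e m \<alpha> c where "d = CHAR('a) ^ e * m" "\<not> CHAR('a) dvd m" "m dvd CHAR('a) ^ e - 1"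
    "\<alpha> e \<noteq> 0" "\<alpha> 0 = (1::'a)" "c \<in> {0, 1}"
    "projectively_equivalent (curve F) (curve_of_affine_equation (char_dvd_equation d e m \<alpha> c))"
proof -
  have d2: "d \<ge> 2" "d > 0" using d3 by auto
  obtain p where p: "P = vec.span {p}" "p \<noteq> 0" using P by (auto simp: inner_galois_point_def galois_point_def proj_plane_def)
  obtain q where q: "Q = vec.span {q}" "q \<noteq> 0" using Q by (auto simp: outer_galois_point_def galois_point_def proj_plane_def)
  have Fp: "eval3 F p = 0" "\<exists>u. dd F p u \<noteq> 0"
    using P proj_plane_eval3[OF hom d2(2), of p] singular_span_iff[OF hom d2(1), of p] p by (auto simp: inner_galois_point_def)
  have Fq: "eval3 F q \<noteq> 0"
    using Q proj_plane_eval3[OF hom d2(2), of q] q by (auto simp: outer_galois_point_def)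
  \<comment> \<open>P lies on C and Q does not, so p and q can serve as the first two basis
    vectors.\<close>
  have "q \<noteq> k *s p" for k using Fp(1) Fq eval3_homogeneous[OF hom, of k p] by auto
  then obtain B :: "'a^3^3" where B: "invertible B" "column 1 B = p" "column 2 B = q" by (rule basis_extension[OF p(2)])
  define v' where "v' = mv gconst (matrix_inv B) v"
  interpret g: gcurve "subst3 B F" d v' unfolding v'_def by (rule gcurve_change(1)[OF B(1)])
  have S: "g.S = S" unfolding v'_def by (rule gcurve_change(2)[OF B(1)])
  note fr = frame[OF B(1), folded v'_def, unfolded B(2,3), folded p(1) q(1)]
  have ax: "B *v axis 1 1 = p" "B *v axis 2 1 = q"
    unfolding B(2,3)[symmetric] by (simp_all add: matrix_vector_mult_def column_def axis_def vec_eq_iff if_distrib cong: if_cong)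
  have axp: "eval3 (subst3 B F) (axis 1 1) = 0" using Fp(1) by (simp add: eval3_subst3 ax)
  obtain u where u: "dd F p u \<noteq> 0" using Fp(2) by blast
  have "dd (subst3 B F) (axis 1 1) (matrix_inv B *v u) \<noteq> 0"
    using u matrix_inv_invertible(2)[OF B(1)] by (simp add: dd_subst3 ax matrix_vector_mul_assoc)
  then have c1: "coeff (subst3 B F) (d - 1) \<noteq> 0" using smooth_at_axis[OF g.hom d2(1) axp] by blast
  have cd: "coeff (subst3 B F) d = 0"
  proof (intro poly_eqI)
    fix j l
    have "coeff (coeff (coeff (subst3 B F) d) 0) 0 = 0" using eval3_axis(1)[OF g.hom] axp by simp
    moreover have "coeff (coeff (coeff (subst3 B F) d) j) l = 0" if "j \<noteq> 0 \<or> l \<noteq> 0"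
      using g.hom[unfolded homogeneous_def, rule_format, of d j l] that by linarith
    ultimately show "coeff (coeff (coeff (subst3 B F) d) j) l = coeff (coeff 0 j) l"
      by (cases "j = 0 \<and> l = 0") auto
  qed
  have degF: "degree (subst3 B F) = d - 1"
  proof (rule antisym)
    show "degree (subst3 B F) \<le> d - 1"
    proof (rule degree_le, intro allI impI)
      fix i assume "d - 1 < i"
      then have "i = d \<or> degree (subst3 B F) < i" using degree_homogeneous_le[OF g.hom] by linarith
      then show "coeff (subst3 B F) i = 0" using cd coeff_eq_0 by blast
    qed
  qed (rule le_degree[OF c1])
  have gP: "galois_extension K (projection_field F P)" and gQ: "galois_extension K (projection_field F Q)"
    using P Q by (simp_all add: inner_galois_point_def outer_galois_point_def galois_point_def)
  note fP = conjunct2[OF iffD1[OF galois_extension_iff[OF fr(1)] gP], unfolded fr(3)]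
  note fQ = conjunct2[OF iffD1[OF galois_extension_iff[OF fr(2)] gQ], unfolded fr(4)]
  note GP = galois_group_at_eq[OF fr(1), unfolded fr(3)]
  note GQ = galois_group_at_eq[OF fr(2), unfolded fr(4)]
  interpret g: gal_curve "subst3 B F" d v'
  proof
    show "eval3 (subst3 B F) (axis 2 1) \<noteq> 0" using Fq by (simp add: eval3_subst3 ax)
    show "z \<in> g.ratf g.vy" if "z \<in> g.S" "\<And>\<tau>. g.ff.kaut \<tau> \<Longrightarrow> \<tau> g.vy = g.vy \<Longrightarrow> \<tau> z = z" for z
      using fP that unfolding S by blast
    show "z \<in> g.ratf g.vx" if "z \<in> g.S" "\<And>\<tau>. g.ff.kaut \<tau> \<Longrightarrow> \<tau> g.vx = g.vx \<Longrightarrow> \<tau> z = z" for z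
      using fQ that unfolding S by blast
    show "\<tau> (\<sigma> g.vy) = \<sigma> g.vy" if "g.ff.kaut \<tau>" "\<tau> g.vy = g.vy" "g.ff.kaut \<sigma>" "\<sigma> g.vx = g.vx" for \<tau> \<sigma>
      using semidirect_commute[OF GP GQ sd] g.vy_S that unfolding S by blast
    show "of_nat (d - 1) \<noteq> (0::'a)" by (rule of_nat_coprime_CHAR[OF tame]) (use d3 in auto)
  qed (rule degF)
  obtain M :: "'a^3^3" and e m \<alpha> c \<kappa> where n: "invertible M" "d = CHAR('a) ^ e * m" "\<not> CHAR('a) dvd m" "m dvd CHAR('a) ^ e - 1"
    "\<alpha> e \<noteq> 0" "\<alpha> 0 = (1::'a)" "c \<in> {0, 1}" "\<kappa> \<noteq> 0" "subst3 M (subst3 B F) = C3 \<kappa> * homogenization (char_dvd_equation d e m \<alpha> c)"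
    by (rule g.normalized)
  let ?W = "B ** M"
  have W: "invertible ?W" using invertible_mult[OF B(1) n(1)] .
  have sW: "subst3 ?W F = C3 \<kappa> * homogenization (char_dvd_equation d e m \<alpha> c)" using n(9) by (simp add: subst3_subst3)
  have "eval3 (C3 \<kappa> * G) u = \<kappa> * eval3 G u" for G u
    by (simp add: eval3_eq_ev3 rhom_mult[OF rhom_ev3[OF rhom_id]] ev3_C3[OF rhom_id])
  then have "curve (subst3 ?W F) = curve_of_affine_equation (char_dvd_equation d e m \<alpha> c)"
    unfolding sW curve_def curve_of_affine_equation_def using n(8) by simp
  then have "(\<lambda>R. (\<lambda>v. matrix_inv ?W *v v) ` R) ` curve F = curve_of_affine_equation (char_dvd_equation d e m \<alpha> c)"
    using curve_image[OF matrix_inv_invertible(3)[OF W], of F] matrix_inv_invertible(4)[OF W] by simp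
  then have "projectively_equivalent (curve F) (curve_of_affine_equation (char_dvd_equation d e m \<alpha> c))"
    unfolding projectively_equivalent_def using matrix_inv_invertible(3)[OF W] by blast
  then show ?thesis by (rule that[OF n(2-7)])
qed

end

section \<open>Commuting subgroups\<close>

lemma (in group) commuting_product:
  assumes N: "subgroup N G" and H: "subgroup H G" and comm: "\<And>a b. a \<in> N \<Longrightarrow> b \<in> H \<Longrightarrow> a \<otimes> b = b \<otimes> a"
  shows "subgroup (N <#> H) G" "N \<lhd> G\<lparr>carrier := N <#> H\<rparr>"
proof -
  have c: "a \<in> N \<Longrightarrow> a \<in> carrier G" "b \<in> H \<Longrightarrow> b \<in> carrier G" for a b
    using subgroup.mem_carrier[OF N] subgroup.mem_carrier[OF H] by auto
  show sub: "subgroup (N <#> H) G"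
  proof (rule subgroupI)
    show "N <#> H \<subseteq> carrier G" using c by (auto simp: set_mult_def)
    show "N <#> H \<noteq> {}" using subgroup.one_closed[OF N] subgroup.one_closed[OF H] by (auto simp: set_mult_def)
    fix x assume "x \<in> N <#> H"
    then obtain a b where ab: "a \<in> N" "b \<in> H" "x = a \<otimes> b" by (auto simp: set_mult_def)
    have i: "inv a \<in> N" "inv b \<in> H" using ab subgroup.m_inv_closed[OF N] subgroup.m_inv_closed[OF H] by auto
    have "inv x = inv a \<otimes> inv b" unfolding ab(3) using c ab i comm[OF i] by (simp add: inv_mult_group)
    then show "inv x \<in> N <#> H" using i by (auto simp: set_mult_def)
    fix y assume "y \<in> N <#> H"
    then obtain a' b' where ab': "a' \<in> N" "b' \<in> H" "y = a' \<otimes> b'" by (auto simp: set_mult_def)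
    have "x \<otimes> y = a \<otimes> (b \<otimes> a') \<otimes> b'" unfolding ab(3) ab'(3) using c ab ab' by (simp add: m_assoc)
    also have "b \<otimes> a' = a' \<otimes> b" by (rule comm[OF ab'(1) ab(2), symmetric])
    finally have "x \<otimes> y = (a \<otimes> a') \<otimes> (b \<otimes> b')" using c ab ab' by (simp add: m_assoc)
    then show "x \<otimes> y \<in> N <#> H"
      using subgroup.m_closed[OF N ab(1) ab'(1)] subgroup.m_closed[OF H ab(2) ab'(2)] by (auto simp: set_mult_def)
  qed
  interpret C: group "G\<lparr>carrier := N <#> H\<rparr>" by (rule subgroup.subgroup_is_group[OF sub group_axioms])
  have NC: "N \<subseteq> N <#> H"
  proof
    fix a assume a: "a \<in> N"
    then have "a = a \<otimes> \<one>" using c by simp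
    then show "a \<in> N <#> H" using a subgroup.one_closed[OF H] unfolding set_mult_def by blast
  qed
  show "N \<lhd> G\<lparr>carrier := N <#> H\<rparr>"
    unfolding C.normal_inv_iff
  proof (intro conjI ballI)
    show "subgroup N (G\<lparr>carrier := N <#> H\<rparr>)" by (rule subgroup_incl[OF N sub NC])
    fix x h assume x: "x \<in> carrier (G\<lparr>carrier := N <#> H\<rparr>)" and h: "h \<in> N"
    then obtain a b where ab: "a \<in> N" "b \<in> H" "x = a \<otimes> b" by (auto simp: set_mult_def)
    have "x \<otimes> h \<otimes> inv x = a \<otimes> (b \<otimes> h) \<otimes> (inv b \<otimes> inv a)"
      unfolding ab(3) using c ab h by (simp add: m_assoc inv_mult_group)
    also have "b \<otimes> h = h \<otimes> b" by (rule comm[OF h ab(2), symmetric])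
    also have "a \<otimes> (h \<otimes> b) \<otimes> (inv b \<otimes> inv a) = a \<otimes> h \<otimes> ((b \<otimes> inv b) \<otimes> inv a)"
      using c ab h by (simp only: m_assoc m_closed inv_closed)
    also have "\<dots> = a \<otimes> h \<otimes> inv a" using c ab h by simp
    finally have "x \<otimes> h \<otimes> inv x \<in> N"
      using ab(1) h subgroup.m_closed[OF N] subgroup.m_inv_closed[OF N] by simp
    then show "x \<otimes>\<^bsub>G\<lparr>carrier := N <#> H\<rparr>\<^esub> h \<otimes>\<^bsub>G\<lparr>carrier := N <#> H\<rparr>\<^esub> inv\<^bsub>G\<lparr>carrier := N <#> H\<rparr>\<^esub> x \<in> N"
      using m_inv_consistent[OF sub, of x] x by simp
  qed
qed

lemma (in group) commuting_direct_product:
  assumes N: "subgroup N G" and H: "subgroup H G" and comm: "\<And>a b. a \<in> N \<Longrightarrow> b \<in> H \<Longrightarrow> a \<otimes> b = b \<otimes> a"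
    and "N \<inter> H = {\<one>}"
  shows "internal_direct_product G N H"
proof -
  have "H <#> N = N <#> H" using comm unfolding set_mult_def by fastforce
  then show ?thesis
    using commuting_product[OF N H comm] commuting_product(2)[OF H N] comm assms(4)
    unfolding internal_direct_product_def by simp
qed

section \<open>Separable polynomials\<close>

lemma card_roots_separable:
  fixes p :: "'a::alg_closed_field poly"
  assumes p: "p \<noteq> 0" and sep: "\<And>x. poly p x = 0 \<Longrightarrow> poly (pderiv p) x \<noteq> 0"
  shows "card {x. poly p x = 0} = degree p"
proof -
  let ?Z = "{x. poly p x = 0}"
  let ?q = "\<Prod>a\<in>?Z. [:- a, 1:]"
  have fin: "finite ?Z" by (rule poly_roots_finite[OF p])
  have "?q dvd p" by (rule prod_linear_dvd[OF fin]) simp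
  then obtain r where r: "p = ?q * r" by (rule dvdE)
  have noroot: "poly r a \<noteq> 0" for a
  proof
    assume a: "poly r a = 0"
    then have pa: "poly p a = 0" by (subst r) simp
    then have "poly ?q a = 0" unfolding poly_prod using fin by (intro prod_zero) auto
    then have "poly (pderiv p) a = 0" using a by (subst r) (simp add: pderiv_mult)
    then show False using sep[OF pa] by simp
  qed
  then have "degree r = 0" using alg_closed_imp_poly_has_root[of r] by (cases "degree r") auto
  moreover have "r \<noteq> 0" "?q \<noteq> 0" using p r by auto
  ultimately have "degree p = degree ?q" by (subst r) (simp add: degree_mult_eq)
  then show ?thesis using degree_prod_linear[OF fin] by simp
qed

lemma roots_of_unity:
  assumes "of_nat n \<noteq> (0::'a::alg_closed_field)"
  shows "card {x::'a. x ^ n = 1} = n" "finite {x::'a. x ^ n = 1}"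
proof -
  let ?p = "monom 1 n - 1 :: 'a poly"
  have n: "0 < n" using assms by (auto intro!: gr0I)
  have c: "coeff ?p n = 1" using n by (simp add: coeff_monom coeff_1)
  then have p0: "?p \<noteq> 0" by (metis coeff_0 zero_neq_one)
  have "degree ?p \<le> n" by (intro degree_diff_le) (auto intro: degree_monom_le)
  moreover have "n \<le> degree ?p" by (rule le_degree) (simp only: c one_neq_zero not_False_eq_True)
  ultimately have deg: "degree ?p = n" by simp
  have z: "{x::'a. x ^ n = 1} = {x. poly ?p x = 0}" by (simp add: poly_monom)
  show "card {x::'a. x ^ n = 1} = n" unfolding z
  proof (subst card_roots_separable[OF p0])
    fix x assume "poly ?p x = 0"
    then have "x ^ n = 1" by (simp add: poly_monom)
    then have "x \<noteq> 0" using n by (auto simp: power_0_left)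
    then show "poly (pderiv ?p) x \<noteq> 0" using assms by (simp add: pderiv_diff pderiv_monom poly_monom)
  qed (rule deg)
  show "finite {x::'a. x ^ n = 1}" unfolding z by (rule poly_roots_finite[OF p0])
qed

lemma poly_lpoly: "poly (lpoly e m \<alpha>) x = (\<Sum>i\<in>{i. i \<le> e \<and> m dvd CHAR('a) ^ i - 1}. \<alpha> i * x ^ (CHAR('a) ^ i))"
  for x :: "'a::comm_ring_1"
  by (simp add: lpoly_def poly_sum poly_monom)

text \<open>The powers with exponent p ^ i are additive, and they fix \<omega> because m divides p ^
  i - 1.\<close>

lemma lpoly_affine:
  fixes \<alpha> :: "nat \<Rightarrow> 'a::idom"
  assumes d: "CHAR('a) ^ e * m > 0" and w: "\<omega> ^ m = 1"
  shows "poly (lpoly e m \<alpha>) (\<omega> * x + \<beta>) = \<omega> * poly (lpoly e m \<alpha>) x + poly (lpoly e m \<alpha>) \<beta>"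
proof -
  have t: "(\<omega> * x + \<beta>) ^ (CHAR('a) ^ i) = \<omega> * x ^ (CHAR('a) ^ i) + \<beta> ^ (CHAR('a) ^ i)"
    if i: "i \<le> e" "m dvd CHAR('a) ^ i - 1" for i
  proof (cases "CHAR('a) = 0")
    case True
    then have "e = 0" using d by (cases e) auto
    then show ?thesis using i by simp
  next
    case False
    then have pr: "Factorial_Ring.prime CHAR('a)" by (intro prime_CHAR_semidom) simp
    obtain k where k: "CHAR('a) ^ i - 1 = m * k" using i(2) by (rule dvdE)
    have "CHAR('a) ^ i = Suc (m * k)" using k False by (metis Suc_pred' One_nat_def zero_less_power gr0I diff_Suc_1)
    then have "\<omega> ^ (CHAR('a) ^ i) = \<omega>" using w by (simp add: power_mult)
    then show ?thesis using freshmans_dream'[OF pr refl, of "\<omega> * x" \<beta> i] by (simp add: power_mult_distrib)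
  qed
  show ?thesis unfolding poly_lpoly sum_distrib_left sum.distrib[symmetric]
    by (rule sum.cong) (simp_all only: t mem_Collect_eq distrib_left mult.left_commute)
qed

text \<open>The exponents p ^ i with i > 0 have zero derivative. With \<alpha> 0 \<noteq> 0 all
  roots are therefore simple.\<close>

lemma pderiv_lpoly: "poly (pderiv (lpoly e m \<alpha>)) x = \<alpha> 0" for x :: "'a::idom"
proof -
  have "pderiv (lpoly e m \<alpha>) = (\<Sum>i\<in>{i. i \<le> e \<and> m dvd CHAR('a) ^ i - 1}. if i = 0 then [:\<alpha> 0:] else 0)"
    unfolding lpoly_def higher_pderiv_sum[of 1, simplified]
    by (rule sum.cong) (auto simp: pderiv_monom monom_0)
  also have "\<dots> = [:\<alpha> 0:]" by (simp add: sum.delta)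
  finally show ?thesis by simp
qed

context gcurve
begin

section \<open>Automorphisms induced by linear maps\<close>

text \<open>M preserves F, so substituting M into forms preserves vanishing at the generic point and
  hence acts on quotients of values.\<close>

lemma aut_of_matrix:
  assumes M: "invertible M" and FM: "subst3 M F = F"
  obtains \<tau> where "ff.kaut \<tau>" "\<forall>i j. \<tau> (v $ i / v $ j) = mv gconst M v $ i / mv gconst M v $ j"
proof -
  define T where "T G = E (subst3 M G)" for G
  have rT: "rhom T" unfolding T_def by (rule rhom_comp[OF rhom_E rhom_subst3])
  have bij: "bij (subst3 M)"
    by (rule o_bij[of "subst3 (matrix_inv M)"]) (auto simp: fun_eq_iff subst3_inverse[OF M])
  have T0: "T G = 0 \<longleftrightarrow> E G = 0" for G
    unfolding T_def using gen bij_rhom_dvd_iff[OF rhom_subst3 bij, of F G] FM by simp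
  have eq: "T G / T H = T G' / T H' \<longleftrightarrow> E G / E H = E G' / E H'" if "E H \<noteq> 0" "E H' \<noteq> 0" for G H G' H'
  proof -
    have nz: "T H \<noteq> 0" "T H' \<noteq> 0" using that T0 by auto
    have "T G / T H = T G' / T H' \<longleftrightarrow> T (G * H' - G' * H) = 0"
      using nz by (simp add: frac_eq_eq rhom_diff[OF rT] rhom_mult[OF rT])
    also have "\<dots> \<longleftrightarrow> E (G * H' - G' * H) = 0" by (rule T0)
    also have "\<dots> \<longleftrightarrow> E G / E H = E G' / E H'"
      using that by (simp add: frac_eq_eq rhom_diff[OF rhom_E] rhom_mult[OF rhom_E])
    finally show ?thesis .
  qed
  \<comment> \<open>The choice picks a representation of z as a quotient of values;
    \<open>eq\<close> shows that the result does not depend on it and that the map is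
    injective.\<close>
  define \<tau> where "\<tau> z = (SOME w. \<exists>G H n. homogeneous n G \<and> homogeneous n H \<and> E H \<noteq> 0 \<and> z = E G / E H \<and> w = T G / T H)" for z
  have \<tau>: "\<tau> (E G / E H) = T G / T H" if "homogeneous n G" "homogeneous n H" "E H \<noteq> 0" for n G H
  proof -
    have "\<exists>w G' H' n. homogeneous n G' \<and> homogeneous n H' \<and> E H' \<noteq> 0 \<and> E G / E H = E G' / E H' \<and> w = T G' / T H'"
      using that by blast
    then have "\<exists>G' H' n. homogeneous n G' \<and> homogeneous n H' \<and> E H' \<noteq> 0 \<and> E G / E H = E G' / E H' \<and> \<tau> (E G / E H) = T G' / T H'"
      unfolding \<tau>_def by (rule someI_ex)
    then obtain G' H' where "E H' \<noteq> 0" "E G / E H = E G' / E H'" "\<tau> (E G / E H) = T G' / T H'" by blast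
    then show ?thesis using eq[OF that(3), of H' G G'] by simp
  qed
  have TS: "T G / T H \<in> S" if "homogeneous n G" "homogeneous n H" "E H \<noteq> 0" for n G H
    unfolding T_def using that T0[of H] homogeneous_subst3 by (intro S_I[of n]) (auto simp: T_def)
  have "ff.kaut \<tau>"
    unfolding ff.kaut_def
  proof (intro conjI allI ballI)
    show "bij_betw \<tau> S S"
      unfolding bij_betw_def
    proof
      show "inj_on \<tau> S"
      proof (rule inj_onI)
        fix a b assume a: "a \<in> S" and b: "b \<in> S" and ab: "\<tau> a = \<tau> b"
        obtain G H n where 1: "a = E G / E H" "homogeneous n G" "homogeneous n H" "E H \<noteq> 0" using a by (rule S_E)
        obtain G' H' n' where 2: "b = E G' / E H'" "homogeneous n' G'" "homogeneous n' H'" "E H' \<noteq> 0" using b by (rule S_E)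
        show "a = b" using ab eq[OF 1(4) 2(4)] unfolding 1(1) 2(1) \<tau>[OF 1(2-4)] \<tau>[OF 2(2-4)] by blast
      qed
      show "\<tau> ` S = S"
      proof (intro Set.set_eqI iffI)
        fix b assume "b \<in> \<tau> ` S"
        then obtain a where a: "a \<in> S" "b = \<tau> a" by blast
        obtain G H n where 1: "a = E G / E H" "homogeneous n G" "homogeneous n H" "E H \<noteq> 0" using a(1) by (rule S_E)
        show "b \<in> S" unfolding a(2) 1(1) \<tau>[OF 1(2-4)] by (rule TS[OF 1(2-4)])
      next
        fix b assume "b \<in> S"
        then obtain G H n where 1: "b = E G / E H" "homogeneous n G" "homogeneous n H" "E H \<noteq> 0" by (rule S_E)
        let ?G = "subst3 (matrix_inv M) G" and ?H = "subst3 (matrix_inv M) H"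
        have e: "T ?G = E G" "T ?H = E H" by (simp_all add: T_def subst3_inverse(1)[OF M])
        have h: "homogeneous n ?G" "homogeneous n ?H" "E ?H \<noteq> 0" using 1 T0[of ?H] e homogeneous_subst3 by auto
        have "b = \<tau> (E ?G / E ?H)" unfolding \<tau>[OF h] e 1(1) ..
        moreover have "E ?G / E ?H \<in> S" by (rule S_I[OF h])
        ultimately show "b \<in> \<tau> ` S" by blast
      qed
    qed
    show "\<tau> (gconst k) = gconst k" for k
    proof -
      have h1: "homogeneous 0 (1 :: 'a poly3)" by (rule hom_one)
      have e1: "E 1 = 1" "T 1 = 1" by (rule rhom_1[OF rhom_E], rule rhom_1[OF rT])
      have ek: "E (C3 k) = gconst k" "T (C3 k) = gconst k"
        by (simp_all add: T_def ev3_C3 rhom_gconst ev3_subst3)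
      show ?thesis using \<tau>[OF homogeneous_C3[of k] h1] by (simp add: e1 ek)
    qed
    fix a b assume a: "a \<in> S" and b: "b \<in> S"
    obtain G H n where 1: "a = E G / E H" "homogeneous n G" "homogeneous n H" "E H \<noteq> 0" using a by (rule S_E)
    obtain G' H' n' where 2: "b = E G' / E H'" "homogeneous n' G'" "homogeneous n' H'" "E H' \<noteq> 0" using b by (rule S_E)
    note ab = \<tau>[OF 1(2-4), folded 1(1)] \<tau>[OF 2(2-4), folded 2(1)]
    have nz: "T H \<noteq> 0" "T H' \<noteq> 0" using 1(4) 2(4) T0 by auto
    have hh: "homogeneous (n + n') (H * H')" by (rule homogeneous_mult[OF 1(3) 2(3)])
    have ehh: "E (H * H') \<noteq> 0" using 1(4) 2(4) by (simp add: rhom_mult[OF rhom_E])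
    have hg: "homogeneous (n + n') (G * H' + G' * H)"
      using homogeneous_add[OF homogeneous_mult[OF 1(2) 2(3)] homogeneous_mult[OF 1(3) 2(2)]] by (simp add: mult.commute)
    have "a + b = E (G * H' + G' * H) / E (H * H')"
      unfolding 1(1) 2(1) rhom_mult[OF rhom_E] rhom_add[OF rhom_E] by (rule add_frac_eq[OF 1(4) 2(4)])
    then have "\<tau> (a + b) = T (G * H' + G' * H) / T (H * H')" using \<tau>[OF hg hh ehh] by simp
    also have "\<dots> = \<tau> a + \<tau> b" unfolding ab rhom_mult[OF rT] rhom_add[OF rT] by (rule add_frac_eq[OF nz, symmetric])
    finally show "\<tau> (a + b) = \<tau> a + \<tau> b" .
    have "a * b = E (G * G') / E (H * H')" using 1 2 by (simp add: rhom_mult[OF rhom_E])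
    then have "\<tau> (a * b) = T (G * G') / T (H * H')" using \<tau>[OF homogeneous_mult[OF 1(2) 2(2)] hh ehh] by simp
    also have "\<dots> = \<tau> a * \<tau> b" unfolding ab by (simp add: rhom_mult[OF rT])
    finally show "\<tau> (a * b) = \<tau> a * \<tau> b" .
  qed
  moreover have "\<tau> (v $ i / v $ j) = mv gconst M v $ i / mv gconst M v $ j" for i j
  proof -
    have "E (X3 $ k) = v $ k" "T (X3 $ k) = mv gconst M v $ k" for k
      by (simp_all add: T_def ev3_subst3 rhom_gconst ev3_X3)
    then show ?thesis using \<tau>[OF homogeneous_X3[of i] homogeneous_X3[of j]] v_nonzero[of j] by simp
  qed
  ultimately show ?thesis using that by blast
qed

lemma kaut_eqI:
  assumes t: "ff.kaut \<tau>" and s: "ff.kaut \<sigma>" and xy: "\<tau> vx = \<sigma> vx" "\<tau> vy = \<sigma> vy" and z: "z \<in> S"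
  shows "\<tau> z = \<sigma> z"
proof -
  obtain D a where D: "D \<noteq> 0" "z * ey D = ee a" using S_reduced[OF z] by blast
  have D0: "ey D \<noteq> 0" using D(1) ey_eq_0 by simp
  have "\<rho> z * \<rho> (ey D) = \<rho> (ee a)" if "ff.kaut \<rho>" for \<rho>
    using ff.kaut_D(4)[OF that z ff.S_evp[OF vy_S, of D]] D(2) by simp
  moreover have "\<tau> (ee a) = \<sigma> (ee a)" unfolding ee_def kaut_ee[OF t vx_S vy_S] kaut_ee[OF s vx_S vy_S] xy ..
  moreover have "\<tau> (ey D) = \<sigma> (ey D)" unfolding ff.kaut_evp[OF t vy_S] ff.kaut_evp[OF s vy_S] xy ..
  moreover have "\<sigma> (ey D) \<noteq> 0" using ff.kaut_D(5)[OF s ff.S_evp[OF vy_S] ff.S_01(1)] ff.kaut_D(6)[OF s] D0 by simp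
  ultimately show ?thesis using t s by (metis mult_right_cancel)
qed

text \<open>A fixed z satisfies z D(b) = q(t) for every conjugate t of a. These are more equations
  than the degree of q in t, so q(T) - z D(b) vanishes identically and z is its constant term over
  D(b).\<close>

lemma fixed_field:
  assumes ab: "a \<in> S" "b \<in> S" and D: "evp gconst b D \<noteq> 0" "z * evp gconst b D = evp (evp gconst b) a q"
    and Z: "finite Z" "degree q < card Z" "\<And>t. t \<in> Z \<Longrightarrow> \<exists>\<tau>. ff.kaut \<tau> \<and> \<tau> b = b \<and> \<tau> a = t"
    and z: "z \<in> S" "\<And>\<tau>. ff.kaut \<tau> \<Longrightarrow> \<tau> b = b \<Longrightarrow> \<tau> z = z"
  shows "z \<in> ratf b"
proof -
  let ?eb = "evp gconst b"
  note rb = rhom_evp[OF rhom_gconst, of b]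
  define p where "p = map_poly ?eb q - [:z * ?eb D:]"
  have root: "poly p t = 0" if t: "t \<in> Z" for t
  proof -
    obtain \<tau> where \<tau>: "ff.kaut \<tau>" "\<tau> b = b" "\<tau> a = t" using Z(3)[OF t] by blast
    have "\<tau> (z * ?eb D) = \<tau> (evp ?eb a q)" by (simp only: D(2))
    then have "z * ?eb D = evp ?eb t q"
      using ff.kaut_D(4)[OF \<tau>(1) z(1) ff.S_evp[OF ab(2)]] z(2)[OF \<tau>(1,2)] ff.kaut_evp[OF \<tau>(1) ab(2)] \<tau>(2,3)
        kaut_ee[OF \<tau>(1) ab] by simp
    then show ?thesis by (simp add: p_def evp_def[of ?eb])
  qed
  have "p = 0"
  proof (rule ccontr)
    assume p0: "p \<noteq> 0"
    have "degree p \<le> degree q"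
      unfolding p_def by (intro degree_diff_le) (auto intro: map_poly_degree_leq)
    moreover have "card Z \<le> card {t. poly p t = 0}" by (rule card_mono[OF poly_roots_finite[OF p0]]) (use root in auto)
    ultimately show False using card_poly_roots_bound[OF p0] Z(2) by linarith
  qed
  then have "coeff p 0 = 0" by simp
  then have "z * ?eb D = ?eb (coeff q 0)" by (simp add: p_def coeff_map_poly evp_0)
  then have "z = ?eb (coeff q 0) / ?eb D" using D(1) by (simp add: eq_divide_eq)
  then show ?thesis using ratf_I[OF D(1)] by simp
qed

lemma span_powers:
  assumes D: "evp gconst b D \<noteq> 0" "z * evp gconst b D = evp (evp gconst b) a q" and n: "degree q < n"
  shows "\<exists>c. (\<forall>i. c i \<in> ratf b) \<and> z = (\<Sum>i<n. c i * a ^ i)"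
proof (intro exI conjI allI)
  let ?eb = "evp gconst b"
  let ?c = "\<lambda>i. ?eb (coeff q i) / ?eb D"
  show "?c i \<in> ratf b" for i by (rule ratf_I[OF D(1)])
  have nn: "{..n - 1} = {..<n}" using n by auto
  have "evp ?eb a q = (\<Sum>i<n. ?eb (coeff q i) * a ^ i)"
    using evp_sum_le[OF rhom_evp[OF rhom_gconst], of q "n - 1" b a] n unfolding nn by simp
  then have "z = (\<Sum>i<n. ?eb (coeff q i) * a ^ i) / ?eb D" using D by (simp add: eq_divide_eq)
  then show "z = (\<Sum>i<n. ?c i * a ^ i)" by (simp add: sum_divide_distrib)
qed

lemma direct_product_of_commuting:
  assumes P: "galois_group_at F P = act ` {\<tau>. ff.kaut \<tau> \<and> \<tau> y = y}"
    and Q: "galois_group_at F Q = act ` {\<sigma>. ff.kaut \<sigma> \<and> \<sigma> x = x}"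
    and xy: "x \<in> S" "y \<in> S"
    and comm: "\<And>\<tau> \<sigma> z. ff.kaut \<tau> \<Longrightarrow> \<tau> y = y \<Longrightarrow> ff.kaut \<sigma> \<Longrightarrow> \<sigma> x = x \<Longrightarrow> z \<in> S \<Longrightarrow> \<tau> (\<sigma> z) = \<sigma> (\<tau> z)"
    and triv: "\<And>\<tau> z. ff.kaut \<tau> \<Longrightarrow> \<tau> y = y \<Longrightarrow> \<tau> x = x \<Longrightarrow> z \<in> S \<Longrightarrow> \<tau> z = z"
  shows "internal_direct_product (Aut_X F) (galois_group_at F P) (galois_group_at F Q)"
proof -
  interpret A: group "Aut_X F" by (rule group_Aut)
  have sub: "subgroup (act ` {\<tau>. ff.kaut \<tau> \<and> \<tau> t = t}) (Aut_X F)" if t: "t \<in> S" for t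
  proof (rule A.subgroupI)
    show "act ` {\<tau>. ff.kaut \<tau> \<and> \<tau> t = t} \<subseteq> carrier (Aut_X F)" using act_Aut by auto
    show "act ` {\<tau>. ff.kaut \<tau> \<and> \<tau> t = t} \<noteq> {}" using kaut_id by fastforce
    fix a assume "a \<in> act ` {\<tau>. ff.kaut \<tau> \<and> \<tau> t = t}"
    then obtain \<tau> where \<tau>: "ff.kaut \<tau>" "\<tau> t = t" "a = act \<tau>" by blast
    have k: "ff.kaut (inv_into S \<tau>)" by (rule ff.kaut_inv(1)[OF \<tau>(1)])
    have kt: "inv_into S \<tau> t = t" using ff.kaut_inv(2)[OF \<tau>(1) t] \<tau>(2) by simp
    have "act (inv_into S \<tau>) \<otimes>\<^bsub>Aut_X F\<^esub> a = act (inv_into S \<tau> \<circ> \<tau>)" unfolding \<tau>(3) by (rule mult_act[OF k \<tau>(1)])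
    also have "\<dots> = act id" by (rule act_cong) (simp add: ff.kaut_inv(2)[OF \<tau>(1)])
    finally have "act (inv_into S \<tau>) \<otimes>\<^bsub>Aut_X F\<^esub> a = \<one>\<^bsub>Aut_X F\<^esub>" by (simp add: one_act)
    then have "inv\<^bsub>Aut_X F\<^esub> a = act (inv_into S \<tau>)" using A.inv_equality act_Aut \<tau> k by blast
    then show "inv\<^bsub>Aut_X F\<^esub> a \<in> act ` {\<tau>. ff.kaut \<tau> \<and> \<tau> t = t}" using k kt by blast
    fix b assume "b \<in> act ` {\<tau>. ff.kaut \<tau> \<and> \<tau> t = t}"
    then obtain \<sigma> where \<sigma>: "ff.kaut \<sigma>" "\<sigma> t = t" "b = act \<sigma>" by blast
    have "a \<otimes>\<^bsub>Aut_X F\<^esub> b = act (\<tau> \<circ> \<sigma>)" unfolding \<tau>(3) \<sigma>(3) by (rule mult_act[OF \<tau>(1) \<sigma>(1)])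
    then show "a \<otimes>\<^bsub>Aut_X F\<^esub> b \<in> act ` {\<tau>. ff.kaut \<tau> \<and> \<tau> t = t}"
      using ff.kaut_comp[OF \<tau>(1) \<sigma>(1)] \<tau>(2) \<sigma>(2) by (intro image_eqI[of _ _ "\<tau> \<circ> \<sigma>"]) auto
  qed
  show ?thesis
    unfolding P Q
  proof (rule A.commuting_direct_product[OF sub[OF xy(2)] sub[OF xy(1)]])
    fix a b assume "a \<in> act ` {\<tau>. ff.kaut \<tau> \<and> \<tau> y = y}" "b \<in> act ` {\<tau>. ff.kaut \<tau> \<and> \<tau> x = x}"
    then obtain \<tau> \<sigma> where t: "ff.kaut \<tau>" "\<tau> y = y" "a = act \<tau>" and s: "ff.kaut \<sigma>" "\<sigma> x = x" "b = act \<sigma>" by blast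
    have "act (\<tau> \<circ> \<sigma>) = act (\<sigma> \<circ> \<tau>)" by (rule act_cong) (simp add: comm[OF t(1,2) s(1,2)])
    then show "a \<otimes>\<^bsub>Aut_X F\<^esub> b = b \<otimes>\<^bsub>Aut_X F\<^esub> a" unfolding t(3) s(3) mult_act[OF t(1) s(1)] mult_act[OF s(1) t(1)] .
  next
    show "act ` {\<tau>. ff.kaut \<tau> \<and> \<tau> y = y} \<inter> act ` {\<tau>. ff.kaut \<tau> \<and> \<tau> x = x} = {\<one>\<^bsub>Aut_X F\<^esub>}"
    proof (intro Set.set_eqI iffI)
      fix a assume "a \<in> act ` {\<tau>. ff.kaut \<tau> \<and> \<tau> y = y} \<inter> act ` {\<tau>. ff.kaut \<tau> \<and> \<tau> x = x}"
      then obtain \<tau> \<sigma> where t: "ff.kaut \<tau>" "\<tau> y = y" "a = act \<tau>" and s: "ff.kaut \<sigma>" "\<sigma> x = x" "a = act \<sigma>" by blast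
      have "\<tau> x = \<sigma> x" by (rule act_inj[OF t(1) s(1) _ xy(1)]) (use t s in simp)
      then have "act \<tau> = act id" using s(2) by (intro act_cong) (simp add: triv[OF t(1,2)])
      then show "a \<in> {\<one>\<^bsub>Aut_X F\<^esub>}" by (simp add: t(3) one_act)
    next
      fix a assume "a \<in> {\<one>\<^bsub>Aut_X F\<^esub>}"
      then show "a \<in> act ` {\<tau>. ff.kaut \<tau> \<and> \<tau> y = y} \<inter> act ` {\<tau>. ff.kaut \<tau> \<and> \<tau> x = x}"
        using kaut_id by (auto simp: one_act)
    qed
  qed
qed

end

section \<open>The Galois points of the curves in the classification\<close>

locale eq_curve = gcurve F d v
  for F :: "'a::alg_closed_field poly3" and d :: nat and v :: "'a generic_field^3" +
  fixes e m :: nat and \<alpha> :: "nat \<Rightarrow> 'a" and c \<kappa> :: 'a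
  assumes eqn: "dehom F = affine_const \<kappa> * char_dvd_equation d e m \<alpha> c" and \<kappa>: "\<kappa> \<noteq> 0"
    and dm: "d = CHAR('a) ^ e * m" and pm: "\<not> CHAR('a) dvd m" and mdvd: "m dvd CHAR('a) ^ e - 1"
    and ae: "\<alpha> e \<noteq> 0" and a0: "\<alpha> 0 \<noteq> 0" and tame: "of_nat (d - 1) \<noteq> (0::'a)"
begin

definition g :: "'a poly" where "g = lpoly e m \<alpha> ^ m + [:c:]"

lemma d0: "d > 0" "d - 1 > 0" using d3 by auto

lemma degree_g: "degree g = d"
  unfolding g_def by (rule equation_poly_degree[where \<alpha> = \<alpha>, OF dm[symmetric] d0(1) mdvd ae])

lemma dehom_F: "dehom F = affine_const \<kappa> * (monom 1 (d - 1) + [:g:])"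
  unfolding eqn char_dvd_equation_eq g_def ..

lemma coeff_dehom_F: "coeff (dehom F) i = [:\<kappa>:] * (if i = 0 then g else if i = d - 1 then 1 else 0)"
  unfolding dehom_F affine_const_def using d0 by (cases i) (auto simp: coeff_monom)

lemma deg_X: "degree F = d - 1"
proof (rule antisym)
  show "degree F \<le> d - 1"
    unfolding degree_dehom_F[symmetric] by (rule degree_le) (auto simp: coeff_dehom_F)
  have "coeff (dehom F) (d - 1) \<noteq> 0" using \<kappa> d0 by (simp add: coeff_dehom_F)
  then show "d - 1 \<le> degree F" unfolding degree_dehom_F[symmetric] by (rule le_degree)
qed

lemma outer: "eval3 F (axis 2 1) \<noteq> 0"
proof -
  have "coeff g d \<noteq> 0" using degree_g d0 leading_coeff_neq_0[of g] by fastforce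
  then have "coeff (coeff (dehom F) 0) d \<noteq> 0" using \<kappa> by (simp add: coeff_dehom_F)
  then show ?thesis using eval3_axis(2)[OF hom] coeff_dehom[OF hom, of 0 d] by simp
qed

lemma relation: "vx ^ (d - 1) = - ey g"
proof -
  have "ee (affine_const \<kappa>) = gconst \<kappa>" by (simp add: affine_const_def ee_const evp_const rhom_gconst)
  moreover have "ee (monom 1 (d - 1) + [:g:]) = vx ^ (d - 1) + ey g"
    unfolding rhom_add[OF rhom_ee] ee_const by (simp add: ee_def evp_monom rhom_ey rhom_1[OF rhom_ey])
  moreover have "gconst \<kappa> \<noteq> 0" using \<kappa> rhom_inj[OF rhom_gconst] by (simp add: rhom_0[OF rhom_gconst])
  ultimately show ?thesis using ee_dehom_F unfolding dehom_F rhom_mult[OF rhom_ee] by (simp add: eq_neg_iff_add_eq_0)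
qed

lemma g_affine: "\<omega> ^ m = 1 \<Longrightarrow> poly (lpoly e m \<alpha>) \<beta> = 0 \<Longrightarrow> pcompose g [:\<beta>, \<omega>:] = g"
proof (rule poly_fun_eqI)
  fix x assume w: "\<omega> ^ m = 1" "poly (lpoly e m \<alpha>) \<beta> = 0"
  have "poly (lpoly e m \<alpha>) (\<omega> * x + \<beta>) = \<omega> * poly (lpoly e m \<alpha>) x"
    using lpoly_affine[where \<alpha> = \<alpha>, OF d0(1)[unfolded dm] w(1)] w(2) by simp
  moreover have "poly [:\<beta>, \<omega>:] x = \<omega> * x + \<beta>" by (simp add: mult.commute)
  ultimately show "poly (pcompose g [:\<beta>, \<omega>:]) x = poly g x"
    unfolding poly_pcompose by (simp only: g_def poly_add poly_power power_mult_distrib w(1) mult_1_left poly_pCons poly_0 mult_zero_right)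
qed

lemma aut:
  assumes \<zeta>: "\<zeta> ^ (d - 1) = 1" and \<omega>: "\<omega> \<noteq> 0" "pcompose g [:\<beta>, \<omega>:] = g"
  obtains \<tau> where "ff.kaut \<tau>" "\<tau> vx = gconst \<zeta> * vx" "\<tau> vy = ey [:\<beta>, \<omega>:]"
proof -
  define M :: "'a^3^3" where "M = vector [vector [\<zeta>, 0, 0], vector [0, \<omega>, \<beta>], vector [0, 0, 1]]"
  have \<zeta>0: "\<zeta> \<noteq> 0" using \<zeta> d0 by (auto simp: power_0_left)
  have "det M = \<zeta> * \<omega>" by (simp add: det_3 M_def vector_3)
  then have M: "invertible M" using \<zeta>0 \<omega>(1) by (simp add: invertible_det_nz)
  let ?h = "affine_const :: 'a \<Rightarrow> _"
  note rh = rhom_affine_const[where ?'a = 'a]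
  note hs = rhom_0[OF rh] rhom_1[OF rh]
  define yy where "yy = ?h \<omega> * affine_y + ?h \<beta>"
  have mvM: "mv ?h M (vector [affine_x, affine_y, 1]) = vector [?h \<zeta> * affine_x, yy, 1]"
    by (simp add: mv_def M_def vec_eq_iff forall_3 sum_3 vector_3 yy_def hs)
  note pch = evp_pcompose[OF rh]
  have y: "evp ?h affine_y [:\<beta>, \<omega>:] = yy" by (simp add: yy_def evp_pCons[OF rh] evp_0 algebra_simps)
  have ev: "evp (evp ?h b) a (dehom F) = ?h \<kappa> * (a ^ (d - 1) + evp ?h b g)" for a b
  proof -
    note rb = rhom_evp[OF rh, of b]
    have k: "evp (evp ?h b) a (affine_const \<kappa>) = ?h \<kappa>"
      unfolding affine_const_def[of \<kappa>] evp_const[OF rb] evp_const[OF rh] by (simp add: affine_const_def)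
    show ?thesis unfolding dehom_F rhom_mult[OF rhom_evp[OF rb]] rhom_add[OF rhom_evp[OF rb]] k evp_const[OF rb] evp_monom[OF rb]
        rhom_1[OF rb] by simp
  qed
  have "dehom (subst3 M F) = evp (evp ?h yy) (?h \<zeta> * affine_x) (dehom F)"
    by (simp add: dehom_eq_ev3[of "subst3 M F"] ev3_subst3[OF rh] mvM ev3_dehom[OF rh])
  also have "\<dots> = ?h \<kappa> * (affine_x ^ (d - 1) + evp ?h affine_y (pcompose g [:\<beta>, \<omega>:]))"
    unfolding ev pch y power_mult_distrib rhom_power[OF rh, symmetric] \<zeta> hs by simp
  also have "\<dots> = evp (evp ?h affine_y) affine_x (dehom F)" unfolding \<omega>(2) ev ..
  also have "\<dots> = dehom F" unfolding ev3_dehom[OF rh, symmetric] dehom_eq_ev3[of F, symmetric] ..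
  finally have "subst3 M F = F" by (rule dehom_inj[OF homogeneous_subst3[OF hom] hom])
  then obtain \<tau> where \<tau>: "ff.kaut \<tau>" "\<forall>i j. \<tau> (v $ i / v $ j) = mv gconst M v $ i / mv gconst M v $ j"
    by (rule aut_of_matrix[OF M])
  note gs = rhom_0[OF rhom_gconst] rhom_1[OF rhom_gconst]
  have mvs: "mv gconst M v $ 1 = gconst \<zeta> * v $ 1" "mv gconst M v $ 2 = gconst \<omega> * v $ 2 + gconst \<beta> * v $ 3" "mv gconst M v $ 3 = v $ 3"
    by (simp_all add: mv_def M_def sum_3 vector_3 gs)
  show ?thesis
  proof (rule that[OF \<tau>(1)])
    show "\<tau> vx = gconst \<zeta> * vx" unfolding vx_def \<tau>(2)[rule_format] mvs by simp
    show "\<tau> vy = ey [:\<beta>, \<omega>:]" using v_nonzero[of 3] unfolding vy_def \<tau>(2)[rule_format] mvs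
      by (simp add: evp_pCons rhom_gconst evp_0 gs add_divide_distrib)
  qed
qed

text \<open>The images of x, and in \<open>ZQ\<close> of y, under the explicit automorphisms;
  counted directly, they number d - 1 and d.\<close>

definition ZP where "ZP = (\<lambda>\<zeta>. gconst \<zeta> * vx) ` {\<zeta>. \<zeta> ^ (d - 1) = 1}"

definition ZQ where "ZQ = (\<lambda>(\<omega>, \<beta>). ey [:\<beta>, \<omega>:]) ` ({\<omega>. \<omega> ^ m = 1} \<times> {\<beta>. poly (lpoly e m \<alpha>) \<beta> = 0})"

lemma vx_nonzero: "vx \<noteq> 0" using v_nonzero by (simp add: vx_def)

lemma ZP: "finite ZP" "card ZP = d - 1"
proof -
  have "inj_on (\<lambda>\<zeta>. gconst \<zeta> * vx) A" for A using vx_nonzero rhom_inj[OF rhom_gconst] by (auto simp: inj_on_def)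
  then show "finite ZP" "card ZP = d - 1" unfolding ZP_def using roots_of_unity[OF tame] by (simp_all add: card_image)
qed

lemma ZQ: "finite ZQ" "card ZQ = d"
proof -
  have nm: "of_nat m \<noteq> (0::'a)" using pm by (simp add: of_nat_eq_0_iff_char_dvd)
  note L = lpoly_degree[where \<alpha> = \<alpha>, OF dm[symmetric] d0(1) mdvd ae]
  have "card {\<beta>. poly (lpoly e m \<alpha>) \<beta> = 0} = CHAR('a) ^ e"
    unfolding L(1)[symmetric] by (rule card_roots_separable[OF L(2)]) (simp add: pderiv_lpoly a0)
  then have "card ({\<omega>::'a. \<omega> ^ m = 1} \<times> {\<beta>. poly (lpoly e m \<alpha>) \<beta> = 0}) = d"
    using roots_of_unity(1)[OF nm] dm by (simp add: card_cartesian_product mult.commute)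
  moreover have "inj_on (\<lambda>(\<omega>, \<beta>). ey [:\<beta>, \<omega>:]) A" for A by (auto simp: inj_on_def ey_inj)
  ultimately show "card ZQ = d" unfolding ZQ_def by (simp add: card_image)
  then show "finite ZQ" using d0 card.infinite by fastforce
qed

lemma ZP_ex: "t \<in> ZP \<Longrightarrow> \<exists>\<tau>. ff.kaut \<tau> \<and> \<tau> vy = vy \<and> \<tau> vx = t"
proof -
  assume "t \<in> ZP"
  then obtain \<zeta> where \<zeta>: "\<zeta> ^ (d - 1) = 1" "t = gconst \<zeta> * vx" by (auto simp: ZP_def)
  obtain \<tau> where "ff.kaut \<tau>" "\<tau> vx = gconst \<zeta> * vx" "\<tau> vy = ey [:0, 1:]"
    by (rule aut[OF \<zeta>(1), of 1 0]) (simp_all add: pcompose_idR)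
  then show ?thesis using \<zeta>(2) by (auto simp: evp_var rhom_gconst)
qed

lemma ZQ_ex: "t \<in> ZQ \<Longrightarrow> \<exists>\<sigma>. ff.kaut \<sigma> \<and> \<sigma> vx = vx \<and> \<sigma> vy = t"
proof -
  assume "t \<in> ZQ"
  then obtain \<omega> \<beta> where w: "\<omega> ^ m = 1" "poly (lpoly e m \<alpha>) \<beta> = 0" "t = ey [:\<beta>, \<omega>:]" by (auto simp: ZQ_def)
  have "m > 0" using dm d0 by (auto intro!: gr0I)
  then have w0: "\<omega> \<noteq> 0" using w(1) by (auto simp: power_0_left)
  obtain \<tau> where "ff.kaut \<tau>" "\<tau> vx = gconst 1 * vx" "\<tau> vy = ey [:\<beta>, \<omega>:]"
    by (rule aut[OF power_one w0 g_affine[OF w(1,2)]])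
  then show ?thesis using w(3) by (auto simp: rhom_1[OF rhom_gconst])
qed

text \<open>(\<tau> x) / x is a (d - 1)-th root of unity in the generic field, and k already
  contains d - 1 of them.\<close>

lemma ZP_all:
  assumes \<tau>: "ff.kaut \<tau>" "\<tau> vy = vy" shows "\<tau> vx \<in> ZP"
proof -
  have rel: "\<tau> vx ^ (d - 1) = vx ^ (d - 1)"
  proof -
    have "\<tau> vx ^ (d - 1) = \<tau> (vx ^ (d - 1))" using ff.kaut_D(11)[OF \<tau>(1) vx_S] by simp
    also have "\<dots> = vx ^ (d - 1)" unfolding relation
      using ff.kaut_D(8)[OF \<tau>(1) ff.S_evp[OF vy_S]] ff.kaut_evp[OF \<tau>(1) vy_S] \<tau>(2) by simp
    finally show ?thesis .
  qed
  have tame': "of_nat (d - 1) \<noteq> (0 :: 'a generic_field)"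
    using tame rhom_of_nat[OF rhom_gconst, of "d - 1"] rhom_inj[OF rhom_gconst]
    by (metis rhom_0[OF rhom_gconst])
  let ?U = "{w :: 'a generic_field. w ^ (d - 1) = 1}"
  have "gconst ` {\<zeta>. \<zeta> ^ (d - 1) = 1} = ?U"
  proof (rule card_subset_eq[OF roots_of_unity(2)[OF tame']])
    show "gconst ` {\<zeta>. \<zeta> ^ (d - 1) = 1} \<subseteq> ?U"
      by (auto simp: rhom_power[OF rhom_gconst, symmetric] rhom_1[OF rhom_gconst])
    have "card (gconst ` {\<zeta>::'a. \<zeta> ^ (d - 1) = 1}) = card {\<zeta>::'a. \<zeta> ^ (d - 1) = 1}"
      by (rule card_image) (use rhom_inj[OF rhom_gconst] in \<open>auto simp: inj_on_def\<close>)
    then show "card (gconst ` {\<zeta>::'a. \<zeta> ^ (d - 1) = 1}) = card ?U"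
      unfolding roots_of_unity(1)[OF tame] roots_of_unity(1)[OF tame'] .
  qed
  moreover have "\<tau> vx / vx \<in> ?U" using rel vx_nonzero by (simp add: power_divide)
  ultimately obtain \<zeta> where "\<zeta> ^ (d - 1) = 1" "\<tau> vx / vx = gconst \<zeta>" by blast
  then show ?thesis unfolding ZP_def using vx_nonzero by (auto simp: divide_eq_eq intro!: image_eqI[of _ _ \<zeta>])
qed

text \<open>\<sigma> y is a root of g(T) = g(y), which has at most d roots, and \<open>ZQ\<close>
  provides d.\<close>

lemma ZQ_all:
  assumes \<sigma>: "ff.kaut \<sigma>" "\<sigma> vx = vx" shows "\<sigma> vy \<in> ZQ"
proof -
  have dg: "0 < degree g" using degree_g d0 by simp
  have sub: "ZQ \<subseteq> {z. evp gconst z g = ey g}"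
    by (auto simp: ZQ_def ey_pcompose[symmetric] g_affine)
  have "ZQ = {z. evp gconst z g = ey g}"
    by (rule card_seteq[OF ey_affine_roots(1)[OF dg] sub]) (use ey_affine_roots(2)[OF dg] degree_g ZQ(2) in simp)
  moreover have "evp gconst (\<sigma> vy) g = ey g"
  proof -
    have e: "ey g = - (vx ^ (d - 1))" using relation by simp
    have "evp gconst (\<sigma> vy) g = \<sigma> (ey g)" by (rule ff.kaut_evp[OF \<sigma>(1) vy_S, symmetric])
    also have "\<dots> = ey g" unfolding e
      using ff.kaut_D(8)[OF \<sigma>(1) ff.S_power[OF vx_S]] ff.kaut_D(11)[OF \<sigma>(1) vx_S] \<sigma>(2) by simp
    finally show ?thesis .
  qed
  ultimately show ?thesis by simp
qed

text \<open>\<tau> only scales x by a constant, and \<sigma> only replaces y by a polynomial in y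
  over k, so the two commute on the generators x and y.\<close>

lemma commute:
  assumes \<tau>: "ff.kaut \<tau>" "\<tau> vy = vy" and \<sigma>: "ff.kaut \<sigma>" "\<sigma> vx = vx" and z: "z \<in> S"
  shows "\<tau> (\<sigma> z) = \<sigma> (\<tau> z)"
proof -
  obtain \<zeta> where \<zeta>: "\<tau> vx = gconst \<zeta> * vx" using ZP_all[OF \<tau>] by (auto simp: ZP_def)
  obtain p where p: "\<sigma> vy = ey p" using ZQ_all[OF \<sigma>] by (auto simp: ZQ_def)
  have "(\<tau> \<circ> \<sigma>) z = (\<sigma> \<circ> \<tau>) z"
  proof (rule kaut_eqI[OF ff.kaut_comp[OF \<tau>(1) \<sigma>(1)] ff.kaut_comp[OF \<sigma>(1) \<tau>(1)] _ _ z])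
    show "(\<tau> \<circ> \<sigma>) vx = (\<sigma> \<circ> \<tau>) vx"
      using ff.kaut_D(4)[OF \<sigma>(1) const_S vx_S] ff.kaut_D(2)[OF \<sigma>(1)] by (simp add: \<sigma>(2) \<zeta>)
    show "(\<tau> \<circ> \<sigma>) vy = (\<sigma> \<circ> \<tau>) vy"
      using ff.kaut_evp[OF \<tau>(1) vy_S] by (simp add: \<tau>(2) p)
  qed
  then show ?thesis by simp
qed

lemmas S_reduced_x = swapped_reduced(2)[OF outer]

lemma ex_nonzero: "D \<noteq> 0 \<Longrightarrow> evp gconst vx D \<noteq> 0"
  using swapped_reduced(1)[OF outer] by blast

lemma S_reduced_y: "z \<in> S \<Longrightarrow> \<exists>D a. D \<noteq> 0 \<and> z * ey D = evp ey vx a \<and> degree a < d - 1"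
  using S_reduced[of z] unfolding deg_X ee_def by metis

lemma fixP:
  assumes z: "z \<in> S" "\<And>\<tau>. ff.kaut \<tau> \<Longrightarrow> \<tau> vy = vy \<Longrightarrow> \<tau> z = z" shows "z \<in> ratf vy"
proof -
  obtain D a where D: "D \<noteq> 0" "z * ey D = evp ey vx a" "degree a < d - 1" using S_reduced_y[OF z(1)] by blast
  show ?thesis
  proof (rule fixed_field[where a = vx and D = D and q = a and Z = ZP, OF vx_S vy_S _ D(2) ZP(1)])
    show "ey D \<noteq> 0" using D(1) ey_eq_0 by simp
    show "degree a < card ZP" using D(3) ZP(2) by simp
  qed (use ZP_ex z in blast)+
qed

lemma fixQ:
  assumes z: "z \<in> S" "\<And>\<tau>. ff.kaut \<tau> \<Longrightarrow> \<tau> vx = vx \<Longrightarrow> \<tau> z = z" shows "z \<in> ratf vx"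
proof -
  obtain D a where D: "D \<noteq> 0" "z * evp gconst vx D = evp (evp gconst vx) vy a" "degree a < d" using S_reduced_x[OF z(1)] by blast
  show ?thesis
  proof (rule fixed_field[where a = vy and D = D and q = a and Z = ZQ, OF vy_S vx_S ex_nonzero[OF D(1)] D(2) ZQ(1)])
    show "degree a < card ZQ" using D(3) ZQ(2) by simp
  qed (use ZQ_ex z in blast)+
qed

lemma spanP: "z \<in> S \<Longrightarrow> \<exists>c. (\<forall>i. c i \<in> ratf vy) \<and> z = (\<Sum>i<d - 1. c i * vx ^ i)"
  using S_reduced_y[of z] ey_eq_0 span_powers[of vy _ z vx _ "d - 1"] by blast

lemma spanQ: "z \<in> S \<Longrightarrow> \<exists>c. (\<forall>i. c i \<in> ratf vx) \<and> z = (\<Sum>i<d. c i * vy ^ i)"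
  using S_reduced_x[of z] ex_nonzero span_powers[of vx _ z vy _ d] by blast

end

context gcurve
begin

text \<open>The points are the images of (1:0:0) and (0:1:0) under the change of coordinates. First
  the pulled-back form has to be identified with the model equation, since only the curves are known
  to coincide as point sets.\<close>

lemma direct_product_of_equation:
  assumes dm: "d = CHAR('a) ^ e * m" and pm: "\<not> CHAR('a) dvd m" and mdvd: "m dvd CHAR('a) ^ e - 1"
    and ae: "\<alpha> e \<noteq> 0" and a0: "\<alpha> 0 \<noteq> (0::'a)" and tame: "of_nat (d - 1) \<noteq> (0::'a)"
    and pe: "projectively_equivalent (curve F) (curve_of_affine_equation (char_dvd_equation d e m \<alpha> c))"
  shows "\<exists>P Q. inner_galois_point F P \<and> outer_galois_point F Q \<and>
    internal_direct_product (Aut_X F) (galois_group_at F P) (galois_group_at F Q)"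
proof -
  have d2: "d \<ge> 2" "d > 0" using d3 by auto
  let ?eq = "char_dvd_equation d e m \<alpha> c"
  let ?H = "homogenization ?eq"
  have td: "total_degree ?eq = d" by (rule total_degree_equation[where \<alpha> = \<alpha>, OF dm[symmetric] d3 mdvd ae])
  then have hH: "homogeneous d ?H" using homogeneous_homogenization[of ?eq] by simp
  obtain A :: "'a^3^3" where A: "invertible A" "(\<lambda>R. (\<lambda>v. A *v v) ` R) ` curve F = curve ?H"
    using pe unfolding projectively_equivalent_def curve_of_affine_equation_def by blast
  define B where "B = matrix_inv A"
  have B: "invertible B" unfolding B_def by (rule matrix_inv_invertible(3)[OF A(1)])
  have cH: "curve (subst3 B F) = curve ?H" unfolding B_def using curve_image[OF A(1), of F] A(2) by simp
  define v' where "v' = mv gconst (matrix_inv B) v"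
  interpret g: gcurve "subst3 B F" d v' unfolding v'_def by (rule gcurve_change(1)[OF B])
  have S: "g.S = S" unfolding v'_def by (rule gcurve_change(2)[OF B])
  \<comment> \<open>F is irreducible and vanishes only where the model does; as both forms have
    degree d, the cofactor is a constant k.\<close>
  have "subst3 B F dvd ?H"
  proof (rule nullstellensatz[OF g.irr g.hom d2(1)])
    fix u :: "'a^3" assume u: "u \<noteq> 0" "eval3 (subst3 B F) u = 0"
    then have "vec.span {u} \<in> curve ?H" using proj_plane_eval3[OF g.hom d2(2), of u] cH by simp
    then show "eval3 ?H u = 0" using proj_plane_eval3[OF hH d2(2), of u] by simp
  qed
  then obtain G where G: "?H = subst3 B F * G" by (rule dvdE)
  have nz: "?H \<noteq> 0"
  proof
    assume "?H = 0"
    then have "?eq = 0" using dehom_homogenization[of ?eq] by (simp add: dehom_def)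
    then show False using td d2 by (simp add: total_degree_def)
  qed
  have "homogeneous (d - d) G" using homogeneous_factor(2)[OF g.hom, of d G] hH nz G by simp
  then obtain k where k: "G = C3 k" using homogeneous_0_const by auto
  have k0: "k \<noteq> 0" using nz G k by (auto simp: C3_def)
  have rh: "rhom (affine_const :: 'a \<Rightarrow> _)" by (rule rhom_affine_const)
  have "affine_const (inverse k) * ?eq = affine_const (inverse k) * (dehom (subst3 B F) * affine_const k)"
    using arg_cong[OF G, of dehom] by (simp add: dehom_homogenization rhom_mult[OF rhom_dehom] k dehom_C3)
  also have "\<dots> = dehom (subst3 B F) * affine_const (inverse k * k)" unfolding rhom_mult[OF rh] by (simp only: mult_ac)
  also have "\<dots> = dehom (subst3 B F)" using k0 by (simp add: rhom_1[OF rh])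
  finally have eqn: "dehom (subst3 B F) = affine_const (inverse k) * ?eq" ..
  interpret g: eq_curve "subst3 B F" d v' e m \<alpha> c "inverse k"
    by unfold_locales (use eqn k0 assms in auto)
  define p where "p = B *v axis 1 1"
  define q where "q = B *v axis 2 1"
  have pq: "column 1 B = p" "column 2 B = q"
    unfolding p_def q_def by (simp_all add: matrix_vector_mult_def column_def axis_def vec_eq_iff if_distrib cong: if_cong)
  have inj: "B *v u = 0 \<Longrightarrow> u = 0" for u
    using matrix_inv_invertible(1)[OF B] by (metis matrix_vector_mul_assoc matrix_vector_mul_lid matrix_vector_mult_0_right)
  have p0: "p \<noteq> 0" "q \<noteq> 0" unfolding p_def q_def using inj by (metis axis_eq_0_iff one_neq_zero)+
  note fr = frame[OF B, folded v'_def, unfolded pq]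
  let ?P = "vec.span {p}" and ?Q = "vec.span {q}"
  have pp: "?P \<in> proj_plane" "?Q \<in> proj_plane" unfolding proj_plane_def using p0 by auto
  have cd: "coeff (subst3 B F) d = 0" using g.deg_X d2 by (intro coeff_eq_0) simp
  then have e1: "eval3 (subst3 B F) (axis 1 1) = 0" using eval3_axis(1)[OF g.hom] by simp
  have "coeff (subst3 B F) (d - 1) \<noteq> 0"
    using g.deg_X g.irr leading_coeff_neq_0[of "subst3 B F"] by (auto simp: Factorial_Ring.irreducible_def)
  then obtain u where "dd (subst3 B F) (axis 1 1) u \<noteq> 0" using smooth_at_axis[OF g.hom d2(1) e1] by blast
  then have "dd F p (B *v u) \<noteq> 0" by (simp add: dd_subst3 p_def)
  then have Pc: "?P \<in> curve F - singular_points F"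
    using proj_plane_eval3[OF hom d2(2), of p] singular_span_iff[OF hom d2(1), of p] p0 e1
    by (auto simp: eval3_subst3 p_def)
  have Qc: "?Q \<in> proj_plane - curve F"
    using pp proj_plane_eval3[OF hom d2(2), of q] g.outer by (simp add: eval3_subst3 q_def)
  have "galois_extension K (projection_field F ?P)"
    unfolding galois_extension_iff[OF fr(1)]
  proof (intro conjI ballI impI)
    show "K.finite_dimension (projection_field F ?P) (carrier K)"
      by (rule finite_dimension_of_span[OF fr(1), of "\<lambda>i. g.vx ^ i" "d - 1"])
        (use g.spanP g.ff.S_power[OF g.vx_S] in \<open>simp_all add: S fr(3)\<close>)
  qed (use g.fixP in \<open>unfold fr(3) S, blast\<close>)
  then have P: "inner_galois_point F ?P" using Pc pp by (simp add: inner_galois_point_def galois_point_def)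
  have "galois_extension K (projection_field F ?Q)"
    unfolding galois_extension_iff[OF fr(2)]
  proof (intro conjI ballI impI)
    show "K.finite_dimension (projection_field F ?Q) (carrier K)"
      by (rule finite_dimension_of_span[OF fr(2), of "\<lambda>i. g.vy ^ i" d])
        (use g.spanQ g.ff.S_power[OF g.vy_S] in \<open>simp_all add: S fr(4)\<close>)
  qed (use g.fixQ in \<open>unfold fr(4) S, blast\<close>)
  then have Q: "outer_galois_point F ?Q" using Qc pp by (simp add: outer_galois_point_def galois_point_def)
  have "internal_direct_product (Aut_X F) (galois_group_at F ?P) (galois_group_at F ?Q)"
  proof (rule direct_product_of_commuting[OF galois_group_at_eq[OF fr(1), unfolded fr(3)] galois_group_at_eq[OF fr(2), unfolded fr(4)]])
    show "g.vx \<in> S" "g.vy \<in> S" using g.vx_S g.vy_S S by auto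
    show "\<tau> (\<sigma> z) = \<sigma> (\<tau> z)" if "ff.kaut \<tau>" "\<tau> g.vy = g.vy" "ff.kaut \<sigma>" "\<sigma> g.vx = g.vx" "z \<in> S" for \<tau> \<sigma> z
      using g.commute that unfolding S by blast
    show "\<tau> z = z" if "ff.kaut \<tau>" "\<tau> g.vy = g.vy" "\<tau> g.vx = g.vx" "z \<in> S" for \<tau> z
      using g.kaut_eqI[OF _ g.kaut_id, of \<tau> z] that unfolding S by simp
  qed
  then show ?thesis using P Q by blast
qed

end

theorem theorem2:
  fixes F :: "'a::alg_closed_field poly poly poly" and d :: nat
  assumes "irreducible_plane_curve d F"
    and "d \<ge> 3"
    and "CHAR('a) = 0 \<or> coprime (d - 1) CHAR('a)"
  shows
    "((\<exists>P Q. inner_galois_point F P \<and> outer_galois_point F Q \<and>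
         internal_semidirect_product (Aut_X F) (galois_group_at F P) (galois_group_at F Q))
      \<longleftrightarrow>
      (\<exists>P Q. inner_galois_point F P \<and> outer_galois_point F Q \<and>
         internal_direct_product (Aut_X F) (galois_group_at F P) (galois_group_at F Q)))
     \<and>
     ((\<exists>P Q. inner_galois_point F P \<and> outer_galois_point F Q \<and>
         internal_direct_product (Aut_X F) (galois_group_at F P) (galois_group_at F Q))
      \<longleftrightarrow>
      ((CHAR('a) = 0 \<or> coprime d CHAR('a)) \<and>
         (\<exists>c::'a. c \<in> {0, 1} \<and>
            projectively_equivalent (curve F)
              (curve_of_affine_equation (prime_to_char_equation d c))))
      \<or> (CHAR('a) > 0 \<and> CHAR('a) dvd d \<and>
         (\<exists>(e::nat) (m::nat) (\<alpha> :: nat \<Rightarrow> 'a) (c::'a).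
            d = CHAR('a) ^ e * m \<and> \<not> CHAR('a) dvd m \<and> m dvd CHAR('a) ^ e - 1 \<and>
            \<alpha> e * \<alpha> 0 \<noteq> 0 \<and> c \<in> {0, 1} \<and>
            projectively_equivalent (curve F)
              (curve_of_affine_equation (char_dvd_equation d e m \<alpha> c)))))"
    (is "(?a \<longleftrightarrow> ?b) \<and> (?b \<longleftrightarrow> ?c1 \<or> ?c2)")
proof -
  have hom: "homogeneous d F" and irr: "Factorial_Ring.irreducible F"
    using assms(1) by (simp_all add: irreducible_plane_curve_def)
  have "degree F \<noteq> 0" by (rule homogeneous_irreducible_degree[OF irr hom]) (use assms(2) in simp)
  then obtain v :: "'a generic_field^3" where "\<And>G. ev3 gconst v G = 0 \<longleftrightarrow> F dvd G"
    using generic_point_ex[OF irr] by blast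
  then interpret gcurve F d v by unfold_locales (use irr hom assms(2) in auto)
  have tame: "of_nat (d - 1) \<noteq> (0::'a)" by (rule of_nat_coprime_CHAR[OF assms(3)]) (use d3 in auto)
  have ba: "?b \<Longrightarrow> ?a"
    unfolding internal_direct_product_def internal_semidirect_product_def
    using normal_imp_subgroup by blast
  have ac: "?c1 \<or> ?c2" if a: ?a
  proof -
    obtain P Q where PQ: "inner_galois_point F P" "outer_galois_point F Q"
      "internal_semidirect_product (Aut_X F) (galois_group_at F P) (galois_group_at F Q)" using a by blast
    obtain e m \<alpha> c where n: "d = CHAR('a) ^ e * m" "\<not> CHAR('a) dvd m" "m dvd CHAR('a) ^ e - 1"
      "\<alpha> e \<noteq> 0" "\<alpha> 0 = (1::'a)" "c \<in> {0, 1}"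
      "projectively_equivalent (curve F) (curve_of_affine_equation (char_dvd_equation d e m \<alpha> c))"
      by (rule equation_of_semidirect[OF assms(3) PQ])
    show ?thesis
    \<comment> \<open>e = 0 is the first family; for e > 0 the characteristic is positive, because 0
      ^ e = 0 would make d zero.\<close>
    proof (cases "e = 0")
      case True
      then have dm: "d = m" using n(1) by simp
      have "CHAR('a) = 0 \<or> coprime d CHAR('a)"
        using prime_CHAR_semidom[where ?'a = 'a] prime_imp_coprime[of "CHAR('a)" d] n(2) dm
        by (auto simp: coprime_commute)
      moreover have "char_dvd_equation d e m \<alpha> c = prime_to_char_equation d c"
        unfolding True dm[symmetric] prime_to_char_equation_eq[of \<alpha>, OF n(5)] prime_to_char_equation_def ..
      ultimately show ?thesis using n(6,7) by auto
    next
      case False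
      have "CHAR('a) \<noteq> 0"
      proof
        assume "CHAR('a) = 0"
        then have "CHAR('a) ^ e = 0" using False by (simp add: power_0_left)
        then have "d = 0" using n(1) mult_zero_left by metis
        then show False using d3 by simp
      qed
      moreover have "CHAR('a) dvd d" unfolding n(1) using False by (simp add: dvd_power)
      moreover have "\<alpha> e * \<alpha> 0 \<noteq> 0" using n(4,5) by simp
      ultimately show ?thesis using n(1,2,3,6,7) by blast
    qed
  qed
  have cb: ?b if c: "?c1 \<or> ?c2"
    using c
  proof
    assume ?c1
    then obtain c where c: "CHAR('a) = 0 \<or> coprime d CHAR('a)"
      "projectively_equivalent (curve F) (curve_of_affine_equation (prime_to_char_equation d c))" by blast
    have "of_nat d \<noteq> (0::'a)" by (rule of_nat_coprime_CHAR[OF c(1)]) (use d3 in auto)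
    then have nd: "\<not> CHAR('a) dvd d" by (simp add: of_nat_eq_0_iff_char_dvd)
    have e: "prime_to_char_equation d c = char_dvd_equation d 0 d (\<lambda>_. 1) c"
      unfolding prime_to_char_equation_eq[of "\<lambda>_. 1", OF refl] prime_to_char_equation_def ..
    show ?b by (rule direct_product_of_equation[where \<alpha> = "\<lambda>_. 1", OF _ nd _ _ _ tame c(2)[unfolded e]]) simp_all
  next
    assume ?c2
    then obtain e m \<alpha> and c :: 'a where n: "d = CHAR('a) ^ e * m" "\<not> CHAR('a) dvd m" "m dvd CHAR('a) ^ e - 1"
      "\<alpha> e * \<alpha> 0 \<noteq> (0::'a)"
      "projectively_equivalent (curve F) (curve_of_affine_equation (char_dvd_equation d e m \<alpha> c))" by blast
    show ?b by (rule direct_product_of_equation[OF n(1-3) _ _ tame n(5)]) (use n(4) in auto)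
  qed
  show ?thesis
  proof (rule conjI)
    show "?a \<longleftrightarrow> ?b"
    proof
      assume a: ?a
      show ?b by (rule cb[OF ac[OF a]])
    next
      assume b: ?b
      show ?a by (rule ba[OF b])
    qed
    show "?b \<longleftrightarrow> ?c1 \<or> ?c2"
    proof
      assume b: ?b
      show "?c1 \<or> ?c2" by (rule ac[OF ba[OF b]])
    next
      assume c: "?c1 \<or> ?c2"
      show ?b by (rule cb[OF c])
    qed
  qed
qed

end
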